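(* Let $R>0$. Let $V$ be an operator system and $S$ a self-adjoint spanning set for $V$ containing the unit such that $\|x\|\le R$ for each $x\in S$. Then $$h(V)=\sup_{\epsilon>0,\,E}\ \inf_{F,\delta,q}\ \limsup_{N\to\infty}\frac1{N^2}\log K^{\mathrm{orb}}_{E,\epsilon}\big(\Gamma_R^{(N)}(S,F,\delta,q)\big),$$ where $E$ ranges over finite subsets of $S$, $\delta>0$, $1\le q<\infty$, and $F$ ranges over finite subsets of the disjoint union, over $m\ge1$, of the sets of finitely supported tuples in $M_m(\mathbb{C})^S$.
   Context: An operator system is a subspace $V$ of a unital $C^*$-algebra containing the unit and closed under $*$. $C^*_{\max}(V)$ is the universal (maximal) $C^*$-algebra of $V$: it is generated by a completely order isomorphic unital copy of $V$, and every u.c.p. map $V\to B(\mathscr{H})$ extends uniquely to a $*$-homomorphism $C^*_{\max}(V)\to B(\mathscr{H})$. By definition $h(V):=h(C^*_{\max}(V))$, the $1$-bounded entropy of the tracial completion of $C^*_{\max}(V)$ with respect to all its traces (tracial states). $1$-bounded entropy of a unital $C^*$-algebra $\mathscr{A}$: for an index set $I$ let $\mathbb{C}^*\langle T_i\mid i\in I\rangle$ be the unital $*$-algebra of noncommutative complex polynomials in $T_i$ and formal adjoints. For $R>0$, $\Sigma_{R,I}$ is the set of linear functionals $\ell$ on it with $\ell(P^*P)\ge 0$, $\ell(1)=1$, $\ell(PQ)=\ell(QP)$, and $\ell((T_j^*T_j)^k)\le R^{2k}$ for all $k\in\mathbb{N},j\in I$, with the weak-$*$ topology. For $A\in M_N(\mathbb{C})^I$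 with $\|A_i\|\le R$, $\ell_A(P)=\frac1N\mathrm{Tr}(P(A))$; for $\mathcal{O}\subset\Sigma_{R,I}$ open, $\Gamma_R^{(N)}(\mathcal{O})=\{A\in M_N(\mathbb{C})^I:\|A_i\|\le R\ \forall i,\ \ell_A\in\mathcal{O}\}$. Let $\|A\|_2=(\frac1N\mathrm{Tr}(A^*A))^{1/2}$. For $\Omega\subset M_N(\mathbb{C})^I$, $E\subset I$ finite, $\epsilon>0$, $K^{\mathrm{orb}}_{E,\epsilon}(\Omega)$ is the minimal cardinality of $\Omega_0\subset\Omega$ such that for each $C\in\Omega$ there are $B\in\Omega_0$, $U\in U(N)$ with $\|C_i-UB_iU^*\|_2<\epsilon$ for all $i\in E$. For $K\subset\Sigma_{R,I}$ compact convex, $h(K)=\sup_{E,\epsilon}\inf_{\mathcal{O}\supset K}\limsup_{N\to\infty}\frac1{N^2}\log K^{\mathrm{orb}}_{E,\epsilon}(\Gamma_R^{(N)}(\mathcal{O}))$ with $\mathcal{O}$ ranging over weak-$*$ open neighborhoods of $K$ in $\Sigma_{R,I}$ and $\log0=-\infty$. Then $h(\mathscr{A})=h(L_a)$, where $a=(a_i)_{i\in I}$ is any generating tuple of $\mathscr{A}$ with $\|a_i\|\le R$ for all $i$ and $L_a=\{P\mapsto\tau(P(a)):\tau\text{ a trace on }\mathscr{A}\}$; this does not depend on the choice of $R$ and $a$. Operator system microstates: $\Gamma_R^{(N)}(S,F,\delta,q)$ is the set of tuples $(A_y)_{y\in S}$ of $N\times N$ complex matrices of operator norm at most $R$, with $A_1=I_N$,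 such that $$\Big\|B_1\otimes1+\sum_{y\in S\setminus\{1\}}B_y\otimes A_y\Big\|_{L^q}\le\delta+\Big\|B_1\otimes1+\sum_{y\in S\setminus\{1\}}B_y\otimes y\Big\|$$ for every $(B_y)_{y\in S}\in F$. For $(B_y)\in M_m(\mathbb{C})^S$, the left norm is $\|X\|_{L^q}=\mathrm{tr}(|X|^q)^{1/q}$ with respect to the normalized trace on $M_m(\mathbb{C})\otimes M_N(\mathbb{C})$, and the right norm is the norm on $M_m(V)$. *)

theory Defs
  imports
    "HOL-Analysis.Analysis"
    "HOL-Library.Poly_Mapping"
    "HOL-Library.Function_Algebras"
    "HOL-Library.Extended_Nat"
    "Jordan_Normal_Form.Schur_Decomposition"
begin

section \<open>Unital $C^*$-algebras\<close>

class cstar_algebra = real_normed_algebra_1 + banach +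
  fixes scaleC :: "complex \<Rightarrow> 'a \<Rightarrow> 'a"  (infixr \<open>*\<^sub>C\<close> 75)
    and star :: "'a \<Rightarrow> 'a"
  assumes scaleC_of_real: "of_real r *\<^sub>C x = r *\<^sub>R x"
    and scaleC_add_right: "c *\<^sub>C (x + y) = c *\<^sub>C x + c *\<^sub>C y"
    and scaleC_add_left: "(c + d) *\<^sub>C x = c *\<^sub>C x + d *\<^sub>C x"
    and scaleC_scaleC: "c *\<^sub>C (d *\<^sub>C x) = (c * d) *\<^sub>C x"
    and mult_scaleC_left: "(c *\<^sub>C x) * y = c *\<^sub>C (x * y)"
    and mult_scaleC_right: "x * (c *\<^sub>C y) = c *\<^sub>C (x * y)"
    and norm_scaleC: "norm (c *\<^sub>C x) = cmod c * norm x"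
    and star_add: "star (x + y) = star x + star y"
    and star_scaleC: "star (c *\<^sub>C x) = cnj c *\<^sub>C star x"
    and star_mult: "star (x * y) = star y * star x"
    and star_star: "star (star x) = x"
    and cstar_identity: "norm (star x * x) = (norm x)\<^sup>2"

lemma scaleC_one: "1 *\<^sub>C (x::'a::cstar_algebra) = x"
  using scaleC_of_real[of 1 x] by simp

global_interpretation complex_vector: vector_space "scaleC :: complex \<Rightarrow> 'a \<Rightarrow> 'a::cstar_algebra"
  by unfold_locales (simp_all add: scaleC_add_right scaleC_add_left scaleC_scaleC scaleC_one)

instantiation complex :: cstar_algebra
begin
definition scaleC_complex :: "complex \<Rightarrow> complex \<Rightarrow> complex" where "scaleC_complex c x = c * x"
definition star_complex :: "complex \<Rightarrow> complex" where "star_complex x = cnj x"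
instance
  by standard (auto simp: scaleC_complex_def star_complex_def scaleR_conv_of_real algebra_simps
      norm_mult power2_eq_square)
end

definition cstar_subalgebra :: "'a::cstar_algebra set \<Rightarrow> bool" where
  "cstar_subalgebra B \<longleftrightarrow> closed B \<and> complex_vector.subspace B \<and> 1 \<in> B \<and>
     (\<forall>x\<in>B. \<forall>y\<in>B. x * y \<in> B) \<and> (\<forall>x\<in>B. star x \<in> B)"

definition cstar_generates :: "'a::cstar_algebra set \<Rightarrow> bool" where
  "cstar_generates X \<longleftrightarrow> cstar_subalgebra hull X = UNIV"

definition tracial_state :: "('a::cstar_algebra \<Rightarrow> complex) \<Rightarrow> bool" where
  "tracial_state \<tau> \<longleftrightarrow>
     (\<forall>x y. \<tau> (x + y) = \<tau> x + \<tau> y) \<and> (\<forall>c x. \<tau> (c *\<^sub>C x) = c * \<tau> x) \<and>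
     \<tau> 1 = 1 \<and> (\<forall>x. 0 \<le> \<tau> (star x * x)) \<and> (\<forall>x y. \<tau> (x * y) = \<tau> (y * x))"


section \<open>Matrices over a $C^*$-algebra\<close>

definition star_mat :: "'a::cstar_algebra mat \<Rightarrow> 'a mat" where
  "star_mat X = Matrix.mat (dim_col X) (dim_row X) (\<lambda>(i,j). star (X $$ (j,i)))"

definition positive_mat :: "'a::cstar_algebra mat \<Rightarrow> bool" where
  "positive_mat X \<longleftrightarrow> (\<exists>Y\<in>carrier_mat (dim_row X) (dim_row X). X = star_mat Y * Y)"

text \<open>The $C^*$-norm of $M_m(A)$, for which $M_m(A)$ acts as bounded operators on the Hilbert
  $A$-module $A^m$ with $A$-valued inner product $\sum_i v_i^* w_i$. For $A$ the complex numbers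
  this is the operator norm on Euclidean space.\<close>

definition column_norm :: "'a::cstar_algebra Matrix.vec \<Rightarrow> real" where
  "column_norm v = sqrt (norm (\<Sum>i<dim_vec v. star (vec_index v i) * vec_index v i))"

definition mat_norm :: "'a::cstar_algebra mat \<Rightarrow> real" where
  "mat_norm X = (SUP v\<in>{v \<in> carrier_vec (dim_col X). column_norm v \<le> 1}. column_norm (X *\<^sub>v v))"

definition mats_over :: "'a set \<Rightarrow> nat \<Rightarrow> 'a mat set" where
  "mats_over V m = {X \<in> carrier_mat m m. \<forall>i<m. \<forall>j<m. X $$ (i,j) \<in> V}"


section \<open>Operator systems and the maximal $C^*$-algebra\<close>

definition operator_system :: "'a::cstar_algebra set \<Rightarrow> bool" where
  "operator_system V \<longleftrightarrow> complex_vector.subspace V \<and> 1 \<in> V \<and> (\<forall>x\<in>V. star x \<in> V)"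

definition complete_order_embedding ::
  "'a::cstar_algebra set \<Rightarrow> ('a \<Rightarrow> 'b::cstar_algebra) \<Rightarrow> bool" where
  "complete_order_embedding V \<iota> \<longleftrightarrow>
     (\<forall>x\<in>V. \<forall>y\<in>V. \<iota> (x + y) = \<iota> x + \<iota> y) \<and> (\<forall>c. \<forall>x\<in>V. \<iota> (c *\<^sub>C x) = c *\<^sub>C \<iota> x) \<and>
     inj_on \<iota> V \<and>
     (\<forall>m. \<forall>X\<in>mats_over V m. positive_mat X \<longleftrightarrow> positive_mat (map_mat \<iota> X))"

text \<open>A Hilbert space is given by a set \<open>H\<close> of functions on \<open>'w\<close> that is closed under the pointwise
  operations, together with an arbitrary inner product \<open>ip\<close>, conjugate linear in the first variable,
  for which \<open>H\<close> is complete. Up to unitary isomorphism these are at least all Hilbert spaces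
  with an orthonormal basis indexed by a subset of \<open>'w\<close>, since those are of the form
  $\ell^2(X)$ with $X$ a set of elements of \<open>'w\<close>.\<close>

definition ip_norm :: "(('w \<Rightarrow> complex) \<Rightarrow> ('w \<Rightarrow> complex) \<Rightarrow> complex) \<Rightarrow> ('w \<Rightarrow> complex) \<Rightarrow> real" where
  "ip_norm ip f = sqrt (Re (ip f f))"

definition hilbert_space ::
  "('w \<Rightarrow> complex) set \<Rightarrow> (('w \<Rightarrow> complex) \<Rightarrow> ('w \<Rightarrow> complex) \<Rightarrow> complex) \<Rightarrow> bool" where
  "hilbert_space H ip \<longleftrightarrow>
     module.subspace (\<lambda>c f w. c * f w) H \<and>
     (\<forall>f\<in>H. \<forall>g\<in>H. ip f g = cnj (ip g f)) \<and>
     (\<forall>f\<in>H. \<forall>g\<in>H. \<forall>h\<in>H. ip f (g + h) = ip f g + ip f h) \<and>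
     (\<forall>c. \<forall>f\<in>H. \<forall>g\<in>H. ip f (\<lambda>w. c * g w) = c * ip f g) \<and>
     (\<forall>f\<in>H. 0 \<le> ip f f \<and> (ip f f = 0 \<longrightarrow> f = 0)) \<and>
     (\<forall>X. (\<forall>n::nat. X n \<in> H) \<longrightarrow>
        (\<forall>e>0. \<exists>M. \<forall>m\<ge>M. \<forall>n\<ge>M. ip_norm ip (X m - X n) < e) \<longrightarrow>
        (\<exists>f\<in>H. (\<lambda>n. ip_norm ip (X n - f)) \<longlonglongrightarrow> 0))"

definition bounded_operators ::
  "('w \<Rightarrow> complex) set \<Rightarrow> (('w \<Rightarrow> complex) \<Rightarrow> ('w \<Rightarrow> complex) \<Rightarrow> complex) \<Rightarrow>
   (('w \<Rightarrow> complex) \<Rightarrow> ('w \<Rightarrow> complex)) set" where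
  "bounded_operators H ip = {T \<in> H \<rightarrow>\<^sub>E H.
     (\<forall>f\<in>H. \<forall>g\<in>H. T (f + g) = T f + T g) \<and>
     (\<forall>c. \<forall>f\<in>H. T (\<lambda>w. c * f w) = (\<lambda>w. c * T f w)) \<and>
     (\<exists>C. \<forall>f\<in>H. ip_norm ip (T f) \<le> C * ip_norm ip f)}"

text \<open>The last clause says that the matrix $(\phi(X_{ij}))_{ij}$ is a positive operator on $H^m$.\<close>

definition ucp_map ::
  "'a::cstar_algebra set \<Rightarrow> ('w \<Rightarrow> complex) set \<Rightarrow> (('w \<Rightarrow> complex) \<Rightarrow> ('w \<Rightarrow> complex) \<Rightarrow> complex) \<Rightarrow>
   ('a \<Rightarrow> ('w \<Rightarrow> complex) \<Rightarrow> ('w \<Rightarrow> complex)) \<Rightarrow> bool" where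
  "ucp_map V H ip \<phi> \<longleftrightarrow>
     (\<forall>x\<in>V. \<phi> x \<in> bounded_operators H ip) \<and>
     (\<forall>x\<in>V. \<forall>y\<in>V. \<forall>f\<in>H. \<phi> (x + y) f = \<phi> x f + \<phi> y f) \<and>
     (\<forall>c. \<forall>x\<in>V. \<forall>f\<in>H. \<phi> (c *\<^sub>C x) f = (\<lambda>w. c * \<phi> x f w)) \<and>
     (\<forall>f\<in>H. \<phi> 1 f = f) \<and>
     (\<forall>m. \<forall>X\<in>mats_over V m. positive_mat X \<longrightarrow>
        (\<forall>\<xi>. (\<forall>i<m. \<xi> i \<in> H) \<longrightarrow> 0 \<le> (\<Sum>i<m. \<Sum>j<m. ip (\<xi> i) (\<phi> (X $$ (i,j)) (\<xi> j)))))"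

definition star_hom ::
  "('w \<Rightarrow> complex) set \<Rightarrow> (('w \<Rightarrow> complex) \<Rightarrow> ('w \<Rightarrow> complex) \<Rightarrow> complex) \<Rightarrow>
   ('b::cstar_algebra \<Rightarrow> ('w \<Rightarrow> complex) \<Rightarrow> ('w \<Rightarrow> complex)) \<Rightarrow> bool" where
  "star_hom H ip \<pi> \<longleftrightarrow>
     (\<forall>x. \<pi> x \<in> bounded_operators H ip) \<and>
     (\<forall>x y. \<forall>f\<in>H. \<pi> (x + y) f = \<pi> x f + \<pi> y f) \<and>
     (\<forall>c x. \<forall>f\<in>H. \<pi> (c *\<^sub>C x) f = (\<lambda>w. c * \<pi> x f w)) \<and>
     (\<forall>x y. \<forall>f\<in>H. \<pi> (x * y) f = \<pi> x (\<pi> y f)) \<and>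
     (\<forall>x. \<forall>f\<in>H. \<forall>g\<in>H. ip (\<pi> (star x) f) g = ip f (\<pi> x g))"

text \<open>The algebra \<open>'b\<close> together with \<open>\<iota>\<close> is the maximal $C^*$-algebra of \<open>V\<close>. The Hilbert spaces
  range over those carried by functions on \<open>'a list\<close>. This covers the general universal
  property: any \<open>H\<close> is the orthogonal sum of subspaces that are cyclic for the $C^*$-algebra
  generated by the range of a given u.c.p. map on \<open>V\<close>, and such subspaces have orthonormal
  bases of cardinality at most that of \<open>'a list\<close>.\<close>

definition maximal_cstar :: "'a::cstar_algebra set \<Rightarrow> ('a \<Rightarrow> 'b::cstar_algebra) \<Rightarrow> bool" where
  "maximal_cstar V \<iota> \<longleftrightarrow>
     complete_order_embedding V \<iota> \<and> \<iota> 1 = 1 \<and> cstar_generates (\<iota> ` V) \<and>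
     (\<forall>(H :: ('a list \<Rightarrow> complex) set) ip \<phi>.
        hilbert_space H ip \<longrightarrow> ucp_map V H ip \<phi> \<longrightarrow>
        (\<exists>!\<pi> :: 'b \<Rightarrow> _. star_hom H ip \<pi> \<and> (\<forall>x\<in>V. \<pi> (\<iota> x) = \<phi> x)))"


section \<open>Noncommutative $*$-polynomials\<close>

text \<open>The letter \<open>(i, False)\<close> stands for $T_i$ and \<open>(i, True)\<close> for $T_i^*$. Words form a monoid under
  concatenation, written additively so that \<open>'i nc_word \<Rightarrow>\<^sub>0 complex\<close> is the monoid algebra.\<close>

datatype 'i nc_word = Word (letters: "('i \<times> bool) list")

instantiation nc_word :: (type) monoid_add
begin
definition zero_nc_word :: "'a nc_word" where "0 = Word []"
definition plus_nc_word :: "'a nc_word \<Rightarrow> 'a nc_word \<Rightarrow> 'a nc_word" where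
  "v + w = Word (letters v @ letters w)"
instance by standard (simp_all add: zero_nc_word_def plus_nc_word_def)
end

type_synonym 'i nc_poly = "'i nc_word \<Rightarrow>\<^sub>0 complex"

definition nc_polys :: "'i set \<Rightarrow> 'i nc_poly set" where
  "nc_polys I = {P. \<forall>w\<in>Poly_Mapping.keys P. fst ` set (letters w) \<subseteq> I}"

definition nc_var :: "'i \<Rightarrow> 'i nc_poly" where
  "nc_var i = Poly_Mapping.single (Word [(i, False)]) 1"

definition word_star :: "'i nc_word \<Rightarrow> 'i nc_word" where
  "word_star w = Word (rev (map (\<lambda>(i,b). (i, \<not> b)) (letters w)))"

definition nc_star :: "'i nc_poly \<Rightarrow> 'i nc_poly" where
  "nc_star P = (\<Sum>w\<in>Poly_Mapping.keys P. Poly_Mapping.single (word_star w) (cnj (Poly_Mapping.lookup P w)))"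

definition nc_eval :: "('i \<Rightarrow> 'b::cstar_algebra) \<Rightarrow> 'i nc_poly \<Rightarrow> 'b" where
  "nc_eval a P = (\<Sum>w\<in>Poly_Mapping.keys P. Poly_Mapping.lookup P w *\<^sub>C
     prod_list (map (\<lambda>(i,b). if b then star (a i) else a i) (letters w)))"

definition msum :: "nat \<Rightarrow> ('t \<Rightarrow> 'a::comm_monoid_add mat) \<Rightarrow> 't set \<Rightarrow> 'a mat" where
  "msum n f T = Matrix.mat n n (\<lambda>ij. \<Sum>t\<in>T. f t $$ ij)"

definition word_eval_mat :: "nat \<Rightarrow> ('i \<Rightarrow> complex mat) \<Rightarrow> 'i nc_word \<Rightarrow> complex mat" where
  "word_eval_mat N A w =
     foldr (\<lambda>(i,b) M. (if b then mat_adjoint (A i) else A i) * M) (letters w) (1\<^sub>m N)"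

definition nc_eval_mat :: "nat \<Rightarrow> ('i \<Rightarrow> complex mat) \<Rightarrow> 'i nc_poly \<Rightarrow> complex mat" where
  "nc_eval_mat N A P = msum N (\<lambda>w. Poly_Mapping.lookup P w \<cdot>\<^sub>m word_eval_mat N A w) (Poly_Mapping.keys P)"


section \<open>Complex matrices\<close>

definition ntr :: "complex mat \<Rightarrow> complex" where
  "ntr A = (\<Sum>i<dim_row A. A $$ (i,i)) / of_nat (dim_row A)"

definition norm2 :: "complex mat \<Rightarrow> real" where
  "norm2 A = sqrt (Re (ntr (mat_adjoint A * A)))"

definition unitary_mats :: "nat \<Rightarrow> complex mat set" where
  "unitary_mats N = {U \<in> carrier_mat N N. mat_adjoint U * U = 1\<^sub>m N}"

text \<open>Functional calculus $f(H)$ for Hermitian \<open>H\<close>; the result does not depend on the chosen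
  diagonalization.\<close>

definition mat_fun :: "(real \<Rightarrow> real) \<Rightarrow> complex mat \<Rightarrow> complex mat" where
  "mat_fun f H = (SOME M. \<exists>U\<in>unitary_mats (dim_row H). \<exists>d :: nat \<Rightarrow> real.
     H = U * mat_diag (dim_row H) (\<lambda>i. of_real (d i)) * mat_adjoint U \<and>
     M = U * mat_diag (dim_row H) (\<lambda>i. of_real (f (d i))) * mat_adjoint U)"

definition mat_abs :: "complex mat \<Rightarrow> complex mat" where
  "mat_abs X = mat_fun sqrt (mat_adjoint X * X)"

definition Lq_norm :: "real \<Rightarrow> complex mat \<Rightarrow> real" where
  "Lq_norm q X = Re (ntr (mat_fun (\<lambda>t. t powr q) (mat_abs X))) powr (1 / q)"

text \<open>Kronecker product, identifying $M_m \otimes M_N$ with $M_{mN}$.\<close>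

definition kron :: "complex mat \<Rightarrow> complex mat \<Rightarrow> complex mat" where
  "kron B A = Matrix.mat (dim_row B * dim_row A) (dim_col B * dim_col A)
     (\<lambda>(i,j). B $$ (i div dim_row A, j div dim_col A) * A $$ (i mod dim_row A, j mod dim_col A))"


section \<open>Laws, microstate spaces and 1-bounded entropy\<close>

definition law_space :: "real \<Rightarrow> 'i set \<Rightarrow> ('i nc_poly \<Rightarrow> complex) set" where
  "law_space R I = {l \<in> extensional (nc_polys I).
     (\<forall>P\<in>nc_polys I. \<forall>Q\<in>nc_polys I. l (P + Q) = l P + l Q) \<and>
     (\<forall>c. \<forall>P\<in>nc_polys I. l (Poly_Mapping.single 0 c * P) = c * l P) \<and>
     (\<forall>P\<in>nc_polys I. 0 \<le> l (nc_star P * P)) \<and>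
     l 1 = 1 \<and>
     (\<forall>P\<in>nc_polys I. \<forall>Q\<in>nc_polys I. l (P * Q) = l (Q * P)) \<and>
     (\<forall>k. \<forall>j\<in>I. l ((nc_star (nc_var j) * nc_var j) ^ k) \<le> of_real (R ^ (2 * k)))}"

definition law_topology :: "real \<Rightarrow> 'i set \<Rightarrow> ('i nc_poly \<Rightarrow> complex) topology" where
  "law_topology R I =
     subtopology (product_topology (\<lambda>_. euclidean) (nc_polys I)) (law_space R I)"

definition mat_law :: "nat \<Rightarrow> 'i set \<Rightarrow> ('i \<Rightarrow> complex mat) \<Rightarrow> ('i nc_poly \<Rightarrow> complex)" where
  "mat_law N I A = restrict (\<lambda>P. ntr (nc_eval_mat N A P)) (nc_polys I)"

definition microstates ::
  "real \<Rightarrow> 'i set \<Rightarrow> nat \<Rightarrow> ('i nc_poly \<Rightarrow> complex) set \<Rightarrow> ('i \<Rightarrow> complex mat) set" where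
  "microstates R I N U =
     {A \<in> I \<rightarrow>\<^sub>E carrier_mat N N. (\<forall>i\<in>I. mat_norm (A i) \<le> R) \<and> mat_law N I A \<in> U}"

text \<open>The orbital covering number; it is \<open>\<infinity>\<close> if there is no finite cover.\<close>

definition orbital_covering_number ::
  "nat \<Rightarrow> 'i set \<Rightarrow> real \<Rightarrow> ('i \<Rightarrow> complex mat) set \<Rightarrow> enat" where
  "orbital_covering_number N E \<epsilon> \<Omega> =
     (INF \<Omega>'\<in>{\<Omega>'. \<Omega>' \<subseteq> \<Omega> \<and> finite \<Omega>' \<and>
        (\<forall>C\<in>\<Omega>. \<exists>B\<in>\<Omega>'. \<exists>U\<in>unitary_mats N. \<forall>i\<in>E. norm2 (C i - U * B i * mat_adjoint U) < \<epsilon>)}.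
      enat (card \<Omega>'))"

definition log_enat :: "enat \<Rightarrow> ereal" where
  "log_enat k = (case k of enat n \<Rightarrow> (if n = 0 then -\<infinity> else ereal (ln (real n))) | \<infinity> \<Rightarrow> \<infinity>)"

definition orbital_growth ::
  "'i set \<Rightarrow> real \<Rightarrow> (nat \<Rightarrow> ('i \<Rightarrow> complex mat) set) \<Rightarrow> ereal" where
  "orbital_growth E \<epsilon> \<Omega> =
     limsup (\<lambda>N. ereal (1 / (real N)\<^sup>2) * log_enat (orbital_covering_number N E \<epsilon> (\<Omega> N)))"

definition one_bounded_entropy :: "real \<Rightarrow> 'i set \<Rightarrow> ('i nc_poly \<Rightarrow> complex) set \<Rightarrow> ereal" where
  "one_bounded_entropy R I K =
     (SUP E\<in>{E. finite E \<and> E \<subseteq> I}. SUP \<epsilon>\<in>{0<..}.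
        INF U\<in>{U. openin (law_topology R I) U \<and> K \<subseteq> U}.
          orbital_growth E \<epsilon> (\<lambda>N. microstates R I N U))"

definition trace_laws :: "'i set \<Rightarrow> ('i \<Rightarrow> 'b::cstar_algebra) \<Rightarrow> ('i nc_poly \<Rightarrow> complex) set" where
  "trace_laws I a = {restrict (\<lambda>P. \<tau> (nc_eval a P)) (nc_polys I) | \<tau>. tracial_state \<tau>}"


section \<open>Operator system microstates\<close>

definition coeff_support :: "'a set \<Rightarrow> nat \<Rightarrow> ('a \<Rightarrow> complex mat) \<Rightarrow> 'a set" where
  "coeff_support S m B = {y \<in> S. B y \<noteq> 0\<^sub>m m m}"

text \<open>A pair \<open>(m, B)\<close> is a finitely supported tuple in $M_m(\mathbb{C})^S$.\<close>

definition coeff_tuples :: "'a set \<Rightarrow> (nat \<times> ('a \<Rightarrow> complex mat)) set" where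
  "coeff_tuples S =
     {(m, B). 1 \<le> m \<and> B \<in> S \<rightarrow>\<^sub>E carrier_mat m m \<and> finite (coeff_support S m B)}"

definition mat_pencil ::
  "'a::cstar_algebra set \<Rightarrow> nat \<Rightarrow> nat \<Rightarrow> ('a \<Rightarrow> complex mat) \<Rightarrow> ('a \<Rightarrow> complex mat) \<Rightarrow> complex mat" where
  "mat_pencil S m N B A =
     kron (B 1) (1\<^sub>m N) + msum (m * N) (\<lambda>y. kron (B y) (A y)) (coeff_support (S - {1}) m B)"

definition system_pencil ::
  "'a::cstar_algebra set \<Rightarrow> nat \<Rightarrow> ('a \<Rightarrow> complex mat) \<Rightarrow> 'a mat" where
  "system_pencil S m B =
     map_mat (\<lambda>c. c *\<^sub>C 1) (B 1) +
     msum m (\<lambda>y. map_mat (\<lambda>c. c *\<^sub>C y) (B y)) (coeff_support (S - {1}) m B)"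

definition system_microstates ::
  "real \<Rightarrow> 'a::cstar_algebra set \<Rightarrow> nat \<Rightarrow> (nat \<times> ('a \<Rightarrow> complex mat)) set \<Rightarrow> real \<Rightarrow> real \<Rightarrow>
   ('a \<Rightarrow> complex mat) set" where
  "system_microstates R S N F \<delta> q =
     {A \<in> S \<rightarrow>\<^sub>E carrier_mat N N. (\<forall>y\<in>S. mat_norm (A y) \<le> R) \<and> A 1 = 1\<^sub>m N \<and>
        (\<forall>(m, B)\<in>F. Lq_norm q (mat_pencil S m N B A) \<le> \<delta> + mat_norm (system_pencil S m B))}"

end

theory Submission
  imports Defs "Jordan_Normal_Form.Spectral_Radius"
begin

text \<open>
  Both sides count, up to conjugation by unitaries, tuples of matrices that resemble the operator system \<open>V\<close>: on the
  left the law of the tuple is near the law of a trace on the maximal algebra, on the right the norms of matrix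
  pencils in the tuple nearly obey the norms in \<open>V\<close>. The proof compares the two notions of resemblance.

  The entropy may be computed from any generators, here \<open>\<iota> y\<close> for \<open>y \<in> S\<close>, with the additional requirement
  that the matrix of the unit is the identity, as for operator system microstates (\<open>unital_entropy_le\<close>). The reason is
  that a microstate for one generating tuple, inserted in polynomials that approximate another tuple, nearly
  is a microstate for the latter. It may violate the norm bound, but its high moments show that cutting off the large
  singular values changes it little in the 2-norm (\<open>truncation\<close>, \<open>microstate_transfer\<close>). All estimates are uniform in the
  matrix size because the Lipschitz constants of polynomials are (\<open>poly_mat_lipschitz\<close>).

  For these generators each kind of microstate space eventually lies in the other. If the law of a tuple is near the law
  of a trace, its pencils have moments bounded by the norms in \<open>V\<close>, because the complete order embedding \<open>\<iota>\<close> is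
  completely contractive (\<open>trace_pencil_moments\<close>), and moments dominate \<open>L\<^sup>q\<close>-norms (\<open>unital_in_system\<close>).
  Conversely, by compactness of the space of laws it suffices that a law obeying the moment bounds of all pencils is the
  law of a trace (\<open>trace_of_law\<close>, \<open>system_in_unital\<close>). In the GNS representation of such a law, the moment bounds turn
  into norm bounds: pencils act on columns with at most the norm of their values in \<open>M\<^sub>m(V)\<close>. So
  the linear polynomials define a map on \<open>V\<close>, which is completely positive since positivity of a self-adjoint element
  is visible in the norms of its translates by scalars (\<open>\<phi>_positive\<close>). The universal property extends this map to a
  representation of the maximal algebra, and its vector state at the cyclic vector is a trace with the given law.

  The C*-algebras are abstract and not represented on a Hilbert space. Positivity is defined by a norm inequality; that
  \<open>x\<^sup>*x\<close> is positive is the theorem of Kelley and Vaught (\<open>pos_star_mult\<close>), from which the Cauchy--Schwarz inequality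
  for the Hilbert module of columns and the properties of the norm on matrices follow.
\<close>

section \<open>Involution and positivity in C*-algebras\<close>

lemma scaleC_zero [simp]: "c *\<^sub>C (0::'a::cstar_algebra) = 0" "0 *\<^sub>C (x::'a) = 0" by simp_all

lemma scaleC_minus_left: "(- c) *\<^sub>C (x::'a::cstar_algebra) = - (c *\<^sub>C x)" by (rule complex_vector.scale_minus_left)

lemma scaleC_diff_right: "c *\<^sub>C (x - y::'a::cstar_algebra) = c *\<^sub>C x - c *\<^sub>C y" by (rule complex_vector.scale_right_diff_distrib)

lemma star_zero [simp]: "star (0::'a::cstar_algebra) = 0" using star_add[of 0 "0::'a"] by simp

lemma star_minus: "star (- x::'a::cstar_algebra) = - star x" using star_add[of x "- x"] by (simp add: eq_neg_iff_add_eq_0 add.commute)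

lemma star_diff: "star (x - y::'a::cstar_algebra) = star x - star y" using star_add[of x "- y"] by (simp add: star_minus)

lemma star_one [simp]: "star (1::'a::cstar_algebra) = 1" by (metis mult.left_neutral star_mult star_star mult_1_right)

lemma star_scaleR: "star (r *\<^sub>R (x::'a::cstar_algebra)) = r *\<^sub>R star x" by (simp flip: scaleC_of_real add: star_scaleC)

lemma star_of_real [simp]: "star (of_real r::'a::cstar_algebra) = of_real r" by (simp add: of_real_def star_scaleR)

lemma star_sum: "star (sum f A :: 'a::cstar_algebra) = (\<Sum>x\<in>A. star (f x))"
  by (induction A rule: infinite_finite_induct) (simp_all add: star_add)

lemma star_power: "star (x ^ n :: 'a::cstar_algebra) = star x ^ n" by (induction n) (simp_all add: star_mult power_commutes)

lemma norm_star [simp]: "norm (star x :: 'a::cstar_algebra) = norm x"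
proof -
  have "norm x \<le> norm (star x)" for x :: 'a
  proof (cases "norm x = 0")
    case False
    have "(norm x)\<^sup>2 \<le> norm (star x) * norm x" by (metis cstar_identity norm_mult_ineq)
    then show ?thesis using False by (simp add: power2_eq_square)
  qed simp
  from this[of x] this[of "star x"] show ?thesis by (simp add: star_star)
qed

lemma bounded_linear_star: "bounded_linear (star :: 'a::cstar_algebra \<Rightarrow> 'a)"
  by (rule bounded_linear_intro[where K=1]) (simp_all add: star_add star_scaleR)

lemma continuous_star: "continuous_on A (star :: 'a::cstar_algebra \<Rightarrow> 'a)" using linear_continuous_on[OF bounded_linear_star] .

lemmas tendsto_star [tendsto_intros] = bounded_linear.tendsto[OF bounded_linear_star]

lemma bounded_linear_scaleC: "bounded_linear (\<lambda>x::'a::cstar_algebra. c *\<^sub>C x)"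
proof (rule bounded_linear_intro[where K="cmod c"])
  show "c *\<^sub>C (r *\<^sub>R x) = r *\<^sub>R (c *\<^sub>C x)" for r and x :: 'a by (simp flip: scaleC_of_real add: scaleC_scaleC mult.commute)
qed (simp_all add: scaleC_add_right norm_scaleC)

lemmas tendsto_scaleC [tendsto_intros] = bounded_linear.tendsto[OF bounded_linear_scaleC]

lemma norm_selfadjoint_square:
  assumes "star (h::'a::cstar_algebra) = h" shows "norm (h * h) = (norm h)\<^sup>2" using cstar_identity[of h] assms by simp

text \<open>For \<open>k = 1 - u\<close> the equation reads \<open>u = (z + u\<^sup>2) / 2\<close>. This is a fixed point equation for a contraction on the
  elements of norm at most \<open>\<parallel>z\<parallel>\<close> that commute with everything that commutes with \<open>z\<close>, and are self-adjoint if \<open>z\<close> is.\<close>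

lemma sqrt_one_minus:
  fixes z :: "'a::cstar_algebra"
  assumes z: "norm z < 1"
  obtains k where "k * k = 1 - z" "norm (1 - k) \<le> norm z"
    "\<And>y. y * z = z * y \<Longrightarrow> y * k = k * y" "star z = z \<Longrightarrow> star k = k"
proof -
  define s where "s = {u::'a. norm u \<le> norm z \<and> (star z = z \<longrightarrow> star u = u) \<and>
     (\<forall>y. y * z = z * y \<longrightarrow> y * u = u * y)}"
  define f where "f = (\<lambda>u::'a. (1/2) *\<^sub>R (z + u * u))"
  have "closed s"
  proof -
    have "closed {u::'a. star z = z \<longrightarrow> star u = u}"
      by (cases "star z = z") (auto intro!: closed_Collect_eq continuous_star continuous_intros)
    moreover have "closed {u::'a. \<forall>y. y * z = z * y \<longrightarrow> y * u = u * y}"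
    proof -
      have "{u::'a. \<forall>y. y * z = z * y \<longrightarrow> y * u = u * y} = (\<Inter>y\<in>{y. y * z = z * y}. {u. y * u = u * y})" by auto
      then show ?thesis by (auto intro!: closed_INT closed_Collect_eq continuous_intros)
    qed
    moreover have "closed {u::'a. norm u \<le> norm z}" by (intro closed_Collect_le continuous_intros)
    ultimately show ?thesis unfolding s_def Collect_conj_eq by (intro closed_Int)
  qed
  then have "complete s" by (simp add: complete_eq_closed)
  moreover have "s \<noteq> {}" by (auto simp: s_def intro: exI[of _ 0])
  moreover have "f ` s \<subseteq> s"
  proof
    fix v assume "v \<in> f ` s"
    then obtain u where us: "u \<in> s" and v: "v = f u" by auto
    have u: "norm u \<le> norm z" "star z = z \<Longrightarrow> star u = u" using us by (simp_all add: s_def)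
    have uc: "y * u = u * y" if "y * z = z * y" for y using us that unfolding s_def by blast
    have "norm (z + u * u) \<le> norm z + norm u * norm u" by (meson add_left_mono norm_mult_ineq norm_triangle_le)
    also have "norm u * norm u \<le> norm z * 1" using u(1) z by (intro mult_mono) auto
    finally have "norm v \<le> norm z" by (simp add: v f_def)
    moreover have "star v = v" if "star z = z" using u(2)[OF that] that by (simp add: v f_def star_scaleR star_add star_mult)
    moreover have "y * v = v * y" if "y * z = z * y" for y
    proof -
      have "y * (u * u) = u * u * y" using uc[OF that] by (metis mult.assoc)
      then show ?thesis using that by (simp add: v f_def distrib_left distrib_right)
    qed
    ultimately show "v \<in> s" unfolding s_def by blast
  qed
  moreover have "dist (f x) (f y) \<le> norm z * dist x y" if "x \<in> s" "y \<in> s" for x y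
  proof -
    have "norm (x * x - y * y) = norm (x * (x - y) + (x - y) * y)" by (simp add: algebra_simps)
    also have "\<dots> \<le> norm x * norm (x - y) + norm (x - y) * norm y" by (meson add_mono norm_mult_ineq norm_triangle_le)
    also have "\<dots> \<le> norm z * norm (x - y) + norm (x - y) * norm z"
    proof -
      have "norm x \<le> norm z" "norm y \<le> norm z" using that by (simp_all add: s_def)
      then show ?thesis by (intro add_mono mult_mono) simp_all
    qed
    finally show ?thesis by (simp add: f_def dist_norm flip: scaleR_diff_right)
  qed
  ultimately have "\<exists>!x\<in>s. f x = x" using z by (intro Banach_fix[where c="norm z"]) auto
  then obtain u where us: "u \<in> s" and fu: "f u = u" by blast
  have u: "norm u \<le> norm z" "star z = z \<Longrightarrow> star u = u" using us by (simp_all add: s_def)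
  have uc: "y * u = u * y" if "y * z = z * y" for y using us that unfolding s_def by blast
  have "2 *\<^sub>R f u = z + u * u" by (simp add: f_def)
  then have e: "u + u = z + u * u" by (simp add: fu scaleR_2)
  show ?thesis
  proof (rule that[of "1 - u"])
    show "(1 - u) * (1 - u) = 1 - z" using e by (simp add: algebra_simps)
    show "norm (1 - (1 - u)) \<le> norm z" using u by simp
    show "y * (1 - u) = (1 - u) * y" if "y * z = z * y" for y using uc[OF that] by (simp add: algebra_simps)
    show "star (1 - u) = 1 - u" if "star z = z" using u(2)[OF that] by (simp add: star_diff)
  qed
qed

text \<open>For self-adjoint \<open>x\<close> the inequality means that the spectrum lies in \<open>[0, 2t]\<close>. In this form, sums of positive
  elements are positive by the triangle inequality.\<close>

definition pos :: "'a::cstar_algebra \<Rightarrow> bool" where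
  "pos x \<longleftrightarrow> star x = x \<and> (\<exists>t\<ge>0. norm (of_real t - x) \<le> t)"

lemma posI: "star x = x \<Longrightarrow> norm (of_real t - x) \<le> t \<Longrightarrow> pos x" unfolding pos_def by (meson norm_ge_zero order_trans)

lemma pos_selfadjoint: "pos x \<Longrightarrow> star x = x" by (simp add: pos_def)

lemma selfadjoint_sqrt:
  fixes x :: "'a::cstar_algebra"
  assumes x: "star x = x" and t: "norm (of_real t - x) < t"
  obtains h where "h * h = x" "star h = h" "\<And>y. y * x = x * y \<Longrightarrow> y * h = h * y"
    "norm (of_real (sqrt t) - h) < sqrt t"
proof -
  have t0: "t > 0" using t by (meson norm_ge_zero order_le_less_trans)
  define z where "z = 1 - (1/t) *\<^sub>R x"
  have "of_real t - x = t *\<^sub>R z" using t0 by (simp add: z_def of_real_def algebra_simps)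
  then have "norm z < 1" using t t0 by simp
  then obtain k where k: "k * k = 1 - z" "norm (1 - k) \<le> norm z"
    "\<And>y. y * z = z * y \<Longrightarrow> y * k = k * y" "star z = z \<Longrightarrow> star k = k" by (rule sqrt_one_minus) blast
  have kk: "k * k = (1/t) *\<^sub>R x" using k(1) by (simp add: z_def)
  show ?thesis
  proof (rule that[of "sqrt t *\<^sub>R k"])
    show "sqrt t *\<^sub>R k * (sqrt t *\<^sub>R k) = x" using t0 by (simp add: kk)
    have "star z = z" by (simp add: z_def star_diff star_scaleR x)
    then show "star (sqrt t *\<^sub>R k) = sqrt t *\<^sub>R k" by (simp add: star_scaleR k(4))
    show "y * sqrt t *\<^sub>R k = sqrt t *\<^sub>R k * y" if "y * x = x * y" for y using k(3)[of y] that by (simp add: z_def algebra_simps)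
    have "of_real (sqrt t) - sqrt t *\<^sub>R k = sqrt t *\<^sub>R (1 - k)" by (simp add: of_real_def algebra_simps)
    then show "norm (of_real (sqrt t) - sqrt t *\<^sub>R k) < sqrt t" using t0 k(2) \<open>norm z < 1\<close> by simp
  qed
qed

text \<open>If \<open>h\<^sup>2 + k\<^sup>2 = s\<close> with commuting self-adjoint \<open>h\<close>, \<open>k\<close>, then \<open>h + \<i> k\<close> is
  a multiple of a unitary, so that \<open>\<parallel>h\<parallel>\<^sup>2 \<le> s\<close>.\<close>

lemma norm_summand_of_squares:
  fixes h k :: "'a::cstar_algebra"
  assumes "star h = h" "star k = k" "h * k = k * h" "h * h + k * k = of_real s" "s \<ge> 0"
  shows "norm (h * h) \<le> s"
proof -
  define u where "u = h + \<i> *\<^sub>C k"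
  have su: "star u = h - \<i> *\<^sub>C k" by (simp add: u_def star_add star_scaleC assms scaleC_minus_left)
  have "star u * u = h * h + k * k" unfolding su by (simp add: u_def algebra_simps mult_scaleC_left mult_scaleC_right scaleC_scaleC
        assms(3) scaleC_minus_left scaleC_one)
  then have "(norm u)\<^sup>2 = s" using cstar_identity[of u] assms(4,5) by simp
  have "2 *\<^sub>R h = u + star u" by (simp add: su) (simp add: u_def scaleR_2)
  then have "norm (2 *\<^sub>R h) \<le> norm u + norm (star u)" by (metis norm_triangle_ineq)
  then have "norm h \<le> norm u" by simp
  then have "(norm h)\<^sup>2 \<le> s" using \<open>(norm u)\<^sup>2 = s\<close> by (metis norm_ge_zero power_mono)
  then show ?thesis by (simp add: norm_selfadjoint_square assms)
qed

text \<open>The square root \<open>k\<close> of \<open>s - h\<^sup>2\<close> commutes with \<open>h\<close>, so that \<open>norm_summand_of_squares\<close> applies to \<open>k\<close>. It exists after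
  enlarging \<open>s\<close> a little.\<close>

lemma norm_diff_square_le:
  fixes h :: "'a::cstar_algebra"
  assumes h: "star h = h" and s: "norm (h * h) \<le> s"
  shows "norm (of_real s - h * h) \<le> s"
proof (rule field_le_epsilon)
  fix e :: real assume "e > 0"
  define t where "t = s + e / 2"
  have t: "norm (h * h) < t" using s \<open>e > 0\<close> by (simp add: t_def)
  have "norm (of_real t - (of_real t - h * h)) < t" using t by simp
  moreover have "star (of_real t - h * h) = of_real t - h * h" by (simp add: star_diff star_mult h)
  moreover note selfadjoint_sqrt
  ultimately obtain k where k: "k * k = of_real t - h * h" "star k = k"
    "\<And>y. y * (of_real t - h * h) = (of_real t - h * h) * y \<Longrightarrow> y * k = k * y" by metis
  have "h * k = k * h" by (rule k(3)) (simp add: algebra_simps flip: scaleR_conv_of_real, simp add: of_real_def)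
  then have "norm (k * k) \<le> t" using k(1,2) h t norm_ge_zero[of "h * h"]
    by (intro norm_summand_of_squares[of k h]) (simp_all del: norm_ge_zero)
  then have "norm (of_real t - h * h) \<le> t" by (simp add: k(1))
  moreover have "of_real s - h * h = (of_real t - h * h) - of_real (e/2)" by (simp add: t_def)
  then have "norm (of_real s - h * h) \<le> norm (of_real t - h * h) + norm (of_real (e/2) :: 'a)" by (metis norm_triangle_ineq4)
  ultimately show "norm (of_real s - h * h) \<le> s + e" using \<open>e > 0\<close> by (simp add: t_def)
qed

lemma pos_square: "star h = h \<Longrightarrow> pos (h * h)" by (rule posI[OF _ norm_diff_square_le[OF _ order_refl]]) (simp_all add: star_mult)

lemma pos_add: assumes "pos x" "pos y" shows "pos (x + y)"
proof -
  obtain s t where s: "norm (of_real s - x) \<le> s" and t: "norm (of_real t - y) \<le> t" using assms by (auto simp: pos_def)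
  have "norm (of_real (s + t) - (x + y)) = norm ((of_real s - x) + (of_real t - y))" by (simp add: algebra_simps)
  also have "\<dots> \<le> s + t" using s t norm_triangle_mono by blast
  finally show ?thesis using assms by (intro posI[of _ "s + t"]) (simp_all add: pos_def star_add)
qed

lemma pos_of_real: "0 \<le> t \<Longrightarrow> pos (of_real t)" by (rule posI[of _ t]) simp_all

lemma pos_zero [simp]: "pos 0" using pos_of_real[of 0] by simp
lemma pos_sum: "(\<And>i. i \<in> A \<Longrightarrow> pos (f i)) \<Longrightarrow> pos (sum f A)" by (induction A rule: infinite_finite_induct) (auto intro: pos_add)

lemma pos_scaleR: assumes "pos x" "0 \<le> r" shows "pos (r *\<^sub>R x)"
proof -
  obtain t where t: "norm (of_real t - x) \<le> t" using assms by (auto simp: pos_def)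
  have "of_real (r * t) - r *\<^sub>R x = r *\<^sub>R (of_real t - x)" by (simp add: of_real_def algebra_simps)
  then have "norm (of_real (r * t) - r *\<^sub>R x) \<le> r * t" using t assms(2) by (simp add: mult_left_mono)
  then show ?thesis using assms by (intro posI[of _ "r * t"]) (simp_all add: pos_def star_scaleR)
qed

lemma mult_of_real_commute: "y * of_real r = of_real r * (y :: 'a::real_algebra_1)" by (simp add: of_real_def)

lemma pos_plus_eps_sqrt:
  fixes x :: "'a::cstar_algebra"
  assumes "pos x" "e > 0"
  obtains h where "h * h = x + of_real e" "star h = h" "\<And>y. y * x = x * y \<Longrightarrow> y * h = h * y"
proof -
  obtain t where t: "norm (of_real t - x) \<le> t" using assms by (auto simp: pos_def)
  have "norm (of_real (t + e) - (x + of_real e)) < t + e" using t assms(2) by simp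
  moreover have "star (x + of_real e) = x + of_real e" using assms by (simp add: star_add pos_def)
  moreover note selfadjoint_sqrt
  ultimately obtain h where "h * h = x + of_real e" "star h = h"
    "\<And>y. y * (x + of_real e) = (x + of_real e) * y \<Longrightarrow> y * h = h * y" by metis
  moreover from this(3) have "y * h = h * y" if "y * x = x * y" for y using that by (metis distrib_left distrib_right mult_of_real_commute)
  ultimately show ?thesis using that by blast
qed

text \<open>Any bound for the norm serves as the constant in the definition of positivity, since \<open>x\<close> is a limit of squares.\<close>

lemma pos_norm_bound:
  assumes x: "pos (x::'a::cstar_algebra)" and s: "norm x \<le> s"
  shows "norm (of_real s - x) \<le> s"
proof (rule field_le_epsilon)
  fix e :: real assume "e > 0"
  then have e2: "e / 2 > 0" by simp
  obtain h where h: "h * h = x + of_real (e/2)" "star h = h" using pos_plus_eps_sqrt[OF x e2] by blast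
  have "norm (h * h) \<le> s + e / 2" unfolding h(1) using s \<open>e > 0\<close> norm_triangle_ineq[of x "of_real (e/2)"] by simp
  from norm_diff_square_le[OF h(2) this] show "norm (of_real s - x) \<le> s + e" using \<open>e > 0\<close> by (simp add: h(1))
qed

lemma pos_limit:
  assumes "\<And>n. pos (f n :: 'a::cstar_algebra)" "f \<longlonglongrightarrow> x"
  shows "pos x"
proof -
  obtain K where K: "\<And>n. norm (f n) \<le> K" using assms(2) by (meson BseqE convergentI convergent_imp_Bseq)
  have "(\<lambda>n. norm (of_real K - f n)) \<longlonglongrightarrow> norm (of_real K - x)" by (intro tendsto_intros assms)
  then have "norm (of_real K - x) \<le> K" by (rule Lim_bounded) (use pos_norm_bound assms(1) K in blast)
  moreover have "(\<lambda>n. star (f n)) \<longlonglongrightarrow> star x" by (intro tendsto_intros assms)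
  then have "star x = x" using assms LIMSEQ_unique by (simp add: pos_selfadjoint)
  ultimately show ?thesis by (rule posI[rotated])
qed

text \<open>Up to \<open>e\<close>, the elements \<open>x\<close> and \<open>s - x\<close> have commuting square roots \<open>h\<close> and \<open>k\<close> with \<open>h\<^sup>2 + k\<^sup>2 = s\<close>.\<close>

lemma norm_le_if_pos:
  assumes x: "pos (x::'a::cstar_algebra)" and s: "pos (of_real s - x)" and s0: "s \<ge> 0"
  shows "norm x \<le> s"
proof (rule field_le_epsilon)
  fix e :: real assume e: "e > 0"
  then have e4: "e / 4 > 0" by simp
  obtain h where h: "h * h = x + of_real (e/4)" "star h = h" "\<And>y. y * x = x * y \<Longrightarrow> y * h = h * y" using pos_plus_eps_sqrt[OF x e4] by blast
  obtain k where k: "k * k = of_real s - x + of_real (e/4)" "star k = k"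
    "\<And>y. y * (of_real s - x) = (of_real s - x) * y \<Longrightarrow> y * k = k * y" using pos_plus_eps_sqrt[OF s e4] by blast
  have "h * x = x * h" using h(3)[OF refl] by simp
  then have "h * k = k * h" by (intro k(3)) (simp add: left_diff_distrib right_diff_distrib mult_of_real_commute)
  then have "norm (h * h) \<le> s + e / 2" by (intro norm_summand_of_squares[of h k]) (use h(1,2) k(1,2) e s0 in \<open>simp_all flip: of_real_add\<close>)
  moreover have "x = h * h - of_real (e/4)" by (simp add: h(1))
  then have "norm x \<le> norm (h * h) + norm (of_real (e/4) :: 'a)" by (metis norm_triangle_ineq4)
  ultimately show "norm x \<le> s + e" using e by simp
qed

lemma pos_le_norm: "star x = x \<Longrightarrow> norm x \<le> c \<Longrightarrow> pos (of_real c - x)" by (rule posI[of _ c]) (simp_all add: star_diff)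

lemma norm_mono_pos:
  assumes "pos (x::'a::cstar_algebra)" "pos (y - x)" shows "norm x \<le> norm y"
proof (rule norm_le_if_pos[OF assms(1)])
  have "star y = y" using pos_selfadjoint[OF pos_add[OF assms(2,1)]] by simp
  from pos_add[OF pos_le_norm[OF this order_refl] assms(2)] show "pos (of_real (norm y) - x)" by simp
qed simp

lemma sum_of_squares_cartesian:
  fixes x :: "'a::cstar_algebra"
  shows "pos (star x * x + x * star x)"
proof -
  define a where "a = x + star x"
  define b where "b = \<i> *\<^sub>C (x - star x)"
  have sa: "star a = a" by (simp add: a_def star_add star_star add.commute)
  have sb: "star b = b" by (simp add: b_def star_scaleC star_diff star_star scaleC_minus_left scaleC_diff_right)
  have "b * b = - ((x - star x) * (x - star x))"
    by (simp add: b_def mult_scaleC_left mult_scaleC_right scaleC_scaleC scaleC_minus_left scaleC_one)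
  then have "a * a + b * b = 2 *\<^sub>R (star x * x + x * star x)" by (simp add: a_def algebra_simps scaleR_2)
  then have "pos (2 *\<^sub>R (star x * x + x * star x))" by (metis pos_add pos_square sa sb)
  from pos_scaleR[OF this, of "1/2"] show ?thesis by simp
qed

lemma le_of_double_powers:
  fixes r \<rho> K :: real
  assumes r: "0 \<le> r" "0 \<le> \<rho>" and le: "\<And>n. r ^ (2 ^ n) \<le> K * \<rho> ^ (2 ^ n)"
  shows "r \<le> \<rho>"
proof (rule ccontr)
  assume "\<not> r \<le> \<rho>"
  then have rr: "\<rho> < r" by simp
  define q where "q = \<rho> / r"
  have q: "0 \<le> q" "q < 1" using r rr by (auto simp: q_def)
  have "(\<lambda>n. K * q ^ n) \<longlonglongrightarrow> K * 0" using q by (intro tendsto_intros LIMSEQ_power_zero) simp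
  then have "\<forall>\<^sub>F n in sequentially. K * q ^ n < 1" by (intro order_tendstoD) auto
  then obtain M where M: "\<And>n. n \<ge> M \<Longrightarrow> K * q ^ n < 1" by (auto simp: eventually_sequentially)
  have "M \<le> 2 ^ M" by (simp add: less_imp_le)
  from M[OF this] have "K * \<rho> ^ (2 ^ M) < r ^ (2 ^ M)" using r rr by (simp add: q_def power_divide divide_simps split: if_splits)
  then show False using le[of M] by simp
qed

text \<open>The C*-identity makes the norm multiplicative on the powers of \<open>x\<close> whose exponent is a power of two, and a polynomial
  factor disappears under the corresponding roots.\<close>

lemma selfadjoint_norm_le_by_powers:
  fixes x :: "'a::cstar_algebra"
  assumes x: "star x = x" and t: "t \<ge> 0" and C: "\<And>n. norm (x ^ n) \<le> t ^ n + C * real n * t ^ (n - 1)"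
  shows "norm x \<le> t"
proof (rule dense_ge)
  fix s assume s: "t < s"
  have pw: "norm (x ^ (2 ^ n)) = norm x ^ (2 ^ n)" for n
  proof (induction n)
    case (Suc n)
    have "x ^ (2 ^ Suc n) = x ^ (2 ^ n) * x ^ (2 ^ n)" by (simp flip: power_add add: mult_2)
    moreover have "star (x ^ (2 ^ n)) = x ^ (2 ^ n)" by (simp add: star_power x)
    ultimately have "norm (x ^ (2 ^ Suc n)) = (norm x ^ (2 ^ n))\<^sup>2" using norm_selfadjoint_square[of "x ^ (2 ^ n)"] Suc by simp
    then show ?case by (simp flip: power_mult add: mult.commute)
  qed simp
  define q where "q = t / s"
  have q: "0 \<le> q" "q < 1" using s t by (auto simp: q_def)
  have "(\<lambda>n. q ^ Suc n + C / s * (real n * q ^ n + q ^ n)) \<longlonglongrightarrow> q * 0 + C / s * (0 + 0)"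
    unfolding power_Suc using q by (intro tendsto_intros powser_times_n_limit_0 LIMSEQ_power_zero) auto
  from convergent_imp_Bseq[OF convergentI[OF this]]
  obtain K where K: "\<And>n. norm (q ^ Suc n + C / s * (real n * q ^ n + q ^ n)) \<le> K" unfolding Bseq_def by blast
  have "norm x ^ (2 ^ n) \<le> K * s ^ (2 ^ n)" for n
  proof -
    obtain m where m: "2 ^ n = Suc m" by (metis gr0_implies_Suc zero_less_numeral zero_less_power)
    have "norm x ^ Suc m \<le> t ^ Suc m + C * real (Suc m) * t ^ m" using C[of "Suc m"] pw[of n] by (simp add: m)
    also have "\<dots> = (q ^ Suc m + C / s * (real m * q ^ m + q ^ m)) * s ^ Suc m" using s t by (simp add: q_def power_divide field_simps)
    also have "\<dots> \<le> K * s ^ Suc m" using K[of m] s t by (intro mult_right_mono) auto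
    finally show ?thesis by (simp only: m)
  qed
  then show "norm x \<le> s" by (intro le_of_double_powers[where K=K and r="norm x"]) (use s t in auto)
qed

text \<open>The elements \<open>x\<^sup>*x\<close> and \<open>x x\<^sup>*\<close> have the same spectrum away from \<open>0\<close>. In place of spectra,
  the powers of \<open>k = r + x x\<^sup>*\<close> and \<open>h = r + x\<^sup>*x\<close> are compared by means of \<open>k x = x h\<close>.\<close>

lemma pos_shift_swap:
  fixes x :: "'a::cstar_algebra"
  assumes e: "e \<ge> 0" and p: "pos (of_real e - star x * x)"
  shows "pos (of_real e - x * star x)"
proof -
  have sw: "star (x * star x) = x * star x" by (simp add: star_mult star_star)
  define t where "t = e + (norm x)\<^sup>2"
  define r where "r = (of_real (t - e) :: 'a)"
  define h where "h = r + star x * x"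
  define k where "k = r + x * star x"
  have "norm (of_real e - star x * x) \<le> t" using norm_triangle_ineq4[of "of_real e" "star x * x"] e unfolding t_def cstar_identity by simp
  from pos_norm_bound[OF p this] have h: "norm h \<le> t" by (simp add: h_def r_def algebra_simps)
  have t0: "0 \<le> t" using h norm_ge_zero order_trans by blast
  have r: "norm r \<le> t" using e by (simp only: r_def norm_of_real t_def) simp
  have "k * x = x * h" by (simp only: h_def k_def distrib_left distrib_right r_def mult_of_real_commute mult.assoc)
  then have kx: "k ^ n * x = x * h ^ n" for n
    by (induction n) (simp_all only: power_0 power_Suc2 mult.assoc mult_1_left mult_1_right, simp only: flip: mult.assoc)
  have "norm k \<le> t"
  proof (rule selfadjoint_norm_le_by_powers[OF _ t0])
    show "star k = k" unfolding k_def r_def by (simp only: star_add sw star_of_real)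
    show "norm (k ^ n) \<le> t ^ n + (norm x)\<^sup>2 * real n * t ^ (n - 1)" for n
    proof (induction n)
      case (Suc n)
      have "k ^ Suc n = k ^ n * r + x * h ^ n * star x" unfolding kx[symmetric] by (simp only: power_Suc2 k_def distrib_left mult.assoc)
      then have "norm (k ^ Suc n) \<le> norm (k ^ n) * norm r + norm x * norm (h ^ n) * norm (star x)"
        by (simp only:) (intro norm_triangle_mono norm_mult_ineq[THEN order_trans] mult_right_mono norm_mult_ineq order_refl norm_ge_zero)
      also have "\<dots> \<le> (t ^ n + (norm x)\<^sup>2 * real n * t ^ (n - 1)) * t + norm x * t ^ n * norm x"
        using Suc r t0 norm_power_ineq[of h n] power_mono[OF h norm_ge_zero, of n] by (intro add_mono mult_mono) auto
      also have "\<dots> = t ^ Suc n + (norm x)\<^sup>2 * real (Suc n) * t ^ (Suc n - 1)" by (cases n) (simp_all add: algebra_simps power2_eq_square)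
      finally show ?case .
    qed simp
  qed
  then show ?thesis by (intro posI[of _ t]) (simp_all add: star_diff sw k_def r_def algebra_simps)
qed

text \<open>The argument of Kelley and Vaught. For \<open>w = x\<^sup>*x\<close> and \<open>r = (w\<^sup>2 + e)\<^sup>1\<^sup>/\<^sup>2\<close>, write \<open>w = p - n\<close> with \<open>p = (r + w) / 2\<close> and
  \<open>n = (r - w) / 2\<close>, which commute and have the product \<open>e / 4\<close>. For \<open>z = x n r\<^sup>1\<^sup>/\<^sup>2\<close>, the element \<open>z\<^sup>*z\<close> is \<open>- n (r n) n\<close>
  up to order \<open>e\<close> and thus almost negative. By \<open>pos_shift_swap\<close> so is \<open>z z\<^sup>*\<close>. But \<open>z\<^sup>*z + z z\<^sup>*\<close> is a sum of squares, so
  \<open>z\<^sup>*z\<close> and with it \<open>n\<^sup>4\<close> are small. Hence \<open>w\<close> is a limit of the positive elements \<open>w + 2n = r\<close>.\<close>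

theorem pos_star_mult: "pos (star x * x :: 'a::cstar_algebra)"
proof -
  define w where "w = star x * x"
  have sw: "star w = w" by (simp add: w_def star_mult star_star)
  define K where "K = norm w + 1"
  have K: "K > 0" by (simp add: K_def add_nonneg_pos)
  have main: "\<exists>n. pos (w + 2 *\<^sub>R n) \<and> star n = n \<and> norm n ^ 4 \<le> 2 * (e * K\<^sup>2)"
    if e: "0 < e" "e \<le> 1" for e :: real
  proof -
    have "norm (of_real ((norm w)\<^sup>2) - w * w) \<le> (norm w)\<^sup>2" by (rule norm_diff_square_le[OF sw]) (simp add: norm_selfadjoint_square[OF sw])
    then have "norm (of_real ((norm w)\<^sup>2 + e) - (w * w + of_real e)) < (norm w)\<^sup>2 + e" using e by simp
    moreover have "star (w * w + of_real e) = w * w + of_real e" by (simp add: star_add star_mult sw)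
    moreover note selfadjoint_sqrt
    ultimately obtain r where r: "r * r = w * w + of_real e" "star r = r"
      "\<And>y. y * (w * w + of_real e) = (w * w + of_real e) * y \<Longrightarrow> y * r = r * y"
      "norm (of_real (sqrt ((norm w)\<^sup>2 + e)) - r) < sqrt ((norm w)\<^sup>2 + e)" by metis
    obtain k where k: "k * k = r" "star k = k" "\<And>y. y * r = r * y \<Longrightarrow> y * k = k * y" by (rule selfadjoint_sqrt[OF r(2,4)]) blast
    have wr: "w * r = r * w" by (rule r(3)) (simp add: distrib_left distrib_right mult_of_real_commute mult.assoc)
    have wk: "w * k = k * w" by (rule k(3)[OF wr])
    have posr: "pos r" using pos_square[OF k(2)] k(1) by simp
    define n where "n = (1/2) *\<^sub>R (r - w)"
    define p where "p = (1/2) *\<^sub>R (r + w)"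
    have sn: "star n = n" by (simp add: n_def star_scaleR star_diff r sw)
    have wpn: "w = p - n" by (simp add: p_def n_def flip: scaleR_diff_right scaleR_2)
    have rpn: "r = p + n" by (simp add: p_def n_def flip: scaleR_add_right scaleR_2)
    have wn: "w * n = n * w" by (simp add: n_def left_diff_distrib right_diff_distrib wr)
    have rn: "r * n = n * r" by (simp add: n_def left_diff_distrib right_diff_distrib wr)
    have kn: "k * n = n * k" using k(3)[of n] rn by simp
    have "p * n = (1/4) *\<^sub>R (r * r - w * w)" by (simp add: p_def n_def algebra_simps wr)
    then have pn: "p * n = of_real (e/4)" by (simp add: r(1) of_real_def)
    have rnq: "r * n = of_real (e/4) + n * n" by (simp add: rpn distrib_right pn)
    define z where "z = x * (n * k)"
    have "star z * z = k * n * w * n * k" by (simp add: z_def star_mult sn k(2) w_def mult.assoc)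
    also have "\<dots> = (r * n) * (n * w)" by (metis (no_types) k(1) kn wk wn mult.assoc)
    also have "n * w = of_real (e/4) - n * n" by (metis pn wn wpn left_diff_distrib)
    finally have "star z * z = (r * n) * (of_real (e/4) - n * n)" .
    then have zz: "star z * z = (e/4) *\<^sub>R (r * n) - n * (r * n) * n"
    proof -
      have "(r * n) * (n * n) = n * (r * n) * n" by (metis rn mult.assoc)
      moreover have "(r * n) * of_real (e/4) = (e/4) *\<^sub>R (r * n)" by (simp add: of_real_def)
      ultimately show ?thesis unfolding \<open>star z * z = (r * n) * (of_real (e/4) - n * n)\<close> by (simp only: right_diff_distrib)
    qed
    have posrn: "pos (r * n)" unfolding rnq using e sn by (intro pos_add pos_of_real pos_square) auto
    have rnk: "r * n = (1/2) *\<^sub>R (r * r - r * w)" by (simp add: n_def right_diff_distrib)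
    have nr: "norm r \<le> K"
    proof -
      have "(norm r)\<^sup>2 = norm (w * w + of_real e)" using norm_selfadjoint_square[OF r(2)] r(1) by simp
      also have "\<dots> \<le> (norm w)\<^sup>2 + e" using norm_triangle_ineq[of "w * w" "of_real e"] e by (simp add: norm_selfadjoint_square[OF sw])
      also have "\<dots> \<le> K\<^sup>2" by (simp add: K_def power2_sum) (use e norm_ge_zero[of w] in linarith)
      finally show ?thesis using K by (intro power2_le_imp_le[of "norm r" K]) simp_all
    qed
    have nw: "norm w \<le> K" by (simp add: K_def)
    have nrn: "norm (r * n) \<le> K\<^sup>2"
    proof -
      have "norm (r * r - r * w) \<le> norm r * norm r + norm r * norm w" by (meson add_mono norm_mult_ineq norm_triangle_ineq4 order_trans)
      also have "\<dots> \<le> K * K + K * K" using nr nw K by (intro add_mono mult_mono) auto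
      finally show ?thesis by (simp add: rnk power2_eq_square)
    qed
    define \<eta> where "\<eta> = e / 4 * K\<^sup>2"
    have eta: "\<eta> \<ge> 0" using e by (simp add: \<eta>_def)
    have "pos (n * (r * n) * n)"
    proof -
      have "n * (r * n) * n = (e/4) *\<^sub>R (n * n) + (n * n) * (n * n)" by (simp add: rnq distrib_left distrib_right of_real_def mult.assoc)
      then show ?thesis using e sn by (auto intro!: pos_add pos_scaleR pos_square simp: star_mult)
    qed
    moreover have "pos (of_real \<eta> - (e/4) *\<^sub>R (r * n))"
      by (rule pos_le_norm) (use nrn e posrn in \<open>simp_all add: star_scaleR pos_selfadjoint \<eta>_def\<close>)
    ultimately have "pos (of_real \<eta> - (e/4) *\<^sub>R (r * n) + n * (r * n) * n)" by (rule pos_add[rotated])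
    then have "pos (of_real \<eta> - star z * z)" by (simp add: zz algebra_simps)
    then have "pos (of_real \<eta> - z * star z)" by (rule pos_shift_swap[OF eta])
    from pos_add[OF this sum_of_squares_cartesian[of z]]
    have "pos (of_real \<eta> + star z * z)" by simp
    moreover have "of_real \<eta> + star z * z + (of_real \<eta> - (e/4) *\<^sub>R (r * n))
       = of_real (2 * \<eta>) - n * (r * n) * n" by (simp only: zz mult_2 of_real_add) simp
    ultimately have "pos (of_real (2 * \<eta>) - n * (r * n) * n)" using \<open>pos (of_real \<eta> - (e/4) *\<^sub>R (r * n))\<close> by (metis pos_add)
    moreover have "n * (r * n) * n = (e/4) *\<^sub>R (n * n) + (n * n) * (n * n)"
      by (simp add: rnq distrib_left distrib_right of_real_def mult.assoc)
    moreover have "pos ((e/4) *\<^sub>R (n * n))" using e sn by (intro pos_scaleR pos_square) auto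
    ultimately have "pos (of_real (2 * \<eta>) - (n * n) * (n * n))"
      using pos_add[of "of_real (2 * \<eta>) - n * (r * n) * n" "(e/4) *\<^sub>R (n * n)"] by simp
    moreover have sn2: "star (n * n) = n * n" by (simp add: star_mult sn)
    ultimately have "norm ((n * n) * (n * n)) \<le> 2 * \<eta>" using eta by (intro norm_le_if_pos pos_square) auto
    then have "norm n ^ 4 \<le> 2 * \<eta>" by (simp only: norm_selfadjoint_square[OF sn2] norm_selfadjoint_square[OF sn] flip: power_mult) simp
    moreover have "w + 2 *\<^sub>R n = r" by (simp add: n_def)
    moreover have "2 * \<eta> \<le> 2 * (e * K\<^sup>2)" using e by (simp add: \<eta>_def)
    ultimately have "pos (w + 2 *\<^sub>R n)" "norm n ^ 4 \<le> 2 * (e * K\<^sup>2)" using posr by auto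
    then show ?thesis using sn by blast
  qed
  have "\<exists>n. pos (w + 2 *\<^sub>R n) \<and> norm n \<le> d" if d: "d > 0" for d :: real
  proof -
    define e where "e = min 1 (d ^ 4 / (2 * K\<^sup>2))"
    have e: "0 < e" "e \<le> 1" using d K by (auto simp: e_def)
    obtain n where n: "pos (w + 2 *\<^sub>R n)" "norm n ^ 4 \<le> 2 * (e * K\<^sup>2)" using main[OF e] by auto
    have "e * K\<^sup>2 \<le> d ^ 4 / (2 * K\<^sup>2) * K\<^sup>2" by (intro mult_right_mono) (auto simp: e_def)
    then have "norm n ^ 4 \<le> d ^ 4" using n(2) K by simp
    then have "norm n \<le> d" using d by (meson less_imp_le power_mono_iff zero_less_numeral norm_ge_zero)
    then show ?thesis using n by auto
  qed
  then have "\<forall>m. \<exists>n. pos (w + 2 *\<^sub>R n) \<and> norm n \<le> 1 / real (Suc m)" by simp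
  then obtain n where n: "\<And>m. pos (w + 2 *\<^sub>R n m)" "\<And>m. norm (n m) \<le> 1 / real (Suc m)" by metis
  have "n \<longlonglongrightarrow> 0" by (rule Lim_null_comparison[OF _ LIMSEQ_inverse_real_of_nat]) (use n(2) in \<open>simp add: inverse_eq_divide\<close>)
  then have "(\<lambda>m. w + 2 *\<^sub>R n m) \<longlonglongrightarrow> w + 2 *\<^sub>R 0" by (intro tendsto_intros)
  then show ?thesis using pos_limit[of "\<lambda>m. w + 2 *\<^sub>R n m"] n(1) by (simp add: w_def)
qed

lemma pos_conjugate: "pos a \<Longrightarrow> pos (star b * a * b :: 'a::cstar_algebra)"
proof (rule pos_limit)
  fix m :: nat
  assume "pos a"
  then obtain h where h: "h * h = a + of_real (1 / real (Suc m))" "star h = h"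
    using pos_plus_eps_sqrt[of a "1 / real (Suc m)"] by (metis of_nat_0_less_iff zero_less_Suc zero_less_divide_1_iff)
  have "star (h * b) * (h * b) = star b * (a + of_real (1 / real (Suc m))) * b"
    unfolding h(1)[symmetric] by (simp only: star_mult h(2) mult.assoc)
  then show "pos (star b * (a + of_real (1 / real (Suc m))) * b)" by (metis pos_star_mult)
next
  have "(\<lambda>m. star b * (a + of_real (1 / real (Suc m))) * b) \<longlonglongrightarrow> star b * (a + of_real 0) * b"
    by (intro tendsto_intros) (use LIMSEQ_inverse_real_of_nat in \<open>simp add: inverse_eq_divide\<close>)
  then show "(\<lambda>m. star b * (a + of_real (1 / real (Suc m))) * b) \<longlonglongrightarrow> star b * a * b" by simp
qed

lemma pos_norm_square_diff: "norm b \<le> c \<Longrightarrow> pos (of_real (c\<^sup>2) - star b * b :: 'a::cstar_algebra)"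
  by (rule pos_le_norm) (simp_all add: star_mult star_star cstar_identity power_mono)

lemma pos_conjugate_norm:
  assumes "norm b \<le> c"
  shows "pos (c\<^sup>2 *\<^sub>R (star a * a) - star a * (star b * b) * a :: 'a::cstar_algebra)"
proof -
  have "star a * (of_real (c\<^sup>2) - star b * b) * a = c\<^sup>2 *\<^sub>R (star a * a) - star a * (star b * b) * a"
    by (simp only: left_diff_distrib right_diff_distrib of_real_def) (simp add: mult.assoc)
  then show ?thesis using pos_conjugate[OF pos_norm_square_diff[OF assms], of a] by simp
qed

section \<open>The Hilbert module of columns\<close>

text \<open>Columns of length \<open>n\<close> are sequences of which the entries below \<open>n\<close> count.\<close>

definition cip :: "nat \<Rightarrow> (nat \<Rightarrow> 'a::cstar_algebra) \<Rightarrow> (nat \<Rightarrow> 'a) \<Rightarrow> 'a" where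
  "cip n v w = (\<Sum>i<n. star (v i) * w i)"

lemma cip_add_right: "cip n u (\<lambda>i. v i + w i) = cip n u v + cip n u w" by (simp add: cip_def distrib_left sum.distrib)
lemma cip_add_left: "cip n (\<lambda>i. v i + w i) u = cip n v u + cip n w u" by (simp add: cip_def distrib_right sum.distrib star_add)
lemma cip_diff_right: "cip n u (\<lambda>i. v i - w i) = cip n u v - cip n u w" by (simp add: cip_def right_diff_distrib sum_subtractf)
lemma cip_diff_left: "cip n (\<lambda>i. v i - w i) u = cip n v u - cip n w u" by (simp add: cip_def left_diff_distrib sum_subtractf star_diff)
lemma cip_mult_right: "cip n u (\<lambda>i. v i * c) = cip n u v * c" by (simp add: cip_def sum_distrib_right mult.assoc)
lemma cip_mult_left: "cip n (\<lambda>i. v i * c) u = star c * cip n v u" by (simp add: cip_def sum_distrib_left star_mult mult.assoc)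
lemma cip_scaleC_right: "cip n u (\<lambda>i. c *\<^sub>C v i) = c *\<^sub>C cip n u v" by (simp add: cip_def mult_scaleC_right complex_vector.scale_sum_right)
lemma cip_scaleC_left: "cip n (\<lambda>i. c *\<^sub>C v i) u = cnj c *\<^sub>C cip n v u"
  by (simp add: cip_def mult_scaleC_left complex_vector.scale_sum_right star_scaleC)
lemma star_cip: "star (cip n v w) = cip n w v" by (simp add: cip_def star_sum star_mult star_star)
lemma cip_scaleR_right: "cip n u (\<lambda>i. c *\<^sub>R v i) = c *\<^sub>R cip n u v" by (simp add: cip_def scaleR_sum_right)
lemma cip_scaleR_left: "cip n (\<lambda>i. c *\<^sub>R v i) u = c *\<^sub>R cip n v u" by (simp add: cip_def scaleR_sum_right star_scaleR)

lemma pos_cip: "pos (cip n v v)" by (auto simp: cip_def intro!: pos_sum pos_star_mult)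

text \<open>The Cauchy--Schwarz inequality comes from the positivity of \<open>\<langle>v c - w, v c - w\<rangle>\<close> for \<open>c = \<langle>v, w\<rangle> / \<alpha>\<close> and
  \<open>\<alpha> \<ge> \<parallel>\<langle>v, v\<rangle>\<parallel>\<close>, which makes the term quadratic in \<open>c\<close> at most \<open>\<langle>v, w\<rangle>\<^sup>*\<langle>v, w\<rangle> / \<alpha>\<close>.\<close>

lemma norm_cip_le: "norm (cip n v w) \<le> sqrt (norm (cip n v v)) * sqrt (norm (cip n w w))"
proof -
  define b where "b = cip n v w"
  have *: "(norm b)\<^sup>2 \<le> \<alpha> * norm (cip n w w)" if a: "\<alpha> > 0" "norm (cip n v v) \<le> \<alpha>" for \<alpha>
  proof -
    define c where "c = (1/\<alpha>) *\<^sub>R b"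
    have sb: "cip n w v = star b" by (simp add: b_def star_cip)
    have "cip n (\<lambda>i. v i * c - w i) (\<lambda>i. v i * c - w i) =
      cip n (\<lambda>i. v i * c) (\<lambda>i. v i * c) - cip n (\<lambda>i. v i * c) w
        - (cip n w (\<lambda>i. v i * c) - cip n w w)" by (simp only: cip_diff_left cip_diff_right)
    also have "\<dots> = star c * (cip n v v * c) - star c * b - (star b * c - cip n w w)"
      unfolding cip_mult_left[of n v c] cip_mult_right[of n _ v c] sb unfolding b_def ..
    finally have "pos (star c * (cip n v v * c) - star c * b - (star b * c - cip n w w))"
      using pos_cip[of n "\<lambda>i. v i * c - w i"] by (simp only:)
    then have 1: "pos (star c * cip n v v * c - star c * b - star b * c + cip n w w)" by (simp only: mult.assoc diff_diff_eq2 diff_add_eq)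
    have "pos (star c * (of_real \<alpha> - cip n v v) * c)" by (intro pos_conjugate pos_le_norm a) (simp add: star_cip)
    from pos_add[OF 1 this]
    have "pos (star c * of_real \<alpha> * c - star c * b - star b * c + cip n w w)" by (simp add: algebra_simps)
    moreover have "star c * of_real \<alpha> * c = (1/\<alpha>) *\<^sub>R (star b * b)" using a by (simp add: c_def star_scaleR of_real_def)
    ultimately have "pos (cip n w w - (1/\<alpha>) *\<^sub>R (star b * b))" by (simp add: c_def star_scaleR)
    moreover have "pos ((1/\<alpha>) *\<^sub>R (star b * b))" using a by (intro pos_scaleR pos_star_mult) auto
    ultimately have "norm ((1/\<alpha>) *\<^sub>R (star b * b)) \<le> norm (cip n w w)" by (intro norm_mono_pos)
    then show ?thesis using a by (simp add: cstar_identity field_simps)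
  qed
  have "(norm b)\<^sup>2 \<le> norm (cip n v v) * norm (cip n w w)"
  proof (cases "norm (cip n v v) > 0")
    case True then show ?thesis by (rule *) simp
  next
    case False
    then have v0: "norm (cip n v v) = 0" by simp
    have "(norm b)\<^sup>2 \<le> 0"
    proof (rule field_le_epsilon)
      fix e :: real assume "e > 0"
      define \<alpha> where "\<alpha> = e / (norm (cip n w w) + 1)"
      have "\<alpha> > 0" using \<open>e > 0\<close> by (simp add: \<alpha>_def add_nonneg_pos)
      moreover have "\<alpha> * norm (cip n w w) \<le> e"
      proof -
        have "norm (cip n w w) + 1 > 0" by (simp add: add_nonneg_pos)
        then show ?thesis using \<open>e > 0\<close> by (simp add: \<alpha>_def divide_simps)
      qed
      ultimately show "(norm b)\<^sup>2 \<le> 0 + e" using *[of \<alpha>] v0 by simp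
    qed
    then show ?thesis by (simp add: v0)
  qed
  then have "sqrt ((norm b)\<^sup>2) \<le> sqrt (norm (cip n v v) * norm (cip n w w))" by (rule real_sqrt_le_mono)
  then show ?thesis by (simp add: b_def real_sqrt_mult)
qed

definition cnorm :: "nat \<Rightarrow> (nat \<Rightarrow> 'a::cstar_algebra) \<Rightarrow> real" where
  "cnorm n v = sqrt (norm (cip n v v))"

lemma cnorm_nonneg [simp]: "0 \<le> cnorm n v" by (simp add: cnorm_def)

lemma cnorm_square: "(cnorm n v)\<^sup>2 = norm (cip n v v)" by (simp add: cnorm_def)

lemma cnorm_triangle: "cnorm n (\<lambda>i. v i + w i) \<le> cnorm n v + cnorm n w"
proof (rule power2_le_imp_le)
  have "(cnorm n (\<lambda>i. v i + w i))\<^sup>2 = norm (cip n v v + cip n v w + (cip n w v + cip n w w))"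
    by (simp add: cnorm_square cip_add_left cip_add_right algebra_simps)
  also have "\<dots> \<le> norm (cip n v v) + norm (cip n v w) + (norm (cip n w v) + norm (cip n w w))" by (intro norm_triangle_le add_mono) auto
  also have "\<dots> \<le> (cnorm n v)\<^sup>2 + cnorm n v * cnorm n w + (cnorm n w * cnorm n v + (cnorm n w)\<^sup>2)"
    unfolding cnorm_square unfolding cnorm_def by (intro add_mono norm_cip_le) auto
  finally show "(cnorm n (\<lambda>i. v i + w i))\<^sup>2 \<le> (cnorm n v + cnorm n w)\<^sup>2" by (simp add: power2_sum)
qed simp

lemma norm_entry_le_cnorm: assumes "j < n" shows "norm (v j) \<le> cnorm n v"
proof (rule power2_le_imp_le)
  have "cip n v v - star (v j) * v j = (\<Sum>i\<in>{..<n}-{j}. star (v i) * v i)" using assms by (simp add: cip_def sum_diff1)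
  then have "pos (cip n v v - star (v j) * v j)" by (auto intro: pos_sum pos_star_mult)
  from norm_mono_pos[OF pos_star_mult this]
  show "(norm (v j))\<^sup>2 \<le> (cnorm n v)\<^sup>2" by (simp add: cnorm_square cstar_identity)
qed simp

lemma cnorm_le_sum: "cnorm n v \<le> (\<Sum>i<n. norm (v i))"
proof (rule power2_le_imp_le)
  have "norm (cip n v v) \<le> (\<Sum>i<n. (norm (v i))\<^sup>2)" unfolding cip_def by (rule order_trans[OF norm_sum]) (simp add: cstar_identity)
  also have "\<dots> \<le> (\<Sum>i<n. norm (v i))\<^sup>2" by (induction n) (auto simp: power2_sum intro!: add_mono sum_nonneg mult_nonneg_nonneg
        order_trans[OF _ le_add_same_cancel1[THEN iffD2]])
  finally show "(cnorm n v)\<^sup>2 \<le> (\<Sum>i<n. norm (v i))\<^sup>2" by (simp add: cnorm_square)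
qed (simp add: sum_nonneg)

lemma cnorm_scaleR: "cnorm n (\<lambda>i. c *\<^sub>R v i) = \<bar>c\<bar> * cnorm n v"
  by (simp add: cnorm_def cip_scaleR_left cip_scaleR_right real_sqrt_mult flip: power2_eq_square)

lemma cnorm_zero [simp]: "cnorm n (\<lambda>i. 0) = 0" by (simp add: cnorm_def cip_def)

definition mact :: "'a::semiring_0 mat \<Rightarrow> (nat \<Rightarrow> 'a) \<Rightarrow> nat \<Rightarrow> 'a" where
  "mact X v i = (\<Sum>j<dim_col X. X $$ (i,j) * v j)"

lemma cip_cong: "(\<And>i. i < n \<Longrightarrow> v i = v' i) \<Longrightarrow> (\<And>i. i < n \<Longrightarrow> w i = w' i) \<Longrightarrow> cip n v w = cip n v' w'" by (auto simp: cip_def)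

lemma cnorm_cong: "(\<And>i. i < n \<Longrightarrow> v i = v' i) \<Longrightarrow> cnorm n v = cnorm n v'" by (simp add: cnorm_def cong: cip_cong)

lemma column_norm_eq: "column_norm v = cnorm (dim_vec v) (vec_index v)" by (simp add: column_norm_def cnorm_def cip_def)

lemma column_norm_mult:
  assumes "v \<in> carrier_vec (dim_col X)"
  shows "column_norm (X *\<^sub>v v) = cnorm (dim_row X) (mact X (vec_index v))" unfolding column_norm_eq dim_mult_mat_vec
  by (rule cnorm_cong) (use assms in \<open>simp add: mact_def scalar_prod_def atLeast0LessThan\<close>)

lemma cip_mact_left:
  assumes X: "X \<in> carrier_mat m n"
  shows "cip m (mact X v) w = cip n v (mact (star_mat X) w)"
proof -
  have "cip m (mact X v) w = (\<Sum>i<m. \<Sum>j<n. star (v j) * (star (X $$ (i,j)) * w i))"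
    using X by (simp add: cip_def mact_def star_sum sum_distrib_right star_mult mult.assoc)
  also have "\<dots> = (\<Sum>j<n. \<Sum>i<m. star (v j) * (star (X $$ (i,j)) * w i))" by (rule sum.swap)
  also have "\<dots> = cip n v (mact (star_mat X) w)" using X by (simp add: cip_def mact_def sum_distrib_left star_mat_def)
  finally show ?thesis .
qed

lemma star_mat_carrier [simp]: "X \<in> carrier_mat m n \<Longrightarrow> star_mat X \<in> carrier_mat n m" by (auto simp: star_mat_def)

lemma dim_star_mat [simp]: "dim_row (star_mat X) = dim_col X" "dim_col (star_mat X) = dim_row X" by (simp_all add: star_mat_def)

lemma index_star_mat [simp]: "i < dim_col X \<Longrightarrow> j < dim_row X \<Longrightarrow> star_mat X $$ (i,j) = star (X $$ (j,i))" by (simp add: star_mat_def)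

lemma star_mat_star_mat [simp]: "star_mat (star_mat X) = X" by (auto simp: star_mat_def star_star intro!: eq_matI)

lemma cip_mact_right:
  assumes "X \<in> carrier_mat m n"
  shows "cip m w (mact X v) = cip n (mact (star_mat X) w) v" using cip_mact_left[of "star_mat X" n m w v] assms by simp

lemma index_mult_mat_sum:
  "i < dim_row A \<Longrightarrow> j < dim_col B \<Longrightarrow> dim_col A = dim_row B \<Longrightarrow>
   (A * B) $$ (i,j) = (\<Sum>l<dim_col A. A $$ (i,l) * B $$ (l,j))" by (simp add: scalar_prod_def atLeast0LessThan)

declare index_mult_mat(1) [simp del]

lemma mact_mult:
  fixes X Y :: "'a::semiring_0 mat"
  assumes "X \<in> carrier_mat m n" "Y \<in> carrier_mat n k" "i < m"
  shows "mact (X * Y) v i = mact X (mact Y v) i"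
proof -
  have "mact (X * Y) v i = (\<Sum>j<k. \<Sum>l<n. X $$ (i,l) * (Y $$ (l,j) * v j))"
    using assms by (simp add: mact_def index_mult_mat_sum sum_distrib_right mult.assoc)
  also have "\<dots> = (\<Sum>l<n. \<Sum>j<k. X $$ (i,l) * (Y $$ (l,j) * v j))" by (rule sum.swap)
  finally show ?thesis using assms by (simp add: mact_def sum_distrib_left)
qed

lemma cnorm_mact_crude:
  assumes X: "X \<in> carrier_mat m n"
  shows "cnorm m (mact X v) \<le> (\<Sum>i<m. \<Sum>j<n. norm (X $$ (i,j))) * cnorm n v"
proof -
  have "cnorm m (mact X v) \<le> (\<Sum>i<m. norm (mact X v i))" by (rule cnorm_le_sum)
  also have "\<dots> \<le> (\<Sum>i<m. \<Sum>j<n. norm (X $$ (i,j)) * norm (v j))"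
    using X by (auto simp: mact_def intro!: sum_mono order_trans[OF norm_sum] norm_mult_ineq)
  also have "\<dots> \<le> (\<Sum>i<m. \<Sum>j<n. norm (X $$ (i,j)) * cnorm n v)" by (intro sum_mono mult_left_mono norm_entry_le_cnorm) auto
  finally show ?thesis by (simp add: sum_distrib_right)
qed

lemma mat_norm_bdd:
  "bdd_above ((\<lambda>v. column_norm (X *\<^sub>v v)) ` {v \<in> carrier_vec (dim_col X). column_norm v \<le> 1})" for X :: "'a::cstar_algebra mat"
proof (rule bdd_aboveI2)
  fix v :: "'a Matrix.vec" assume v: "v \<in> {v \<in> carrier_vec (dim_col X). column_norm v \<le> 1}"
  have X: "X \<in> carrier_mat (dim_row X) (dim_col X)" by simp
  have "column_norm (X *\<^sub>v v) \<le> (\<Sum>i<dim_row X. \<Sum>j<dim_col X. norm (X $$ (i,j))) * column_norm v"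
    using v cnorm_mact_crude[OF X, of "vec_index v"] by (auto simp: column_norm_mult) (simp add: column_norm_eq)
  also have "\<dots> \<le> (\<Sum>i<dim_row X. \<Sum>j<dim_col X. norm (X $$ (i,j))) * 1" using v by (intro mult_left_mono sum_nonneg) auto
  finally show "column_norm (X *\<^sub>v v) \<le> (\<Sum>i<dim_row X. \<Sum>j<dim_col X. norm (X $$ (i,j)))" by simp
qed

lemma cnorm_mact_le:
  assumes X: "X \<in> carrier_mat m n"
  shows "cnorm m (mact X v) \<le> mat_norm X * cnorm n v"
proof (cases "cnorm n v = 0")
  case True
  have "cnorm m (mact X v) \<le> 0" using cnorm_mact_crude[OF X, of v] True by simp
  then show ?thesis by (simp add: True)
next
  case False
  then have c: "cnorm n v > 0" by (simp add: less_le)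
  define w where "w = Matrix.vec n (\<lambda>i. (1 / cnorm n v) *\<^sub>R v i)"
  have wi: "cnorm n (vec_index w) = cnorm n (\<lambda>i. (1 / cnorm n v) *\<^sub>R v i)" by (rule cnorm_cong) (simp add: w_def)
  have w1: "column_norm w \<le> 1" using c by (simp add: column_norm_eq wi cnorm_scaleR) (simp add: w_def wi[unfolded w_def] cnorm_scaleR)
  have w: "w \<in> carrier_vec (dim_col X)" using X by (simp add: w_def)
  have "column_norm (X *\<^sub>v w) \<le> mat_norm X" unfolding mat_norm_def by (rule cSUP_upper[OF _ mat_norm_bdd]) (use w w1 in auto)
  moreover have "column_norm (X *\<^sub>v w) = cnorm m (\<lambda>i. (1 / cnorm n v) *\<^sub>R mact X v i)"
  proof -
    have "cnorm m (mact X (vec_index w)) = cnorm m (\<lambda>i. (1 / cnorm n v) *\<^sub>R mact X v i)"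
      by (rule cnorm_cong) (use X in \<open>simp add: mact_def w_def scaleR_sum_right\<close>)
    then show ?thesis using X by (simp add: column_norm_mult[OF w])
  qed
  ultimately show ?thesis using c by (simp add: cnorm_scaleR field_simps)
qed

lemma mat_norm_leI:
  fixes X :: "'a::cstar_algebra mat"
  assumes X: "X \<in> carrier_mat m n" and c: "c \<ge> 0" and le: "\<And>v. cnorm m (mact X v) \<le> c * cnorm n v"
  shows "mat_norm X \<le> c" unfolding mat_norm_def
proof (rule cSUP_least)
  have "0\<^sub>v n \<in> {v \<in> carrier_vec (dim_col X). column_norm v \<le> 1}"
    using X by (auto simp: column_norm_eq cnorm_cong[of n "vec_index (0\<^sub>v n)" "\<lambda>_. 0"])
  then show "{v \<in> carrier_vec (dim_col X). column_norm v \<le> 1} \<noteq> {}" by blast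
  fix v :: "'a Matrix.vec" assume "v \<in> {v \<in> carrier_vec (dim_col X). column_norm v \<le> 1}"
  then have v: "v \<in> carrier_vec n" "cnorm n (vec_index v) \<le> 1" using X by (auto simp: column_norm_eq)
  then have "column_norm (X *\<^sub>v v) \<le> c * cnorm n (vec_index v)" using X le[of "vec_index v"] column_norm_mult[of v X] by auto
  also have "\<dots> \<le> c * 1" using v c by (intro mult_left_mono)
  finally show "column_norm (X *\<^sub>v v) \<le> c" by simp
qed

lemma mat_norm_nonneg [simp]: "0 \<le> mat_norm X"
proof -
  have "0 \<le> column_norm (X *\<^sub>v 0\<^sub>v (dim_col X))" by (simp add: column_norm_eq)
  also have "\<dots> \<le> mat_norm X" unfolding mat_norm_def by (rule cSUP_upper[OF _ mat_norm_bdd])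
      (auto simp: column_norm_eq cnorm_cong[of "dim_col X" "vec_index (0\<^sub>v (dim_col X))" "\<lambda>_. 0"])
  finally show ?thesis .
qed

lemma mat_norm_mult:
  assumes X: "X \<in> carrier_mat m n" and Y: "Y \<in> carrier_mat n k"
  shows "mat_norm (X * Y) \<le> mat_norm X * mat_norm Y"
proof (rule mat_norm_leI)
  show "X * Y \<in> carrier_mat m k" using assms by simp
  fix v
  have "cnorm m (mact (X * Y) v) = cnorm m (mact X (mact Y v))" by (rule cnorm_cong) (rule mact_mult[OF X Y])
  also have "\<dots> \<le> mat_norm X * cnorm n (mact Y v)" by (rule cnorm_mact_le[OF X])
  also have "\<dots> \<le> mat_norm X * (mat_norm Y * cnorm k v)" by (intro mult_left_mono cnorm_mact_le[OF Y]) simp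
  finally show "cnorm m (mact (X * Y) v) \<le> mat_norm X * mat_norm Y * cnorm k v" by simp
qed simp

lemma mat_norm_add:
  assumes X: "X \<in> carrier_mat m n" and Y: "Y \<in> carrier_mat m n"
  shows "mat_norm (X + Y) \<le> mat_norm X + mat_norm Y"
proof (rule mat_norm_leI)
  show "X + Y \<in> carrier_mat m n" using assms by simp
  fix v
  have "cnorm m (mact (X + Y) v) = cnorm m (\<lambda>i. mact X v i + mact Y v i)"
    by (rule cnorm_cong) (use assms in \<open>simp add: mact_def distrib_right sum.distrib\<close>)
  also have "\<dots> \<le> cnorm m (mact X v) + cnorm m (mact Y v)" by (rule cnorm_triangle)
  also have "\<dots> \<le> mat_norm X * cnorm n v + mat_norm Y * cnorm n v" by (intro add_mono cnorm_mact_le assms)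
  finally show "cnorm m (mact (X + Y) v) \<le> (mat_norm X + mat_norm Y) * cnorm n v" by (simp add: distrib_right)
qed simp

lemma mat_norm_star_le:
  assumes X: "X \<in> carrier_mat m n"
  shows "mat_norm (star_mat X) \<le> mat_norm X"
proof (rule mat_norm_leI)
  show sX: "star_mat X \<in> carrier_mat n m" using X by simp
  fix v
  let ?u = "mact (star_mat X) v"
  have "(cnorm n ?u)\<^sup>2 = norm (cip m v (mact X ?u))" unfolding cnorm_square cip_mact_right[OF X] ..
  also have "\<dots> \<le> cnorm m v * cnorm m (mact X ?u)" using norm_cip_le[of m v "mact X ?u"] by (simp add: cnorm_def)
  also have "\<dots> \<le> cnorm m v * (mat_norm X * cnorm n ?u)" by (intro mult_left_mono cnorm_mact_le[OF X]) simp
  finally have "cnorm n ?u * cnorm n ?u \<le> (mat_norm X * cnorm m v) * cnorm n ?u" by (simp add: power2_eq_square mult_ac)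
  then show "cnorm n ?u \<le> mat_norm X * cnorm m v" by (cases "cnorm n ?u = 0") (auto simp: less_le)
qed simp

lemma mat_norm_star: "X \<in> carrier_mat m n \<Longrightarrow> mat_norm (star_mat X) = mat_norm X"
  using mat_norm_star_le[of X m n] mat_norm_star_le[of "star_mat X" n m] by simp

lemma cnorm_unit: "j < n \<Longrightarrow> cnorm n (\<lambda>i. if i = j then 1 else 0) = 1" by (simp add: cnorm_def cip_def if_distrib cong: if_cong)

lemma norm_entry_le_mat_norm:
  fixes X :: "'a::cstar_algebra mat"
  assumes X: "X \<in> carrier_mat m n" and ij: "i < m" "j < n"
  shows "norm (X $$ (i,j)) \<le> mat_norm X"
proof -
  let ?e = "\<lambda>k. if k = j then 1 else (0::'a)"
  have "mact X ?e i = X $$ (i,j)" using assms by (simp add: mact_def if_distrib cong: if_cong)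
  then have "norm (X $$ (i,j)) \<le> cnorm m (mact X ?e)" using norm_entry_le_cnorm[OF ij(1), of "mact X ?e"] by simp
  also have "\<dots> \<le> mat_norm X * cnorm n ?e" by (rule cnorm_mact_le[OF X])
  finally show ?thesis by (simp add: cnorm_unit ij)
qed

lemma mat_norm_one_le: "mat_norm (1\<^sub>m n :: 'a::cstar_algebra mat) \<le> 1"
proof (rule mat_norm_leI)
  fix v :: "nat \<Rightarrow> 'a"
  have "cnorm n (mact (1\<^sub>m n) v) = cnorm n v" by (rule cnorm_cong) (simp add: mact_def if_distrib[of "\<lambda>x. x * _"] cong: if_cong)
  then show "cnorm n (mact (1\<^sub>m n) v) \<le> 1 * cnorm n v" by simp
qed auto

lemma mat_norm_power_le:
  assumes X: "X \<in> carrier_mat n n"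
  shows "mat_norm (X ^\<^sub>m k) \<le> mat_norm X ^ k"
proof (induction k)
  case 0 then show ?case using X mat_norm_one_le[of n] by simp
next
  case (Suc k)
  have "mat_norm (X ^\<^sub>m k * X) \<le> mat_norm (X ^\<^sub>m k) * mat_norm X" using X by (intro mat_norm_mult) auto
  also have "\<dots> \<le> mat_norm X ^ k * mat_norm X" using Suc by (intro mult_right_mono) auto
  finally show ?case by (simp add: mult.commute)
qed

section \<open>Noncommutative polynomials\<close>

abbreviation "words \<equiv> Poly_Mapping.keys"
abbreviation "wcoeff \<equiv> Poly_Mapping.lookup"
abbreviation "wterm \<equiv> Poly_Mapping.single"

lemma poly_sum_singles: "(P :: 'w \<Rightarrow>\<^sub>0 complex) = (\<Sum>w\<in>words P. wterm w (wcoeff P w))"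
proof (rule poly_mapping_eqI)
  fix k
  have "wcoeff (\<Sum>w\<in>words P. wterm w (wcoeff P w)) k
    = (\<Sum>w\<in>words P. wcoeff P w when w = k)" by (simp only: lookup_sum lookup_single)
  also have "\<dots> = wcoeff P k" by (simp add: when_def in_keys_iff)
  finally show "wcoeff P k =
    wcoeff (\<Sum>w\<in>words P. wterm w (wcoeff P w)) k" ..
qed

lemma poly_induct [case_names single zero add]:
  fixes P :: "'w \<Rightarrow>\<^sub>0 complex"
  assumes "\<And>w c. w \<in> words P \<Longrightarrow> Q (wterm w c)" "Q 0"
    "\<And>f g. Q f \<Longrightarrow> Q g \<Longrightarrow> Q (f + g)"
  shows "Q P"
proof -
  have "Q (\<Sum>w\<in>A. wterm w (wcoeff P w))" if "A \<subseteq> words P" for A using that by (induction A rule: infinite_finite_induct) (auto intro: assms)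
  from this[of "words P"] show ?thesis by (subst poly_sum_singles) simp
qed

lemma sum_keys_superset:
  assumes "finite A" "words P \<subseteq> A" "\<And>w. g w 0 = (0::'v::comm_monoid_add)"
  shows "(\<Sum>w\<in>words P. g w (wcoeff P w)) = (\<Sum>w\<in>A. g w (wcoeff P w))" by (rule sum.mono_neutral_left) (use assms in \<open>auto simp: in_keys_iff\<close>)

lemma sum_keys_add:
  assumes "\<And>w. g w 0 = (0::'v::comm_monoid_add)" "\<And>w c d. g w (c + d) = g w c + g w d"
  shows "(\<Sum>w\<in>words (P + Q). g w (wcoeff (P + Q) w)) =
    (\<Sum>w\<in>words P. g w (wcoeff P w)) + (\<Sum>w\<in>words Q. g w (wcoeff Q w))"
proof -
  define A where "A = words P \<union> words Q"
  have A: "finite A" "words P \<subseteq> A" "words Q \<subseteq> A" "words (P + Q) \<subseteq> A" using keys_add[of P Q] by (auto simp: A_def)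
  show ?thesis unfolding sum_keys_superset[OF A(1,2), of g, OF assms(1)] sum_keys_superset[OF A(1,3), of g, OF assms(1)]
       sum_keys_superset[OF A(1,4), of g, OF assms(1)] by (simp add: lookup_add assms(2) sum.distrib)
qed

lemma sum_keys_single:
  assumes "\<And>w. g w 0 = (0::'v::comm_monoid_add)"
  shows "(\<Sum>v\<in>words (wterm w c). g v (wcoeff (wterm w c) v)) = g w c" by (cases "c = 0") (simp_all add: assms)

abbreviation const :: "complex \<Rightarrow> 'i nc_poly" where "const c \<equiv> wterm 0 c"

lemma const_mult_single: "const c * wterm w d = wterm w (c * d)" by (simp add: mult_single)

lemma const_commute: "const c * P = P * (const c :: 'i nc_poly)"
  by (induction P rule: poly_induct) (simp_all add: mult_single distrib_left distrib_right mult.commute)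

lemma letters_plus [simp]: "letters (v + w) = letters v @ letters w" by (simp add: plus_nc_word_def)
lemma letters_zero [simp]: "letters 0 = []" by (simp add: zero_nc_word_def)

lemma uminus_eq_const: "- P = const (- 1) * (P :: 'i nc_poly)"
proof -
  have "const 1 = (1 :: 'i nc_poly)" by simp
  then have "const (-1) = - (1 :: 'i nc_poly)" by (simp only: single_uminus)
  then show ?thesis by (simp only: mult_minus_left mult_1)
qed

section \<open>Evaluation\<close>

definition word_eval :: "('i \<Rightarrow> 'b::cstar_algebra) \<Rightarrow> 'i nc_word \<Rightarrow> 'b" where
  "word_eval a w = prod_list (map (\<lambda>(i,b). if b then star (a i) else a i) (letters w))"

lemma nc_eval_alt: "nc_eval a P = (\<Sum>w\<in>words P. wcoeff P w *\<^sub>C word_eval a w)" by (simp add: nc_eval_def word_eval_def)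

lemma nc_eval_add: "nc_eval a (P + Q) = nc_eval a P + nc_eval a Q"
  unfolding nc_eval_alt by (rule sum_keys_add) (simp_all add: scaleC_add_left)

lemma nc_eval_single: "nc_eval a (wterm w c) = c *\<^sub>C word_eval a w" unfolding nc_eval_alt by (rule sum_keys_single) simp

lemma nc_eval_zero [simp]: "nc_eval a 0 = 0" by (simp add: nc_eval_alt)

lemma word_eval_plus: "word_eval a (v + w) = word_eval a v * word_eval a w" by (simp add: word_eval_def)

lemma word_eval_zero [simp]: "word_eval a 0 = 1" by (simp add: word_eval_def)

lemma nc_eval_mult: "nc_eval a (P * Q) = nc_eval a P * nc_eval a Q"
proof (induction P rule: poly_induct)
  case (single w c)
  show ?case by (induction Q rule: poly_induct)
      (simp_all add: nc_eval_single mult_single word_eval_plus mult_scaleC_left mult_scaleC_right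
        scaleC_scaleC distrib_left nc_eval_add)
qed (simp_all add: nc_eval_add distrib_right)

lemma nc_eval_one [simp]: "nc_eval a 1 = 1" using nc_eval_single[of a 0 1] by (simp add: scaleC_one)

lemma nc_eval_const [simp]: "nc_eval a (const c) = c *\<^sub>C 1" by (simp add: nc_eval_single)

lemma nc_eval_const_mult: "nc_eval a (const c * P) = c *\<^sub>C nc_eval a P" by (simp add: nc_eval_mult mult_scaleC_left)

lemma nc_eval_minus: "nc_eval a (- P) = - nc_eval a P"
  by (subst uminus_eq_const) (simp only: nc_eval_const_mult scaleC_minus_left scaleC_one)

lemma nc_eval_diff: "nc_eval a (P - Q) = nc_eval a P - nc_eval a Q" by (simp only: diff_conv_add_uminus nc_eval_add nc_eval_minus)

lemma nc_eval_sum: "nc_eval a (sum f A) = (\<Sum>x\<in>A. nc_eval a (f x))" by (induction A rule: infinite_finite_induct) (simp_all add: nc_eval_add)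

lemma nc_eval_power: "nc_eval a (P ^ n) = nc_eval a P ^ n" by (induction n) (simp_all add: nc_eval_mult)

lemma nc_eval_var [simp]: "nc_eval a (nc_var i) = a i" by (simp add: nc_var_def nc_eval_single word_eval_def scaleC_one)

lemma nc_star_add: "nc_star (P + Q) = nc_star P + nc_star Q" unfolding nc_star_def by (rule sum_keys_add) (simp_all add: single_add)

lemma nc_star_single: "nc_star (wterm w c) = wterm (word_star w) (cnj c)" unfolding nc_star_def by (rule sum_keys_single) simp

lemma nc_star_zero [simp]: "nc_star 0 = 0" by (simp add: nc_star_def)

lemma nc_star_sum: "nc_star (sum f A) = (\<Sum>x\<in>A. nc_star (f x))" by (induction A rule: infinite_finite_induct) (simp_all add: nc_star_add)

lemma word_star_plus: "word_star (v + w) = word_star w + word_star v" by (simp add: word_star_def plus_nc_word_def)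

lemma word_star_word_star [simp]: "word_star (word_star w) = w" by (cases w) (simp add: word_star_def rev_map o_def case_prod_unfold)

lemma word_star_zero [simp]: "word_star 0 = 0" by (simp add: word_star_def zero_nc_word_def)

lemma nc_star_mult: "nc_star (P * Q) = nc_star Q * nc_star P"
proof (induction P rule: poly_induct)
  case (single w c)
  show ?case by (induction Q rule: poly_induct)
      (simp_all add: nc_star_single mult_single word_star_plus mult.commute distrib_left distrib_right nc_star_add)
qed (simp_all add: nc_star_add distrib_left distrib_right)

lemma nc_star_star [simp]: "nc_star (nc_star P) = P" by (induction P rule: poly_induct) (simp_all add: nc_star_single nc_star_add)

lemma nc_star_one [simp]: "nc_star 1 = 1" using nc_star_single[of 0 1] by simp

lemma nc_star_const [simp]: "nc_star (const c) = const (cnj c)" by (simp add: nc_star_single)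

lemma nc_star_minus: "nc_star (- P) = - nc_star P" using nc_star_add[of P "- P"] by (simp add: eq_neg_iff_add_eq_0 add.commute)

lemma nc_star_diff: "nc_star (P - Q) = nc_star P - nc_star Q" by (simp only: diff_conv_add_uminus nc_star_add nc_star_minus)

lemma nc_star_const_mult: "nc_star (const c * P) = const (cnj c) * nc_star P" by (simp add: nc_star_mult const_commute)

lemma word_eval_star: "word_eval a (word_star w) = star (word_eval a w)"
proof -
  have "prod_list (map (\<lambda>(i,b). if b then star (a i) else a i) (rev (map (\<lambda>(i,b). (i, \<not> b)) l))) =
    star (prod_list (map (\<lambda>(i,b). if b then star (a i) else a i) l))" for l by (induction l) (auto simp: star_mult star_star)
  then show ?thesis by (simp add: word_eval_def word_star_def)
qed

lemma nc_eval_star: "nc_eval a (nc_star P) = star (nc_eval a P)" by (induction P rule: poly_induct)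
    (simp_all add: nc_eval_single nc_star_single word_eval_star star_scaleC nc_eval_add nc_star_add star_add)

section \<open>Polynomials in a subset of the variables\<close>

lemma nc_polys_UNIV [simp]: "nc_polys UNIV = UNIV" by (simp add: nc_polys_def)

lemma nc_polys_add: "P \<in> nc_polys I \<Longrightarrow> Q \<in> nc_polys I \<Longrightarrow> P + Q \<in> nc_polys I" using keys_add[of P Q] by (fastforce simp: nc_polys_def)

lemma nc_polys_zero [simp]: "0 \<in> nc_polys I" by (simp add: nc_polys_def)

lemma nc_polys_single: "fst ` set (letters w) \<subseteq> I \<Longrightarrow> wterm w c \<in> nc_polys I" by (simp add: nc_polys_def)

lemma nc_polys_one [simp]: "1 \<in> nc_polys I" by (simp add: nc_polys_def)
lemma nc_polys_const [simp]: "const c \<in> nc_polys I" by (simp add: nc_polys_single)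

lemma nc_polys_var: "i \<in> I \<Longrightarrow> nc_var i \<in> nc_polys I" by (simp add: nc_var_def nc_polys_single)

lemma nc_polys_mult: "P \<in> nc_polys I \<Longrightarrow> Q \<in> nc_polys I \<Longrightarrow> P * Q \<in> nc_polys I"
  using keys_mult[of P Q] by (fastforce simp: nc_polys_def image_Un)

lemma nc_polys_sum: "(\<And>x. x \<in> A \<Longrightarrow> f x \<in> nc_polys I) \<Longrightarrow> sum f A \<in> nc_polys I"
  by (induction A rule: infinite_finite_induct) (auto intro: nc_polys_add)

lemma nc_polys_star: "P \<in> nc_polys I \<Longrightarrow> nc_star P \<in> nc_polys I" unfolding nc_star_def
  by (intro nc_polys_sum nc_polys_single) (force simp: nc_polys_def word_star_def image_image case_prod_unfold)

lemma nc_polys_minus: "P \<in> nc_polys I \<Longrightarrow> - P \<in> nc_polys I" by (simp add: nc_polys_def)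

lemma nc_polys_diff: "P \<in> nc_polys I \<Longrightarrow> Q \<in> nc_polys I \<Longrightarrow> P - Q \<in> nc_polys I" using nc_polys_add[of P I "- Q"] nc_polys_minus by fastforce

lemma nc_polys_power: "P \<in> nc_polys I \<Longrightarrow> P ^ n \<in> nc_polys I" by (induction n) (auto intro: nc_polys_mult)

lemma nc_polys_mono: "I \<subseteq> J \<Longrightarrow> nc_polys I \<subseteq> nc_polys J" by (auto simp: nc_polys_def)

lemma nc_polys_finite_support:
  assumes "P \<in> nc_polys I" obtains I' where "finite I'" "I' \<subseteq> I" "P \<in> nc_polys I'"
proof
  let ?I' = "\<Union>w\<in>words P. fst ` set (letters w)"
  show "finite ?I'" "?I' \<subseteq> I" "P \<in> nc_polys ?I'" using assms by (auto simp: nc_polys_def)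
qed

section \<open>Substitution\<close>

definition word_subst :: "('j \<Rightarrow> 'i nc_poly) \<Rightarrow> 'j nc_word \<Rightarrow> 'i nc_poly" where
  "word_subst p w = prod_list (map (\<lambda>(i,b). if b then nc_star (p i) else p i) (letters w))"

definition nc_subst :: "('j \<Rightarrow> 'i nc_poly) \<Rightarrow> 'j nc_poly \<Rightarrow> 'i nc_poly" where
  "nc_subst p P = (\<Sum>w\<in>words P. const (wcoeff P w) * word_subst p w)"

lemma nc_subst_add: "nc_subst p (P + Q) = nc_subst p P + nc_subst p Q"
  unfolding nc_subst_def by (rule sum_keys_add) (simp_all add: single_add distrib_right)

lemma nc_subst_single: "nc_subst p (wterm w c) = const c * word_subst p w" unfolding nc_subst_def by (rule sum_keys_single) simp

lemma nc_subst_zero [simp]: "nc_subst p 0 = 0" by (simp add: nc_subst_def)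

lemma word_subst_zero [simp]: "word_subst p 0 = 1" by (simp add: word_subst_def)

lemma nc_subst_one [simp]: "nc_subst p 1 = 1" using nc_subst_single[of p 0 1] by simp

lemma nc_subst_const [simp]: "nc_subst p (const c) = const c" by (simp add: nc_subst_single)

lemma nc_subst_mult: "nc_subst p (P * Q) = nc_subst p P * nc_subst p Q"
proof (induction P rule: poly_induct)
  case (single w c)
  show ?case
  proof (induction Q rule: poly_induct)
    case (single v d)
    have "const (c * d) * (word_subst p w * word_subst p v) = const c * (const d * word_subst p w) * word_subst p v"
      by (simp add: mult_single flip: mult.assoc)
    also have "\<dots> = const c * word_subst p w * (const d * word_subst p v)" by (simp only: const_commute[of d] mult.assoc)
    finally show ?case by (simp add: mult_single nc_subst_single word_subst_def)
  qed (simp_all add: distrib_left nc_subst_add)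
qed (simp_all add: nc_subst_add distrib_right)

lemma word_subst_star: "word_subst p (word_star w) = nc_star (word_subst p w)"
proof -
  have "prod_list (map (\<lambda>(i,b). if b then nc_star (p i) else p i) (rev (map (\<lambda>(i,b). (i, \<not> b)) l))) =
    nc_star (prod_list (map (\<lambda>(i,b). if b then nc_star (p i) else p i) l))" for l by (induction l) (auto simp: nc_star_mult)
  then show ?thesis by (simp add: word_subst_def word_star_def)
qed

lemma nc_subst_star: "nc_subst p (nc_star P) = nc_star (nc_subst p P)" by (induction P rule: poly_induct)
    (simp_all add: nc_subst_single nc_star_single word_subst_star nc_star_const_mult nc_subst_add nc_star_add)

lemma word_eval_subst: "nc_eval a (word_subst p w) = word_eval (\<lambda>j. nc_eval a (p j)) w"
proof -
  have "nc_eval a (prod_list (map (\<lambda>(i,b). if b then nc_star (p i) else p i) l)) =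
    prod_list (map (\<lambda>(i,b). if b then star (nc_eval a (p i)) else nc_eval a (p i)) l)" for l
    by (induction l) (auto simp: nc_eval_mult nc_eval_star)
  then show ?thesis by (simp add: word_subst_def word_eval_def)
qed

lemma nc_eval_subst: "nc_eval a (nc_subst p P) = nc_eval (\<lambda>j. nc_eval a (p j)) P" by (induction P rule: poly_induct)
    (simp_all add: nc_subst_single nc_eval_single nc_eval_const_mult word_eval_subst nc_subst_add nc_eval_add)

lemma nc_polys_subst:
  assumes "P \<in> nc_polys J" "\<And>j. j \<in> J \<Longrightarrow> p j \<in> nc_polys I"
  shows "nc_subst p P \<in> nc_polys I"
proof -
  have "prod_list (map (\<lambda>(i,b). if b then nc_star (p i) else p i) l) \<in> nc_polys I" if "fst ` set l \<subseteq> J" for l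
    using that by (induction l) (auto intro!: nc_polys_mult nc_polys_star assms)
  then show ?thesis using assms(1) unfolding nc_subst_def word_subst_def
    by (intro nc_polys_sum nc_polys_mult nc_polys_const) (auto simp: nc_polys_def)
qed

lemma nc_subst_ident:
  assumes "P \<in> nc_polys J" "\<And>j. j \<in> J \<Longrightarrow> p j = nc_var j"
  shows "nc_subst p P = P"
proof -
  have *: "prod_list (map (\<lambda>(i,b). if b then nc_star (p i) else p i) l) = wterm (Word l) 1"
    if "fst ` set l \<subseteq> J" for l using that
  proof (induction l)
    case Nil then show ?case by (simp flip: zero_nc_word_def)
  next
    case (Cons x l)
    obtain i b where x: "x = (i,b)" by force
    have "p i = nc_var i" using Cons.prems x assms(2) by auto
    then have "(if b then nc_star (p i) else p i) = wterm (Word [(i,b)]) 1" by (simp add: nc_var_def nc_star_single word_star_def)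
    then show ?case using Cons by (simp add: x mult_single plus_nc_word_def)
  qed
  show ?thesis using assms(1)
    by (subst (2) poly_sum_singles) (auto simp: nc_subst_def word_subst_def nc_polys_def * const_mult_single intro!: sum.cong)
qed

lemma nc_eval_cong:
  assumes "P \<in> nc_polys I" "\<And>i. i \<in> I \<Longrightarrow> a i = b i"
  shows "nc_eval a P = nc_eval b P" unfolding nc_eval_def
proof (rule sum.cong[OF refl])
  fix w assume "w \<in> words P"
  then have "fst ` set (letters w) \<subseteq> I" using assms by (auto simp: nc_polys_def)
  then have "map (\<lambda>(i,c). if c then star (a i) else a i) (letters w) = map (\<lambda>(i,c). if c then star (b i) else b i) (letters w)"
    using assms(2) by (auto simp: image_subset_iff)
  then show "wcoeff P w *\<^sub>C prod_list (map (\<lambda>(i,c). if c then star (a i) else a i) (letters w)) =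
    wcoeff P w *\<^sub>C prod_list (map (\<lambda>(i,c). if c then star (b i) else b i) (letters w))" by (simp only:)
qed

lemma tendsto_nc_eval:
  assumes "\<And>i. i \<in> I \<Longrightarrow> ((\<lambda>n. a n i) \<longlongrightarrow> b i) F" "P \<in> nc_polys I"
  shows "((\<lambda>n. nc_eval (a n) P) \<longlongrightarrow> nc_eval b P) F"
proof -
  have *: "((\<lambda>n. prod_list (map (\<lambda>(i,c). if c then star (a n i) else a n i) l)) \<longlongrightarrow>
     prod_list (map (\<lambda>(i,c). if c then star (b i) else b i) l)) F" if "fst ` set l \<subseteq> I" for l using that
  proof (induction l)
    case (Cons x l)
    then show ?case using assms(1) by (cases x; cases "snd x") (auto intro!: tendsto_mult tendsto_star)
  qed simp
  show ?thesis unfolding nc_eval_def using assms(2) by (intro tendsto_sum tendsto_scaleC *) (auto simp: nc_polys_def)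
qed

section \<open>Complex matrices\<close>

lemma mat_adjoint_eq: "mat_adjoint (X :: complex mat) = star_mat X"
  by (rule eq_matI) (auto simp: mat_adjoint_def star_mat_def star_complex_def mat_of_rows_def)

lemma star_mat_mult:
  fixes X Y :: "'a::cstar_algebra mat"
  assumes "X \<in> carrier_mat m n" "Y \<in> carrier_mat n k"
  shows "star_mat (X * Y) = star_mat Y * star_mat X" by (rule eq_matI)
    (use assms in \<open>auto simp: index_mult_mat_sum star_sum star_mult intro!: sum.cong\<close>)

lemma star_mat_one [simp]: "star_mat (1\<^sub>m n :: 'a::cstar_algebra mat) = 1\<^sub>m n" by (rule eq_matI) auto

lemma star_mat_add:
  fixes X Y :: "'a::cstar_algebra mat"
  assumes "X \<in> carrier_mat m n" "Y \<in> carrier_mat m n"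
  shows "star_mat (X + Y) = star_mat X + star_mat Y" by (rule eq_matI) (use assms in \<open>auto simp: star_add\<close>)

lemma star_mat_diff:
  fixes X Y :: "'a::cstar_algebra mat"
  assumes "X \<in> carrier_mat m n" "Y \<in> carrier_mat m n"
  shows "star_mat (X - Y) = star_mat X - star_mat Y" by (rule eq_matI) (use assms in \<open>auto simp: star_diff\<close>)

lemma star_mat_smult: "star_mat (c \<cdot>\<^sub>m X :: complex mat) = cnj c \<cdot>\<^sub>m star_mat X" by (rule eq_matI) (auto simp: star_complex_def)

lemma word_eval_mat_alt: "word_eval_mat N A w =
   foldr (\<lambda>(i,b) M. (if b then star_mat (A i) else A i) * M) (letters w) (1\<^sub>m N)" unfolding word_eval_mat_def mat_adjoint_eq ..

context
  fixes N :: nat and A :: "'i \<Rightarrow> complex mat"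
  assumes A: "\<And>i. A i \<in> carrier_mat N N"
begin

lemma word_eval_mat_carrier [simp]: "word_eval_mat N A w \<in> carrier_mat N N"
proof -
  have "foldr (\<lambda>(i,b) M. (if b then star_mat (A i) else A i) * M) l (1\<^sub>m N) \<in> carrier_mat N N" for l
    by (induction l) (auto intro!: mult_carrier_mat star_mat_carrier A)
  then show ?thesis by (simp add: word_eval_mat_alt)
qed

lemma word_eval_mat_plus: "word_eval_mat N A (v + w) = word_eval_mat N A v * word_eval_mat N A w"
proof -
  let ?f = "\<lambda>l. foldr (\<lambda>(i,b) M. (if b then star_mat (A i) else A i) * M) l (1\<^sub>m N)"
  have c: "?f l \<in> carrier_mat N N" for l by (induction l) (auto intro!: mult_carrier_mat star_mat_carrier A)
  have "?f (k @ l) = ?f k * ?f l" for k l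
  proof (induction k)
    case Nil then show ?case using left_mult_one_mat[OF c[of l]] by simp
  next
    case (Cons x k)
    obtain i b where x: "x = (i, b)" by force
    have "(if b then star_mat (A i) else A i) \<in> carrier_mat N N" using A by auto
    from assoc_mult_mat[OF this c[of k] c[of l]] show ?case using Cons by (simp add: x)
  qed
  then show ?thesis by (simp add: word_eval_mat_alt)
qed

lemma word_eval_mat_star: "word_eval_mat N A (word_star w) = star_mat (word_eval_mat N A w)"
proof -
  let ?f = "\<lambda>l. word_eval_mat N A (Word l)"
  have app: "?f (k @ l) = ?f k * ?f l" for k l using word_eval_mat_plus[of "Word k" "Word l"] by (simp add: plus_nc_word_def)
  have one: "?f [(i, b)] = (if b then star_mat (A i) else A i)" for i b
    using A by (auto simp: word_eval_mat_alt intro!: right_mult_one_mat star_mat_carrier)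
  have "?f (rev (map (\<lambda>(i,b). (i, \<not> b)) l)) = star_mat (?f l)" for l
  proof (induction l)
    case Nil then show ?case by (simp add: word_eval_mat_alt)
  next
    case (Cons x l)
    obtain i b where x: "x = (i, b)" by force
    have "star_mat (?f ([x] @ l)) = star_mat (?f l) * star_mat (?f [x])" unfolding app by (rule star_mat_mult[of _ N N _ N]) auto
    moreover have "star_mat (?f [x]) = ?f [(i, \<not> b)]" by (simp add: x one)
    ultimately show ?case using Cons by (simp add: x app)
  qed
  then show ?thesis by (cases w) (simp add: word_star_def)
qed

lemma nc_eval_mat_carrier [simp]: "nc_eval_mat N A P \<in> carrier_mat N N" by (simp add: nc_eval_mat_def msum_def)

lemma dim_nc_eval_mat [simp]: "dim_row (nc_eval_mat N A P) = N" "dim_col (nc_eval_mat N A P) = N"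
  by (simp_all add: nc_eval_mat_def msum_def)

lemma nc_eval_mat_index:
  assumes "i < N" "j < N"
  shows "nc_eval_mat N A P $$ (i,j) = (\<Sum>w\<in>words P. wcoeff P w * word_eval_mat N A w $$ (i,j))"
proof -
  have "dim_row (word_eval_mat N A w) = N" "dim_col (word_eval_mat N A w) = N" for w using word_eval_mat_carrier by (metis carrier_matD)+
  then show ?thesis using assms by (simp add: nc_eval_mat_def msum_def)
qed

lemma nc_eval_mat_add: "nc_eval_mat N A (P + Q) = nc_eval_mat N A P + nc_eval_mat N A Q"
  by (rule eq_matI) (simp_all add: nc_eval_mat_index sum_keys_add[where g="\<lambda>w c. c * word_eval_mat N A w $$ _"] distrib_right)

lemma nc_eval_mat_single: "nc_eval_mat N A (wterm w c) = c \<cdot>\<^sub>m word_eval_mat N A w"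
proof -
  have d: "dim_row (word_eval_mat N A w) = N" "dim_col (word_eval_mat N A w) = N" using word_eval_mat_carrier by (metis carrier_matD)+
  show ?thesis by (rule eq_matI) (simp_all add: d nc_eval_mat_index sum_keys_single[where g="\<lambda>w c. c * word_eval_mat N A w $$ _"])
qed

lemma nc_eval_mat_zero [simp]: "nc_eval_mat N A 0 = 0\<^sub>m N N" by (rule eq_matI) (simp_all add: nc_eval_mat_index)

lemma nc_eval_mat_mult: "nc_eval_mat N A (P * Q) = nc_eval_mat N A P * nc_eval_mat N A Q"
proof (induction P rule: poly_induct)
  case (single w c)
  show ?case
  proof (induction Q rule: poly_induct)
    case (single v d)
    have d: "dim_row (word_eval_mat N A w) = N" "dim_col (word_eval_mat N A w) = N" for w
      using word_eval_mat_carrier by (metis carrier_matD)+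
    show ?case unfolding nc_eval_mat_single mult_single word_eval_mat_plus
      by (rule eq_matI) (simp_all add: d index_mult_mat_sum sum_distrib_left mult_ac)
  next
    case (add f g)
    then show ?case
      by (simp only: distrib_left nc_eval_mat_add mult_add_distrib_mat[OF nc_eval_mat_carrier nc_eval_mat_carrier nc_eval_mat_carrier])
  next
    case zero
    show ?case using right_mult_zero_mat[OF nc_eval_mat_carrier] by simp
  qed
next
  case zero
  show ?case using left_mult_zero_mat[OF nc_eval_mat_carrier] by simp
next
  case (add f g)
  then show ?case
    by (simp only: distrib_right nc_eval_mat_add add_mult_distrib_mat[OF nc_eval_mat_carrier nc_eval_mat_carrier nc_eval_mat_carrier])
qed

lemma nc_eval_mat_const: "nc_eval_mat N A (const c) = c \<cdot>\<^sub>m 1\<^sub>m N" by (simp add: nc_eval_mat_single word_eval_mat_def)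

lemma nc_eval_mat_one [simp]: "nc_eval_mat N A 1 = 1\<^sub>m N"
proof -
  have "1 \<cdot>\<^sub>m 1\<^sub>m N = (1\<^sub>m N :: complex mat)" by (rule eq_matI) auto
  then show ?thesis using nc_eval_mat_const[of 1] by simp
qed

lemma nc_eval_mat_const_mult: "nc_eval_mat N A (const c * P) = c \<cdot>\<^sub>m nc_eval_mat N A P"
  by (simp only: nc_eval_mat_mult nc_eval_mat_const mult_smult_assoc_mat[OF one_carrier_mat nc_eval_mat_carrier]
      left_mult_one_mat[OF nc_eval_mat_carrier])

lemma nc_eval_mat_diff: "nc_eval_mat N A (P - Q) = nc_eval_mat N A P - nc_eval_mat N A Q"
proof -
  have "nc_eval_mat N A (P - Q) + nc_eval_mat N A Q = nc_eval_mat N A P" by (simp flip: nc_eval_mat_add)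
  from this[symmetric] show ?thesis by (auto intro!: eq_matI)
qed

lemma nc_eval_mat_star: "nc_eval_mat N A (nc_star P) = star_mat (nc_eval_mat N A P)"
proof (induction P rule: poly_induct)
  case (add f g)
  then show ?case by (simp only: nc_star_add nc_eval_mat_add star_mat_add[OF nc_eval_mat_carrier nc_eval_mat_carrier])
qed (auto simp: nc_star_single nc_eval_mat_single word_eval_mat_star star_mat_smult intro!: eq_matI)

lemma nc_eval_mat_var: "nc_eval_mat N A (nc_var i) = A i"
  using A[of i] by (auto simp: nc_var_def nc_eval_mat_single word_eval_mat_def intro!: eq_matI)

end

lemma nc_eval_mat_subst:
  assumes A: "\<And>i. A i \<in> carrier_mat N N"
  shows "nc_eval_mat N A (nc_subst p P) = nc_eval_mat N (\<lambda>j. nc_eval_mat N A (p j)) P"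
proof (induction P rule: poly_induct)
  case (single w c)
  let ?B = "\<lambda>j. nc_eval_mat N A (p j)"
  have B: "?B j \<in> carrier_mat N N" for j by (rule nc_eval_mat_carrier[OF A])
  have "nc_eval_mat N A (prod_list (map (\<lambda>(i,b). if b then nc_star (p i) else p i) l)) =
     foldr (\<lambda>(i,b) M. (if b then star_mat (?B i) else ?B i) * M) l (1\<^sub>m N)" for l
    by (induction l) (auto simp: nc_eval_mat_mult[OF A] nc_eval_mat_star[OF A] nc_eval_mat_one[OF A])
  then show ?case by (simp add: nc_subst_single nc_eval_mat_const_mult[OF A] nc_eval_mat_single[OF B] word_subst_def word_eval_mat_alt)
next
  case zero
  show ?case by (simp add: nc_eval_mat_def msum_def)
next
  case (add f g)
  have B: "nc_eval_mat N A (p j) \<in> carrier_mat N N" for j by (rule nc_eval_mat_carrier[OF A])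
  show ?case by (simp only: nc_subst_add nc_eval_mat_add[OF A] nc_eval_mat_add[OF B] add)
qed

lemma nc_eval_mat_cong:
  assumes "P \<in> nc_polys I" "\<And>i. i \<in> I \<Longrightarrow> A i = B i"
  shows "nc_eval_mat N A P = nc_eval_mat N B P"
proof -
  have "word_eval_mat N A w = word_eval_mat N B w" if "w \<in> words P" for w
  proof -
    have "fst ` set (letters w) \<subseteq> I" using assms that by (auto simp: nc_polys_def)
    then show ?thesis unfolding word_eval_mat_def using assms(2) by (intro foldr_cong) (auto simp: image_subset_iff)
  qed
  then show ?thesis by (simp add: nc_eval_mat_def msum_def)
qed

section \<open>Diagonalization of Hermitian matrices\<close>

lemma mult_carrier_square [simp]:
  "A \<in> carrier_mat n n \<Longrightarrow> B \<in> carrier_mat n n \<Longrightarrow> A * B \<in> carrier_mat n n" by (rule mult_carrier_mat)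

lemma minus_carrier_square [simp]:
  "B \<in> carrier_mat m n \<Longrightarrow> A - B \<in> carrier_mat m n" by (rule minus_carrier_mat)

lemma dim_mat_diag [simp]: "dim_row (mat_diag n f) = n" "dim_col (mat_diag n f) = n" by (simp_all add: mat_diag_def)

lemma unitary_mats_iff: "U \<in> unitary_mats N \<longleftrightarrow> U \<in> carrier_mat N N \<and> star_mat U * U = 1\<^sub>m N" by (simp add: unitary_mats_def mat_adjoint_eq)

lemma unitary_mats_carrier: "U \<in> unitary_mats N \<Longrightarrow> U \<in> carrier_mat N N" by (simp add: unitary_mats_iff)

lemma unitary_right_inverse: "U \<in> unitary_mats N \<Longrightarrow> U * star_mat U = 1\<^sub>m N"
  using mat_mult_left_right_inverse[of "star_mat U" N U] by (simp add: unitary_mats_iff)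

lemma unitary_star: "U \<in> unitary_mats N \<Longrightarrow> star_mat U \<in> unitary_mats N" by (auto simp: unitary_right_inverse unitary_mats_iff)

lemma mult_star_cancel:
  assumes "U \<in> unitary_mats N" "X \<in> carrier_mat N k"
  shows "star_mat U * (U * X) = X" "U * (star_mat U * X) = X"
proof -
  have U: "U \<in> carrier_mat N N" "star_mat U \<in> carrier_mat N N" using assms by (auto simp: unitary_mats_iff)
  show "star_mat U * (U * X) = X" using assms assoc_mult_mat[OF U(2,1) assms(2)] by (simp add: unitary_mats_iff)
  show "U * (star_mat U * X) = X" using assms assoc_mult_mat[OF U(1,2) assms(2)] by (simp add: unitary_right_inverse)
qed

lemma unitary_mult:
  assumes "U \<in> unitary_mats N" "W \<in> unitary_mats N"
  shows "U * W \<in> unitary_mats N"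
proof -
  have U: "U \<in> carrier_mat N N" and W: "W \<in> carrier_mat N N" using assms by (auto simp: unitary_mats_iff)
  have "star_mat (U * W) * (U * W) = star_mat W * (star_mat U * (U * W))"
    unfolding star_mat_mult[OF U W] by (rule assoc_mult_mat) (use U W in auto)
  also have "\<dots> = 1\<^sub>m N" using mult_star_cancel(1)[OF assms(1) W] assms(2) by (simp add: unitary_mats_iff)
  finally show ?thesis using U W by (simp add: unitary_mats_iff)
qed

text \<open>The Householder reflection along \<open>u = v - e\<^sub>0\<close> maps the first basis vector \<open>e\<^sub>0\<close> to \<open>v\<close> because \<open>v 0\<close> is real. If
  \<open>v = e\<^sub>0\<close>, then \<open>s = 0\<close> and the convention \<open>2 / 0 = 0\<close> gives the identity.\<close>

lemma unitary_with_first_column: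
  fixes v :: "nat \<Rightarrow> complex"
  assumes n: "n > 0" and v: "(\<Sum>i<n. cnj (v i) * v i) = 1" and v0: "v 0 = of_real x"
  obtains W where "W \<in> unitary_mats n" "\<And>i. i < n \<Longrightarrow> W $$ (i,0) = v i"
proof -
  define u where "u i = (if i = 0 then v i - 1 else v i)" for i
  define s where "s = 2 - 2 * v 0"
  have sp: "(\<Sum>i<n. f i) = f 0 + (\<Sum>i\<in>{..<n}-{0}. f i)" for f :: "nat \<Rightarrow> complex" using n by (simp add: sum.remove)
  have us: "(\<Sum>i<n. cnj (u i) * u i) = s"
  proof -
    have "(\<Sum>i<n. cnj (u i) * u i) = (cnj (v 0) - 1) * (v 0 - 1) + (\<Sum>i\<in>{..<n}-{0}. cnj (v i) * v i)"
      unfolding sp[of "\<lambda>i. cnj (u i) * u i"] by (simp add: u_def)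
    also have "\<dots> = (cnj (v 0) - 1) * (v 0 - 1) + (1 - cnj (v 0) * v 0)"
      using v sp[of "\<lambda>i. cnj (v i) * v i"] by (simp add: eq_diff_eq add.commute)
    finally show ?thesis by (simp add: v0 s_def algebra_simps)
  qed
  define W where "W = Matrix.mat n n (\<lambda>(i,j). (if i = j then 1 else 0) - 2 / s * (u i * cnj (u j)))"
  have cs: "cnj s = s" by (simp add: s_def v0)
  have "star_mat W * W = 1\<^sub>m n"
  proof (rule eq_matI)
    fix i j assume "i < dim_row (1\<^sub>m n :: complex mat)" "j < dim_col (1\<^sub>m n :: complex mat)"
    then have ij: "i < n" "j < n" by auto
    define c where "c = 2 / s * u i * cnj (u j) * (2 / s)"
    have "(star_mat W * W) $$ (i,j) = (\<Sum>l<n. ((if l = i then 1 else 0) - 2 / s * (u i * cnj (u l))) *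
       ((if l = j then 1 else 0) - 2 / s * (u l * cnj (u j))))"
      using ij by (simp add: W_def index_mult_mat_sum star_complex_def cs if_distrib[of cnj] mult_ac cong: if_cong)
    also have "\<dots> = (\<Sum>l<n. (if l = i then (if l = j then 1 else 0) else 0) - (if l = i then 2 / s * (u l * cnj (u j)) else 0)
       - (if l = j then 2 / s * (u i * cnj (u l)) else 0) + c * (cnj (u l) * u l))" by (rule sum.cong) (auto simp: algebra_simps c_def)
    also have "\<dots> = (if i = j then 1 else 0) - 2 / s * (u i * cnj (u j)) - 2 / s * (u i * cnj (u j))
       + c * s" using ij by (simp add: sum.distrib sum_subtractf us flip: sum_distrib_left)
    also have "\<dots> = (if i = j then 1 else 0)" by (cases "s = 0") (auto simp: c_def)
    finally show "(star_mat W * W) $$ (i,j) = 1\<^sub>m n $$ (i,j)" using ij by simp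
  qed (auto simp: W_def)
  then have W: "W \<in> unitary_mats n" by (simp add: unitary_mats_iff W_def)
  have "W $$ (i,0) = v i" if i: "i < n" for i
  proof (cases "s = 0")
    case True
    have "(\<Sum>i<n. (cmod (u i))\<^sup>2) = 0"
    proof -
      have "complex_of_real (\<Sum>i<n. (cmod (u i))\<^sup>2) = s" unfolding us[symmetric]
        by (simp add: complex_norm_square mult.commute del: of_real_power)
      then show ?thesis using True by (metis of_real_eq_0_iff)
    qed
    then have "u i = 0" using i by (simp add: sum_nonneg_eq_0_iff)
    then show ?thesis using i n by (auto simp: W_def u_def True split: if_splits)
  next
    case False
    have "cnj (u 0) = - s / 2" by (simp add: u_def s_def v0)
    then show ?thesis using i n False by (auto simp: W_def u_def)
  qed
  with W show ?thesis by (rule that)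
qed

text \<open>The phase is chosen so that the first entry is real, as \<open>unitary_with_first_column\<close> asks for.\<close>

lemma unit_eigenvector:
  assumes H: "(H :: complex mat) \<in> carrier_mat n n" and n: "n > 0"
  obtains v x e where "(\<Sum>i<n. cnj (v i) * v i) = 1" "v 0 = of_real x"
    "\<And>i. i < n \<Longrightarrow> (\<Sum>j<n. H $$ (i,j) * v j) = e * v i"
proof -
  obtain e where "e \<in> spectrum H" using spectrum_non_empty[OF H n] by auto
  then obtain w where w: "w \<in> carrier_vec n" "w \<noteq> 0\<^sub>v n" "H *\<^sub>v w = e \<cdot>\<^sub>v w"
    using H by (auto simp: spectrum_def eigenvalue_def eigenvector_def)
  define r where "r = sqrt (\<Sum>i<n. (cmod (w $ i))\<^sup>2)"
  have "\<exists>i<n. w $ i \<noteq> 0"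
  proof (rule ccontr)
    assume "\<not> ?thesis"
    then have "w = 0\<^sub>v n" using w(1) by (intro eq_vecI) auto
    then show False using w(2) by simp
  qed
  then obtain i where i: "i < n" "w $ i \<noteq> 0" by auto
  have "(cmod (w $ i))\<^sup>2 \<le> (\<Sum>i<n. (cmod (w $ i))\<^sup>2)" using i by (intro member_le_sum) auto
  moreover have "(cmod (w $ i))\<^sup>2 > 0" using i by simp
  ultimately have pos: "(\<Sum>i<n. (cmod (w $ i))\<^sup>2) > 0" by linarith
  then have r: "r > 0" by (simp add: r_def)
  define c where "c = (if w $ 0 = 0 then 1 else cnj (w $ 0) / cmod (w $ 0)) / of_real r"
  have cw: "c * w $ 0 = of_real (cmod (w $ 0) / r)"
  proof (cases "w $ 0 = 0")
    case False
    have "cnj (w $ 0) * w $ 0 = of_real (cmod (w $ 0)) * of_real (cmod (w $ 0))"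
      using complex_norm_square[of "w $ 0"] by (simp add: power2_eq_square mult.commute)
    moreover have "c * w $ 0 = (cnj (w $ 0) * w $ 0) / of_real (cmod (w $ 0)) / of_real r" using False by (simp add: c_def)
    ultimately show ?thesis using False by simp
  qed simp
  have cc: "cnj c * c = 1 / (of_real r)\<^sup>2"
  proof -
    have "cmod c = 1 / r" using r by (auto simp: c_def norm_divide)
    then show ?thesis using complex_norm_square[of c] by (simp add: power_divide mult.commute)
  qed
  show ?thesis
  proof (rule that[of "\<lambda>i. c * w $ i" "cmod (w $ 0) / r" e])
    have "(\<Sum>i<n. cnj (c * w $ i) * (c * w $ i)) = (cnj c * c) * of_real (\<Sum>i<n. (cmod (w $ i))\<^sup>2)"
      by (simp add: sum_distrib_left complex_norm_square mult_ac del: of_real_power)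
    also have "(\<Sum>i<n. (cmod (w $ i))\<^sup>2) = r\<^sup>2" using pos by (simp add: r_def)
    also have "cnj c * c * of_real (r\<^sup>2) = 1" using r by (simp add: cc)
    finally show "(\<Sum>i<n. cnj (c * w $ i) * (c * w $ i)) = 1" .
    show "c * w $ 0 = of_real (cmod (w $ 0) / r)" by (rule cw)
    fix i assume i: "i < n"
    have "(\<Sum>j<n. H $$ (i,j) * w $ j) = (H *\<^sub>v w) $ i" using i H w(1) by (simp add: scalar_prod_def atLeast0LessThan)
    also have "\<dots> = e * w $ i" using w i by simp
    finally have "(\<Sum>j<n. H $$ (i,j) * w $ j) = e * w $ i" .
    then have "c * (\<Sum>j<n. H $$ (i,j) * w $ j) = c * (e * w $ i)" by simp
    then show "(\<Sum>j<n. H $$ (i,j) * (c * w $ j)) = e * (c * w $ i)" by (simp add: sum_distrib_left mult_ac)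
  qed
qed

abbreviation rdiag :: "nat \<Rightarrow> (nat \<Rightarrow> real) \<Rightarrow> complex mat" where
  "rdiag n d \<equiv> mat_diag n (\<lambda>i. of_real (d i))"

lemma conj_diag_index:
  assumes "U \<in> carrier_mat n n" "i < n" "j < n"
  shows "(U * rdiag n d * star_mat U) $$ (i,j) = (\<Sum>l<n. U $$ (i,l) * of_real (d l) * cnj (U $$ (j,l)))"
proof -
  have "(U * rdiag n d) $$ (i,l) = U $$ (i,l) * of_real (d l)" if "l < n" for l using assms that by (simp add: mat_diag_mult_right)
  then show ?thesis using assms by (simp add: index_mult_mat_sum star_complex_def)
qed

text \<open>In a basis that starts with an eigenvector, the first row and column of a Hermitian matrix vanish off the diagonal; the
  remaining block is diagonalized by induction.\<close>

theorem hermitian_diagonalization: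
  assumes "(H :: complex mat) \<in> carrier_mat n n" "star_mat H = H"
  shows "\<exists>U\<in>unitary_mats n. \<exists>d. H = U * rdiag n d * star_mat U" using assms
proof (induction n arbitrary: H)
  case 0
  then have "H = 1\<^sub>m 0 * rdiag 0 (\<lambda>_. 0) * star_mat (1\<^sub>m 0)" by (intro eq_matI) auto
  moreover have "1\<^sub>m 0 \<in> unitary_mats 0" by (simp add: unitary_mats_iff)
  ultimately show ?case by (intro bexI[of _ "1\<^sub>m 0"] exI[of _ "\<lambda>_. 0"]) simp_all
next
  case (Suc k H)
  let ?n = "Suc k"
  obtain v x e where v: "(\<Sum>i<?n. cnj (v i) * v i) = 1" "v 0 = of_real x"
    "\<And>i. i < ?n \<Longrightarrow> (\<Sum>j<?n. H $$ (i,j) * v j) = e * v i" using unit_eigenvector[OF Suc.prems(1)] by blast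
  obtain W where W: "W \<in> unitary_mats ?n" "\<And>i. i < ?n \<Longrightarrow> W $$ (i,0) = v i" using unitary_with_first_column[OF _ v(1,2)] by blast
  have Wc: "W \<in> carrier_mat ?n ?n" "star_mat W \<in> carrier_mat ?n ?n" using W by (auto simp: unitary_mats_iff)
  define G where "G = star_mat W * (H * W)"
  have HW: "H * W \<in> carrier_mat ?n ?n" using Suc.prems Wc by simp
  have G: "G \<in> carrier_mat ?n ?n" using HW Wc(1) by (simp add: G_def)
  have sG: "star_mat G = G" using Suc.prems Wc HW unfolding G_def
    by (simp add: star_mat_mult[OF Wc(2) HW] star_mat_mult[OF Suc.prems(1) Wc(1)] assoc_mult_mat[of _ ?n ?n _ ?n _ ?n])
  have HG: "H = W * (G * star_mat W)"
  proof -
    have "G * star_mat W = star_mat W * (H * (W * star_mat W))"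
      unfolding G_def using Suc.prems Wc HW by (simp add: assoc_mult_mat[of _ ?n ?n _ ?n _ ?n])
    also have "\<dots> = star_mat W * H" using unitary_right_inverse[OF W(1)] Suc.prems by simp
    finally show ?thesis using mult_star_cancel(2)[OF W(1) Suc.prems(1)] by simp
  qed
  have col0: "G $$ (i,0) = (if i = 0 then e else 0)" if i: "i < ?n" for i
  proof -
    have "(H * W) $$ (l,0) = e * W $$ (l,0)" if "l < ?n" for l using that Suc.prems Wc v(3)[OF that] W(2)
      by (simp add: index_mult_mat_sum del: sum.lessThan_Suc)
    then have "G $$ (i,0) = e * (star_mat W * W) $$ (i,0)" using i HW Wc Suc.prems(1) unfolding G_def
      by (simp add: index_mult_mat_sum sum_distrib_left mult_ac star_complex_def del: sum.lessThan_Suc)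
    then show ?thesis using i W(1) by (simp add: unitary_mats_iff)
  qed
  have herm: "G $$ (j,i) = cnj (G $$ (i,j))" if "i < ?n" "j < ?n" for i j
    using arg_cong[OF sG, of "\<lambda>M. M $$ (j,i)"] G that by (simp add: star_complex_def)
  have row0: "G $$ (0,i) = (if i = 0 then e else 0)" if i: "i < ?n" for i using herm[of i 0] col0[OF i] herm[of 0 0] col0[of 0] i by auto
  have e: "e = of_real (Re e)" using herm[of 0 0] col0[of 0] by (simp add: complex_eq_iff)
  define G' where "G' = Matrix.mat k k (\<lambda>(i,j). G $$ (Suc i, Suc j))"
  have "star_mat G' = G'" by (rule eq_matI) (auto simp: G'_def star_complex_def herm[symmetric])
  then obtain U' d' where U': "U' \<in> unitary_mats k" "G' = U' * rdiag k d' * star_mat U'" using Suc.IH[of G'] by (auto simp: G'_def)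
  have U'c: "U' \<in> carrier_mat k k" using U' by (simp add: unitary_mats_iff)
  define V where "V = Matrix.mat ?n ?n (\<lambda>(i,j). if i = 0 \<and> j = 0 then 1 else if i = 0 \<or> j = 0 then 0 else U' $$ (i - 1, j - 1))"
  define d where "d i = (if i = 0 then Re e else d' (i - 1))" for i
  have Vc: "V \<in> carrier_mat ?n ?n" by (simp add: V_def)
  have V: "V \<in> unitary_mats ?n"
  proof -
    have "star_mat V * V = 1\<^sub>m ?n"
    proof (rule eq_matI)
      fix i j assume "i < dim_row (1\<^sub>m ?n :: complex mat)" "j < dim_col (1\<^sub>m ?n :: complex mat)"
      then have ij: "i < ?n" "j < ?n" by auto
      have "(star_mat V * V) $$ (i,j) = (\<Sum>l<?n. cnj (V $$ (l,i)) * V $$ (l,j))"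
        using ij Vc by (simp add: index_mult_mat_sum star_complex_def del: sum.lessThan_Suc)
      also have "\<dots> = cnj (V $$ (0,i)) * V $$ (0,j) + (\<Sum>l<k. cnj (V $$ (Suc l,i)) * V $$ (Suc l,j))" by (rule sum.lessThan_Suc_shift)
      also have "\<dots> = 1\<^sub>m ?n $$ (i,j)"
      proof (cases "i = 0 \<or> j = 0")
        case False
        then obtain i' j' where i': "i = Suc i'" "j = Suc j'" by (metis not0_implies_Suc)
        have "(\<Sum>l<k. cnj (U' $$ (l,i')) * U' $$ (l,j')) = (star_mat U' * U') $$ (i',j')"
          using ij i' U'c by (simp add: index_mult_mat_sum star_complex_def)
        then show ?thesis using ij i' U'(1) by (simp add: V_def unitary_mats_iff)
      qed (use ij in \<open>auto simp: V_def\<close>)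
      finally show "(star_mat V * V) $$ (i,j) = 1\<^sub>m ?n $$ (i,j)" .
    qed (use Vc in auto)
    then show ?thesis using Vc by (simp add: unitary_mats_iff)
  qed
  have GV: "G = V * rdiag ?n d * star_mat V"
  proof (rule eq_matI)
    fix i j assume "i < dim_row (V * rdiag ?n d * star_mat V)" "j < dim_col (V * rdiag ?n d * star_mat V)"
    then have ij: "i < ?n" "j < ?n" using Vc by auto
    have "(V * rdiag ?n d * star_mat V) $$ (i,j) = V $$ (i,0) * of_real (d 0) * cnj (V $$ (j,0))
      + (\<Sum>l<k. V $$ (i,Suc l) * of_real (d (Suc l)) * cnj (V $$ (j,Suc l)))"
      unfolding conj_diag_index[OF Vc ij] by (rule sum.lessThan_Suc_shift)
    also have "\<dots> = G $$ (i,j)"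
    proof (cases "i = 0 \<or> j = 0")
      case False
      then obtain i' j' where i': "i = Suc i'" "j = Suc j'" by (metis not0_implies_Suc)
      have "G' $$ (i',j') = (\<Sum>l<k. U' $$ (i',l) * of_real (d' l) * cnj (U' $$ (j',l)))"
        unfolding U'(2) by (rule conj_diag_index[OF U'c]) (use ij i' in auto)
      then show ?thesis using ij i' by (simp add: V_def d_def G'_def)
    next
      case True
      then show ?thesis using ij row0[of j] col0[of i] e by (auto simp: V_def d_def)
    qed
    finally show "G $$ (i,j) = (V * rdiag ?n d * star_mat V) $$ (i,j)" by simp
  qed (use Vc G in auto)
  have "H = (W * V) * rdiag ?n d * star_mat (W * V)" unfolding HG GV star_mat_mult[OF Wc(1) Vc] using Wc Vc
    by (simp add: assoc_mult_mat[of _ ?n ?n _ ?n _ ?n])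
  then show ?case using unitary_mult[OF W(1) V] by blast
qed

section \<open>The normalized Hilbert--Schmidt norm\<close>

definition fro :: "nat \<Rightarrow> complex mat \<Rightarrow> real" where
  "fro N X = (\<Sum>j<N. \<Sum>i<N. (cmod (X $$ (i,j)))\<^sup>2)"

lemma fro_nonneg [simp]: "0 \<le> fro N X" by (simp add: fro_def sum_nonneg)

lemma ntr_star_mult:
  assumes X: "X \<in> carrier_mat N N"
  shows "ntr (star_mat X * X) = of_real (fro N X / N)"
proof -
  have "ntr (star_mat X * X) = (\<Sum>j<N. \<Sum>i<N. cnj (X $$ (i,j)) * X $$ (i,j)) / of_nat N"
    using X by (simp add: ntr_def index_mult_mat_sum star_complex_def)
  also have "(\<Sum>j<N. \<Sum>i<N. cnj (X $$ (i,j)) * X $$ (i,j)) = of_real (fro N X)"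
    by (simp add: fro_def complex_norm_square mult.commute del: of_real_power)
  finally show ?thesis by simp
qed

lemma norm2_eq: "X \<in> carrier_mat N N \<Longrightarrow> norm2 X = sqrt (fro N X / N)" by (simp add: norm2_def mat_adjoint_eq ntr_star_mult)

lemma ntr_star_mult_norm2: "X \<in> carrier_mat N N \<Longrightarrow> ntr (star_mat X * X) = of_real ((norm2 X)\<^sup>2)" by (simp add: ntr_star_mult norm2_eq)

lemma norm2_nonneg [simp]: "X \<in> carrier_mat N N \<Longrightarrow> 0 \<le> norm2 X" by (simp add: norm2_eq)

lemma norm2_L2: "X \<in> carrier_mat N N \<Longrightarrow>
    norm2 X = L2_set (\<lambda>(j,i). cmod (X $$ (i,j))) ({..<N} \<times> {..<N}) / sqrt N"
  by (simp add: norm2_eq fro_def L2_set_def real_sqrt_divide sum.cartesian_product case_prod_unfold)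

lemma norm2_triangle:
  assumes "X \<in> carrier_mat N N" "Y \<in> carrier_mat N N"
  shows "norm2 (X + Y) \<le> norm2 X + norm2 Y"
proof -
  have "L2_set (\<lambda>(j,i). cmod ((X + Y) $$ (i,j))) ({..<N} \<times> {..<N}) \<le>
    L2_set (\<lambda>x. (case x of (j,i) \<Rightarrow> cmod (X $$ (i,j))) + (case x of (j,i) \<Rightarrow> cmod (Y $$ (i,j)))) ({..<N} \<times> {..<N})"
    using assms by (intro L2_set_mono) (auto intro: norm_triangle_ineq)
  also have "\<dots> \<le> L2_set (\<lambda>(j,i). cmod (X $$ (i,j))) ({..<N} \<times> {..<N}) + L2_set (\<lambda>(j,i). cmod (Y $$ (i,j))) ({..<N} \<times> {..<N})"
    by (rule L2_set_triangle_ineq)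
  finally show ?thesis
    using assms by (simp add: norm2_L2[OF add_carrier_mat[OF assms(2), of X]] norm2_L2 divide_right_mono flip: add_divide_distrib)
qed

lemma norm2_uminus: "X \<in> carrier_mat N N \<Longrightarrow> norm2 (- X) = norm2 X" by (simp add: norm2_eq[of _ N] fro_def)

lemma norm2_diff_triangle:
  assumes "X \<in> carrier_mat N N" "Y \<in> carrier_mat N N" "Z \<in> carrier_mat N N"
  shows "norm2 (X - Z) \<le> norm2 (X - Y) + norm2 (Y - Z)"
proof -
  have "X - Z = (X - Y) + (Y - Z)" using assms by (intro eq_matI) auto
  then show ?thesis using norm2_triangle[of "X - Y" N "Y - Z"] assms by simp
qed

lemma norm2_minus_commute:
  assumes "X \<in> carrier_mat N N" "Y \<in> carrier_mat N N"
  shows "norm2 (X - Y) = norm2 (Y - X)"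
proof -
  have "X - Y = - (Y - X)" using assms by (intro eq_matI) auto
  then show ?thesis using norm2_uminus[of "Y - X" N] assms by simp
qed

lemma norm2_star: "X \<in> carrier_mat N N \<Longrightarrow> norm2 (star_mat X) = norm2 X"
  by (simp add: norm2_eq[of _ N] fro_def star_complex_def) (subst sum.swap, simp)

lemma norm2_smult: "X \<in> carrier_mat N N \<Longrightarrow> norm2 (c \<cdot>\<^sub>m X) = cmod c * norm2 X"
  by (simp add: norm2_eq[of _ N] fro_def norm_mult power_mult_distrib real_sqrt_mult real_sqrt_divide flip: sum_distrib_left)

lemma norm2_zero [simp]: "norm2 (0\<^sub>m N N) = 0" by (simp add: norm2_eq[of _ N] fro_def)

lemma norm2_one_le: "norm2 (1\<^sub>m N) \<le> 1"
proof -
  have "fro N (1\<^sub>m N) = (\<Sum>j<N. \<Sum>i<N. if i = j then 1 else 0)" unfolding fro_def by (intro sum.cong) auto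
  then have "fro N (1\<^sub>m N) = N" by simp
  then show ?thesis by (simp add: norm2_eq[of _ N])
qed

lemma fro_columns: "fro N X = (\<Sum>j<N. (cnorm N (\<lambda>i. X $$ (i,j)))\<^sup>2)"
proof -
  have "(cnorm N v)\<^sup>2 = (\<Sum>i<N. (cmod (v i))\<^sup>2)" for v
  proof -
    have "cip N v v = of_real (\<Sum>i<N. (cmod (v i))\<^sup>2)"
      by (simp add: cip_def star_complex_def complex_norm_square mult.commute del: of_real_power)
    then show ?thesis unfolding cnorm_square by (simp only: norm_of_real) (simp add: sum_nonneg)
  qed
  then show ?thesis by (simp add: fro_def)
qed

lemma norm2_mult_left:
  assumes "X \<in> carrier_mat N N" "Y \<in> carrier_mat N N"
  shows "norm2 (X * Y) \<le> mat_norm X * norm2 Y"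
proof -
  have "fro N (X * Y) \<le> (\<Sum>j<N. (mat_norm X * cnorm N (\<lambda>i. Y $$ (i,j)))\<^sup>2)" unfolding fro_columns
  proof (intro sum_mono power_mono)
    fix j assume j: "j \<in> {..<N}"
    have "cnorm N (\<lambda>i. (X * Y) $$ (i,j)) = cnorm N (mact X (\<lambda>i. Y $$ (i,j)))"
      by (rule cnorm_cong) (use assms j in \<open>simp add: index_mult_mat_sum mact_def\<close>)
    then show "cnorm N (\<lambda>i. (X * Y) $$ (i,j)) \<le> mat_norm X * cnorm N (\<lambda>i. Y $$ (i,j))" using cnorm_mact_le[OF assms(1)] by simp
  qed auto
  also have "\<dots> = (mat_norm X)\<^sup>2 * fro N Y" by (simp add: fro_columns power_mult_distrib sum_distrib_left)
  finally have "sqrt (fro N (X * Y) / N) \<le> sqrt ((mat_norm X)\<^sup>2 * fro N Y / N)" by (intro real_sqrt_le_mono divide_right_mono) auto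
  then show ?thesis using assms by (simp add: norm2_eq[of _ N] real_sqrt_mult real_sqrt_divide)
qed

lemma norm2_mult_right:
  assumes "X \<in> carrier_mat N N" "Y \<in> carrier_mat N N"
  shows "norm2 (X * Y) \<le> norm2 X * mat_norm Y"
proof -
  have "norm2 (X * Y) = norm2 (star_mat Y * star_mat X)" using assms norm2_star[of "X * Y" N] by (simp add: star_mat_mult[of X N N Y N])
  also have "\<dots> \<le> mat_norm (star_mat Y) * norm2 (star_mat X)" by (rule norm2_mult_left[of _ N]) (use assms in auto)
  finally show ?thesis using assms by (simp add: mat_norm_star[of _ N N] norm2_star[of _ N] mult.commute)
qed

lemma norm2_le_mat_norm:
  assumes "X \<in> carrier_mat N N" shows "norm2 X \<le> mat_norm X"
proof -
  have "norm2 (X * 1\<^sub>m N) \<le> mat_norm X * norm2 (1\<^sub>m N)" by (rule norm2_mult_left[OF assms]) simp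
  also have "\<dots> \<le> mat_norm X * 1" by (intro mult_left_mono norm2_one_le) simp
  finally show ?thesis using assms by simp
qed

lemma mat_norm_unitary_le:
  assumes U: "U \<in> unitary_mats N" shows "mat_norm U \<le> 1"
proof -
  have Uc: "U \<in> carrier_mat N N" using U by (rule unitary_mats_carrier)
  show ?thesis
  proof (rule mat_norm_leI[OF Uc])
    fix v
    have "cip N (mact U v) (mact U v) = cip N v (mact (star_mat U) (mact U v))" by (rule cip_mact_left[OF Uc])
    also have "\<dots> = cip N v (mact (star_mat U * U) v)" by (rule cip_cong) (auto simp: mact_mult[OF star_mat_carrier[OF Uc] Uc])
    also have "\<dots> = cip N v v"
    proof (rule cip_cong)
      fix i assume "i < N"
      then show "mact (star_mat U * U) v i = v i" using U by (simp add: unitary_mats_iff mact_def if_distrib[of "\<lambda>x. x * _"] cong: if_cong)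
    qed simp
    finally show "cnorm N (mact U v) \<le> 1 * cnorm N v" by (simp add: cnorm_def)
  qed simp
qed

lemma norm2_unitary_conj:
  assumes U: "U \<in> unitary_mats N" and X: "X \<in> carrier_mat N N"
  shows "norm2 (U * X * star_mat U) \<le> norm2 X"
proof -
  have Uc: "U \<in> carrier_mat N N" using U by (rule unitary_mats_carrier)
  have 1: "norm2 (U * X) \<le> 1 * norm2 X" by (rule order_trans[OF norm2_mult_left[OF Uc X]])
      (use X in \<open>intro mult_right_mono mat_norm_unitary_le[OF U], auto\<close>)
  have "norm2 (U * X * star_mat U) \<le> norm2 (U * X) * mat_norm (star_mat U)" by (rule norm2_mult_right[of _ N]) (use X Uc in auto)
  also have "\<dots> \<le> norm2 (U * X)"
    by (rule mult_left_le[OF mat_norm_unitary_le[OF unitary_star[OF U]]]) (use X Uc norm2_nonneg[of "U * X" N] in simp)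
  finally have "norm2 (U * X * star_mat U) \<le> norm2 (U * X)" .
  with 1 show ?thesis by simp
qed

lemma ntr_le_norm2:
  assumes X: "X \<in> carrier_mat N N"
  shows "cmod (ntr X) \<le> norm2 X"
proof (cases "N = 0")
  case True then show ?thesis using X by (simp add: ntr_def norm2_eq[of _ N])
next
  case False
  have "cmod (\<Sum>i<N. X $$ (i,i)) \<le> (\<Sum>i<N. cmod (X $$ (i,i)) * 1)" by (simp add: norm_sum)
  also have "\<dots> \<le> L2_set (\<lambda>i. cmod (X $$ (i,i))) {..<N} * L2_set (\<lambda>i. 1) {..<N}"
    using L2_set_mult_ineq[of "\<lambda>i. cmod (X $$ (i,i))" "\<lambda>i. 1" "{..<N}"] by simp
  also have "L2_set (\<lambda>i. 1) {..<N} = sqrt N" by (simp add: L2_set_def)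
  also have "L2_set (\<lambda>i. cmod (X $$ (i,i))) {..<N} \<le> sqrt (fro N X)" unfolding L2_set_def fro_def
    by (intro real_sqrt_le_mono sum_mono member_le_sum[where f="\<lambda>i. (cmod (X $$ (i,_)))\<^sup>2"]) auto
  finally have "cmod (\<Sum>i<N. X $$ (i,i)) \<le> sqrt (fro N X) * sqrt N" by (simp add: mult_right_mono)
  then have "cmod (\<Sum>i<N. X $$ (i,i)) / N \<le> sqrt (fro N X) * sqrt N / N" by (intro divide_right_mono) auto
  also have "\<dots> = sqrt (fro N X / N)" using False by (simp add: real_sqrt_divide field_simps)
  finally show ?thesis using X by (simp add: ntr_def norm2_eq norm_divide)
qed

lemma ntr_add: "X \<in> carrier_mat N N \<Longrightarrow> Y \<in> carrier_mat N N \<Longrightarrow> ntr (X + Y) = ntr X + ntr Y"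
  by (simp add: ntr_def sum.distrib add_divide_distrib)

lemma ntr_smult: "X \<in> carrier_mat N N \<Longrightarrow> ntr (c \<cdot>\<^sub>m X) = c * ntr X" by (simp add: ntr_def sum_distrib_left)

lemma ntr_diff: "X \<in> carrier_mat N N \<Longrightarrow> Y \<in> carrier_mat N N \<Longrightarrow> ntr (X - Y) = ntr X - ntr Y"
  by (simp add: ntr_def sum_subtractf diff_divide_distrib)

lemma ntr_mult_commute:
  assumes "X \<in> carrier_mat N N" "Y \<in> carrier_mat N N"
  shows "ntr (X * Y) = ntr (Y * X)"
proof -
  have "(\<Sum>i<N. \<Sum>j<N. X $$ (i,j) * Y $$ (j,i)) = (\<Sum>i<N. \<Sum>j<N. Y $$ (i,j) * X $$ (j,i))" by (subst sum.swap) (simp add: mult.commute)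
  then show ?thesis using assms by (simp add: ntr_def index_mult_mat_sum)
qed

lemma ntr_star: "X \<in> carrier_mat N N \<Longrightarrow> ntr (star_mat X) = cnj (ntr X)" by (simp add: ntr_def star_complex_def)

section \<open>Conjugation by unitaries\<close>

definition uconj :: "complex mat \<Rightarrow> complex mat \<Rightarrow> complex mat" where
  "uconj U X = U * X * star_mat U"

context
  fixes N U assumes U: "U \<in> unitary_mats N"
begin

lemma uconj_carrier [simp]: "X \<in> carrier_mat N N \<Longrightarrow> uconj U X \<in> carrier_mat N N" unfolding uconj_def using unitary_mats_carrier[OF U] by simp

lemma uconj_mult:
  assumes X: "X \<in> carrier_mat N N" and Y: "Y \<in> carrier_mat N N"
  shows "uconj U (X * Y) = uconj U X * uconj U Y"
proof -
  note c = unitary_mats_carrier[OF U] and c' = unitary_mats_carrier[OF unitary_star[OF U]]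
  have YU: "Y * star_mat U \<in> carrier_mat N N" using Y c' by simp
  have "uconj U X * uconj U Y = U * X * (star_mat U * (U * (Y * star_mat U)))" unfolding uconj_def using X Y c c' YU
    by (simp add: assoc_mult_mat[of _ N N _ N _ N] mult_carrier_mat[of _ N N _ N])
  also have "star_mat U * (U * (Y * star_mat U)) = Y * star_mat U" by (rule mult_star_cancel(1)[OF U YU])
  also have "U * X * (Y * star_mat U) = uconj U (X * Y)" unfolding uconj_def using X Y c c' YU
    by (simp add: assoc_mult_mat[of _ N N _ N _ N] mult_carrier_mat[of _ N N _ N])
  finally show ?thesis ..
qed

lemma uconj_add: "X \<in> carrier_mat N N \<Longrightarrow> Y \<in> carrier_mat N N \<Longrightarrow> uconj U (X + Y) = uconj U X + uconj U Y"
  unfolding uconj_def using unitary_mats_carrier[OF U] by (simp add: mult_add_distrib_mat[of _ N N] add_mult_distrib_mat[of _ N N _ _ N])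

lemma uconj_diff: "X \<in> carrier_mat N N \<Longrightarrow> Y \<in> carrier_mat N N \<Longrightarrow> uconj U (X - Y) = uconj U X - uconj U Y"
  unfolding uconj_def using unitary_mats_carrier[OF U]
  by (simp add: mult_minus_distrib_mat[of _ N N _ N] minus_mult_distrib_mat[of _ N N _ _ N])

lemma uconj_smult: "X \<in> carrier_mat N N \<Longrightarrow> uconj U (c \<cdot>\<^sub>m X) = c \<cdot>\<^sub>m uconj U X" unfolding uconj_def using unitary_mats_carrier[OF U]
  by (simp add: mult_smult_distrib[of _ N N _ N] mult_smult_assoc_mat[of _ N N _ N])

lemma uconj_one: "uconj U (1\<^sub>m N) = 1\<^sub>m N" unfolding uconj_def using unitary_mats_carrier[OF U] unitary_right_inverse[OF U] by simp

lemma uconj_star: assumes X: "X \<in> carrier_mat N N" shows "uconj U (star_mat X) = star_mat (uconj U X)"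
proof -
  note c = unitary_mats_carrier[OF U]
  have "star_mat (U * X * star_mat U) = U * (star_mat X * star_mat U)"
    using X c by (simp add: star_mat_mult[of _ N N _ N] mult_carrier_mat[of _ N N _ N])
  also have "\<dots> = U * star_mat X * star_mat U" by (rule assoc_mult_mat[symmetric, of _ N N _ N _ N]) (use X c in auto)
  finally show ?thesis by (simp add: uconj_def)
qed

lemma norm2_uconj: "X \<in> carrier_mat N N \<Longrightarrow> norm2 (uconj U X) \<le> norm2 X" unfolding uconj_def by (rule norm2_unitary_conj[OF U])

lemma mat_norm_uconj: assumes X: "X \<in> carrier_mat N N" shows "mat_norm (uconj U X) \<le> mat_norm X"
proof -
  note c = unitary_mats_carrier[OF U] and c' = unitary_mats_carrier[OF unitary_star[OF U]]
  have "mat_norm (U * X * star_mat U) \<le> mat_norm (U * X) * mat_norm (star_mat U)" by (rule mat_norm_mult[of _ N N _ N]) (use X c c' in auto)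
  also have "\<dots> \<le> mat_norm (U * X) * 1" by (intro mult_left_mono mat_norm_unitary_le[OF unitary_star[OF U]] mat_norm_nonneg)
  also have "mat_norm (U * X) \<le> mat_norm U * mat_norm X" by (rule mat_norm_mult[OF c X])
  also have "\<dots> \<le> 1 * mat_norm X" by (intro mult_right_mono mat_norm_unitary_le[OF U] mat_norm_nonneg)
  finally show ?thesis by (simp add: uconj_def)
qed

lemma nc_eval_mat_uconj:
  assumes A: "\<And>i. A i \<in> carrier_mat N N"
  shows "nc_eval_mat N (\<lambda>i. uconj U (A i)) P = uconj U (nc_eval_mat N A P)"
proof (induction P rule: poly_induct)
  case (single w c)
  have B: "uconj U (A i) \<in> carrier_mat N N" for i using A by simp
  have "foldr (\<lambda>(i,b) M. (if b then star_mat (uconj U (A i)) else uconj U (A i)) * M) l (1\<^sub>m N) =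
     uconj U (foldr (\<lambda>(i,b) M. (if b then star_mat (A i) else A i) * M) l (1\<^sub>m N))" for l
  proof (induction l)
    case Nil then show ?case by (simp add: uconj_one)
  next
    case (Cons x l)
    obtain i b where x: "x = (i,b)" by force
    have c: "foldr (\<lambda>(i,b) M. (if b then star_mat (A i) else A i) * M) l (1\<^sub>m N) \<in> carrier_mat N N"
      using word_eval_mat_carrier[OF A, where w="Word l"] by (simp add: word_eval_mat_alt)
    have s: "star_mat (A i) \<in> carrier_mat N N" using A by simp
    show ?case using Cons uconj_mult[OF A c] uconj_mult[OF s c] A by (simp add: x uconj_star)
  qed
  then show ?case by (simp add: nc_eval_mat_single[OF A] nc_eval_mat_single[OF B] word_eval_mat_alt)
      (use uconj_smult[OF word_eval_mat_carrier[OF A, where w=w]] in \<open>simp add: word_eval_mat_alt\<close>)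
next
  case zero
  have B: "uconj U (A i) \<in> carrier_mat N N" for i using A by simp
  have "uconj U (0\<^sub>m N N) \<in> carrier_mat N N" by simp
  note this carrier_matD[OF this]
  then have "0 \<cdot>\<^sub>m uconj U (0\<^sub>m N N) = 0\<^sub>m N N" by (intro eq_matI) (auto dest: carrier_matD)
  then show ?case using uconj_smult[of "0\<^sub>m N N" 0] by (simp add: nc_eval_mat_zero[OF A] nc_eval_mat_zero[OF B])
next
  case (add f g)
  have B: "uconj U (A i) \<in> carrier_mat N N" for i using A by simp
  show ?case unfolding nc_eval_mat_add[OF A] nc_eval_mat_add[OF B] add
    by (rule uconj_add[symmetric]) (auto intro: nc_eval_mat_carrier[OF A])
qed

end

lemma uconj_uconj:
  assumes "U \<in> unitary_mats N" "W \<in> unitary_mats N" "X \<in> carrier_mat N N"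
  shows "uconj U (uconj W X) = uconj (U * W) X"
proof -
  note c = unitary_mats_carrier[OF assms(1)] unitary_mats_carrier[OF assms(2)]
    unitary_mats_carrier[OF unitary_star[OF assms(1)]] unitary_mats_carrier[OF unitary_star[OF assms(2)]]
  show ?thesis unfolding uconj_def star_mat_mult[OF c(1,2)] using c assms(3)
    by (simp add: assoc_mult_mat[of _ N N _ N _ N] mult_carrier_mat[of _ N N _ N])
qed

lemma uconj_cancel:
  assumes U: "U \<in> unitary_mats N" and X: "X \<in> carrier_mat N N"
  shows "uconj (star_mat U) (uconj U X) = X"
proof -
  have "star_mat U * U = 1\<^sub>m N" using U by (simp add: unitary_mats_iff)
  then show ?thesis unfolding uconj_uconj[OF unitary_star[OF U] U X] using X by (simp add: uconj_def)
qed

section \<open>Truncation\<close>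

lemma mat_norm_leI_gram:
  fixes Y :: "complex mat"
  assumes Y: "Y \<in> carrier_mat n n" and U: "U \<in> unitary_mats n" and R: "R \<ge> 0"
    and YY: "star_mat Y * Y = U * rdiag n e * star_mat U" and e: "\<And>i. i < n \<Longrightarrow> e i \<le> R\<^sup>2"
  shows "mat_norm Y \<le> R"
proof (rule mat_norm_leI[OF Y R])
  fix v :: "nat \<Rightarrow> complex"
  have Uc: "U \<in> carrier_mat n n" using U by (rule unitary_mats_carrier)
  define w where "w = mact (star_mat U) v"
  have cipd: "cip n x (mact (rdiag n e) x) = of_real (\<Sum>i<n. e i * (cmod (x i))\<^sup>2)" for x
    by (simp add: cip_def mact_def mat_diag_def if_distrib[of "\<lambda>y. y * _"] star_complex_def complex_norm_square
        if_distrib[of "(*) _"] mult_ac del: of_real_power cong: if_cong)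
  have "cip n (mact Y v) (mact Y v) = cip n v (mact (star_mat Y) (mact Y v))" by (rule cip_mact_left[OF Y])
  also have "\<dots> = cip n v (mact (star_mat Y * Y) v)" by (rule cip_cong) (auto simp: mact_mult[OF star_mat_carrier[OF Y] Y])
  also have "\<dots> = cip n v (mact U (mact (rdiag n e) w))" unfolding YY w_def
  proof (rule cip_cong)
    fix i assume i: "i < n"
    have "mact (U * rdiag n e * star_mat U) v i = mact (U * rdiag n e) (mact (star_mat U) v) i" by (rule mact_mult) (use Uc i in auto)
    also have "\<dots> = mact U (mact (rdiag n e) (mact (star_mat U) v)) i" by (rule mact_mult) (use Uc i in auto)
    finally show "mact (U * rdiag n e * star_mat U) v i = mact U (mact (rdiag n e) (mact (star_mat U) v)) i" .
  qed simp
  also have "\<dots> = cip n w (mact (rdiag n e) w)" unfolding w_def by (rule cip_mact_right[OF Uc])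
  finally have 0: "cip n (mact Y v) (mact Y v) = of_real (\<Sum>i<n. e i * (cmod (w i))\<^sup>2)" unfolding cipd .
  then have 1: "norm (cip n (mact Y v) (mact Y v)) = \<bar>\<Sum>i<n. e i * (cmod (w i))\<^sup>2\<bar>" by (simp only: norm_of_real)
  note 0
  moreover have "cip n (mact Y v) (mact Y v) = of_real (\<Sum>i<n. (cmod (mact Y v i))\<^sup>2)"
    by (simp add: cip_def star_complex_def complex_norm_square mult.commute del: of_real_power)
  ultimately have "(\<Sum>i<n. e i * (cmod (w i))\<^sup>2) = (\<Sum>i<n. (cmod (mact Y v i))\<^sup>2)" by (metis of_real_eq_iff)
  then have "(\<Sum>i<n. e i * (cmod (w i))\<^sup>2) \<ge> 0" by (simp add: sum_nonneg)
  with 1 have "(cnorm n (mact Y v))\<^sup>2 = (\<Sum>i<n. e i * (cmod (w i))\<^sup>2)" by (simp add: cnorm_square)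
  also have "\<dots> \<le> (\<Sum>i<n. R\<^sup>2 * (cmod (w i))\<^sup>2)" by (intro sum_mono mult_right_mono e) auto
  also have "\<dots> = R\<^sup>2 * (cnorm n w)\<^sup>2"
  proof -
    have "cip n w w = of_real (\<Sum>i<n. (cmod (w i))\<^sup>2)"
      by (simp add: cip_def star_complex_def complex_norm_square mult.commute del: of_real_power)
    then have "(cnorm n w)\<^sup>2 = (\<Sum>i<n. (cmod (w i))\<^sup>2)" unfolding cnorm_square by (simp only: norm_of_real) (simp add: sum_nonneg)
    then show ?thesis by (simp add: sum_distrib_left)
  qed
  also have "\<dots> \<le> R\<^sup>2 * (cnorm n v)\<^sup>2"
  proof -
    have "cnorm n w \<le> mat_norm (star_mat U) * cnorm n v" unfolding w_def by (rule cnorm_mact_le[OF star_mat_carrier[OF Uc]])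
    also have "\<dots> \<le> 1 * cnorm n v" by (intro mult_right_mono mat_norm_unitary_le[OF unitary_star[OF U]]) simp
    finally show ?thesis by (intro mult_left_mono power_mono) simp_all
  qed
  finally have "(cnorm n (mact Y v))\<^sup>2 \<le> (R * cnorm n v)\<^sup>2" by (simp only: power_mult_distrib)
  then show "cnorm n (mact Y v) \<le> R * cnorm n v" by (rule power2_le_imp_le) (use R in simp)
qed

lemma ntr_conj_diag:
  assumes U: "U \<in> unitary_mats n"
  shows "ntr (U * rdiag n e * star_mat U) = of_real ((\<Sum>i<n. e i) / n)"
proof -
  have Uc: "U \<in> carrier_mat n n" using U by (rule unitary_mats_carrier)
  have "ntr (U * rdiag n e * star_mat U) = ntr (star_mat U * (U * rdiag n e))" by (rule ntr_mult_commute) (use Uc in auto)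
  also have "star_mat U * (U * rdiag n e) = rdiag n e" by (rule mult_star_cancel(1)[OF U, of _ n]) simp
  finally show ?thesis by (simp add: ntr_def mat_diag_def)
qed

lemma conj_diag_mult:
  "U \<in> unitary_mats n \<Longrightarrow> (U * rdiag n d * star_mat U) * (U * rdiag n e * star_mat U) = U * rdiag n (\<lambda>i. d i * e i) * star_mat U"
  using uconj_mult[of U n "rdiag n d" "rdiag n e"] by (simp add: uconj_def)

lemma conj_diag_power:
  assumes U: "U \<in> unitary_mats n"
  shows "(U * rdiag n d * star_mat U) ^\<^sub>m k = U * rdiag n (\<lambda>i. d i ^ k) * star_mat U"
proof (induction k)
  case 0
  have "rdiag n (\<lambda>i. d i ^ 0) = 1\<^sub>m n" by (rule eq_matI) (auto simp: mat_diag_def)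
  then show ?case using unitary_mats_carrier[OF U] unitary_right_inverse[OF U] by simp
next
  case (Suc k)
  show ?case by (simp only: pow_mat.simps Suc conj_diag_mult[OF U]) (simp add: mult.commute)
qed

text \<open>In an eigenbasis \<open>U\<close> of \<open>X\<^sup>*X\<close> the columns of \<open>X U\<close> are orthogonal, and their squared lengths \<open>d i\<close> are the squares of the
  singular values. This takes the place of a polar decomposition.\<close>

lemma gram_diagonalization:
  assumes X: "(X :: complex mat) \<in> carrier_mat n n" and U: "U \<in> unitary_mats n"
    and H: "star_mat X * X = U * rdiag n d * star_mat U"
  shows "star_mat (X * U) * (X * U) = rdiag n d" "\<And>i. i < n \<Longrightarrow> 0 \<le> d i" "\<And>i. i < n \<Longrightarrow> d i \<le> (mat_norm X)\<^sup>2"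
proof -
  have Uc: "U \<in> carrier_mat n n" using U by (rule unitary_mats_carrier)
  have "star_mat (X * U) * (X * U) = star_mat U * ((star_mat X * X) * U)"
    using X Uc by (simp add: star_mat_mult[OF X Uc] assoc_mult_mat[of _ n n _ n _ n])
  also have "\<dots> = (star_mat U * (U * (rdiag n d * (star_mat U * U))))" unfolding H using Uc by (simp add: assoc_mult_mat[of _ n n _ n _ n])
  also have "\<dots> = rdiag n d * (star_mat U * U)" by (rule mult_star_cancel(1)[OF U, of _ n]) (use Uc in simp)
  also have "\<dots> = rdiag n d" using U by (simp add: unitary_mats_iff)
  finally show V: "star_mat (X * U) * (X * U) = rdiag n d" .
  fix i assume i: "i < n"
  have "of_real (d i) = (star_mat (X * U) * (X * U)) $$ (i,i)" using i by (simp add: V mat_diag_def)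
  also have "\<dots> = (\<Sum>l<n. cnj ((X * U) $$ (l,i)) * (X * U) $$ (l,i))"
    using i X Uc by (simp add: index_mult_mat_sum[of i "star_mat (X * U)" i "X * U"] star_complex_def)
  also have "\<dots> = of_real (\<Sum>l<n. (cmod ((X * U) $$ (l,i)))\<^sup>2)" by (simp add: complex_norm_square mult.commute del: of_real_power)
  finally have "d i = (\<Sum>l<n. (cmod ((X * U) $$ (l,i)))\<^sup>2)" by (simp only: of_real_eq_iff)
  then show d0: "0 \<le> d i" by (simp add: sum_nonneg)
  have XU: "X * U \<in> carrier_mat n n" using X Uc by simp
  have "mat_norm (X * U) \<le> mat_norm X * mat_norm U" by (rule mat_norm_mult[OF X Uc])
  also have "\<dots> \<le> mat_norm X * 1" by (intro mult_left_mono mat_norm_unitary_le[OF U]) simp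
  finally have XUn: "mat_norm (X * U) \<le> mat_norm X" by simp
  have "d i = cmod (rdiag n d $$ (i,i))" using i d0 by (simp add: mat_diag_def)
  also have "\<dots> \<le> mat_norm (rdiag n d)" by (rule norm_entry_le_mat_norm[OF _ i i]) simp
  also have "\<dots> \<le> mat_norm (star_mat (X * U)) * mat_norm (X * U)"
    unfolding V[symmetric] by (rule mat_norm_mult[OF star_mat_carrier[OF XU] XU])
  also have "\<dots> \<le> mat_norm X * mat_norm X" unfolding mat_norm_star[OF XU] by (intro mult_mono XUn) auto
  finally show "d i \<le> (mat_norm X)\<^sup>2" by (simp add: power2_eq_square)
qed

lemma gram_of_conj:
  assumes V: "V \<in> carrier_mat n n" "star_mat V * V = rdiag n d" and U: "U \<in> unitary_mats n"
  shows "star_mat (V * rdiag n h * star_mat U) * (V * rdiag n h * star_mat U) =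
     U * rdiag n (\<lambda>i. (h i)\<^sup>2 * d i) * star_mat U"
proof -
  have Uc: "U \<in> carrier_mat n n" using U by (rule unitary_mats_carrier)
  have sd: "star_mat (rdiag n h) = rdiag n h" by (rule eq_matI) (auto simp: mat_diag_def star_complex_def)
  have "star_mat (V * rdiag n h * star_mat U) * (V * rdiag n h * star_mat U) =
    U * (rdiag n h * ((star_mat V * V) * (rdiag n h * star_mat U)))"
    using V(1) Uc by (simp add: star_mat_mult[of _ n n _ n] sd assoc_mult_mat[of _ n n _ n _ n])
  also have "\<dots> = U * ((rdiag n h * rdiag n d) * rdiag n h) * star_mat U"
    unfolding V(2) using Uc by (simp add: assoc_mult_mat[of _ n n _ n _ n] del: mat_diag_diag)
  also have "(rdiag n h * rdiag n d) * rdiag n h = rdiag n (\<lambda>i. (h i)\<^sup>2 * d i)" by (simp add: power2_eq_square mult_ac)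
  finally show ?thesis .
qed

text \<open>The singular values beyond \<open>R\<close> are replaced by \<open>R\<close>. They satisfy \<open>1 \<le> (d i / R\<^sup>2)\<^sup>k\<close>, so that a high moment bounds their
  number and with it the error, which is at most \<open>M\<close> for each of them.\<close>

lemma truncation:
  assumes X: "X \<in> carrier_mat n n" and R: "R > 0" and M: "mat_norm X \<le> M"
  obtains Y where "Y \<in> carrier_mat n n" "mat_norm Y \<le> R"
    "\<And>k. (norm2 (X - Y))\<^sup>2 \<le> M\<^sup>2 * (Re (ntr ((star_mat X * X) ^\<^sub>m k)) / R ^ (2 * k))"
proof -
  have H: "star_mat (star_mat X * X) = star_mat X * X" "star_mat X * X \<in> carrier_mat n n"
    using X by (simp_all add: star_mat_mult[of _ n n _ n])
  obtain U d where U: "U \<in> unitary_mats n" and d: "star_mat X * X = U * rdiag n d * star_mat U"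
    using hermitian_diagonalization[OF H(2,1)] by blast
  have Uc: "U \<in> carrier_mat n n" using U by (rule unitary_mats_carrier)
  define V where "V = X * U"
  have V: "V \<in> carrier_mat n n" "star_mat V * V = rdiag n d" using X Uc gram_diagonalization(1)[OF X U d] by (auto simp: V_def)
  have dpos: "0 \<le> d i" and dM: "d i \<le> M\<^sup>2" if "i < n" for i using gram_diagonalization(2,3)[OF X U d that] power_mono[OF M, of 2] by auto
  define g where "g i = (if d i \<le> R\<^sup>2 then 1 else R / sqrt (d i))" for i
  define Y where "Y = V * rdiag n g * star_mat U"
  have Y: "Y \<in> carrier_mat n n" using V Uc by (simp add: Y_def)
  have "mat_norm Y \<le> R"
  proof (rule mat_norm_leI_gram[OF Y U])
    show "star_mat Y * Y = U * rdiag n (\<lambda>i. (g i)\<^sup>2 * d i) * star_mat U" unfolding Y_def by (rule gram_of_conj[OF V U])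
    show "(g i)\<^sup>2 * d i \<le> R\<^sup>2" if "i < n" for i using dpos[OF that] R by (auto simp: g_def power_divide)
  qed (use R in simp)
  moreover have "(norm2 (X - Y))\<^sup>2 \<le> M\<^sup>2 * (Re (ntr ((star_mat X * X) ^\<^sub>m k)) / R ^ (2 * k))" for k
  proof -
    have "X = V * star_mat U" using X Uc unitary_right_inverse[OF U] by (simp add: V_def assoc_mult_mat[of _ n n _ n _ n])
    moreover have "V * rdiag n (\<lambda>i. 1 - g i) = V - V * rdiag n g"
      by (rule eq_matI) (use V in \<open>auto simp: mat_diag_mult_right[of _ n n] algebra_simps\<close>)
    ultimately have XY: "X - Y = V * rdiag n (\<lambda>i. 1 - g i) * star_mat U"
      using V Uc unfolding Y_def by (simp add: minus_mult_distrib_mat[of _ n n _ _ n])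
    have "(norm2 (X - Y))\<^sup>2 = Re (ntr (star_mat (X - Y) * (X - Y)))" using X Y by (simp add: ntr_star_mult_norm2[of _ n])
    also have "\<dots> = (\<Sum>i<n. (1 - g i)\<^sup>2 * d i) / n" unfolding XY gram_of_conj[OF V U] ntr_conj_diag[OF U] by simp
    also have "\<dots> \<le> (\<Sum>i<n. M\<^sup>2 * (d i ^ k / R ^ (2 * k))) / n"
    proof (intro divide_right_mono sum_mono)
      fix i assume "i \<in> {..<n}"
      then have i: "0 \<le> d i" "d i \<le> M\<^sup>2" using dpos dM by auto
      show "(1 - g i)\<^sup>2 * d i \<le> M\<^sup>2 * (d i ^ k / R ^ (2 * k))"
      proof (cases "d i \<le> R\<^sup>2")
        case True then show ?thesis using i R by (simp add: g_def)
      next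
        case False
        have "sqrt (d i) \<ge> R" using False R by (simp add: real_le_rsqrt)
        moreover have "sqrt (d i) > 0" using calculation R by linarith
        ultimately have "0 \<le> g i" "g i \<le> 1" using False R by (simp_all add: g_def)
        then have "(1 - g i)\<^sup>2 \<le> 1" by (simp add: power_le_one)
        then have "(1 - g i)\<^sup>2 * d i \<le> 1 * M\<^sup>2" using i by (intro mult_mono) auto
        moreover have "1 \<le> d i ^ k / R ^ (2 * k)" using False R power_mono[of "R\<^sup>2" "d i" k] by (simp add: power_mult divide_simps)
        then have "M\<^sup>2 * 1 \<le> M\<^sup>2 * (d i ^ k / R ^ (2 * k))" by (intro mult_left_mono) auto
        ultimately show ?thesis by simp
      qed
    qed simp
    also have "\<dots> = M\<^sup>2 * (Re (ntr ((star_mat X * X) ^\<^sub>m k)) / R ^ (2 * k))" unfolding d conj_diag_power[OF U] ntr_conj_diag[OF U]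
      by (simp add: sum_divide_distrib sum_distrib_left mult_ac)
    finally show ?thesis .
  qed
  ultimately show ?thesis using Y that by blast
qed

section \<open>\<open>L\<^sup>q\<close>-norms\<close>

lemma mat_fun_spec:
  assumes "H \<in> carrier_mat n n" "star_mat H = H"
  obtains U d where "U \<in> unitary_mats n" "H = U * rdiag n d * star_mat U"
    "mat_fun f H = U * rdiag n (\<lambda>i. f (d i)) * star_mat U"
proof -
  have dim: "dim_row H = n" using assms by simp
  let ?P = "\<lambda>M. \<exists>U\<in>unitary_mats (dim_row H). \<exists>d :: nat \<Rightarrow> real.
     H = U * mat_diag (dim_row H) (\<lambda>i. of_real (d i)) * mat_adjoint U \<and>
     M = U * mat_diag (dim_row H) (\<lambda>i. of_real (f (d i))) * mat_adjoint U"
  have "\<exists>M. ?P M" using hermitian_diagonalization[OF assms] unfolding dim mat_adjoint_eq by blast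
  then have "?P (mat_fun f H)" unfolding mat_fun_def by (rule someI_ex)
  then show ?thesis using that unfolding dim mat_adjoint_eq by blast
qed

text \<open>The \<open>e i\<close> are the singular values of \<open>X\<close>, taken from the diagonalization of the absolute value that defines its powers.\<close>

lemma Lq_norm_spec:
  assumes X: "X \<in> carrier_mat n n"
  obtains e where "\<And>i. i < n \<Longrightarrow> 0 \<le> e i"
    "Lq_norm q X = ((\<Sum>i<n. e i powr q) / n) powr (1 / q)"
    "\<And>k. ntr ((star_mat X * X) ^\<^sub>m k) = of_real ((\<Sum>i<n. e i ^ (2 * k)) / n)"
proof -
  have H: "star_mat X * X \<in> carrier_mat n n" "star_mat (star_mat X * X) = star_mat X * X"
    using X by (simp_all add: star_mat_mult[of _ n n _ n])
  obtain U d where U: "U \<in> unitary_mats n" "star_mat X * X = U * rdiag n d * star_mat U"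
    "mat_fun sqrt (star_mat X * X) = U * rdiag n (\<lambda>i. sqrt (d i)) * star_mat U" using mat_fun_spec[OF H] by blast
  have Uc: "U \<in> carrier_mat n n" using U(1) by (rule unitary_mats_carrier)
  define A where "A = U * rdiag n (\<lambda>i. sqrt (d i)) * star_mat U"
  have abs: "mat_abs X = A" by (simp add: mat_abs_def mat_adjoint_eq U(3) A_def)
  have "star_mat (rdiag n (\<lambda>i. sqrt (d i))) = rdiag n (\<lambda>i. sqrt (d i))" by (rule eq_matI) (auto simp: mat_diag_def star_complex_def)
  then have A: "A \<in> carrier_mat n n" "star_mat A = A"
    using Uc uconj_star[OF U(1), of "rdiag n (\<lambda>i. sqrt (d i))"] by (simp_all add: A_def uconj_def)
  obtain W e where W: "W \<in> unitary_mats n" "A = W * rdiag n e * star_mat W"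
    "mat_fun (\<lambda>t. t powr q) A = W * rdiag n (\<lambda>i. e i powr q) * star_mat W" using mat_fun_spec[OF A] by blast
  have Wc: "W \<in> carrier_mat n n" "star_mat W \<in> carrier_mat n n" using unitary_mats_carrier[OF W(1)] by auto
  have d0: "0 \<le> d i" if "i < n" for i by (rule gram_diagonalization(2)[OF X U(1,2) that])
  have AA: "A * A = star_mat X * X"
  proof -
    have "rdiag n (\<lambda>i. sqrt (d i) * sqrt (d i)) = rdiag n d" by (rule eq_matI) (auto simp: mat_diag_def d0 simp flip: of_real_mult)
    then show ?thesis unfolding A_def conj_diag_mult[OF U(1)] by (simp add: U(2))
  qed
  have e0: "0 \<le> e i" if i: "i < n" for i
  proof -
    define T where "T = star_mat W * U"
    have T: "T \<in> carrier_mat n n" using Uc Wc(1) by (simp add: T_def)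
    have "rdiag n e = star_mat W * (W * (rdiag n e * (star_mat W * W)))"
      using mult_star_cancel(1)[OF W(1), of "rdiag n e * (star_mat W * W)" n] W(1) Wc(1) by (simp add: unitary_mats_iff)
    also have "\<dots> = star_mat W * (A * W)" unfolding W(2) using Wc(1) by (simp add: assoc_mult_mat[of _ n n _ n _ n])
    also have "\<dots> = T * rdiag n (\<lambda>i. sqrt (d i)) * star_mat T" unfolding A_def T_def using Wc(1) Uc
      by (simp add: assoc_mult_mat[of _ n n _ n _ n] star_mat_mult[of _ n n _ n])
    finally have "rdiag n e $$ (i,i) = (\<Sum>l<n. T $$ (i,l) * of_real (sqrt (d l)) * cnj (T $$ (i,l)))"
      using conj_diag_index[OF T i i] by metis
    also have "\<dots> = of_real (\<Sum>l<n. sqrt (d l) * (cmod (T $$ (i,l)))\<^sup>2)" by (simp add: complex_norm_square mult_ac del: of_real_power)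
    also have "rdiag n e $$ (i,i) = of_real (e i)" using i by (simp add: mat_diag_def)
    finally have "e i = (\<Sum>l<n. sqrt (d l) * (cmod (T $$ (i,l)))\<^sup>2)" by (simp only: of_real_eq_iff)
    also have "\<dots> \<ge> 0" by (intro sum_nonneg mult_nonneg_nonneg) (auto simp: d0)
    finally show ?thesis .
  qed
  show ?thesis
  proof (rule that[of e])
    show "Lq_norm q X = ((\<Sum>i<n. e i powr q) / n) powr (1 / q)" unfolding Lq_norm_def abs W(3) ntr_conj_diag[OF W(1)] by simp
    show "ntr ((star_mat X * X) ^\<^sub>m k) = of_real ((\<Sum>i<n. e i ^ (2 * k)) / n)" for k
    proof -
      have "star_mat X * X = W * rdiag n (\<lambda>i. e i * e i) * star_mat W" using conj_diag_mult[OF W(1), of e e] AA W(2) by simp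
      then show ?thesis by (simp only: conj_diag_power[OF W(1)] ntr_conj_diag[OF W(1)]) (simp add: power_mult power2_eq_square)
    qed
  qed (rule e0)
qed

lemma convex_on_powr: assumes r: "r \<ge> 1" shows "convex_on {0..} (\<lambda>x::real. x powr r)"
proof (rule convex_onI)
  have sc: "(t * y) powr r \<le> t * y powr r" if "0 < t" "t < 1" "y \<ge> 0" for t y :: real
  proof -
    have "t powr r \<le> t powr 1" using that r by (intro powr_mono') auto
    then show ?thesis using that by (simp add: powr_mult mult_right_mono)
  qed
  fix t x y :: real
  assume t: "0 < t" "t < 1" and xy: "x \<in> {0..}" "y \<in> {0..}"
  show "((1 - t) *\<^sub>R x + t *\<^sub>R y) powr r \<le> (1 - t) * x powr r + t * y powr r"
  proof (cases "x = 0 \<or> y = 0")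
    case True
    then show ?thesis using t xy r sc[of t y] sc[of "1 - t" x] by auto
  next
    case False
    then show ?thesis using convex_onD[OF powr_convex[OF r], of t x y] t xy by auto
  qed
qed simp

lemma power_mean_mono:
  fixes e :: "nat \<Rightarrow> real"
  assumes n: "n > 0" and pq: "0 < p" "p \<le> q" and e: "\<And>i. i < n \<Longrightarrow> 0 \<le> e i"
  shows "((\<Sum>i<n. e i powr p) / n) powr (1 / p) \<le> ((\<Sum>i<n. e i powr q) / n) powr (1 / q)"
proof -
  define r where "r = q / p"
  have r: "r \<ge> 1" using pq by (simp add: r_def)
  have "(\<Sum>i<n. (1 / real n) *\<^sub>R (e i powr p)) powr r \<le> (\<Sum>i<n. (1 / real n) * (e i powr p) powr r)"
    by (rule convex_on_sum[where C="{0..}"]) (use n r in \<open>auto intro!: convex_on_powr\<close>)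
  then have "((\<Sum>i<n. e i powr p) / n) powr r \<le> (\<Sum>i<n. e i powr q) / n" using pq by (simp add: powr_powr r_def sum_divide_distrib)
  then have "(((\<Sum>i<n. e i powr p) / n) powr r) powr (1 / q) \<le> ((\<Sum>i<n. e i powr q) / n) powr (1 / q)" using pq by (intro powr_mono2) auto
  then show ?thesis using pq by (simp add: powr_powr r_def)
qed

text \<open>For the normalized trace the \<open>L\<^sup>q\<close>-norm increases with \<open>q\<close>, so even moments with smaller exponent lie below it and those with
  larger exponent above.\<close>

lemma even_moment_le_Lq:
  assumes X: "X \<in> carrier_mat n n" and n: "n > 0" and k: "k \<ge> 1" "2 * real k \<le> q"
  shows "Re (ntr ((star_mat X * X) ^\<^sub>m k)) \<le> Lq_norm q X ^ (2 * k)"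
proof -
  obtain e where e: "\<And>i. i < n \<Longrightarrow> 0 \<le> e i"
    "Lq_norm q X = ((\<Sum>i<n. e i powr q) / n) powr (1 / q)"
    "\<And>k. ntr ((star_mat X * X) ^\<^sub>m k) = of_real ((\<Sum>i<n. e i ^ (2 * k)) / n)" using Lq_norm_spec[OF X, of q] by blast
  define m where "m = (\<Sum>i<n. e i powr (2 * real k)) / n"
  have m0: "m \<ge> 0" by (simp add: m_def sum_nonneg)
  have pw: "e i powr (2 * real k) = e i ^ (2 * k)" if "i < n" for i
    using e(1)[OF that] k by (cases "e i = 0") (auto simp flip: powr_realpow)
  have "m powr (1 / (2 * real k)) \<le> Lq_norm q X" unfolding e(2) m_def by (rule power_mean_mono) (use n k e(1) in auto)
  then have "(m powr (1 / (2 * real k))) ^ (2 * k) \<le> Lq_norm q X ^ (2 * k)" by (rule power_mono) simp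
  also have "(m powr (1 / (2 * real k))) ^ (2 * k) = m" using m0 k by (cases "m = 0") (auto simp: powr_powr simp flip: powr_realpow)
  finally show ?thesis unfolding e(3) by (simp add: m_def pw)
qed

lemma Lq_le_even_moment:
  assumes X: "X \<in> carrier_mat n n" and n: "n > 0" and k: "k \<ge> 1" "1 \<le> q" "q \<le> 2 * real k"
    and c: "Re (ntr ((star_mat X * X) ^\<^sub>m k)) \<le> c ^ (2 * k)" "c \<ge> 0"
  shows "Lq_norm q X \<le> c"
proof -
  obtain e where e: "\<And>i. i < n \<Longrightarrow> 0 \<le> e i"
    "Lq_norm q X = ((\<Sum>i<n. e i powr q) / n) powr (1 / q)"
    "\<And>k. ntr ((star_mat X * X) ^\<^sub>m k) = of_real ((\<Sum>i<n. e i ^ (2 * k)) / n)" using Lq_norm_spec[OF X, of q] by blast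
  define m where "m = (\<Sum>i<n. e i powr (2 * real k)) / n"
  have m0: "m \<ge> 0" by (simp add: m_def sum_nonneg)
  have pw: "e i powr (2 * real k) = e i ^ (2 * k)" if "i < n" for i
    using e(1)[OF that] k by (cases "e i = 0") (auto simp flip: powr_realpow)
  have "m \<le> c ^ (2 * k)" using c(1) unfolding e(3) by (simp add: m_def pw)
  have "Lq_norm q X \<le> m powr (1 / (2 * real k))" unfolding e(2) m_def by (rule power_mean_mono) (use n k e(1) in auto)
  also have "\<dots> \<le> (c ^ (2 * k)) powr (1 / (2 * real k))" using \<open>m \<le> c ^ (2 * k)\<close> m0 k by (intro powr_mono2) auto
  also have "\<dots> = c" using c k by (cases "c = 0") (auto simp: powr_powr simp flip: powr_realpow)
  finally show ?thesis .
qed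

section \<open>Estimates for polynomials of matrices that are uniform in the matrix size\<close>

lemma star_mat_diff_norm2:
  assumes "X \<in> carrier_mat N N" "Y \<in> carrier_mat N N"
  shows "norm2 (star_mat X - star_mat Y) = norm2 (X - Y)" using assms norm2_star[of "X - Y" N] by (simp add: star_mat_diff[of X N N Y])

lemma mat_norm_smult: "mat_norm (c \<cdot>\<^sub>m X) \<le> cmod c * mat_norm (X :: complex mat)"
proof (rule mat_norm_leI)
  show "c \<cdot>\<^sub>m X \<in> carrier_mat (dim_row X) (dim_col X)" by auto
  fix v :: "nat \<Rightarrow> complex"
  have "cnorm (dim_row X) (mact (c \<cdot>\<^sub>m X) v) = cnorm (dim_row X) (\<lambda>i. c *\<^sub>C mact X v i)"
    by (rule cnorm_cong) (simp add: mact_def sum_distrib_left scaleC_complex_def mult.assoc)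
  also have "\<dots> = cmod c * cnorm (dim_row X) (mact X v)"
    by (simp add: cnorm_def cip_scaleC_left cip_scaleC_right scaleC_scaleC norm_scaleC norm_mult real_sqrt_mult
        flip: power2_eq_square)
  also have "\<dots> \<le> cmod c * (mat_norm X * cnorm (dim_col X) v)" by (intro mult_left_mono cnorm_mact_le) auto
  finally show "cnorm (dim_row X) (mact (c \<cdot>\<^sub>m X) v) \<le> cmod c * mat_norm X * cnorm (dim_col X) v" by simp
qed simp

lemma mat_norm_zero_le [simp]: "mat_norm (0\<^sub>m N N :: complex mat) = 0"
  using mat_norm_smult[of 0 "0\<^sub>m N N"] mat_norm_nonneg[of "0\<^sub>m N N :: complex mat"] by simp

lemma ntr_le_mat_norm: "X \<in> carrier_mat N N \<Longrightarrow> cmod (ntr X) \<le> mat_norm X" using ntr_le_norm2[of X N] norm2_le_mat_norm[of X N] by simp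

lemma norm2_self: assumes "X \<in> carrier_mat N N" shows "norm2 (X - X) = 0"
proof -
  have "X - X = 0\<^sub>m N N" by (rule eq_matI) (use assms in auto)
  then show ?thesis by (simp only: norm2_zero)
qed

lemma poly_seminorm_le:
  fixes f :: "('w \<Rightarrow>\<^sub>0 complex) \<Rightarrow> real"
  assumes "f 0 \<le> 0" "\<And>P Q. f (P + Q) \<le> f P + f Q"
    and "\<And>w c. w \<in> words P \<Longrightarrow> f (wterm w c) \<le> cmod c * g w"
  shows "f P \<le> (\<Sum>w\<in>words P. cmod (wcoeff P w) * g w)"
proof -
  let ?c = "wcoeff P"
  have "f (\<Sum>w\<in>K. wterm w (?c w)) \<le> (\<Sum>w\<in>K. cmod (?c w) * g w)" if "finite K" "K \<subseteq> words P" for K using that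
  proof (induction K rule: finite_induct)
    case (insert w K)
    have "f (wterm w (?c w) + (\<Sum>w\<in>K. wterm w (?c w))) \<le>
      cmod (?c w) * g w + (\<Sum>w\<in>K. cmod (?c w) * g w)" by (rule order_trans[OF assms(2)]) (use insert assms(3) in \<open>auto intro!: add_mono\<close>)
    then show ?case using insert by simp
  qed (use assms(1) in simp)
  from this[of "words P"] show ?thesis by (simp flip: poly_sum_singles)
qed

text \<open>The matrix size is prescribed at all indices, so that every polynomial can be evaluated.\<close>

definition bounded_tuple :: "nat \<Rightarrow> 'i set \<Rightarrow> real \<Rightarrow> ('i \<Rightarrow> complex mat) \<Rightarrow> bool" where
  "bounded_tuple N I M A \<longleftrightarrow> (\<forall>i. A i \<in> carrier_mat N N) \<and> (\<forall>i\<in>I. mat_norm (A i) \<le> M)"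

lemma bounded_tuple_carrier: "bounded_tuple N I M A \<Longrightarrow> A i \<in> carrier_mat N N" by (simp add: bounded_tuple_def)

text \<open>For \<open>M \<ge> 1\<close> this is a bound on matrices of norm at most \<open>M\<close> and also a Lipschitz constant for the 2-norm, since a word of
  length \<open>n\<close> can be changed in \<open>n\<close> steps, one letter at a time. It does not involve the matrix size.\<close>

definition poly_const :: "real \<Rightarrow> 'i nc_poly \<Rightarrow> real" where
  "poly_const M P = (\<Sum>w\<in>words P. cmod (wcoeff P w) *
     (real (1 + length (letters w)) * M ^ length (letters w)))"

lemma poly_const_nonneg: "M \<ge> 0 \<Longrightarrow> 0 \<le> poly_const M P" by (simp add: poly_const_def sum_nonneg)

lemma word_estimates:
  assumes A: "bounded_tuple N I M A" and B: "bounded_tuple N I M B"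
    and d: "\<And>i. i \<in> I \<Longrightarrow> norm2 (A i - B i) \<le> d" "0 \<le> d" and M: "M \<ge> 1" and l: "fst ` set l \<subseteq> I"
  shows "mat_norm (word_eval_mat N A (Word l)) \<le> M ^ length l" (is ?a)
    "norm2 (word_eval_mat N A (Word l) - word_eval_mat N B (Word l)) \<le> real (length l) * M ^ length l * d" (is ?b)
proof -
  have Ac: "\<And>i. A i \<in> carrier_mat N N" and Bc: "\<And>i. B i \<in> carrier_mat N N" using A B by (simp_all add: bounded_tuple_carrier)
  have "?a \<and> ?b" using l
  proof (induction l)
    case Nil
    show ?case using mat_norm_one_le[of N] norm2_self[of "1\<^sub>m N" N] by (simp add: word_eval_mat_alt)
  next
    case (Cons x l)
    obtain i b where x: "x = (i,b)" by force
    have i: "i \<in> I" using Cons.prems x by auto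
    define X where "X = (if b then star_mat (A i) else A i)"
    define Y where "Y = (if b then star_mat (B i) else B i)"
    define V where "V = word_eval_mat N A (Word l)"
    define W where "W = word_eval_mat N B (Word l)"
    have c: "X \<in> carrier_mat N N" "Y \<in> carrier_mat N N" "V \<in> carrier_mat N N" "W \<in> carrier_mat N N"
      using Ac Bc by (auto simp: X_def Y_def V_def W_def)
    have e: "word_eval_mat N A (Word (x # l)) = X * V" "word_eval_mat N B (Word (x # l)) = Y * W"
      by (simp_all add: word_eval_mat_alt x X_def Y_def V_def W_def)
    have n: "mat_norm X \<le> M" "mat_norm Y \<le> M" "norm2 (X - Y) \<le> d" using A B i d(1)[OF i] Ac Bc
      by (auto simp: X_def Y_def bounded_tuple_def mat_norm_star[of _ N N] star_mat_diff_norm2[of _ N])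
    have IH: "mat_norm V \<le> M ^ length l" "norm2 (V - W) \<le> real (length l) * M ^ length l * d" using Cons by (auto simp: V_def W_def)
    have "mat_norm (X * V) \<le> mat_norm X * mat_norm V" by (rule mat_norm_mult[OF c(1,3)])
    also have "\<dots> \<le> M * M ^ length l" using n IH M by (intro mult_mono) auto
    finally have 1: "mat_norm (X * V) \<le> M ^ length (x # l)" by simp
    have "X * V - Y * W = (X - Y) * V + Y * (V - W)" unfolding minus_mult_distrib_mat[OF c(1,2,3)] mult_minus_distrib_mat[OF c(2,3,4)]
      using c by (intro eq_matI) auto
    then have "norm2 (X * V - Y * W) \<le> norm2 ((X - Y) * V) + norm2 (Y * (V - W))"
      using norm2_triangle[of "(X - Y) * V" N "Y * (V - W)"] c by simp
    also have "norm2 ((X - Y) * V) \<le> norm2 (X - Y) * mat_norm V" by (rule norm2_mult_right[of _ N]) (use c in auto)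
    also have "\<dots> \<le> d * M ^ length l" using n IH d by (intro mult_mono) auto
    also have "\<dots> \<le> d * M ^ length (x # l)" using d M by (intro mult_left_mono power_increasing) auto
    also have "norm2 (Y * (V - W)) \<le> mat_norm Y * norm2 (V - W)" by (rule norm2_mult_left[of _ N]) (use c in auto)
    also have "\<dots> \<le> M * (real (length l) * M ^ length l * d)" using n IH M c by (intro mult_mono norm2_nonneg[of _ N]) auto
    finally have "norm2 (X * V - Y * W) \<le> real (length (x # l)) * M ^ length (x # l) * d" by (simp add: algebra_simps)
    with 1 show ?case by (simp only: e)
  qed
  then show ?a ?b by auto
qed

lemma poly_mat_norm_bound:
  assumes P: "P \<in> nc_polys I" and A: "bounded_tuple N I M A" and M: "M \<ge> 1"
  shows "mat_norm (nc_eval_mat N A P) \<le> poly_const M P" unfolding poly_const_def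
proof (rule poly_seminorm_le)
  note Ac = bounded_tuple_carrier[OF A]
  show "mat_norm (nc_eval_mat N A (P + Q)) \<le> mat_norm (nc_eval_mat N A P) + mat_norm (nc_eval_mat N A Q)" for P Q
    using mat_norm_add[of "nc_eval_mat N A P" N N "nc_eval_mat N A Q"] Ac by (simp add: nc_eval_mat_add[OF Ac])
  fix w c assume "w \<in> words P"
  then have w: "fst ` set (letters w) \<subseteq> I" using P by (auto simp: nc_polys_def)
  have "norm2 (A i - A i) \<le> 0" for i using norm2_self[OF Ac] by simp
  then have "mat_norm (word_eval_mat N A w) \<le> 1 * M ^ length (letters w)" using word_estimates(1)[OF A A _ order_refl M w] by simp
  also have "\<dots> \<le> real (1 + length (letters w)) * M ^ length (letters w)" using M by (intro mult_right_mono) auto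
  finally show "mat_norm (nc_eval_mat N A (wterm w c)) \<le> cmod c * (real (1 + length (letters w)) * M ^ length (letters w))"
    using mat_norm_smult[of c "word_eval_mat N A w"] mult_left_mono order_trans unfolding nc_eval_mat_single[OF Ac] by (metis norm_ge_zero)
qed (simp add: nc_eval_mat_zero bounded_tuple_carrier[OF A])

lemma poly_mat_lipschitz:
  assumes P: "P \<in> nc_polys I" and A: "bounded_tuple N I M A" and B: "bounded_tuple N I M B"
    and d: "\<And>i. i \<in> I \<Longrightarrow> norm2 (A i - B i) \<le> d" "0 \<le> d" and M: "M \<ge> 1"
  shows "norm2 (nc_eval_mat N A P - nc_eval_mat N B P) \<le> poly_const M P * d"
proof -
  note Ac = bounded_tuple_carrier[OF A] and Bc = bounded_tuple_carrier[OF B]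
  have c: "nc_eval_mat N A P \<in> carrier_mat N N" "nc_eval_mat N B P \<in> carrier_mat N N" for P
    by (rule nc_eval_mat_carrier[OF Ac], rule nc_eval_mat_carrier[OF Bc])
  have "norm2 (nc_eval_mat N A P - nc_eval_mat N B P) \<le>
    (\<Sum>w\<in>words P. cmod (wcoeff P w) * (real (1 + length (letters w)) * M ^ length (letters w) * d))"
  proof (rule poly_seminorm_le)
    show "norm2 (nc_eval_mat N A 0 - nc_eval_mat N B 0) \<le> 0"
      unfolding nc_eval_mat_zero[OF Ac] nc_eval_mat_zero[OF Bc] by (simp only: norm2_self[of _ N] zero_carrier_mat order_refl)
    show "norm2 (nc_eval_mat N A (P + Q) - nc_eval_mat N B (P + Q)) \<le>
      norm2 (nc_eval_mat N A P - nc_eval_mat N B P) + norm2 (nc_eval_mat N A Q - nc_eval_mat N B Q)" for P Q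
    proof -
      have "nc_eval_mat N A (P + Q) - nc_eval_mat N B (P + Q) =
        (nc_eval_mat N A P - nc_eval_mat N B P) + (nc_eval_mat N A Q - nc_eval_mat N B Q)"
        unfolding nc_eval_mat_add[OF Ac] nc_eval_mat_add[OF Bc] by (rule eq_matI) (auto simp: dim_nc_eval_mat[OF Ac] dim_nc_eval_mat[OF Bc])
      then show ?thesis using norm2_triangle[OF minus_carrier_mat[OF c(2)] minus_carrier_mat[OF c(2)]] by simp
    qed
    fix w k assume "w \<in> words P"
    then have w: "fst ` set (letters w) \<subseteq> I" using P by (auto simp: nc_polys_def)
    have wc: "word_eval_mat N A w \<in> carrier_mat N N" "word_eval_mat N B w \<in> carrier_mat N N"
      by (rule word_eval_mat_carrier[OF Ac], rule word_eval_mat_carrier[OF Bc])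
    have "nc_eval_mat N A (wterm w k) - nc_eval_mat N B (wterm w k) =
      k \<cdot>\<^sub>m (word_eval_mat N A w - word_eval_mat N B w)" unfolding nc_eval_mat_single[OF Ac] nc_eval_mat_single[OF Bc]
      by (rule eq_matI) (use wc in \<open>auto simp: right_diff_distrib\<close>)
    then have "norm2 (nc_eval_mat N A (wterm w k) - nc_eval_mat N B (wterm w k)) =
      cmod k * norm2 (word_eval_mat N A w - word_eval_mat N B w)" using norm2_smult[OF minus_carrier_mat[OF wc(2)]] by simp
    also have "\<dots> \<le> cmod k * (real (length (letters w)) * M ^ length (letters w) * d)"
      using word_estimates(2)[OF A B d M w] by (intro mult_left_mono) auto
    also have "\<dots> \<le> cmod k * (real (1 + length (letters w)) * M ^ length (letters w) * d)"
      using M d by (intro mult_left_mono mult_right_mono) auto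
    finally show "norm2 (nc_eval_mat N A (wterm w k) - nc_eval_mat N B (wterm w k)) \<le>
      cmod k * (real (1 + length (letters w)) * M ^ length (letters w) * d)" .
  qed
  then show ?thesis by (simp add: poly_const_def sum_distrib_right mult.assoc)
qed

lemma nc_eval_mat_power:
  assumes A: "\<And>i. A i \<in> carrier_mat N N"
  shows "nc_eval_mat N A (P ^ k) = nc_eval_mat N A P ^\<^sub>m k"
proof (induction k)
  case (Suc k)
  then show ?case by (simp only: power_Suc2 nc_eval_mat_mult[OF A] pow_mat.simps)
qed (simp add: nc_eval_mat_one[OF A] dim_nc_eval_mat[OF A])

lemma mat_law_in_law_space:
  assumes A: "A \<in> I \<rightarrow>\<^sub>E carrier_mat N N" and R: "\<And>i. i \<in> I \<Longrightarrow> mat_norm (A i) \<le> R" "R \<ge> 0" and N: "N > 0"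
  shows "mat_law N I A \<in> law_space R I"
proof -
  define A' where "A' i = (if i \<in> I then A i else 0\<^sub>m N N)" for i
  have A': "A' i \<in> carrier_mat N N" for i using A by (auto simp: A'_def)
  have l: "mat_law N I A P = ntr (nc_eval_mat N A' P)" if "P \<in> nc_polys I" for P
    unfolding mat_law_def using that by (simp add: nc_eval_mat_cong[OF that, of A A'] A'_def)
  note c = nc_eval_mat_carrier[of A', OF A']
  have "0 \<le> mat_law N I A (nc_star P * P)" if P: "P \<in> nc_polys I" for P
    using P by (simp add: l nc_polys_mult nc_polys_star nc_eval_mat_mult[OF A'] nc_eval_mat_star[OF A'] ntr_star_mult[OF c] less_eq_complex_def)
  moreover have "mat_law N I A ((nc_star (nc_var j) * nc_var j) ^ k) \<le> of_real (R ^ (2 * k))" if j: "j \<in> I" for j k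
  proof -
    define H where "H = star_mat (A' j) * A' j"
    have H: "H \<in> carrier_mat N N" "star_mat H = H" using A'[of j] by (simp_all add: H_def star_mat_mult[of _ N N _ N])
    have Hk: "H ^\<^sub>m k \<in> carrier_mat N N" "star_mat (H ^\<^sub>m k) = H ^\<^sub>m k"
    proof -
      show "H ^\<^sub>m k \<in> carrier_mat N N" using H by simp
      have comm: "H * H ^\<^sub>m k = H ^\<^sub>m k * H" for k by (induction k) (use H in \<open>simp_all add: assoc_mult_mat[of _ N N _ N _ N, symmetric]\<close>)
      show "star_mat (H ^\<^sub>m k) = H ^\<^sub>m k" by (induction k) (use H comm in \<open>simp_all add: star_mat_mult[of _ N N _ N]\<close>)
    qed
    have val: "mat_law N I A ((nc_star (nc_var j) * nc_var j) ^ k) = ntr (H ^\<^sub>m k)"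
      using j by (simp add: l nc_polys_power nc_polys_mult nc_polys_star nc_polys_var nc_eval_mat_power[OF A']
        nc_eval_mat_mult[OF A'] nc_eval_mat_star[OF A'] nc_eval_mat_var[OF A'] H_def)
    have "cmod (ntr (H ^\<^sub>m k)) \<le> mat_norm (H ^\<^sub>m k)" by (rule ntr_le_mat_norm[OF Hk(1)])
    also have "\<dots> \<le> mat_norm H ^ k" by (rule mat_norm_power_le[OF H(1)])
    also have "\<dots> \<le> (R * R) ^ k"
    proof (rule power_mono)
      have "mat_norm H \<le> mat_norm (star_mat (A' j)) * mat_norm (A' j)"
        unfolding H_def by (rule mat_norm_mult[of _ N N _ N]) (use A' in auto)
      also have "\<dots> \<le> R * R" unfolding mat_norm_star[OF A'] using R j by (intro mult_mono) (auto simp: A'_def)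
      finally show "mat_norm H \<le> R * R" .
    qed simp
    finally have "Re (ntr (H ^\<^sub>m k)) \<le> R ^ (2 * k)" using complex_Re_le_cmod[of "ntr (H ^\<^sub>m k)"] by (simp add: power_mult power2_eq_square)
    moreover have "Im (ntr (H ^\<^sub>m k)) = 0" using ntr_star[OF Hk(1)] unfolding Hk(2) by (simp add: complex_eq_iff)
    ultimately show ?thesis unfolding val by (simp add: less_eq_complex_def)
  qed
  moreover have "mat_law N I A 1 = 1" using N by (simp add: l nc_eval_mat_one[OF A'] ntr_def)
  moreover have "mat_law N I A (P + Q) = mat_law N I A P + mat_law N I A Q" if "P \<in> nc_polys I" "Q \<in> nc_polys I" for P Q
    using that by (simp add: l nc_polys_add nc_eval_mat_add[OF A'] ntr_add[OF c c])
  moreover have "mat_law N I A (const a * P) = a * mat_law N I A P" if "P \<in> nc_polys I" for P a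
    using that by (simp add: l nc_polys_mult nc_eval_mat_const_mult[OF A'] ntr_smult[OF c])
  moreover have "mat_law N I A (P * Q) = mat_law N I A (Q * P)" if "P \<in> nc_polys I" "Q \<in> nc_polys I" for P Q
    using that by (simp add: l nc_polys_mult nc_eval_mat_mult[OF A'] ntr_mult_commute[OF c c])
  ultimately show ?thesis by (simp add: law_space_def mat_law_def)
qed

section \<open>Tracial functionals\<close>

text \<open>The hypothesis is the positivity of a sesquilinear form at \<open>x + c y\<close>, with \<open>\<alpha>\<close>, \<open>\<beta>\<close>, \<open>\<gamma>\<close>, \<open>\<delta>\<close> its values at the pairs of
  \<open>x\<close> and \<open>y\<close>.\<close>

lemma cauchy_schwarz_numeric:
  assumes "\<And>c::complex. 0 \<le> \<alpha> + c * \<beta> + cnj c * \<gamma> + (c * cnj c) * \<delta>" and d: "0 \<le> \<delta>"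
  shows "\<gamma> = cnj \<beta>" "(cmod \<beta>)\<^sup>2 \<le> Re \<alpha> * Re \<delta>"
proof -
  have a: "0 \<le> \<alpha>" using assms(1)[of 0] by simp
  have 1: "Im (\<beta> + \<gamma>) = 0" using assms(1)[of 1] a d by (simp add: less_eq_complex_def)
  have 2: "Re \<beta> = Re \<gamma>" using assms(1)[of \<i>] a d by (simp add: less_eq_complex_def)
  show g: "\<gamma> = cnj \<beta>" using 1 2 by (simp add: complex_eq_iff)
  have q: "0 \<le> Re \<alpha> - 2 * t * (cmod \<beta>)\<^sup>2 + t\<^sup>2 * (cmod \<beta>)\<^sup>2 * Re \<delta>" for t :: real
  proof -
    have "0 \<le> \<alpha> + (- of_real t * cnj \<beta>) * \<beta> + cnj (- of_real t * cnj \<beta>) * \<gamma>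
       + ((- of_real t * cnj \<beta>) * cnj (- of_real t * cnj \<beta>)) * \<delta>" by (rule assms(1))
    also have "\<dots> = \<alpha> - 2 * of_real t * (\<beta> * cnj \<beta>) + (of_real t)\<^sup>2 * (\<beta> * cnj \<beta>) * \<delta>"
      unfolding g by (simp add: power2_eq_square algebra_simps)
    also have "\<beta> * cnj \<beta> = of_real ((cmod \<beta>)\<^sup>2)" by (simp add: complex_norm_square del: of_real_power)
    finally show ?thesis by (simp add: less_eq_complex_def flip: of_real_power)
  qed
  have d': "Re \<delta> \<ge> 0" using d by (simp add: less_eq_complex_def)
  show "(cmod \<beta>)\<^sup>2 \<le> Re \<alpha> * Re \<delta>"
  proof (cases "Re \<delta> = 0")
    case True
    have "(cmod \<beta>)\<^sup>2 = 0"
    proof (rule ccontr)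
      assume "(cmod \<beta>)\<^sup>2 \<noteq> 0"
      then have "2 * ((Re \<alpha> + 1) / (cmod \<beta>)\<^sup>2) * (cmod \<beta>)\<^sup>2 = 2 * (Re \<alpha> + 1)" by simp
      then show False using q[of "(Re \<alpha> + 1) / (cmod \<beta>)\<^sup>2"] True a by (simp add: less_eq_complex_def)
    qed
    then show ?thesis by (simp add: True)
  next
    case False
    then have "Re \<delta> > 0" using d' by simp
    then show ?thesis using q[of "1 / Re \<delta>"] by (simp add: field_simps power2_eq_square)
  qed
qed

text \<open>This structure is shared by the polynomials and, for each size, the matrices of polynomials; the latter do not form a
  type.\<close>

locale trace_algebra =
  fixes A :: "'x set" and mu :: "'x \<Rightarrow> 'x \<Rightarrow> 'x" (infixl \<open>\<cdot>\<close> 70) and st :: "'x \<Rightarrow> 'x"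
    and ph :: "'x \<Rightarrow> complex" and on :: 'x
  assumes mu_closed [simp]: "x \<in> A \<Longrightarrow> y \<in> A \<Longrightarrow> x \<cdot> y \<in> A"
    and st_closed [simp]: "x \<in> A \<Longrightarrow> st x \<in> A" and on_closed [simp]: "on \<in> A"
    and mu_assoc: "x \<in> A \<Longrightarrow> y \<in> A \<Longrightarrow> z \<in> A \<Longrightarrow> (x \<cdot> y) \<cdot> z = x \<cdot> (y \<cdot> z)"
    and st_mu: "x \<in> A \<Longrightarrow> y \<in> A \<Longrightarrow> st (x \<cdot> y) = st y \<cdot> st x"
    and st_st [simp]: "x \<in> A \<Longrightarrow> st (st x) = x" and st_on [simp]: "st on = on"
    and on_left [simp]: "x \<in> A \<Longrightarrow> on \<cdot> x = x" and on_right [simp]: "x \<in> A \<Longrightarrow> x \<cdot> on = x"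
    and ph_pos: "x \<in> A \<Longrightarrow> 0 \<le> Re (ph (st x \<cdot> x))"
    and ph_cs: "x \<in> A \<Longrightarrow> y \<in> A \<Longrightarrow> (cmod (ph (st x \<cdot> y)))\<^sup>2 \<le> Re (ph (st x \<cdot> x)) * Re (ph (st y \<cdot> y))"
    and ph_tr: "x \<in> A \<Longrightarrow> y \<in> A \<Longrightarrow> ph (x \<cdot> y) = ph (y \<cdot> x)"
begin

primrec pw :: "'x \<Rightarrow> nat \<Rightarrow> 'x" where
  "pw x 0 = on" | "pw x (Suc k) = pw x k \<cdot> x"

lemma pw_closed [simp]: "x \<in> A \<Longrightarrow> pw x k \<in> A" by (induction k) auto

lemma pw_add: "x \<in> A \<Longrightarrow> pw x (j + k) = pw x j \<cdot> pw x k" by (induction k) (auto simp: mu_assoc)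

lemma st_pw: assumes "x \<in> A" "st x = x" shows "st (pw x k) = pw x k"
proof (induction k)
  case (Suc k)
  then have "st (pw x (Suc k)) = x \<cdot> pw x k" using assms by (simp add: st_mu)
  also have "\<dots> = pw x (1 + k)" using assms pw_add[of x 1 k] by simp
  finally show ?case by simp
qed simp

text \<open>If the moments of \<open>x\<^sup>*x\<close> grow at most like \<open>\<rho>\<^sup>k\<close>, then left multiplication by \<open>x\<close> has norm
  at most \<open>\<rho>\<^sup>1\<^sup>/\<^sup>2\<close> on the Hilbert space of \<open>ph\<close>. The Cauchy--Schwarz inequality gives \<open>(a k)\<^sup>2 \<le> a 0 * a (2k)\<close> for
  \<open>a k = ph (u\<^sup>*(x\<^sup>*x)\<^sup>k u)\<close>. Iterated, this bounds \<open>a 1 / a 0\<close> by roots of \<open>a (2\<^sup>n) / a 0\<close>, and traciality bounds \<open>a k\<close> by a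
  multiple of \<open>\<rho>\<^sup>k\<close>; the factor disappears under the roots.\<close>

lemma left_mult_bound_of_moments:
  assumes x: "x \<in> A" and \<rho>: "\<rho> \<ge> 0" and mom: "\<And>k. Re (ph (pw (st x \<cdot> x) k)) \<le> C * \<rho> ^ k" and u: "u \<in> A"
  shows "Re (ph (st (x \<cdot> u) \<cdot> (x \<cdot> u))) \<le> \<rho> * Re (ph (st u \<cdot> u))"
proof -
  define H where "H = st x \<cdot> x"
  have H: "H \<in> A" "st H = H" using x by (auto simp: H_def st_mu)
  define a where "a k = Re (ph (st u \<cdot> (pw H k \<cdot> u)))" for k
  have nrm: "a (k + k) = Re (ph (st (pw H k \<cdot> u) \<cdot> (pw H k \<cdot> u)))" for k using u H by (simp add: a_def st_mu st_pw pw_add mu_assoc)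
  have step: "(a k)\<^sup>2 \<le> a 0 * a (k + k)" for k
  proof -
    have "(a k)\<^sup>2 \<le> (cmod (ph (st u \<cdot> (pw H k \<cdot> u))))\<^sup>2" unfolding a_def by (simp only: cmod_power2 le_add_same_cancel1 zero_le_power2)
    also have "\<dots> \<le> Re (ph (st u \<cdot> u)) * Re (ph (st (pw H k \<cdot> u) \<cdot> (pw H k \<cdot> u)))" by (rule ph_cs) (use u H in auto)
    finally show ?thesis unfolding nrm using u by (simp add: a_def)
  qed
  define D where "D = Re (ph (st (u \<cdot> st u) \<cdot> (u \<cdot> st u)))"
  have D: "D \<ge> 0" unfolding D_def by (rule ph_pos) (use u in auto)
  have "C * \<rho> ^ 0 \<ge> Re (ph (pw (st x \<cdot> x) 0))" by (rule mom)
  moreover have "Re (ph (pw (st x \<cdot> x) 0)) \<ge> 0" using ph_pos[of on] by simp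
  ultimately have C: "C \<ge> 0" by simp
  have bound: "a k \<le> sqrt (C * D) * \<rho> ^ k" for k
  proof -
    have "ph (st u \<cdot> (pw H k \<cdot> u)) = ph ((pw H k \<cdot> u) \<cdot> st u)" by (rule ph_tr) (use u H in auto)
    also have "\<dots> = ph (st (pw H k) \<cdot> (u \<cdot> st u))" using u H by (simp add: mu_assoc st_pw)
    finally have "(cmod (ph (st u \<cdot> (pw H k \<cdot> u))))\<^sup>2 \<le> Re (ph (st (pw H k) \<cdot> pw H k)) * D"
      unfolding D_def using ph_cs[of "pw H k" "u \<cdot> st u"] u H by simp
    also have "st (pw H k) \<cdot> pw H k = pw H (k + k)" using H by (simp add: st_pw pw_add)
    also have "Re (ph (pw H (k + k))) * D \<le> C * \<rho> ^ (k + k) * D" unfolding H_def using D by (intro mult_right_mono mom)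
    finally have "(cmod (ph (st u \<cdot> (pw H k \<cdot> u))))\<^sup>2 \<le> (C * D) * (\<rho> ^ k)\<^sup>2" by (simp add: power_add power2_eq_square mult_ac)
    then have "sqrt ((cmod (ph (st u \<cdot> (pw H k \<cdot> u))))\<^sup>2) \<le> sqrt ((C * D) * (\<rho> ^ k)\<^sup>2)" by (rule real_sqrt_le_mono)
    then have "cmod (ph (st u \<cdot> (pw H k \<cdot> u))) \<le> sqrt (C * D) * \<rho> ^ k" using \<rho> by (simp add: real_sqrt_mult)
    then show ?thesis using complex_Re_le_cmod order_trans unfolding a_def by blast
  qed
  have a0: "a 0 \<ge> 0" using ph_pos[OF u] u by (simp add: a_def)
  have a1: "a 1 \<ge> 0"
  proof -
    have "a 1 = Re (ph (st (x \<cdot> u) \<cdot> (x \<cdot> u)))" using x u H by (simp add: a_def H_def st_mu mu_assoc)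
    then show ?thesis using ph_pos[of "x \<cdot> u"] x u by simp
  qed
  have "a 1 \<le> \<rho> * a 0"
  proof (cases "a 0 = 0")
    case True
    then show ?thesis using step[of 1] by simp
  next
    case False
    then have a00: "a 0 > 0" using a0 by simp
    have nn: "a (2 ^ n) \<ge> 0" for n using a1 nrm[of "2 ^ (n - 1)"] ph_pos[of "pw H (2 ^ (n - 1)) \<cdot> u"] H u by (cases n) (auto simp: mult_2)
    have "(a 1 / a 0) ^ (2 ^ n) \<le> a (2 ^ n) / a 0" for n
    proof (induction n)
      case (Suc n)
      have "(a 1 / a 0) ^ (2 ^ Suc n) = ((a 1 / a 0) ^ (2 ^ n))\<^sup>2" by (simp flip: power_mult add: mult.commute)
      also have "\<dots> \<le> (a (2 ^ n) / a 0)\<^sup>2" using Suc a1 a00 by (intro power_mono) auto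
      also have "\<dots> = (a (2 ^ n))\<^sup>2 / a 0 / a 0" by (simp add: power2_eq_square)
      also have "\<dots> \<le> (a 0 * a (2 ^ n + 2 ^ n)) / a 0 / a 0" using a00 step[of "2 ^ n"] by (intro divide_right_mono) auto
      finally show ?case using a00 by (simp add: mult_2)
    qed simp
    note pwr = this
    have pwr': "(a 1 / a 0) ^ (2 ^ n) \<le> (sqrt (C * D) / a 0) * \<rho> ^ (2 ^ n)" for n
    proof -
      have "a (2 ^ n) / a 0 \<le> sqrt (C * D) * \<rho> ^ (2 ^ n) / a 0" using a00 by (intro divide_right_mono bound) simp
      then show ?thesis using pwr[of n] by simp
    qed
    have "0 \<le> a 1 / a 0" using a1 a0 by simp
    then have "a 1 / a 0 \<le> \<rho>" by (rule le_of_double_powers[OF _ \<rho> pwr'])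
    then show ?thesis using a00 by (simp add: field_simps)
  qed
  then show ?thesis using x u H by (simp add: a_def H_def st_mu mu_assoc)
qed

text \<open>For \<open>H = x\<^sup>*x\<close> and \<open>u = H\<^sup>j\<close> the hypothesis compares the moments \<open>2j\<close> and \<open>2j + 1\<close> of \<open>H\<close>; for \<open>u = H\<^sup>j x\<^sup>*\<close> and by
  traciality, it compares \<open>2j + 1\<close> and \<open>2j + 2\<close>.\<close>

lemma moments_of_left_mult_bound:
  assumes x: "x \<in> A" and \<rho>: "\<rho> \<ge> 0"
    and bnd: "\<And>u. u \<in> A \<Longrightarrow> Re (ph (st (x \<cdot> u) \<cdot> (x \<cdot> u))) \<le> \<rho> * Re (ph (st u \<cdot> u))"
  shows "Re (ph (pw (st x \<cdot> x) k)) \<le> \<rho> ^ k * Re (ph on)"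
proof -
  define H where "H = st x \<cdot> x"
  have H: "H \<in> A" "st H = H" using x by (auto simp: H_def st_mu)
  have Suc': "pw H (Suc k) = H \<cdot> pw H k" for k using pw_add[OF H(1), of 1 k] H by simp
  have even: "Re (ph (pw H (j + j + 1))) \<le> \<rho> * Re (ph (pw H (j + j)))" for j
  proof -
    have "st (x \<cdot> pw H j) \<cdot> (x \<cdot> pw H j) = pw H j \<cdot> (H \<cdot> pw H j)"
      using x H by (simp add: st_mu st_pw H_def[symmetric] mu_assoc) (simp add: H_def mu_assoc)
    also have "\<dots> = pw H (j + j + 1)" using H by (simp only: Suc'[symmetric] pw_add[symmetric]) simp
    finally show ?thesis using bnd[of "pw H j"] H by (simp add: st_pw pw_add)
  qed
  have odd: "Re (ph (pw H (j + j + 2))) \<le> \<rho> * Re (ph (pw H (j + j + 1)))" for j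
  proof -
    define u where "u = pw H j \<cdot> st x"
    have u: "u \<in> A" "st u = x \<cdot> pw H j" using x H by (auto simp: u_def st_mu st_pw)
    have "st u \<cdot> u = x \<cdot> (pw H (j + j) \<cdot> st x)" using x H by (simp add: u(2)) (simp add: u_def mu_assoc pw_add)
    then have "ph (st u \<cdot> u) = ph ((pw H (j + j) \<cdot> st x) \<cdot> x)" using x H ph_tr[of x "pw H (j + j) \<cdot> st x"] by simp
    also have "(pw H (j + j) \<cdot> st x) \<cdot> x = pw H (j + j + 1)" using x H by (simp add: mu_assoc) (simp add: H_def)
    finally have 1: "ph (st u \<cdot> u) = ph (pw H (j + j + 1))" .
    have "st (x \<cdot> u) \<cdot> (x \<cdot> u) = st u \<cdot> (H \<cdot> u)" using x u(1) by (simp add: st_mu mu_assoc H_def)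
    also have "\<dots> = x \<cdot> ((pw H j \<cdot> (H \<cdot> pw H j)) \<cdot> st x)" unfolding u(2) using x H by (simp add: u_def mu_assoc)
    also have "pw H j \<cdot> (H \<cdot> pw H j) = pw H (j + j + 1)" using H by (simp only: Suc'[symmetric] pw_add[symmetric]) simp
    finally have "ph (st (x \<cdot> u) \<cdot> (x \<cdot> u)) = ph ((pw H (j + j + 1) \<cdot> st x) \<cdot> x)"
      using x H ph_tr[of x "pw H (j + j + 1) \<cdot> st x"] by (simp del: pw.simps add: pw_closed)
    also have "(pw H (j + j + 1) \<cdot> st x) \<cdot> x = pw H (j + j + 2)"
      using x pw_closed[OF H(1), of "j + j + 1"] by (simp add: mu_assoc del: pw.simps) (simp add: H_def mu_assoc)
    finally show ?thesis using bnd[OF u(1)] 1 by simp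
  qed
  have "Re (ph (pw H (Suc k))) \<le> \<rho> * Re (ph (pw H k))" for k
  proof (cases "even k")
    case True
    then obtain j where "k = j + j" by (metis evenE mult_2)
    then show ?thesis using even[of j] by simp
  next
    case False
    then obtain j where "k = j + j + 1" by (metis oddE mult_2)
    then show ?thesis using odd[of j] by simp
  qed
  note st = this
  have "Re (ph (pw H k)) \<le> \<rho> ^ k * Re (ph on)"
  proof (induction k)
    case (Suc k)
    have "\<rho> * Re (ph (pw H k)) \<le> \<rho> * (\<rho> ^ k * Re (ph on))" using Suc \<rho> by (rule mult_left_mono)
    then show ?case using st[of k] by simp
  qed simp
  then show ?thesis by (simp add: H_def)
qed

end

definition pstar :: "'i nc_poly mat \<Rightarrow> 'i nc_poly mat" where
  "pstar X = Matrix.mat (dim_col X) (dim_row X) (\<lambda>(i,j). nc_star (X $$ (j,i)))"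

lemma pstar_carrier [simp]: "X \<in> carrier_mat m n \<Longrightarrow> pstar X \<in> carrier_mat n m" by (auto simp: pstar_def)
lemma dim_pstar [simp]: "dim_row (pstar X) = dim_col X" "dim_col (pstar X) = dim_row X" by (simp_all add: pstar_def)
lemma index_pstar [simp]: "i < dim_col X \<Longrightarrow> j < dim_row X \<Longrightarrow> pstar X $$ (i,j) = nc_star (X $$ (j,i))" by (simp add: pstar_def)

lemma pstar_mult:
  assumes "X \<in> carrier_mat m n" "Y \<in> carrier_mat n k"
  shows "pstar (X * Y) = pstar Y * pstar X" by (rule eq_matI)
    (use assms in \<open>auto simp: index_mult_mat_sum nc_star_sum nc_star_mult intro!: sum.cong\<close>)

locale tracial_functional =
  fixes l :: "'i nc_poly \<Rightarrow> complex"
  assumes add: "l (P + Q) = l P + l Q" and scale: "l (const c * P) = c * l P"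
    and pos: "0 \<le> l (nc_star P * P)" and one: "l 1 = 1" and tr: "l (P * Q) = l (Q * P)"
begin

lemma zero [simp]: "l 0 = 0" using add[of 0 0] by simp
lemma minus: "l (- P) = - l P" using add[of P "- P"] by (simp add: eq_neg_iff_add_eq_0 add.commute)
lemma diff: "l (P - Q) = l P - l Q" using add[of P "- Q"] by (simp add: minus)
lemma sum: "l (sum f S) = (\<Sum>x\<in>S. l (f x))" by (induction S rule: infinite_finite_induct) (simp_all add: add)

lemma expand_square:
  "l (nc_star (P + const c * Q) * (P + const c * Q)) =
   l (nc_star P * P) + c * l (nc_star P * Q) + cnj c * l (nc_star Q * P) + (c * cnj c) * l (nc_star Q * Q)"
proof -
  have "nc_star (P + const c * Q) * (P + const c * Q) = nc_star P * P + (nc_star P * const c) * Q +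
     const (cnj c) * (nc_star Q * P) + const (cnj c) * ((nc_star Q * const c) * Q)"
    by (simp only: nc_star_add nc_star_const_mult distrib_left distrib_right mult.assoc ac_simps(1-3))
  also have "\<dots> = nc_star P * P + const c * (nc_star P * Q) + const (cnj c) * (nc_star Q * P)
     + const (cnj c) * (const c * (nc_star Q * Q))" by (simp only: const_commute[symmetric] mult.assoc)
  finally show ?thesis by (simp only: add scale) (simp add: algebra_simps)
qed

lemma sesqui: "l (nc_star Q * P) = cnj (l (nc_star P * Q))"
  and cs: "(cmod (l (nc_star P * Q)))\<^sup>2 \<le> Re (l (nc_star P * P)) * Re (l (nc_star Q * Q))"
proof -
  have 1: "0 \<le> l (nc_star P * P) + c * l (nc_star P * Q) + cnj c * l (nc_star Q * P) + (c * cnj c) * l (nc_star Q * Q)" for c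
    using pos[of "P + const c * Q"] unfolding expand_square .
  show "l (nc_star Q * P) = cnj (l (nc_star P * Q))" by (rule cauchy_schwarz_numeric(1)[OF 1 pos])
  show "(cmod (l (nc_star P * Q)))\<^sup>2 \<le> Re (l (nc_star P * P)) * Re (l (nc_star Q * Q))" by (rule cauchy_schwarz_numeric(2)[OF 1 pos])
qed

lemma star: "l (nc_star P) = cnj (l P)" using sesqui[of P 1] by simp

lemma re_pos: "0 \<le> Re (l (nc_star P * P))" using pos[of P] by (simp add: less_eq_complex_def)

sublocale alg: trace_algebra UNIV "(*)" nc_star l 1 by unfold_locales (use re_pos cs tr in \<open>auto simp: mult.assoc nc_star_mult\<close>)

lemma alg_pw: "alg.pw P k = P ^ k" by (induction k) (simp_all add: power_commutes)

text \<open>The trace of \<open>M\<^sub>m\<close>, without normalization, composed with \<open>l\<close>.\<close>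

definition ptr :: "'i nc_poly mat \<Rightarrow> complex" where
  "ptr X = (\<Sum>i<dim_row X. l (X $$ (i,i)))"

lemma ptr_mult:
  assumes "X \<in> carrier_mat m n" "Y \<in> carrier_mat n m"
  shows "ptr (X * Y) = (\<Sum>i<m. \<Sum>j<n. l (X $$ (i,j) * Y $$ (j,i)))" using assms by (simp add: ptr_def index_mult_mat_sum sum)

lemma ptr_commute:
  assumes "X \<in> carrier_mat m n" "Y \<in> carrier_mat n m"
  shows "ptr (X * Y) = ptr (Y * X)" unfolding ptr_mult[OF assms] ptr_mult[OF assms(2,1)] by (subst sum.swap) (simp add: tr)

lemma ptr_star_mult:
  assumes "X \<in> carrier_mat m n" "Y \<in> carrier_mat m n"
  shows "ptr (pstar X * Y) = (\<Sum>j<n. \<Sum>i<m. l (nc_star (X $$ (i,j)) * Y $$ (i,j)))" using assms by (subst ptr_mult[of _ n m]) auto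

lemma trace_algebra_mat: "trace_algebra (carrier_mat m m) (*) pstar ptr (1\<^sub>m m)"
proof unfold_locales
  fix X Y :: "'i nc_poly mat" assume X: "X \<in> carrier_mat m m" and Y: "Y \<in> carrier_mat m m"
  let ?f = "\<lambda>X Y. (\<Sum>j<m. \<Sum>i<m. l (nc_star (X $$ (i,j)) * Y $$ (i,j)))"
  have "0 \<le> ?f X X + c * ?f X Y + cnj c * ?f Y X + (c * cnj c) * ?f Y Y" for c
  proof -
    have "0 \<le> (\<Sum>j<m. \<Sum>i<m. l (nc_star (X $$ (i,j) + const c * Y $$ (i,j)) * (X $$ (i,j) + const c * Y $$ (i,j))))" by (intro sum_nonneg pos)
    also have "\<dots> = ?f X X + c * ?f X Y + cnj c * ?f Y X + (c * cnj c) * ?f Y Y"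
      unfolding expand_square by (simp add: sum.distrib sum_distrib_left)
    finally show ?thesis .
  qed
  moreover have "0 \<le> ?f Y Y" by (intro sum_nonneg pos)
  ultimately have "(cmod (?f X Y))\<^sup>2 \<le> Re (?f X X) * Re (?f Y Y)" by (rule cauchy_schwarz_numeric(2))
  then show "(cmod (ptr (pstar X * Y)))\<^sup>2 \<le> Re (ptr (pstar X * X)) * Re (ptr (pstar Y * Y))"
    using X Y by (simp add: ptr_star_mult[of _ m m])
next
  fix X :: "'i nc_poly mat" assume X: "X \<in> carrier_mat m m"
  have "0 \<le> (\<Sum>j<m. \<Sum>i<m. l (nc_star (X $$ (i,j)) * X $$ (i,j)))" by (intro sum_nonneg pos)
  then show "0 \<le> Re (ptr (pstar X * X))" using X by (simp add: ptr_star_mult[of _ m m] less_eq_complex_def)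
qed (auto intro: ptr_commute pstar_mult eq_matI simp: pstar_mult[of _ m m] assoc_mult_mat[of _ m m _ m _ m] ptr_commute[of _ m m])

lemma mat_pw: "(X :: 'i nc_poly mat) \<in> carrier_mat m m \<Longrightarrow> trace_algebra.pw (*) (1\<^sub>m m) X k = X ^\<^sub>m k"
proof -
  interpret T: trace_algebra "carrier_mat m m" "(*)" pstar ptr "1\<^sub>m m" by (rule trace_algebra_mat)
  show "(X :: 'i nc_poly mat) \<in> carrier_mat m m \<Longrightarrow> trace_algebra.pw (*) (1\<^sub>m m) X k = X ^\<^sub>m k" by (induction k) auto
qed

lemma ptr_one: "ptr (1\<^sub>m m) = of_nat m" by (simp add: ptr_def one)

lemma mat_bound_of_moments:
  assumes "X \<in> carrier_mat m m" "\<rho> \<ge> 0" "\<And>k. Re (ptr ((pstar X * X) ^\<^sub>m k)) \<le> C * \<rho> ^ k" "U \<in> carrier_mat m m"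
  shows "Re (ptr (pstar (X * U) * (X * U))) \<le> \<rho> * Re (ptr (pstar U * U))"
proof -
  interpret T: trace_algebra "carrier_mat m m" "(*)" pstar ptr "1\<^sub>m m" by (rule trace_algebra_mat)
  have "pstar X * X \<in> carrier_mat m m" using assms(1) by simp
  from T.left_mult_bound_of_moments[OF assms(1,2) _ assms(4), of C] mat_pw[OF this] assms(3)
  show ?thesis by simp
qed

lemma mat_moments_of_bound:
  assumes "X \<in> carrier_mat m m" "\<rho> \<ge> 0"
    "\<And>U. U \<in> carrier_mat m m \<Longrightarrow> Re (ptr (pstar (X * U) * (X * U))) \<le> \<rho> * Re (ptr (pstar U * U))"
  shows "Re (ptr ((pstar X * X) ^\<^sub>m k)) \<le> \<rho> ^ k * m"
proof -
  interpret T: trace_algebra "carrier_mat m m" "(*)" pstar ptr "1\<^sub>m m" by (rule trace_algebra_mat)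
  have "pstar X * X \<in> carrier_mat m m" using assms(1) by simp
  from T.moments_of_left_mult_bound[OF assms, of k] mat_pw[OF this] show ?thesis by (simp add: ptr_one)
qed

lemma bound_of_moments:
  assumes "\<rho> \<ge> 0" "\<And>k. Re (l ((nc_star P * P) ^ k)) \<le> C * \<rho> ^ k"
  shows "Re (l (nc_star (P * Q) * (P * Q))) \<le> \<rho> * Re (l (nc_star Q * Q))"
  by (rule alg.left_mult_bound_of_moments[of P \<rho> C Q]) (use assms in \<open>auto simp: alg_pw\<close>)

end

section \<open>Laws as tracial functionals\<close>

text \<open>Setting the variables outside \<open>I\<close> to \<open>0\<close> extends a law to a tracial functional on all polynomials.\<close>

definition restrict_vars :: "'i set \<Rightarrow> 'i \<Rightarrow> 'i nc_poly" where
  "restrict_vars I i = (if i \<in> I then nc_var i else 0)"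

lemma restrict_vars_in [simp]: "nc_subst (restrict_vars I) P \<in> nc_polys I"
  by (rule nc_polys_subst[of _ UNIV]) (auto simp: restrict_vars_def nc_polys_var)

lemma restrict_vars_id: "P \<in> nc_polys I \<Longrightarrow> nc_subst (restrict_vars I) P = P" by (rule nc_subst_ident) (auto simp: restrict_vars_def)

lemma law_space_extend:
  assumes "l \<in> law_space R I"
  shows "tracial_functional (\<lambda>P. l (nc_subst (restrict_vars I) P))"
proof unfold_locales
  let ?r = "nc_subst (restrict_vars I)"
  fix P Q :: "'a nc_poly" and c :: complex
  show "l (?r (P + Q)) = l (?r P) + l (?r Q)" using assms by (simp add: law_space_def nc_subst_add)
  show "l (?r (const c * P)) = c * l (?r P)" using assms by (simp add: law_space_def nc_subst_mult)
  show "0 \<le> l (?r (nc_star P * P))" using assms by (simp add: law_space_def nc_subst_mult nc_subst_star)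
  show "l (?r 1) = 1" using assms by (simp add: law_space_def)
  show "l (?r (P * Q)) = l (?r (Q * P))" using assms by (simp add: law_space_def nc_subst_mult)
qed

text \<open>Every letter acts from the left with norm at most \<open>R\<close>: the variables by \<open>bound_of_moments\<close>, and their adjoints since by
  traciality they have the same moments.\<close>

lemma law_bound:
  assumes l: "l \<in> law_space R I" and R: "R \<ge> 0" and P: "P \<in> nc_polys I"
  shows "cmod (l P) \<le> (\<Sum>w\<in>words P. cmod (wcoeff P w) * R ^ length (letters w))"
proof -
  let ?r = "nc_subst (restrict_vars I)"
  define l' where "l' = (\<lambda>P. l (?r P))"
  interpret tracial_functional l' unfolding l'_def by (rule law_space_extend[OF l])
  define x where "x i b = wterm (Word [(i,b)]) (1::complex)" for i :: 'a and b
  have sx: "nc_star (x i b) = x i (\<not> b)" for i b by (simp add: x_def nc_star_single word_star_def)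
  have xv: "x i False = nc_var i" for i by (simp add: x_def nc_var_def)
  have mom: "Re (l' ((nc_star (x i b) * x i b) ^ k)) \<le> 1 * (R\<^sup>2) ^ k" if i: "i \<in> I" for i b k
  proof -
    have "l' ((nc_star (nc_var i) * nc_var i) ^ k) \<le> of_real (R ^ (2 * k))"
      using l i by (simp add: l'_def law_space_def restrict_vars_id nc_polys_power nc_polys_mult nc_polys_star nc_polys_var)
    then have 1: "Re (l' ((nc_star (x i False) * x i False) ^ k)) \<le> (R\<^sup>2) ^ k" by (simp add: xv less_eq_complex_def power_mult)
    have 2: "l' ((nc_star (x i True) * x i True) ^ k) = l' ((nc_star (x i False) * x i False) ^ k)"
    proof (cases k)
      case (Suc j)
      have *: "(y * z) ^ Suc j = y * ((z * y) ^ j * z)" for y z :: "'a nc_poly"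
        by (induction j) (simp_all only: power_0 power_Suc mult_1_left mult_1_right mult.assoc)
      have "l' ((x i False * x i True) ^ Suc j) = l' (((x i True * x i False) ^ j * x i True) * x i False)" unfolding * by (rule tr)
      also have "((x i True * x i False) ^ j * x i True) * x i False = (x i True * x i False) ^ Suc j" by (simp only: power_Suc2 mult.assoc)
      finally show ?thesis by (simp add: sx Suc)
    qed simp
    show ?thesis using 1 2 by (cases b) auto
  qed
  have w: "Re (l' (nc_star (wterm (Word w) 1) * wterm (Word w) 1)) \<le> (R\<^sup>2) ^ length w"
    if "fst ` set w \<subseteq> I" for w using that
  proof (induction w)
    case Nil then show ?case by (simp add: one flip: zero_nc_word_def)
  next
    case (Cons a w)
    obtain i b where a: "a = (i,b)" by force
    have i: "i \<in> I" using Cons.prems a by auto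
    have s: "wterm (Word (a # w)) 1 = x i b * wterm (Word w) 1" by (simp add: x_def mult_single plus_nc_word_def a)
    have "Re (l' (nc_star (x i b * wterm (Word w) 1) * (x i b * wterm (Word w) 1)))
      \<le> R\<^sup>2 * Re (l' (nc_star (wterm (Word w) 1) * wterm (Word w) 1))" by (rule bound_of_moments[OF _ mom[OF i]]) simp
    also have "\<dots> \<le> R\<^sup>2 * (R\<^sup>2) ^ length w" using Cons by (intro mult_left_mono) auto
    finally show ?case by (simp add: s)
  qed
  have word: "cmod (l' (wterm v 1)) \<le> R ^ length (letters v)" if "fst ` set (letters v) \<subseteq> I" for v
  proof -
    obtain w where v: "v = Word w" by (cases v)
    have "(cmod (l' (nc_star 1 * wterm v 1)))\<^sup>2 \<le>
        Re (l' (nc_star 1 * 1)) * Re (l' (nc_star (wterm v 1) * wterm v 1))" by (rule cs)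
    also have "\<dots> \<le> 1 * (R\<^sup>2) ^ length w" using w[of w] that unfolding v by (simp add: one)
    also have "1 * (R\<^sup>2) ^ length w = (R ^ length w)\<^sup>2" by (simp flip: power_mult add: mult.commute)
    finally have "(cmod (l' (wterm v 1)))\<^sup>2 \<le> (R ^ length w)\<^sup>2" by simp
    then have "cmod (l' (wterm v 1)) \<le> R ^ length w" by (rule power2_le_imp_le) (use R in simp)
    then show ?thesis by (simp add: v)
  qed
  have "l P = l' (\<Sum>w\<in>words P. const (wcoeff P w) * wterm w 1)"
    using P poly_sum_singles[of P] by (simp add: l'_def restrict_vars_id const_mult_single)
  also have "\<dots> = (\<Sum>w\<in>words P. wcoeff P w * l' (wterm w 1))" by (simp only: sum scale)
  finally have "cmod (l P) \<le> (\<Sum>w\<in>words P. cmod (wcoeff P w * l' (wterm w 1)))" by (simp add: norm_sum)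
  also have "\<dots> \<le> (\<Sum>w\<in>words P. cmod (wcoeff P w) * R ^ length (letters w))"
    using P by (intro sum_mono) (auto simp: norm_mult nc_polys_def intro!: mult_left_mono word)
  finally show ?thesis .
qed

section \<open>The GNS construction\<close>

context tracial_functional
begin

text \<open>The seminorm of the GNS Hilbert space.\<close>

definition sn :: "'i nc_poly \<Rightarrow> real" where "sn P = sqrt (Re (l (nc_star P * P)))"

lemma sn_nonneg [simp]: "0 \<le> sn P" by (simp add: sn_def re_pos)
lemma sn_square: "(sn P)\<^sup>2 = Re (l (nc_star P * P))" by (simp add: sn_def re_pos)
lemma l_square: "l (nc_star P * P) = of_real ((sn P)\<^sup>2)" using pos[of P] by (simp add: sn_square less_eq_complex_def complex_eq_iff)

lemma cs_sn: "cmod (l (nc_star P * Q)) \<le> sn P * sn Q"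
proof -
  have "sqrt ((cmod (l (nc_star P * Q)))\<^sup>2) \<le> sqrt (Re (l (nc_star P * P)) * Re (l (nc_star Q * Q)))" by (intro real_sqrt_le_mono cs)
  then show ?thesis by (simp add: sn_def real_sqrt_mult)
qed

lemma sn_const: "sn (const c * P) = cmod c * sn P"
proof -
  have "nc_star (const c * P) * (const c * P) = const (cnj c) * ((nc_star P * const c) * P)" by (simp only: nc_star_const_mult mult.assoc)
  also have "\<dots> = const (cnj c) * (const c * (nc_star P * P))" by (simp only: const_commute[symmetric] mult.assoc)
  finally have "l (nc_star (const c * P) * (const c * P)) = of_real ((cmod c)\<^sup>2) * l (nc_star P * P)"
    by (simp add: scale complex_norm_square mult.commute del: of_real_power)
  then show ?thesis by (simp add: sn_def real_sqrt_mult)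
qed

lemma sn_triangle: "sn (P + Q) \<le> sn P + sn Q"
proof (rule power2_le_imp_le)
  have "l (nc_star (P + Q) * (P + Q)) = l (nc_star P * P) + l (nc_star P * Q) + l (nc_star Q * P) + l (nc_star Q * Q)"
    by (simp add: nc_star_add distrib_left distrib_right add)
  then have "(sn (P + Q))\<^sup>2 = (sn P)\<^sup>2 + Re (l (nc_star P * Q)) + Re (l (nc_star Q * P)) + (sn Q)\<^sup>2" by (simp add: sn_square)
  also have "Re (l (nc_star P * Q)) \<le> sn P * sn Q" using cs_sn complex_Re_le_cmod order_trans by blast
  also have "Re (l (nc_star Q * P)) \<le> sn Q * sn P" using cs_sn complex_Re_le_cmod order_trans by blast
  finally show "(sn (P + Q))\<^sup>2 \<le> (sn P + sn Q)\<^sup>2" by (simp add: power2_sum)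
qed simp

lemma sn_zero [simp]: "sn 0 = 0" by (simp add: sn_def)
lemma sn_minus: "sn (- P) = sn P" by (simp add: sn_def nc_star_minus)
lemma sn_minus_commute: "sn (P - Q) = sn (Q - P)" using sn_minus[of "P - Q"] by simp

definition cau :: "(nat \<Rightarrow> 'i nc_poly) \<Rightarrow> bool" where
  "cau p \<longleftrightarrow> (\<forall>e>0. \<exists>M. \<forall>m\<ge>M. \<forall>n\<ge>M. sn (p m - p n) < e)"

lemma cau_const [simp]: "cau (\<lambda>_. P)" by (simp add: cau_def)

lemma cau_add: assumes "cau p" "cau q" shows "cau (\<lambda>n. p n + q n)" unfolding cau_def
proof (intro allI impI)
  fix e :: real assume "e > 0"
  then have e2: "e / 2 > 0" by simp
  obtain M1 where 1: "\<And>m n. m \<ge> M1 \<Longrightarrow> n \<ge> M1 \<Longrightarrow> sn (p m - p n) < e / 2" using assms(1) e2 unfolding cau_def by blast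
  obtain M2 where 2: "\<And>m n. m \<ge> M2 \<Longrightarrow> n \<ge> M2 \<Longrightarrow> sn (q m - q n) < e / 2" using assms(2) e2 unfolding cau_def by blast
  have "sn (p m + q m - (p n + q n)) < e" if "m \<ge> max M1 M2" "n \<ge> max M1 M2" for m n
  proof -
    have "sn (p m + q m - (p n + q n)) = sn ((p m - p n) + (q m - q n))" by (simp add: algebra_simps)
    also have "\<dots> \<le> sn (p m - p n) + sn (q m - q n)" by (rule sn_triangle)
    also have "\<dots> < e / 2 + e / 2" using that by (intro add_strict_mono 1 2) auto
    finally show ?thesis by simp
  qed
  then show "\<exists>M. \<forall>m\<ge>M. \<forall>n\<ge>M. sn (p m + q m - (p n + q n)) < e" by blast
qed

lemma cau_bounded_map:
  assumes "cau p" and T: "\<And>P Q. T (P - Q) = T P - T Q" "\<And>P. sn (T P) \<le> C * sn P"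
  shows "cau (\<lambda>n. T (p n))" unfolding cau_def
proof (intro allI impI)
  fix e :: real assume "e > 0"
  define D where "D = max C 1"
  have D: "D > 0" "C \<le> D" by (auto simp: D_def)
  then have "e / D > 0" using \<open>e > 0\<close> by simp
  then obtain M where M: "\<And>m n. m \<ge> M \<Longrightarrow> n \<ge> M \<Longrightarrow> sn (p m - p n) < e / D" using assms(1) unfolding cau_def by blast
  have "sn (T (p m) - T (p n)) < e" if "m \<ge> M" "n \<ge> M" for m n
  proof -
    have "sn (T (p m) - T (p n)) \<le> C * sn (p m - p n)" unfolding T(1)[symmetric] by (rule T(2))
    also have "\<dots> \<le> D * sn (p m - p n)" using D by (intro mult_right_mono) auto
    also have "\<dots> < D * (e / D)" using D M[OF that] by (intro mult_strict_left_mono) auto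
    finally show ?thesis using D by simp
  qed
  then show "\<exists>M. \<forall>m\<ge>M. \<forall>n\<ge>M. sn (T (p m) - T (p n)) < e" by blast
qed

lemma cau_scale: "cau p \<Longrightarrow> cau (\<lambda>n. const c * p n)" by (rule cau_bounded_map[where C="cmod c"]) (auto simp: sn_const right_diff_distrib)

lemma cau_diff: "cau p \<Longrightarrow> cau q \<Longrightarrow> cau (\<lambda>n. p n - q n)" using cau_add[of p "\<lambda>n. const (- 1) * q n"] cau_scale[of q "- 1"]
  by (simp flip: uminus_eq_const)

lemma cau_bdd: assumes "cau p" obtains K where "K > 0" "\<And>n. sn (p n) \<le> K"
proof -
  obtain M where M: "\<And>m n. m \<ge> M \<Longrightarrow> n \<ge> M \<Longrightarrow> sn (p m - p n) < 1" using assms[unfolded cau_def, rule_format, of 1] by auto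
  define K where "K = 1 + (\<Sum>n\<le>M. sn (p n))"
  have "sn (p n) \<le> K" for n
  proof (cases "n \<le> M")
    case True
    then have "sn (p n) \<le> (\<Sum>n\<le>M. sn (p n))" by (intro member_le_sum) auto
    then show ?thesis by (simp add: K_def)
  next
    case False
    have "sn (p n) \<le> sn (p n - p M) + sn (p M)" using sn_triangle[of "p n - p M" "p M"] by simp
    also have "\<dots> \<le> 1 + sn (p M)" using M[of n M] False by simp
    also have "sn (p M) \<le> (\<Sum>n\<le>M. sn (p n))" by (intro member_le_sum) auto
    finally show ?thesis by (simp add: K_def)
  qed
  moreover have "K > 0" by (simp add: K_def add_pos_nonneg sum_nonneg)
  ultimately show ?thesis using that by blast
qed

lemma form_diff:
  "cmod (l (nc_star P * Q) - l (nc_star P' * Q')) \<le> sn (P - P') * sn Q + sn P' * sn (Q - Q')"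
proof -
  have "l (nc_star P * Q) - l (nc_star P' * Q') = l (nc_star (P - P') * Q) + l (nc_star P' * (Q - Q'))"
    by (simp add: nc_star_diff left_diff_distrib right_diff_distrib diff)
  also have "cmod \<dots> \<le> cmod (l (nc_star (P - P') * Q)) + cmod (l (nc_star P' * (Q - Q')))" by (rule norm_triangle_ineq)
  also have "\<dots> \<le> sn (P - P') * sn Q + sn P' * sn (Q - Q')" by (intro add_mono cs_sn)
  finally show ?thesis .
qed

lemma form_convergent:
  assumes "cau p" "cau q"
  shows "convergent (\<lambda>n. l (nc_star (p n) * q n))"
proof (rule Cauchy_convergent, rule CauchyI)
  fix e :: real assume "e > 0"
  obtain K where K: "K > 0" "\<And>n. sn (p n) \<le> K" using cau_bdd[OF assms(1)] by blast
  obtain L where L: "L > 0" "\<And>n. sn (q n) \<le> L" using cau_bdd[OF assms(2)] by blast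
  have "e / (2 * L) > 0" "e / (2 * K) > 0" using \<open>e > 0\<close> K(1) L(1) by auto
  then obtain M1 M2 where 1: "\<And>m n. m \<ge> M1 \<Longrightarrow> n \<ge> M1 \<Longrightarrow> sn (p m - p n) < e / (2 * L)"
    and 2: "\<And>m n. m \<ge> M2 \<Longrightarrow> n \<ge> M2 \<Longrightarrow> sn (q m - q n) < e / (2 * K)" using assms unfolding cau_def by meson
  have "cmod (l (nc_star (p m) * q m) - l (nc_star (p n) * q n)) < e" if "m \<ge> max M1 M2" "n \<ge> max M1 M2" for m n
  proof -
    have "cmod (l (nc_star (p m) * q m) - l (nc_star (p n) * q n)) \<le> sn (p m - p n) * sn (q m) + sn (p n) * sn (q m - q n)"
      by (rule form_diff)
    also have "\<dots> \<le> sn (p m - p n) * L + K * sn (q m - q n)" using K L by (intro add_mono mult_left_mono mult_right_mono) auto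
    also have "\<dots> < e / (2 * L) * L + K * (e / (2 * K))"
      using K L that by (intro add_strict_mono mult_strict_left_mono mult_strict_right_mono 1 2) auto
    also have "\<dots> = e" using K L by simp
    finally show ?thesis .
  qed
  then show "\<exists>M. \<forall>m\<ge>M. \<forall>n\<ge>M. norm (l (nc_star (p m) * q m) - l (nc_star (p n) * q n)) < e" by blast
qed

end

text \<open>The Hilbert space of \<open>l\<close> is realized by the functions \<open>u \<mapsto> \<langle>u, \<xi>\<rangle>\<close>, where \<open>u\<close> ranges over the words.\<close>

locale gns = tracial_functional l for l :: "'i nc_poly \<Rightarrow> complex" +
  fixes wd :: "'w \<Rightarrow> 'i nc_word"
  assumes surj_wd: "surj wd"
begin

definition vec :: "(nat \<Rightarrow> 'i nc_poly) \<Rightarrow> 'w \<Rightarrow> complex" where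
  "vec p u = lim (\<lambda>n. l (nc_star (wterm (wd u) 1) * p n))"

definition H :: "('w \<Rightarrow> complex) set" where "H = vec ` Collect cau"

definition rp :: "('w \<Rightarrow> complex) \<Rightarrow> nat \<Rightarrow> 'i nc_poly" where
  "rp f = (SOME p. cau p \<and> vec p = f)"

definition ip :: "('w \<Rightarrow> complex) \<Rightarrow> ('w \<Rightarrow> complex) \<Rightarrow> complex" where
  "ip f g = lim (\<lambda>n. l (nc_star (rp f n) * rp g n))"

lemma rp: assumes "f \<in> H" shows "cau (rp f)" "vec (rp f) = f"
proof -
  have "\<exists>p. cau p \<and> vec p = f" using assms by (auto simp: H_def)
  from someI_ex[OF this] show "cau (rp f)" "vec (rp f) = f" by (auto simp: rp_def)
qed

lemma vec_in_H [simp]: "cau p \<Longrightarrow> vec p \<in> H" by (simp add: H_def)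

lemma vec_lim: "cau p \<Longrightarrow> (\<lambda>n. l (nc_star (wterm (wd u) 1) * p n)) \<longlonglongrightarrow> vec p u"
  unfolding vec_def using form_convergent[of "\<lambda>_. wterm (wd u) 1" p] by (simp add: convergent_LIMSEQ_iff)

lemma vec_eqI:
  assumes "cau p" "\<And>u. (\<lambda>n. l (nc_star (wterm (wd u) 1) * p n)) \<longlonglongrightarrow> f u"
  shows "vec p = f" by (rule ext) (rule LIMSEQ_unique[OF vec_lim[OF assms(1)] assms(2)])

lemma vec_add: assumes "cau p" "cau q" shows "vec (\<lambda>n. p n + q n) = vec p + vec q" by (rule vec_eqI[OF cau_add[OF assms]])
    (use tendsto_add[OF vec_lim[OF assms(1)] vec_lim[OF assms(2)]] in \<open>simp add: distrib_left add\<close>)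

lemma vec_scale: assumes "cau p" shows "vec (\<lambda>n. const c * p n) = (\<lambda>u. c * vec p u)"
proof (rule vec_eqI[OF cau_scale[OF assms]])
  fix u
  have "l (nc_star (wterm (wd u) 1) * (const c * p n)) = c * l (nc_star (wterm (wd u) 1) * p n)" for n
    by (metis const_commute mult.assoc scale)
  then show "(\<lambda>n. l (nc_star (wterm (wd u) 1) * (const c * p n))) \<longlonglongrightarrow> c * vec p u" using tendsto_mult_left[OF vec_lim[OF assms]] by simp
qed

lemma vec_diff: assumes "cau p" "cau q" shows "vec (\<lambda>n. p n - q n) = vec p - vec q" by (rule vec_eqI[OF cau_diff[OF assms]])
    (use tendsto_diff[OF vec_lim[OF assms(1)] vec_lim[OF assms(2)]] in \<open>simp add: right_diff_distrib diff\<close>)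

lemma vec_zero: "vec (\<lambda>_. 0) = 0" by (rule vec_eqI) auto

text \<open>A Cauchy sequence that converges weakly to \<open>0\<close> converges to \<open>0\<close>. So a vector determines its representing sequences up to
  null sequences.\<close>

lemma null_of_vec_zero:
  assumes p: "cau p" and 0: "vec p = 0"
  shows "(\<lambda>n. sn (p n)) \<longlonglongrightarrow> 0"
proof -
  have w: "(\<lambda>n. l (nc_star P * p n)) \<longlonglongrightarrow> 0" for P
  proof (induction P rule: poly_induct)
    case (single w c)
    obtain u where u: "w = wd u" using surj_wd by (metis surjD)
    have "nc_star (wterm w c) = const (cnj c) * nc_star (wterm w 1)"
      using nc_star_const_mult[of c "wterm w 1"] by (simp add: const_mult_single)
    then have "l (nc_star (wterm w c) * p n) = cnj c * l (nc_star (wterm (wd u) 1) * p n)" for n by (simp add: u mult.assoc scale)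
    then show ?case using tendsto_mult_left[OF vec_lim[OF p, of u], of "cnj c"] 0 by simp
  next
    case (add f g)
    then show ?case using tendsto_add[of _ 0 _ _ 0] by (force simp: nc_star_add distrib_right tracial_functional.add[OF tracial_functional_axioms])
  qed simp
  obtain K where K: "K > 0" "\<And>n. sn (p n) \<le> K" using cau_bdd[OF p] by blast
  have "(\<lambda>n. (sn (p n))\<^sup>2) \<longlonglongrightarrow> 0"
  proof (rule LIMSEQ_I)
    fix e :: real assume e: "e > 0"
    then have "e / (2 * K) > 0" using K by simp
    then obtain M where M: "\<And>m n. m \<ge> M \<Longrightarrow> n \<ge> M \<Longrightarrow> sn (p m - p n) < e / (2 * K)" using p unfolding cau_def by blast
    obtain M' where M': "\<And>n. n \<ge> M' \<Longrightarrow> cmod (l (nc_star (p M) * p n)) < e / 2" using LIMSEQ_D[OF w[of "p M"], of "e / 2"] e by auto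
    have "(sn (p n))\<^sup>2 < e" if n: "n \<ge> max M M'" for n
    proof -
      have "(sn (p n))\<^sup>2 = cmod (l (nc_star (p n) * p n))" unfolding l_square norm_of_real by simp
      also have "\<dots> = cmod (l (nc_star (p n - p M) * p n) + l (nc_star (p M) * p n))" by (simp add: nc_star_diff left_diff_distrib diff)
      also have "\<dots> \<le> cmod (l (nc_star (p n - p M) * p n)) + cmod (l (nc_star (p M) * p n))" by (rule norm_triangle_ineq)
      also have "\<dots> < e / (2 * K) * K + e / 2"
      proof (rule add_le_less_mono)
        have "cmod (l (nc_star (p n - p M) * p n)) \<le> sn (p n - p M) * sn (p n)" by (rule cs_sn)
        also have "\<dots> \<le> e / (2 * K) * K" using M[of n M] n K e by (intro mult_mono) auto
        finally show "cmod (l (nc_star (p n - p M) * p n)) \<le> e / (2 * K) * K" .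
        show "cmod (l (nc_star (p M) * p n)) < e / 2" using M'[of n] n by simp
      qed
      finally show ?thesis using K by simp
    qed
    then show "\<exists>no. \<forall>n\<ge>no. norm ((sn (p n))\<^sup>2 - 0) < e" by (intro exI[of _ "max M M'"]) auto
  qed
  from tendsto_real_sqrt[OF this] show ?thesis by simp
qed

lemma vec_eq_imp: assumes "cau p" "cau q" "vec p = vec q" shows "(\<lambda>n. sn (p n - q n)) \<longlonglongrightarrow> 0"
  by (rule null_of_vec_zero[OF cau_diff[OF assms(1,2)]]) (simp add: vec_diff assms)

lemma ip_lim:
  assumes p: "cau p" and q: "cau q"
  shows "(\<lambda>n. l (nc_star (p n) * q n)) \<longlonglongrightarrow> ip (vec p) (vec q)"
proof -
  let ?p = "rp (vec p)" and ?q = "rp (vec q)"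
  have r: "cau ?p" "vec ?p = vec p" "cau ?q" "vec ?q = vec q" using rp[of "vec p"] rp[of "vec q"] p q by auto
  obtain K where K: "K > 0" "\<And>n. sn (?p n) \<le> K" using cau_bdd[OF r(1)] by blast
  obtain L where L: "L > 0" "\<And>n. sn (q n) \<le> L" using cau_bdd[OF q] by blast
  have "(\<lambda>n. l (nc_star (p n) * q n) - l (nc_star (?p n) * ?q n)) \<longlonglongrightarrow> 0"
  proof (rule Lim_null_comparison)
    have "norm (l (nc_star (p n) * q n) - l (nc_star (?p n) * ?q n)) \<le> sn (p n - ?p n) * L + K * sn (q n - ?q n)" for n
      by (rule order_trans[OF form_diff]) (use K L in \<open>intro add_mono mult_left_mono mult_right_mono; simp\<close>)
    then show "\<forall>\<^sub>F n in sequentially. norm (l (nc_star (p n) * q n) - l (nc_star (?p n) * ?q n)) \<le> sn (p n - ?p n) * L + K * sn (q n - ?q n)"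
      by simp
    have "(\<lambda>n. sn (p n - ?p n) * L + K * sn (q n - ?q n)) \<longlonglongrightarrow> 0 * L + K * 0" by (intro tendsto_intros vec_eq_imp) (use p q r in auto)
    then show "(\<lambda>n. sn (p n - ?p n) * L + K * sn (q n - ?q n)) \<longlonglongrightarrow> 0" by simp
  qed
  moreover have "(\<lambda>n. l (nc_star (?p n) * ?q n)) \<longlonglongrightarrow> ip (vec p) (vec q)"
    unfolding ip_def using form_convergent[OF r(1,3)] by (simp add: convergent_LIMSEQ_iff)
  ultimately show ?thesis using tendsto_add by fastforce
qed

lemma ip_eqI: "cau p \<Longrightarrow> cau q \<Longrightarrow> (\<lambda>n. l (nc_star (p n) * q n)) \<longlonglongrightarrow> x \<Longrightarrow> ip (vec p) (vec q) = x" using LIMSEQ_unique ip_lim by blast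

lemma H_cases: assumes "f \<in> H" obtains p where "cau p" "f = vec p" using assms by (auto simp: H_def)

lemma ip_nonneg: assumes "f \<in> H" shows "0 \<le> ip f f"
proof -
  obtain p where p: "cau p" "f = vec p" using assms by (rule H_cases)
  have L: "(\<lambda>n. l (nc_star (p n) * p n)) \<longlonglongrightarrow> ip f f" using ip_lim[OF p(1) p(1)] p(2) by simp
  have "0 \<le> Re (ip f f)" by (rule LIMSEQ_le_const[OF tendsto_Re[OF L]]) (simp add: re_pos)
  moreover have "(\<lambda>n. Im (l (nc_star (p n) * p n))) = (\<lambda>n. 0)" using pos by (simp add: less_eq_complex_def fun_eq_iff)
  then have "Im (ip f f) = 0" using tendsto_Im[OF L] LIMSEQ_unique[of "\<lambda>n. 0::real" _ 0] by auto
  ultimately show ?thesis by (simp add: less_eq_complex_def)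
qed

lemma ip_norm_lim:
  assumes p: "cau p" shows "(\<lambda>n. sn (p n)) \<longlonglongrightarrow> ip_norm ip (vec p)"
  using tendsto_real_sqrt[OF tendsto_Re[OF ip_lim[OF p p]]] by (simp add: ip_norm_def sn_def)

lemma ip_norm_triangle:
  assumes "f \<in> H" "g \<in> H" shows "ip_norm ip (f + g) \<le> ip_norm ip f + ip_norm ip g"
proof -
  obtain p where p: "cau p" "f = vec p" using assms(1) by (rule H_cases)
  obtain q where q: "cau q" "g = vec q" using assms(2) by (rule H_cases)
  have "(\<lambda>n. sn (p n + q n)) \<longlonglongrightarrow> ip_norm ip (f + g)" using ip_norm_lim[OF cau_add[OF p(1) q(1)]] by (simp add: vec_add p q)
  moreover have "(\<lambda>n. sn (p n) + sn (q n)) \<longlonglongrightarrow> ip_norm ip f + ip_norm ip g"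
    using tendsto_add[OF ip_norm_lim[OF p(1)] ip_norm_lim[OF q(1)]] by (simp add: p q)
  ultimately show ?thesis by (rule LIMSEQ_le) (auto intro: sn_triangle)
qed

lemma H_add: assumes "f \<in> H" "g \<in> H" shows "f + g \<in> H" using vec_in_H[OF cau_add[OF rp(1) rp(1)], OF assms] by (simp add: vec_add rp assms)
lemma H_diff: assumes "f \<in> H" "g \<in> H" shows "f - g \<in> H"
  using vec_in_H[OF cau_diff[OF rp(1) rp(1)], OF assms] by (simp add: vec_diff rp assms)
lemma H_scale: assumes "f \<in> H" shows "(\<lambda>u. c * f u) \<in> H" using vec_in_H[OF cau_scale[OF rp(1)], OF assms] by (simp add: vec_scale rp assms)
lemma H_zero: "0 \<in> H" using vec_in_H[of "\<lambda>_. 0"] by (simp add: vec_zero)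

text \<open>Constant sequences are dense: \<open>X n\<close> is within \<open>1 / (n + 1)\<close> of a polynomial \<open>r n\<close>, and then \<open>r\<close> is a Cauchy sequence that
  represents the limit.\<close>

lemma H_complete:
  assumes X: "\<And>n. X n \<in> H" and C: "\<And>e. e > 0 \<Longrightarrow> \<exists>M. \<forall>m\<ge>M. \<forall>n\<ge>M. ip_norm ip (X m - X n) < e"
  shows "\<exists>f\<in>H. (\<lambda>n. ip_norm ip (X n - f)) \<longlonglongrightarrow> 0"
proof -
  have "\<exists>r. ip_norm ip (X n - vec (\<lambda>_. r)) \<le> 1 / real (Suc n)" for n
  proof -
    obtain p where p: "cau p" "X n = vec p" using X by (rule H_cases)
    have "1 / real (Suc n) > 0" by simp
    then obtain M where M: "\<And>m k. m \<ge> M \<Longrightarrow> k \<ge> M \<Longrightarrow> sn (p m - p k) < 1 / real (Suc n)" using p(1) unfolding cau_def by blast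
    have "(\<lambda>m. sn (p m - p M)) \<longlonglongrightarrow> ip_norm ip (X n - vec (\<lambda>_. p M))"
      using ip_norm_lim[OF cau_diff[OF p(1) cau_const[of "p M"]]] by (simp add: vec_diff p)
    then have "ip_norm ip (X n - vec (\<lambda>_. p M)) \<le> 1 / real (Suc n)"
      by (rule LIMSEQ_le_const2) (use M in \<open>auto intro!: exI[of _ M] less_imp_le\<close>)
    then show ?thesis by blast
  qed
  then obtain r where r: "\<And>n. ip_norm ip (X n - vec (\<lambda>_. r n)) \<le> 1 / real (Suc n)" by metis
  have J: "ip_norm ip (vec (\<lambda>_. P) - vec (\<lambda>_. Q)) = sn (P - Q)" for P Q
    using LIMSEQ_unique[OF ip_norm_lim[OF cau_const[of "P - Q"]] tendsto_const] vec_diff[of "\<lambda>_. P" "\<lambda>_. Q"] by simp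
  have sym: "ip_norm ip (f - g) = ip_norm ip (g - f)" if fg: "f \<in> H" "g \<in> H" for f g
  proof -
    obtain p where p: "cau p" "f = vec p" using fg(1) by (rule H_cases)
    obtain q where q: "cau q" "g = vec q" using fg(2) by (rule H_cases)
    show ?thesis using LIMSEQ_unique[OF ip_norm_lim[OF cau_diff[OF p(1) q(1)]]] ip_norm_lim[OF cau_diff[OF q(1) p(1)]] sn_minus_commute
      by (simp add: vec_diff p q)
  qed
  have bound: "sn (r m - r n) \<le> 1 / real (Suc m) + ip_norm ip (X m - X n) + 1 / real (Suc n)" for m n
  proof -
    let ?a = "vec (\<lambda>_. r m)" and ?b = "vec (\<lambda>_. r n)"
    have "?a - ?b = (?a - X m) + ((X m - X n) + (X n - ?b))" by (simp add: fun_eq_iff)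
    then have "sn (r m - r n) \<le> ip_norm ip (?a - X m) + ip_norm ip ((X m - X n) + (X n - ?b))"
      unfolding J[symmetric] using ip_norm_triangle[of "?a - X m" "(X m - X n) + (X n - ?b)"] by (simp add: H_add H_diff X)
    also have "ip_norm ip ((X m - X n) + (X n - ?b)) \<le> ip_norm ip (X m - X n) + ip_norm ip (X n - ?b)"
      by (rule ip_norm_triangle) (simp_all add: H_diff X)
    also have "ip_norm ip (?a - X m) = ip_norm ip (X m - ?a)" by (rule sym) (simp_all add: X)
    finally show ?thesis using r[of m] r[of n] by linarith
  qed
  have "cau r" unfolding cau_def
  proof (intro allI impI)
    fix e :: real assume e: "e > 0"
    then obtain M where M: "\<And>m n. m \<ge> M \<Longrightarrow> n \<ge> M \<Longrightarrow> ip_norm ip (X m - X n) < e / 3" using C[of "e / 3"] by auto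
    obtain K :: nat where K: "1 / real (Suc K) < e / 3" using e by (metis nat_approx_posE divide_pos_pos zero_less_numeral)
    have "sn (r m - r n) < e" if "m \<ge> max M K" "n \<ge> max M K" for m n
    proof -
      have "1 / real (Suc m) \<le> 1 / real (Suc K)" "1 / real (Suc n) \<le> 1 / real (Suc K)" using that by (auto intro!: divide_left_mono)
      then show ?thesis using bound[of m n] M[of m n] that K by simp
    qed
    then show "\<exists>M. \<forall>m\<ge>M. \<forall>n\<ge>M. sn (r m - r n) < e" by blast
  qed
  moreover have "(\<lambda>n. ip_norm ip (X n - vec r)) \<longlonglongrightarrow> 0"
  proof (rule LIMSEQ_I)
    fix e :: real assume e: "e > 0"
    then have "e / 3 > 0" by simp
    with \<open>cau r\<close> obtain M where M: "\<And>m n. m \<ge> M \<Longrightarrow> n \<ge> M \<Longrightarrow> sn (r m - r n) < e / 3" unfolding cau_def by blast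
    obtain K :: nat where K: "1 / real (Suc K) < e / 3" using e by (metis nat_approx_posE divide_pos_pos zero_less_numeral)
    have "ip_norm ip (X n - vec r) < e" if n: "n \<ge> max M K" for n
    proof -
      let ?b = "vec (\<lambda>_. r n)"
      have "(\<lambda>m. sn (r n - r m)) \<longlonglongrightarrow> ip_norm ip (?b - vec r)"
        using ip_norm_lim[OF cau_diff[OF cau_const \<open>cau r\<close>, of "r n"]] by (simp add: vec_diff \<open>cau r\<close>)
      then have 1: "ip_norm ip (?b - vec r) \<le> e / 3" by (rule LIMSEQ_le_const2) (use M[of n] n in \<open>auto intro!: exI[of _ M] less_imp_le\<close>)
      have "X n - vec r = (X n - ?b) + (?b - vec r)" by (simp add: fun_eq_iff)
      then have "ip_norm ip (X n - vec r) \<le> ip_norm ip (X n - ?b) + ip_norm ip (?b - vec r)"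
        using ip_norm_triangle[of "X n - ?b" "?b - vec r"] by (simp add: H_diff X \<open>cau r\<close>)
      moreover have "1 / real (Suc n) \<le> 1 / real (Suc K)" using n by (auto intro!: divide_left_mono)
      ultimately show ?thesis using 1 r[of n] K e by linarith
    qed
    moreover have "0 \<le> ip_norm ip (X n - vec r)" for n
      using ip_nonneg[OF H_diff[OF X vec_in_H[OF \<open>cau r\<close>]]] by (simp add: ip_norm_def less_eq_complex_def)
    ultimately show "\<exists>no. \<forall>n\<ge>no. norm (ip_norm ip (X n - vec r) - 0) < e" by (intro exI[of _ "max M K"]) auto
  qed
  ultimately show ?thesis by (intro bexI[of _ "vec r"]) auto
qed

lemma ip_add_right: assumes "f \<in> H" "g \<in> H" "h \<in> H" shows "ip f (g + h) = ip f g + ip f h"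
proof -
  obtain p where p: "cau p" "f = vec p" using assms(1) by (rule H_cases)
  obtain q where q: "cau q" "g = vec q" using assms(2) by (rule H_cases)
  obtain r where r: "cau r" "h = vec r" using assms(3) by (rule H_cases)
  have "ip (vec p) (vec (\<lambda>n. q n + r n)) = ip f g + ip f h"
    by (rule ip_eqI) (use tendsto_add[OF ip_lim[OF p(1) q(1)] ip_lim[OF p(1) r(1)]] p q r in \<open>simp_all add: cau_add distrib_left add\<close>)
  then show ?thesis by (simp add: vec_add p q r)
qed

lemma ip_scale_right: assumes "f \<in> H" "g \<in> H" shows "ip f (\<lambda>u. c * g u) = c * ip f g"
proof -
  obtain p where p: "cau p" "f = vec p" using assms(1) by (rule H_cases)
  obtain q where q: "cau q" "g = vec q" using assms(2) by (rule H_cases)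
  have "l (nc_star (p n) * (const c * q n)) = c * l (nc_star (p n) * q n)" for n by (metis const_commute mult.assoc scale)
  then have "ip (vec p) (vec (\<lambda>n. const c * q n)) = c * ip f g"
    by (intro ip_eqI) (use tendsto_mult_left[OF ip_lim[OF p(1) q(1)]] p q in \<open>simp_all add: cau_scale\<close>)
  then show ?thesis by (simp add: vec_scale p q)
qed

lemma ip_cnj: assumes "f \<in> H" "g \<in> H" shows "ip f g = cnj (ip g f)"
proof -
  obtain p where p: "cau p" "f = vec p" using assms(1) by (rule H_cases)
  obtain q where q: "cau q" "g = vec q" using assms(2) by (rule H_cases)
  have "ip (vec p) (vec q) = cnj (ip g f)" by (rule ip_eqI) (use tendsto_cnj[OF ip_lim[OF q(1) p(1)]] p q in \<open>simp_all flip: sesqui\<close>)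
  then show ?thesis by (simp add: p q)
qed

lemma ip_definite: assumes "f \<in> H" "ip f f = 0" shows "f = 0"
proof -
  obtain p where p: "cau p" "f = vec p" using assms(1) by (rule H_cases)
  have "(\<lambda>n. sn (p n)) \<longlonglongrightarrow> 0" using ip_norm_lim[OF p(1)] assms(2) p by (simp add: ip_norm_def)
  then have z: "(\<lambda>n. sn (wterm (wd u) 1) * sn (p n)) \<longlonglongrightarrow> sn (wterm (wd u) 1) * 0" for u by (intro tendsto_intros)
  have "vec p = 0"
  proof (rule vec_eqI[OF p(1)])
    fix u
    show "(\<lambda>n. l (nc_star (wterm (wd u) 1) * p n)) \<longlonglongrightarrow> 0 u"
      using Lim_null_comparison[of "\<lambda>n. l (nc_star (wterm (wd u) 1) * p n)" "\<lambda>n. sn (wterm (wd u) 1) * sn (p n)"]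
        z[of u] cs_sn by simp
  qed
  then show ?thesis by (simp add: p)
qed

theorem hilbert_space_H: "hilbert_space H ip"
proof -
  have m: "Modules.module (\<lambda>c (f :: 'w \<Rightarrow> complex) w. c * f w)" by unfold_locales (auto simp: fun_eq_iff distrib_left distrib_right)
  have "module.subspace (\<lambda>c f w. c * f w) H" unfolding module.subspace_def[OF m] by (auto simp: H_zero H_add H_scale)
  moreover have "\<forall>f\<in>H. \<forall>g\<in>H. ip f g = cnj (ip g f)" by (intro ballI) (rule ip_cnj)
  moreover have "\<forall>f\<in>H. \<forall>g\<in>H. \<forall>h\<in>H. ip f (g + h) = ip f g + ip f h" by (intro ballI) (rule ip_add_right)
  moreover have "\<forall>c. \<forall>f\<in>H. \<forall>g\<in>H. ip f (\<lambda>w. c * g w) = c * ip f g" by (intro allI ballI) (rule ip_scale_right)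
  moreover have "\<forall>f\<in>H. 0 \<le> ip f f \<and> (ip f f = 0 \<longrightarrow> f = 0)" by (intro ballI conjI impI) (auto intro: ip_nonneg ip_definite)
  moreover have "\<forall>X. (\<forall>n::nat. X n \<in> H) \<longrightarrow>
        (\<forall>e>0. \<exists>M. \<forall>m\<ge>M. \<forall>n\<ge>M. ip_norm ip (X m - X n) < e) \<longrightarrow>
        (\<exists>f\<in>H. (\<lambda>n. ip_norm ip (X n - f)) \<longlonglongrightarrow> 0)" by (intro allI impI H_complete) simp_all
  ultimately show ?thesis unfolding hilbert_space_def by (intro conjI)
qed

definition op :: "('i nc_poly \<Rightarrow> 'i nc_poly) \<Rightarrow> ('w \<Rightarrow> complex) \<Rightarrow> ('w \<Rightarrow> complex)" where
  "op T = restrict (\<lambda>f. vec (\<lambda>n. T (rp f n))) H"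

definition bdd_map :: "('i nc_poly \<Rightarrow> 'i nc_poly) \<Rightarrow> bool" where
  "bdd_map T \<longleftrightarrow> (\<forall>P Q. T (P + Q) = T P + T Q) \<and> (\<forall>c P. T (const c * P) = const c * T P) \<and>
     (\<exists>C. \<forall>P. sn (T P) \<le> C * sn P)"

lemma bdd_map_diff: assumes "bdd_map T" shows "T (P - Q) = T P - T Q"
proof -
  have "T (P - Q) + T Q = T P" using assms unfolding bdd_map_def by (metis diff_add_cancel)
  then show ?thesis by (simp add: algebra_simps)
qed

lemma cau_bdd_map: assumes "bdd_map T" "cau p" shows "cau (\<lambda>n. T (p n))"
  using cau_bounded_map[OF assms(2), of T] bdd_map_diff[OF assms(1)] assms(1) unfolding bdd_map_def by blast

lemma vec_cong: assumes "cau p" "cau q" "(\<lambda>n. sn (p n - q n)) \<longlonglongrightarrow> 0" shows "vec p = vec q"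
proof -
  have "ip_norm ip (vec p - vec q) = 0"
    using LIMSEQ_unique[OF ip_norm_lim[OF cau_diff[OF assms(1,2)]] assms(3)] by (simp add: vec_diff assms)
  then have "ip (vec p - vec q) (vec p - vec q) = 0"
    using ip_nonneg[of "vec p - vec q"] assms by (simp add: ip_norm_def H_diff less_eq_complex_def complex_eq_iff)
  then have "vec p - vec q = 0" using assms by (intro ip_definite H_diff) auto
  then show ?thesis by simp
qed

lemma op_vec: assumes T: "bdd_map T" and p: "cau p" shows "op T (vec p) = vec (\<lambda>n. T (p n))"
proof -
  let ?q = "rp (vec p)"
  have q: "cau ?q" "vec ?q = vec p" using rp[of "vec p"] p by auto
  obtain C where C: "\<And>P. sn (T P) \<le> C * sn P" using T by (auto simp: bdd_map_def)
  have "(\<lambda>n. sn (T (?q n) - T (p n))) \<longlonglongrightarrow> 0"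
  proof (rule Lim_null_comparison)
    have "norm (sn (T (?q n) - T (p n))) \<le> C * sn (?q n - p n)" for n unfolding bdd_map_diff[OF T, symmetric] using C by simp
    then show "\<forall>\<^sub>F n in sequentially. norm (sn (T (?q n) - T (p n))) \<le> C * sn (?q n - p n)" by simp
    show "(\<lambda>n. C * sn (?q n - p n)) \<longlonglongrightarrow> 0" using tendsto_mult_left[OF vec_eq_imp[OF q(1) p q(2)], of C] by simp
  qed
  then have "vec (\<lambda>n. T (?q n)) = vec (\<lambda>n. T (p n))" by (rule vec_cong[OF cau_bdd_map[OF T q(1)] cau_bdd_map[OF T p]])
  then show ?thesis using p by (simp add: op_def)
qed

lemma op_bounded: assumes T: "bdd_map T" shows "op T \<in> bounded_operators H ip"
proof -
  obtain C where C: "\<And>P. sn (T P) \<le> C * sn P" using T by (auto simp: bdd_map_def)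
  have "op T \<in> H \<rightarrow>\<^sub>E H" using vec_in_H[OF cau_bdd_map[OF T rp(1)]] by (simp add: op_def)
  moreover have "op T (f + g) = op T f + op T g" if fg: "f \<in> H" "g \<in> H" for f g
  proof -
    obtain p where p: "cau p" "f = vec p" using fg(1) by (rule H_cases)
    obtain q where q: "cau q" "g = vec q" using fg(2) by (rule H_cases)
    have "op T (vec (\<lambda>n. p n + q n)) = op T f + op T g"
      unfolding p(2) q(2) op_vec[OF T p(1)] op_vec[OF T q(1)] op_vec[OF T cau_add[OF p(1) q(1)]]
        vec_add[OF cau_bdd_map[OF T p(1)] cau_bdd_map[OF T q(1)], symmetric] using T by (simp add: bdd_map_def)
    then show ?thesis by (simp add: vec_add p q)
  qed
  moreover have "op T (\<lambda>w. c * f w) = (\<lambda>w. c * op T f w)" if f: "f \<in> H" for f c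
  proof -
    obtain p where p: "cau p" "f = vec p" using f by (rule H_cases)
    have "op T (vec (\<lambda>n. const c * p n)) = (\<lambda>w. c * op T f w)" unfolding p(2) op_vec[OF T p(1)] op_vec[OF T cau_scale[OF p(1)]]
        vec_scale[OF cau_bdd_map[OF T p(1)], symmetric] using T by (simp add: bdd_map_def)
    then show ?thesis by (simp add: vec_scale p)
  qed
  moreover have "ip_norm ip (op T f) \<le> C * ip_norm ip f" if f: "f \<in> H" for f
  proof -
    obtain p where p: "cau p" "f = vec p" using f by (rule H_cases)
    show ?thesis unfolding p(2) op_vec[OF T p(1)]
      by (rule LIMSEQ_le[OF ip_norm_lim[OF cau_bdd_map[OF T p(1)]] tendsto_mult_left[OF ip_norm_lim[OF p(1)]]]) (use C in auto)
  qed
  then have "\<exists>C. \<forall>f\<in>H. ip_norm ip (op T f) \<le> C * ip_norm ip f" by (intro exI[of _ C]) simp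
  ultimately show ?thesis by (simp add: bounded_operators_def)
qed

end

section \<open>States on C*-algebras\<close>

locale pos_functional =
  fixes \<tau> :: "'b::cstar_algebra \<Rightarrow> complex"
  assumes add: "\<tau> (x + y) = \<tau> x + \<tau> y" and scale: "\<tau> (c *\<^sub>C x) = c * \<tau> x"
    and one: "\<tau> 1 = 1" and pos: "0 \<le> \<tau> (star x * x)"
begin

lemma zero [simp]: "\<tau> 0 = 0" using add[of 0 0] by simp
lemma minus: "\<tau> (- x) = - \<tau> x" using add[of x "- x"] by (simp add: eq_neg_iff_add_eq_0 add.commute)
lemma diff: "\<tau> (x - y) = \<tau> x - \<tau> y" using add[of x "- y"] by (simp add: minus)
lemma sum: "\<tau> (sum f S) = (\<Sum>x\<in>S. \<tau> (f x))" by (induction S rule: infinite_finite_induct) (simp_all add: add)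
lemma of_real: "\<tau> (of_real r) = of_real r" using scale[of "of_real r" 1] by (simp add: one scaleC_of_real of_real_def[where 'a='b])
lemma scaleR: "\<tau> (r *\<^sub>R x) = of_real r * \<tau> x" using scale[of "of_real r" x] by (simp add: scaleC_of_real)

lemma nonneg: assumes "pos x" shows "0 \<le> \<tau> x"
proof -
  have *: "0 \<le> \<tau> x + of_real e" if e: "e > 0" for e
  proof -
    obtain h where h: "h * h = x + of_real e" "star h = h" using pos_plus_eps_sqrt[OF assms e] by blast
    show ?thesis using pos[of h] h by (simp add: add of_real)
  qed
  have "Im (\<tau> x) = 0" using *[of 1] by (simp add: less_eq_complex_def)
  moreover have "0 \<le> Re (\<tau> x)" by (rule field_le_epsilon) (use * in \<open>simp add: less_eq_complex_def\<close>)
  ultimately show ?thesis by (simp add: less_eq_complex_def)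
qed

lemma norm_le: "cmod (\<tau> x) \<le> norm x"
proof -
  have "0 \<le> \<tau> (star 1 * 1) + c * \<tau> (star 1 * x) + cnj c * \<tau> (star x * 1) + (c * cnj c) * \<tau> (star x * x)" for c
  proof -
    have "0 \<le> \<tau> (star (1 + c *\<^sub>C x) * (1 + c *\<^sub>C x))" by (rule pos)
    also have "star (1 + c *\<^sub>C x) * (1 + c *\<^sub>C x) =
       star 1 * 1 + c *\<^sub>C (star 1 * x) + cnj c *\<^sub>C (star x * 1) + (c * cnj c) *\<^sub>C (star x * x)"
      by (simp add: star_add star_scaleC distrib_left distrib_right mult_scaleC_left mult_scaleC_right
          scaleC_scaleC scaleC_add_right mult.commute add_ac)
    finally show ?thesis by (simp only: add scale)
  qed
  from cauchy_schwarz_numeric(2)[OF this pos]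
  have "(cmod (\<tau> x))\<^sup>2 \<le> Re (\<tau> (star x * x))" by (simp add: one)
  also have "0 \<le> \<tau> (of_real ((norm x)\<^sup>2) - star x * x)" by (rule nonneg[OF pos_norm_square_diff[OF order_refl]])
  then have "Re (\<tau> (star x * x)) \<le> (norm x)\<^sup>2" unfolding diff of_real by (simp add: less_eq_complex_def)
  finally have "(cmod (\<tau> x))\<^sup>2 \<le> (norm x)\<^sup>2" .
  then show ?thesis by (rule power2_le_imp_le) simp
qed

end

lemma tracial_state_pos_functional: "tracial_state \<tau> \<Longrightarrow> pos_functional \<tau>" by unfold_locales (auto simp: tracial_state_def)

lemma tracial_state_functional:
  assumes "tracial_state \<tau>" shows "tracial_functional (\<lambda>P. \<tau> (nc_eval a P))"
proof unfold_locales
  fix P Q c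
  show "\<tau> (nc_eval a (P + Q)) = \<tau> (nc_eval a P) + \<tau> (nc_eval a Q)" using assms by (simp add: tracial_state_def nc_eval_add)
  show "\<tau> (nc_eval a (const c * P)) = c * \<tau> (nc_eval a P)" using assms by (simp add: tracial_state_def nc_eval_const_mult)
  show "0 \<le> \<tau> (nc_eval a (nc_star P * P))" unfolding nc_eval_mult nc_eval_star using assms unfolding tracial_state_def by blast
  show "\<tau> (nc_eval a 1) = 1" using assms by (simp add: tracial_state_def)
  show "\<tau> (nc_eval a (P * Q)) = \<tau> (nc_eval a (Q * P))" unfolding nc_eval_mult using assms unfolding tracial_state_def by blast
qed

section \<open>Square roots in matrix algebras\<close>

text \<open>The iteration \<open>u \<mapsto> (T + u\<^sup>2) / 2\<close> is contractive in the matrix norm. As this norm dominates the entries, the iterates converge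
  entrywise.\<close>

lemma matrix_sqrt_one_minus:
  fixes T :: "'a::cstar_algebra mat"
  assumes T: "T \<in> carrier_mat n n" "star_mat T = T" and r: "mat_norm T < 1"
  obtains D where "D \<in> carrier_mat n n" "star_mat D = D" "D * D = 1\<^sub>m n - T"
proof -
  define h where "h = (\<lambda>X :: 'a mat. map_mat (scaleR (1/2)) X)"
  have hc [simp]: "h X \<in> carrier_mat n n" if "X \<in> carrier_mat n n" for X using that by (simp add: h_def)
  have hn: "mat_norm (h X) \<le> mat_norm X / 2" if X: "X \<in> carrier_mat n n" for X
  proof (rule mat_norm_leI[OF hc[OF X]])
    fix v
    have "cnorm n (mact (h X) v) = cnorm n (\<lambda>i. (1/2) *\<^sub>R mact X v i)"
      by (rule cnorm_cong) (use X in \<open>simp add: mact_def h_def scaleR_sum_right\<close>)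
    also have "\<dots> = cnorm n (mact X v) / 2" by (simp add: cnorm_scaleR)
    finally show "cnorm n (mact (h X) v) \<le> mat_norm X / 2 * cnorm n v" using cnorm_mact_le[OF X, of v] by simp
  qed simp
  define \<rho> where "\<rho> = mat_norm T"
  have \<rho>: "0 \<le> \<rho>" "\<rho> < 1" using r by (auto simp: \<rho>_def)
  define f where "f = (\<lambda>X. h (T + X * X))"
  define u where "u = (\<lambda>k. (f ^^ k) (0\<^sub>m n n))"
  have u0: "u 0 = 0\<^sub>m n n" and uS: "u (Suc k) = f (u k)" for k by (simp_all add: u_def)
  have uc [simp]: "u k \<in> carrier_mat n n" for k
  proof (induction k)
    case (Suc k)
    have "T + u k * u k \<in> carrier_mat n n" using T(1) Suc by simp
    then show ?case by (simp add: uS f_def)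
  qed (simp add: u0)
  have ud [simp]: "dim_row (u k) = n" "dim_col (u k) = n" for k using carrier_matD[OF uc[of k]] by auto
  have us: "star_mat (u k) = u k" for k
  proof (induction k)
    case 0 show ?case unfolding u0 by (rule eq_matI) auto
  next
    case (Suc k)
    have "star_mat (u (Suc k)) = h (star_mat (T + u k * u k))"
      unfolding uS f_def h_def by (rule eq_matI) (use T in \<open>auto simp: star_scaleR\<close>)
    also have "\<dots> = u (Suc k)" using T Suc by (simp add: star_mat_add[of _ n n] star_mat_mult[of _ n n _ n] uS f_def)
    finally show ?case .
  qed
  have un: "mat_norm (u k) \<le> \<rho>" for k
  proof (induction k)
    case 0
    have "mat_norm (0\<^sub>m n n :: 'a mat) \<le> 0" by (rule mat_norm_leI) (auto simp: mact_def cnorm_cong[of n "mact (0\<^sub>m n n) _" "\<lambda>_. 0"])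
    then show ?case using \<rho> by (simp add: u0)
  next
    case (Suc k)
    have "mat_norm (u (Suc k)) \<le> mat_norm (T + u k * u k) / 2" unfolding uS f_def using T by (intro hn) simp
    also have "mat_norm (T + u k * u k) \<le> \<rho> + mat_norm (u k) * mat_norm (u k)"
      unfolding \<rho>_def using mat_norm_add[of T n n "u k * u k"] mat_norm_mult[of "u k" n n "u k" n] T by simp
    also have "mat_norm (u k) * mat_norm (u k) \<le> \<rho> * 1" using Suc \<rho> by (intro mult_mono) auto
    finally show ?case by simp
  qed
  have ue: "u (Suc k) $$ (i,j) = (1/2) *\<^sub>R (T $$ (i,j) + (\<Sum>l<n. u k $$ (i,l) * u k $$ (l,j)))" if "i < n" "j < n" for i j k
    using that T by (simp add: uS f_def h_def index_mult_mat_sum)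
  have step: "mat_norm (u (Suc (Suc k)) - u (Suc k)) \<le> \<rho> * mat_norm (u (Suc k) - u k)" for k
  proof -
    let ?d = "u (Suc k) - u k"
    have d: "?d \<in> carrier_mat n n" by simp
    have e: "u (Suc (Suc k)) - u (Suc k) = h (u (Suc k) * ?d + ?d * u k)"
    proof -
      have "u (Suc k) * ?d = u (Suc k) * u (Suc k) - u (Suc k) * u k" by (rule mult_minus_distrib_mat[of _ n n _ n]) auto
      moreover have "?d * u k = u (Suc k) * u k - u k * u k" by (rule minus_mult_distrib_mat[of _ n n _ _ n]) auto
      ultimately have "u (Suc k) * ?d + ?d * u k = u (Suc k) * u (Suc k) - u k * u k" by (intro eq_matI) auto
      moreover define A where "A = u (Suc k) * u (Suc k)"
      moreover define B where "B = u k * u k"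
      ultimately have d': "u (Suc k) * ?d + ?d * u k = A - B" by simp
      have AB: "A \<in> carrier_mat n n" "B \<in> carrier_mat n n" by (simp_all add: A_def B_def)
      have "u (Suc (Suc k)) = h (T + A)" "u (Suc k) = h (T + B)" unfolding A_def B_def by (simp_all only: uS f_def)
      moreover have "h (T + A) - h (T + B) = h (A - B)" by (rule eq_matI) (use AB T in \<open>auto simp: h_def simp flip: scaleR_diff_right\<close>)
      ultimately show ?thesis unfolding d' by metis
    qed
    have "mat_norm (u (Suc (Suc k)) - u (Suc k)) \<le> mat_norm (u (Suc k) * ?d + ?d * u k) / 2" unfolding e by (rule hn) simp
    also have "mat_norm (u (Suc k) * ?d + ?d * u k) \<le> mat_norm (u (Suc k)) * mat_norm ?d + mat_norm ?d * mat_norm (u k)"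
      by (rule order_trans[OF mat_norm_add[of _ n n]]) (auto intro!: add_mono mat_norm_mult[of _ n n _ n])
    also have "\<dots> \<le> \<rho> * mat_norm ?d + mat_norm ?d * \<rho>" by (intro add_mono mult_mono un) (use \<rho> in auto)
    finally show ?thesis by (simp add: mult.commute)
  qed
  have geo: "mat_norm (u (Suc k) - u k) \<le> \<rho> * \<rho> ^ k" for k
  proof (induction k)
    case 0
    have "u (Suc 0) - u 0 = u (Suc 0)" unfolding u0 by (rule eq_matI) auto
    then show ?case using un[of "Suc 0"] by simp
  next
    case (Suc k)
    have "\<rho> * mat_norm (u (Suc k) - u k) \<le> \<rho> * (\<rho> * \<rho> ^ k)" using Suc \<rho> by (intro mult_left_mono)
    then show ?case using step[of k] by simp
  qed
  have "\<exists>L. (\<lambda>k. u k $$ (i,j)) \<longlonglongrightarrow> L" if ij: "i < n" "j < n" for i j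
  proof -
    have b: "norm (u (Suc k) $$ (i,j) - u k $$ (i,j)) \<le> \<rho> * \<rho> ^ k" for k
    proof -
      have "norm ((u (Suc k) - u k) $$ (i,j)) \<le> mat_norm (u (Suc k) - u k)" by (rule norm_entry_le_mat_norm[of _ n n]) (use ij in auto)
      then show ?thesis using geo[of k] ij by simp
    qed
    have "summable (\<lambda>k. u (Suc k) $$ (i,j) - u k $$ (i,j))" by (rule summable_comparison_test'[where g="\<lambda>k. \<rho> * \<rho> ^ k" and N=0])
        (use \<rho> b in \<open>auto intro!: summable_mult summable_geometric\<close>)
    then have "convergent (\<lambda>k. \<Sum>l<k. u (Suc l) $$ (i,j) - u l $$ (i,j))" by (simp add: summable_iff_convergent)
    then have "convergent (\<lambda>k. u k $$ (i,j) - u 0 $$ (i,j))" by (simp only: sum_lessThan_telescope[where f="\<lambda>k. u k $$ (i,j)"])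
    then show ?thesis using ij by (simp add: u0 convergent_def)
  qed
  then have "\<forall>i j. \<exists>L. i < n \<longrightarrow> j < n \<longrightarrow> (\<lambda>k. u k $$ (i,j)) \<longlonglongrightarrow> L" by blast
  then obtain L where L: "\<And>i j. i < n \<Longrightarrow> j < n \<Longrightarrow> (\<lambda>k. u k $$ (i,j)) \<longlonglongrightarrow> L i j" by metis
  have Ls: "star (L i j) = L j i" if "i < n" "j < n" for i j
  proof -
    have "star (u k $$ (i,j)) = u k $$ (j,i)" for k using arg_cong[OF us[of k], of "\<lambda>M. M $$ (j,i)"] that by simp
    then have "(\<lambda>k. u k $$ (j,i)) \<longlonglongrightarrow> star (L i j)" using tendsto_star[OF L[OF that]] by simp
    then show ?thesis using L[OF that(2,1)] LIMSEQ_unique by blast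
  qed
  have Lf: "2 *\<^sub>R L i j = T $$ (i,j) + (\<Sum>l<n. L i l * L l j)" if ij: "i < n" "j < n" for i j
  proof -
    have "(\<lambda>k. u (Suc k) $$ (i,j)) \<longlonglongrightarrow> L i j" using L[OF ij] by (rule LIMSEQ_Suc)
    moreover have "(\<lambda>k. u (Suc k) $$ (i,j)) \<longlonglongrightarrow> (1/2) *\<^sub>R (T $$ (i,j) + (\<Sum>l<n. L i l * L l j))"
      unfolding ue[OF ij] by (intro tendsto_intros L) (use ij in auto)
    ultimately have "L i j = (1/2) *\<^sub>R (T $$ (i,j) + (\<Sum>l<n. L i l * L l j))" by (rule LIMSEQ_unique)
    then show ?thesis by (metis (no_types) scaleR_half_double scaleR_scaleR scaleR_one mult_2 one_add_one nonzero_eq_divide_eq zero_neq_numeral times_divide_eq_right mult_numeral_1_right)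
  qed
  define D where "D = Matrix.mat n n (\<lambda>(i,j). (if i = j then 1 else 0) - L i j)"
  show ?thesis
  proof (rule that[of D])
    show "D \<in> carrier_mat n n" by (simp add: D_def)
    show "star_mat D = D" by (rule eq_matI) (auto simp: D_def star_diff Ls)
    show "D * D = 1\<^sub>m n - T"
    proof (rule eq_matI)
      fix i j assume "i < dim_row (1\<^sub>m n - T)" "j < dim_col (1\<^sub>m n - T)"
      then have ij: "i < n" "j < n" using T by auto
      have "(D * D) $$ (i,j) = (\<Sum>l<n. ((if i = l then 1 else 0) - L i l) * ((if l = j then 1 else 0) - L l j))"
        using ij by (simp add: D_def index_mult_mat_sum)
      also have "\<dots> = (\<Sum>l<n. (if i = l then (if l = j then 1 else 0) else 0) - (if i = l then L l j else 0)
          - (if l = j then L i l else 0) + L i l * L l j)" by (rule sum.cong) (auto simp: algebra_simps)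
      also have "\<dots> = (if i = j then 1 else 0) - L i j - L i j + (\<Sum>l<n. L i l * L l j)" using ij by (simp add: sum.distrib sum_subtractf)
      also have "\<dots> = (if i = j then 1 else 0) - T $$ (i,j)" using Lf[OF ij] by (simp add: scaleR_2 algebra_simps)
      finally show "(D * D) $$ (i,j) = (1\<^sub>m n - T) $$ (i,j)" using ij T by simp
    qed (use T in \<open>auto simp: D_def\<close>)
  qed
qed

section \<open>Complete order embeddings are completely contractive\<close>

lemma sum_lessThan_add: "(\<Sum>l<m+n. f l) = (\<Sum>l<m. f l) + (\<Sum>l<n. f (m + l :: nat))" for f :: "nat \<Rightarrow> 'a::comm_monoid_add"
  by (induction n) (simp_all add: add.assoc)

definition block_mat :: "real \<Rightarrow> nat \<Rightarrow> 'a::cstar_algebra mat \<Rightarrow> 'a mat \<Rightarrow> 'a mat" where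
  "block_mat c m X Y = Matrix.mat (m + m) (m + m) (\<lambda>(i,j).
     if i < m then (if j < m then (if i = j then of_real c else 0) else X $$ (i, j - m))
     else (if j < m then Y $$ (i - m, j) else (if i = j then of_real c else 0)))"

text \<open>The Cholesky factorization of the block matrix with diagonal blocks \<open>c\<close> and
  off-diagonal blocks \<open>X\<close> and \<open>X\<^sup>*\<close>.\<close>

lemma positive_block_mat:
  fixes X :: "'a::cstar_algebra mat"
  assumes X: "X \<in> carrier_mat m m" and c: "mat_norm X < c"
  shows "positive_mat (block_mat c m X (star_mat X))"
proof -
  have c0: "c > 0" using c mat_norm_nonneg[of X] by linarith
  define T where "T = map_mat (scaleR (1/c\<^sup>2)) (star_mat X * X)"
  have XX: "star_mat X * X \<in> carrier_mat m m" using X by simp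
  have T: "T \<in> carrier_mat m m" using XX by (simp add: T_def)
  have Tij: "T $$ (i,j) = (1/c\<^sup>2) *\<^sub>R (\<Sum>l<m. star (X $$ (l,i)) * X $$ (l,j))" if "i < m" "j < m" for i j
    using that X by (simp add: T_def index_mult_mat_sum)
  have sT: "star_mat T = T" by (rule eq_matI) (use T in \<open>auto simp: Tij star_scaleR star_sum star_mult star_star\<close>)
  have "mat_norm T \<le> (mat_norm X / c)\<^sup>2"
  proof (rule mat_norm_leI[OF T])
    fix v
    have "cnorm m (mact T v) = cnorm m (\<lambda>i. (1/c\<^sup>2) *\<^sub>R mact (star_mat X * X) v i)"
      by (rule cnorm_cong) (use X in \<open>simp add: mact_def T_def scaleR_sum_right\<close>)
    also have "\<dots> = (1/c\<^sup>2) * cnorm m (mact (star_mat X * X) v)" by (simp add: cnorm_scaleR)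
    also have "\<dots> \<le> (1/c\<^sup>2) * (mat_norm (star_mat X * X) * cnorm m v)" by (intro mult_left_mono cnorm_mact_le[OF XX]) simp
    also have "\<dots> \<le> (1/c\<^sup>2) * ((mat_norm X * mat_norm X) * cnorm m v)" using mat_norm_mult[OF star_mat_carrier[OF X] X] mat_norm_star[OF X]
      by (intro mult_left_mono mult_right_mono) auto
    finally show "cnorm m (mact T v) \<le> (mat_norm X / c)\<^sup>2 * cnorm m v" by (simp add: power2_eq_square)
  qed simp
  also have "(mat_norm X / c)\<^sup>2 < 1" using c c0 by (simp add: power_less_one_iff abs_less_iff)
  finally obtain D where D: "D \<in> carrier_mat m m" "star_mat D = D" "D * D = 1\<^sub>m m - T" using matrix_sqrt_one_minus[OF T sT] by blast
  define Z where "Z = Matrix.mat (m + m) (m + m) (\<lambda>(i,j).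
     if i < m then (if j < m then (if i = j then of_real (sqrt c) else 0) else (1 / sqrt c) *\<^sub>R X $$ (i, j - m))
     else (if j < m then 0 else sqrt c *\<^sub>R D $$ (i - m, j - m)))"
  have DD: "(\<Sum>l<m. star (D $$ (l,i)) * D $$ (l,j)) = (if i = j then 1 else 0) - T $$ (i,j)" if "i < m" "j < m" for i j
  proof -
    have "(star_mat D * D) $$ (i,j) = (\<Sum>l<m. star (D $$ (l,i)) * D $$ (l,j))" using that D(1) by (simp add: index_mult_mat_sum)
    then show ?thesis using that D T by simp
  qed
  have "block_mat c m X (star_mat X) = star_mat Z * Z"
  proof (rule eq_matI)
    fix i j assume "i < dim_row (star_mat Z * Z)" "j < dim_col (star_mat Z * Z)"
    then have ij: "i < m + m" "j < m + m" by (auto simp: Z_def)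
    have "(star_mat Z * Z) $$ (i,j) = (\<Sum>l<m + m. star (Z $$ (l,i)) * Z $$ (l,j))" using ij by (simp add: Z_def index_mult_mat_sum)
    also have "\<dots> = (\<Sum>l<m. star (Z $$ (l,i)) * Z $$ (l,j)) + (\<Sum>l<m. star (Z $$ (m + l,i)) * Z $$ (m + l,j))" by (rule sum_lessThan_add)
    also have "\<dots> = block_mat c m X (star_mat X) $$ (i,j)"
    proof (cases "i < m"; cases "j < m")
      assume "i < m" "j < m"
      then show ?thesis using c0 by (simp add: Z_def block_mat_def if_distrib[of star] if_distrib[of "\<lambda>x. x * _"] if_distrib[of "(*) _"]
            cong: if_cong flip: of_real_mult)
    next
      assume "i < m" "\<not> j < m"
      then obtain j' where "j = m + j'" "j' < m" using ij by (metis le_Suc_ex linorder_not_less nat_add_left_cancel_less)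
      then show ?thesis using c0 \<open>i < m\<close>
        by (simp add: Z_def block_mat_def if_distrib[of star] if_distrib[of "\<lambda>x. x * _"] if_distrib[of "\<lambda>x. _ *\<^sub>R x"]
            of_real_def star_scaleR cong: if_cong)
    next
      assume "\<not> i < m" "j < m"
      then obtain i' where "i = m + i'" "i' < m" using ij by (metis le_Suc_ex linorder_not_less nat_add_left_cancel_less)
      then show ?thesis using c0 \<open>j < m\<close> X
        by (simp add: Z_def block_mat_def if_distrib[of "(*) _"] star_scaleR cong: if_cong) (simp add: of_real_def)
    next
      assume nn: "\<not> i < m" "\<not> j < m"
      then obtain i' where i': "i = m + i'" "i' < m" using ij by (metis le_Suc_ex linorder_not_less nat_add_left_cancel_less)
      obtain j' where j': "j = m + j'" "j' < m" using nn ij by (metis le_Suc_ex linorder_not_less nat_add_left_cancel_less)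
      have "(\<Sum>l<m. star (Z $$ (l,i)) * Z $$ (l,j)) = (1/c) *\<^sub>R (\<Sum>l<m. star (X $$ (l,i')) * X $$ (l,j'))"
        using i' j' c0 by (simp add: Z_def star_scaleR scaleR_sum_right)
      also have "\<dots> = c *\<^sub>R T $$ (i',j')" using i' j' c0 by (simp add: Tij power2_eq_square)
      finally have 1: "(\<Sum>l<m. star (Z $$ (l,i)) * Z $$ (l,j)) = c *\<^sub>R T $$ (i',j')" .
      have "(\<Sum>l<m. star (Z $$ (m + l,i)) * Z $$ (m + l,j)) = c *\<^sub>R (\<Sum>l<m. star (D $$ (l,i')) * D $$ (l,j'))"
        using i' j' c0 by (simp add: Z_def star_scaleR scaleR_sum_right)
      then have "(\<Sum>l<m. star (Z $$ (m + l,i)) * Z $$ (m + l,j)) = c *\<^sub>R ((if i' = j' then 1 else 0) - T $$ (i',j'))" using DD i' j' by simp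
      then show ?thesis using 1 i' j' by (simp add: block_mat_def scaleR_diff_right) (simp add: of_real_def)
    qed
    finally show "block_mat c m X (star_mat X) $$ (i,j) = (star_mat Z * Z) $$ (i,j)" by simp
  qed (auto simp: block_mat_def Z_def)
  moreover have "Z \<in> carrier_mat (dim_row (block_mat c m X (star_mat X))) (dim_row (block_mat c m X (star_mat X)))"
    by (simp add: Z_def block_mat_def)
  ultimately show ?thesis unfolding positive_mat_def by blast
qed

text \<open>The polynomial matrix of a pencil; the variable of the unit is replaced by the constant \<open>1\<close>.\<close>

definition pencil_poly :: "'a::one set \<Rightarrow> nat \<Rightarrow> ('a \<Rightarrow> complex mat) \<Rightarrow> 'a nc_poly mat" where
  "pencil_poly S m B = Matrix.mat m m (\<lambda>(i,j). const (B 1 $$ (i,j)) +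
     (\<Sum>y\<in>coeff_support (S - {1}) m B. const (B y $$ (i,j)) * nc_var y))"

lemma pencil_poly_carrier [simp]: "pencil_poly S m B \<in> carrier_mat m m" by (simp add: pencil_poly_def)

locale max_system =
  fixes V :: "'a::cstar_algebra set" and \<iota> :: "'a \<Rightarrow> 'b::cstar_algebra"
  assumes V: "operator_system V" and \<iota>: "complete_order_embedding V \<iota>" and \<iota>_one: "\<iota> 1 = 1"
begin

lemma V_add: "x \<in> V \<Longrightarrow> y \<in> V \<Longrightarrow> x + y \<in> V" using V complex_vector.subspace_add by (auto simp: operator_system_def)
lemma V_scale: "x \<in> V \<Longrightarrow> c *\<^sub>C x \<in> V" using V complex_vector.subspace_scale by (auto simp: operator_system_def)
lemma V_zero: "0 \<in> V" using V complex_vector.subspace_0 by (auto simp: operator_system_def)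
lemma V_one: "1 \<in> V" using V by (simp add: operator_system_def)
lemma V_star: "x \<in> V \<Longrightarrow> star x \<in> V" using V by (simp add: operator_system_def)
lemma V_sum: "(\<And>x. x \<in> A \<Longrightarrow> f x \<in> V) \<Longrightarrow> sum f A \<in> V" by (induction A rule: infinite_finite_induct) (auto intro: V_zero V_add)
lemma V_of_real: "of_real r \<in> V" using V_scale[OF V_one, of "of_real r"] unfolding scaleC_of_real by (simp add: of_real_def)

lemma \<iota>_add: "x \<in> V \<Longrightarrow> y \<in> V \<Longrightarrow> \<iota> (x + y) = \<iota> x + \<iota> y" using \<iota> by (simp add: complete_order_embedding_def)
lemma \<iota>_scale: "x \<in> V \<Longrightarrow> \<iota> (c *\<^sub>C x) = c *\<^sub>C \<iota> x" using \<iota> by (simp add: complete_order_embedding_def)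
lemma \<iota>_zero: "\<iota> 0 = 0" using \<iota>_scale[OF V_one, of 0] by simp
lemma \<iota>_sum: "(\<And>x. x \<in> A \<Longrightarrow> f x \<in> V) \<Longrightarrow> \<iota> (sum f A) = (\<Sum>x\<in>A. \<iota> (f x))"
  by (induction A rule: infinite_finite_induct) (auto simp: \<iota>_zero \<iota>_add V_sum)
lemma \<iota>_of_real: "\<iota> (of_real r) = of_real r"
  using \<iota>_scale[OF V_one, of "of_real r"] unfolding scaleC_of_real by (simp add: of_real_def \<iota>_one)

lemma block_map:
  assumes X: "X \<in> mats_over V m" and c: "mat_norm X < c"
  obtains W where "W \<in> carrier_mat (m + m) (m + m)"
    "map_mat \<iota> (block_mat c m X (star_mat X)) = star_mat W * W"
proof -
  have Xc: "X \<in> carrier_mat m m" "\<And>i j. i < m \<Longrightarrow> j < m \<Longrightarrow> X $$ (i,j) \<in> V" using X by (auto simp: mats_over_def)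
  let ?G = "block_mat c m X (star_mat X)"
  have "?G \<in> mats_over V (m + m)" using Xc by (auto simp: mats_over_def block_mat_def V_of_real V_zero V_star)
  then have "positive_mat (map_mat \<iota> ?G)" using \<iota> positive_block_mat[OF Xc(1) c] by (auto simp: complete_order_embedding_def)
  moreover have "dim_row (map_mat \<iota> ?G) = m + m" by (simp add: block_mat_def)
  ultimately show ?thesis using that unfolding positive_mat_def by auto
qed

text \<open>The image of the block matrix of \<open>x\<close> is positive, hence self-adjoint; its off-diagonal entries give the claim.\<close>

lemma \<iota>_star: assumes x: "x \<in> V" shows "\<iota> (star x) = star (\<iota> x)"
proof -
  define X where "X = Matrix.mat 1 1 (\<lambda>_. x)"
  have X: "X \<in> mats_over V 1" using x by (simp add: X_def mats_over_def)
  obtain W where W: "W \<in> carrier_mat (1 + 1) (1 + 1)"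
    "map_mat \<iota> (block_mat (mat_norm X + 1) 1 X (star_mat X)) = star_mat W * W" using block_map[OF X, of "mat_norm X + 1"] by auto
  have "star_mat (star_mat W * W) = star_mat W * W" using W(1) by (simp add: star_mat_mult[of _ "1+1" "1+1" _ "1+1"])
  then have "star_mat (map_mat \<iota> (block_mat (mat_norm X + 1) 1 X (star_mat X))) $$ (1,0)
     = map_mat \<iota> (block_mat (mat_norm X + 1) 1 X (star_mat X)) $$ (1,0)" using W(2) by simp
  then show ?thesis by (simp add: block_mat_def X_def)
qed

text \<open>Let \<open>T\<close> be the image of \<open>X\<close>. The image of the block matrix is some \<open>W\<^sup>*W\<close>, and its value at the column \<open>(- c\<^sup>-\<^sup>1 T u, u)\<close> is
  \<open>c \<langle>u, u\<rangle> - c\<^sup>-\<^sup>1 \<langle>T u, T u\<rangle>\<close>. The explicit \<open>w\<close> shows that the difference is positive, so that traces can be applied.\<close>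

lemma map_\<iota>_gram:
  assumes X: "X \<in> mats_over V m" and c: "mat_norm X < c"
  obtains w where "(c\<^sup>2) *\<^sub>R cip m u u - cip m (mact (map_mat \<iota> X) u) (mact (map_mat \<iota> X) u) = cip (m + m) w w"
proof -
  have c0: "c > 0" using c mat_norm_nonneg[of X] by linarith
  have Xc: "X \<in> carrier_mat m m" "\<And>i j. i < m \<Longrightarrow> j < m \<Longrightarrow> X $$ (i,j) \<in> V" using X by (auto simp: mats_over_def)
  define T where "T = map_mat \<iota> X"
  have T: "T \<in> carrier_mat m m" using Xc by (simp add: T_def)
  obtain W where W: "W \<in> carrier_mat (m + m) (m + m)"
    "map_mat \<iota> (block_mat c m X (star_mat X)) = star_mat W * W" using block_map[OF X c] by blast
  define v where "v i = (if i < m then - ((1/c) *\<^sub>R mact T u i) else u (i - m))" for i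
  define G where "G = star_mat W * W"
  have G: "G $$ (i,j) = (if i = j then of_real c else 0)" "G $$ (i,m + j) = T $$ (i,j)"
    "G $$ (m + i,j) = star (T $$ (j,i))" "G $$ (m + i,m + j) = (if i = j then of_real c else 0)"
    if "i < m" "j < m" for i j unfolding G_def W(2)[symmetric] using that Xc by (auto simp: block_mat_def T_def \<iota>_of_real \<iota>_zero \<iota>_star)
  have Gc: "G \<in> carrier_mat (m + m) (m + m)" using W(1) by (simp add: G_def)
  have m1: "mact G v i = 0" if i: "i < m" for i
  proof -
    have "mact G v i = (\<Sum>j<m. G $$ (i,j) * v j) + (\<Sum>j<m. G $$ (i,m + j) * v (m + j))" using Gc by (simp add: mact_def sum_lessThan_add)
    also have "\<dots> = (\<Sum>j<m. (if i = j then of_real c else 0) * v j) + (\<Sum>j<m. T $$ (i,j) * u j)" using i by (simp add: G v_def)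
    also have "(\<Sum>j<m. (if i = j then of_real c else 0) * v j) = of_real c * v i"
      using i by (simp add: if_distrib[of "\<lambda>x. x * _"] cong: if_cong)
    also have "\<dots> = - mact T u i" using i c0 by (simp add: v_def of_real_def)
    finally show ?thesis using T by (simp add: mact_def)
  qed
  have m2: "mact G v (m + i) = c *\<^sub>R u i - (1/c) *\<^sub>R mact (star_mat T) (mact T u) i" if i: "i < m" for i
  proof -
    have "mact G v (m + i) = (\<Sum>j<m. G $$ (m + i,j) * v j) + (\<Sum>j<m. G $$ (m + i,m + j) * v (m + j))"
      using Gc by (simp add: mact_def sum_lessThan_add)
    also have "\<dots> = (\<Sum>j<m. star (T $$ (j,i)) * - ((1/c) *\<^sub>R mact T u j)) + (\<Sum>j<m. (if i = j then of_real c else 0) * u j)"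
      using i by (simp add: G v_def)
    also have "(\<Sum>j<m. (if i = j then of_real c else 0) * u j) = c *\<^sub>R u i"
      using i by (simp add: if_distrib[of "\<lambda>x. x * _"] of_real_def cong: if_cong)
    also have "(\<Sum>j<m. star (T $$ (j,i)) * - ((1/c) *\<^sub>R mact T u j)) = - ((1/c) *\<^sub>R mact (star_mat T) (mact T u) i)"
      using i T by (simp add: mact_def[of "star_mat T"] scaleR_sum_right sum_negf)
    finally show ?thesis by simp
  qed
  have "cip (m + m) (mact W v) (mact W v) = cip (m + m) v (mact (star_mat W) (mact W v))" by (rule cip_mact_left[OF W(1)])
  also have "\<dots> = cip (m + m) v (mact G v)" unfolding G_def by (rule cip_cong) (auto simp: mact_mult[OF star_mat_carrier[OF W(1)] W(1)])
  also have "\<dots> = (\<Sum>i<m. star (v i) * mact G v i) + (\<Sum>i<m. star (v (m + i)) * mact G v (m + i))" by (simp add: cip_def sum_lessThan_add)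
  also have "\<dots> = (\<Sum>i<m. star (u i) * (c *\<^sub>R u i - (1/c) *\<^sub>R mact (star_mat T) (mact T u) i))" by (simp add: m1 m2) (simp add: v_def)
  also have "\<dots> = cip m u (\<lambda>i. c *\<^sub>R u i - (1/c) *\<^sub>R mact (star_mat T) (mact T u) i)" by (simp add: cip_def)
  also have "\<dots> = c *\<^sub>R cip m u u - (1/c) *\<^sub>R cip m u (mact (star_mat T) (mact T u))" by (simp add: cip_diff_right cip_scaleR_right)
  also have "cip m u (mact (star_mat T) (mact T u)) = cip m (mact T u) (mact T u)" by (rule cip_mact_left[OF T, symmetric])
  finally have 1: "cip (m + m) (mact W v) (mact W v) = c *\<^sub>R cip m u u - (1/c) *\<^sub>R cip m (mact T u) (mact T u)" .
  show ?thesis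
  proof (rule that[of "\<lambda>i. sqrt c *\<^sub>R mact W v i"])
    have "cip (m + m) (\<lambda>i. sqrt c *\<^sub>R mact W v i) (\<lambda>i. sqrt c *\<^sub>R mact W v i) = c *\<^sub>R cip (m + m) (mact W v) (mact W v)"
      using c0 by (simp add: cip_scaleR_left cip_scaleR_right)
    also have "\<dots> = (c\<^sup>2) *\<^sub>R cip m u u - cip m (mact T u) (mact T u)" unfolding 1 using c0 by (simp add: scaleR_diff_right power2_eq_square)
    finally show "(c\<^sup>2) *\<^sub>R cip m u u - cip m (mact (map_mat \<iota> X) u) (mact (map_mat \<iota> X) u) =
       cip (m + m) (\<lambda>i. sqrt c *\<^sub>R mact W v i) (\<lambda>i. sqrt c *\<^sub>R mact W v i)" by (simp add: T_def)
  qed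
qed

lemma norm_\<iota>_le: assumes x: "x \<in> V" shows "norm (\<iota> x) \<le> norm x"
proof (rule field_le_epsilon)
  fix e :: real assume e: "e > 0"
  define X where "X = Matrix.mat 1 1 (\<lambda>_. x)"
  have X: "X \<in> mats_over V 1" using x by (simp add: X_def mats_over_def)
  have "mat_norm X \<le> norm x"
  proof (rule mat_norm_leI)
    show "X \<in> carrier_mat 1 1" by (simp add: X_def)
    then show "cnorm 1 (mact X v) \<le> norm x * cnorm 1 v" for v using cnorm_mact_crude[of X 1 1 v] by (simp add: X_def)
  qed simp
  then have "mat_norm X < norm x + e" using e by simp
  then obtain w where "((norm x + e)\<^sup>2) *\<^sub>R cip 1 (\<lambda>_. 1) (\<lambda>_. 1) - cip 1 (mact (map_mat \<iota> X) (\<lambda>_. 1)) (mact (map_mat \<iota> X) (\<lambda>_. 1))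
     = cip (1 + 1) w w" using map_\<iota>_gram[OF X] by blast
  then have "of_real ((norm x + e)\<^sup>2) - star (\<iota> x) * \<iota> x = cip (1 + 1) w w"
    by (simp add: cip_def mact_def X_def of_real_def del: of_real_power)
  then have "pos (of_real ((norm x + e)\<^sup>2) - star (\<iota> x) * \<iota> x)" using pos_cip by metis
  from norm_le_if_pos[OF pos_star_mult this] have "(norm (\<iota> x))\<^sup>2 \<le> (norm x + e)\<^sup>2" by (simp add: cstar_identity)
  then show "norm (\<iota> x) \<le> norm x + e" by (rule power2_le_imp_le) (use e in simp)
qed

context
  fixes S assumes S: "S \<subseteq> V" "1 \<in> S"
begin

lemma system_pencil_over:
  assumes "(m, B) \<in> coeff_tuples S"
  shows "system_pencil S m B \<in> mats_over V m"
    "i < m \<Longrightarrow> j < m \<Longrightarrow> system_pencil S m B $$ (i,j) =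
       B 1 $$ (i,j) *\<^sub>C 1 + (\<Sum>y\<in>coeff_support (S - {1}) m B. B y $$ (i,j) *\<^sub>C y)"
proof -
  have B: "B y \<in> carrier_mat m m" if "y \<in> S" for y using assms that by (auto simp: coeff_tuples_def)
  have c: "system_pencil S m B \<in> carrier_mat m m" using B[OF S(2)] by (simp add: system_pencil_def msum_def)
  have e: "system_pencil S m B $$ (i,j) =
       B 1 $$ (i,j) *\<^sub>C 1 + (\<Sum>y\<in>coeff_support (S - {1}) m B. B y $$ (i,j) *\<^sub>C y)" if "i < m" "j < m" for i j
  proof -
    have "dim_row (B y) = m" "dim_col (B y) = m" if "y \<in> coeff_support (S - {1}) m B" for y
      using B[of y] that by (auto simp: coeff_support_def)
    then show ?thesis using that B[OF S(2)] by (simp add: system_pencil_def msum_def)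
  qed
  then show "i < m \<Longrightarrow> j < m \<Longrightarrow> system_pencil S m B $$ (i,j) =
       B 1 $$ (i,j) *\<^sub>C 1 + (\<Sum>y\<in>coeff_support (S - {1}) m B. B y $$ (i,j) *\<^sub>C y)" .
  show "system_pencil S m B \<in> mats_over V m" using c e S by (auto simp: mats_over_def coeff_support_def intro!: V_add V_scale V_one V_sum)
qed

lemma nc_eval_pencil_poly:
  assumes "(m, B) \<in> coeff_tuples S" "i < m" "j < m"
  shows "nc_eval \<iota> (pencil_poly S m B $$ (i,j)) = \<iota> (system_pencil S m B $$ (i,j))"
proof -
  have s: "coeff_support (S - {1}) m B \<subseteq> V" using S by (auto simp: coeff_support_def)
  have "\<iota> (system_pencil S m B $$ (i,j)) =
     B 1 $$ (i,j) *\<^sub>C 1 + (\<Sum>y\<in>coeff_support (S - {1}) m B. B y $$ (i,j) *\<^sub>C \<iota> y)" unfolding system_pencil_over(2)[OF assms] using s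
    by (subst \<iota>_add) (auto simp: V_one V_scale V_sum \<iota>_scale \<iota>_one \<iota>_sum subset_iff intro!: sum.cong V_sum V_scale)
  also have "\<dots> = nc_eval \<iota> (pencil_poly S m B $$ (i,j))"
    using assms by (simp add: pencil_poly_def nc_eval_add nc_eval_sum nc_eval_const_mult)
  finally show ?thesis ..
qed

text \<open>By \<open>map_\<iota>_gram\<close> the image of a pencil acts with at most its norm in \<open>M\<^sub>m(V)\<close> on the Hilbert module, hence also on the Hilbert
  space of every trace; for tracial functionals this bounds the moments.\<close>

lemma trace_pencil_moments:
  assumes \<tau>: "tracial_state \<tau>" and mB: "(m, B) \<in> coeff_tuples S"
  shows "Re (tracial_functional.ptr (\<lambda>P. \<tau> (nc_eval \<iota> P)) ((pstar (pencil_poly S m B) * pencil_poly S m B) ^\<^sub>m k))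
     \<le> mat_norm (system_pencil S m B) ^ (2 * k) * m"
proof -
  interpret t: pos_functional \<tau> by (rule tracial_state_pos_functional[OF \<tau>])
  interpret L: tracial_functional "\<lambda>P. \<tau> (nc_eval \<iota> P)" by (rule tracial_state_functional[OF \<tau>])
  let ?P = "pencil_poly S m B" and ?X = "system_pencil S m B"
  let ?M = "Re (L.ptr ((pstar ?P * ?P) ^\<^sub>m k))"
  have le: "?M \<le> (c\<^sup>2) ^ k * m" if c: "mat_norm ?X < c" for c
  proof (rule L.mat_moments_of_bound)
    fix U :: "'a nc_poly mat" assume U: "U \<in> carrier_mat m m"
    define u where "u j i = nc_eval \<iota> (U $$ (i,j))" for j i
    have PU: "nc_eval \<iota> ((?P * U) $$ (i,j)) = mact (map_mat \<iota> ?X) (u j) i" if "i < m" "j < m" for i j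
    proof -
      have "?X \<in> carrier_mat m m" using system_pencil_over(1)[OF mB] by (simp add: mats_over_def)
      then show ?thesis using that U pencil_poly_carrier[of S m B]
        by (simp add: index_mult_mat_sum mact_def u_def nc_eval_sum nc_eval_mult nc_eval_pencil_poly[OF mB]
            del: pencil_poly_carrier)
    qed
    have sq: "\<tau> (cip m v v) = (\<Sum>i<m. \<tau> (star (v i) * v i))" for v :: "nat \<Rightarrow> 'b" by (simp add: cip_def t.sum)
    have "Re (\<tau> (cip m (mact (map_mat \<iota> ?X) (u j)) (mact (map_mat \<iota> ?X) (u j)))) \<le> c\<^sup>2 * Re (\<tau> (cip m (u j) (u j)))" for j
    proof -
      obtain w where w: "(c\<^sup>2) *\<^sub>R cip m (u j) (u j) - cip m (mact (map_mat \<iota> ?X) (u j)) (mact (map_mat \<iota> ?X) (u j)) = cip (m + m) w w"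
        using map_\<iota>_gram[OF system_pencil_over(1)[OF mB] c] by blast
      have "0 \<le> \<tau> (cip (m + m) w w)" by (rule t.nonneg[OF pos_cip])
      then show ?thesis unfolding w[symmetric] by (simp add: t.diff t.scaleR less_eq_complex_def flip: of_real_power)
    qed
    then have "(\<Sum>j<m. Re (\<tau> (cip m (mact (map_mat \<iota> ?X) (u j)) (mact (map_mat \<iota> ?X) (u j))))) \<le> (\<Sum>j<m. c\<^sup>2 * Re (\<tau> (cip m (u j) (u j))))"
      by (rule sum_mono)
    moreover have "L.ptr (pstar (?P * U) * (?P * U)) = (\<Sum>j<m. \<tau> (cip m (mact (map_mat \<iota> ?X) (u j)) (mact (map_mat \<iota> ?X) (u j))))"
      using U by (subst L.ptr_star_mult[of _ m m]) (auto simp: sq nc_eval_mult nc_eval_star PU)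
    moreover have "L.ptr (pstar U * U) = (\<Sum>j<m. \<tau> (cip m (u j) (u j)))"
      using U by (subst L.ptr_star_mult[of _ m m]) (auto simp: sq nc_eval_mult nc_eval_star u_def)
    ultimately show "Re (L.ptr (pstar (?P * U) * (?P * U))) \<le> c\<^sup>2 * Re (L.ptr (pstar U * U))" by (simp add: sum_distrib_left)
  qed auto
  have "(\<lambda>n. ((mat_norm ?X + 1 / real (Suc n))\<^sup>2) ^ k * m) \<longlonglongrightarrow> ((mat_norm ?X + 0)\<^sup>2) ^ k * m"
    by (intro tendsto_intros) (use LIMSEQ_inverse_real_of_nat in \<open>simp add: inverse_eq_divide\<close>)
  then have "?M \<le> ((mat_norm ?X + 0)\<^sup>2) ^ k * m" by (rule LIMSEQ_le_const) (intro exI[of _ 0] allI impI le, simp)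
  then show ?thesis by (simp add: power_mult)
qed

end

end

section \<open>Positive matrices and norms of their translates\<close>

text \<open>The difference is half the sum of the squares of all \<open>a j - a k\<close>.\<close>

lemma pos_square_of_sum:
  fixes a :: "nat \<Rightarrow> 'a::cstar_algebra"
  shows "pos (real m *\<^sub>R (\<Sum>j<m. star (a j) * a j) - star (\<Sum>j<m. a j) * (\<Sum>j<m. a j))"
proof -
  have half: "(1/2) *\<^sub>R (A + A - B - B) = A - B" for A B :: 'a
  proof -
    have "A + A - B - B = 2 *\<^sub>R (A - B)" by (simp add: scaleR_2)
    then show ?thesis by simp
  qed
  have "(\<Sum>j<m. \<Sum>k<m. star (a j - a k) * (a j - a k)) =
    (\<Sum>j<m. \<Sum>k<m. star (a j) * a j) + (\<Sum>j<m. \<Sum>k<m. star (a k) * a k)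
    - (\<Sum>j<m. \<Sum>k<m. star (a j) * a k) - (\<Sum>j<m. \<Sum>k<m. star (a k) * a j)"
    by (simp add: star_diff left_diff_distrib right_diff_distrib sum.distrib sum_subtractf algebra_simps)
  also have "(\<Sum>j<m. \<Sum>k<m. star (a j) * a j) = real m *\<^sub>R (\<Sum>j<m. star (a j) * a j)"
    by (simp only: sum.swap[of "\<lambda>j k. star (a j) * a j"] sum_constant_scaleR card_lessThan scaleR_sum_right)
  also have "(\<Sum>j<m. \<Sum>k<m. star (a k) * a k) = real m *\<^sub>R (\<Sum>j<m. star (a j) * a j)" by (simp only: sum_constant_scaleR card_lessThan)
  also have "(\<Sum>j<m. \<Sum>k<m. star (a j) * a k) = star (\<Sum>j<m. a j) * (\<Sum>j<m. a j)" by (simp add: star_sum sum_product)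
  also have "(\<Sum>j<m. \<Sum>k<m. star (a k) * a j) = star (\<Sum>j<m. a j) * (\<Sum>j<m. a j)" by (subst sum.swap) (simp add: star_sum sum_product)
  finally have "(1/2) *\<^sub>R (\<Sum>j<m. \<Sum>k<m. star (a j - a k) * (a j - a k)) =
     real m *\<^sub>R (\<Sum>j<m. star (a j) * a j) - star (\<Sum>j<m. a j) * (\<Sum>j<m. a j)" by (simp only: half)
  moreover have "pos ((1/2) *\<^sub>R (\<Sum>j<m. \<Sum>k<m. star (a j - a k) * (a j - a k)))" by (intro pos_scaleR pos_sum pos_star_mult) simp
  ultimately show ?thesis by (simp only:)
qed

text \<open>A bound in the order of the algebra, which is stronger than the bound of the norms.\<close>

lemma cip_mact_order_bound:
  fixes Z :: "'a::cstar_algebra mat"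
  assumes Z: "Z \<in> carrier_mat m n"
  obtains K where "K > 0" "\<And>w. pos (K *\<^sub>R cip n w w - cip m (mact Z w) (mact Z w))"
proof -
  define K where "K = 1 + real n * (\<Sum>i<m. \<Sum>j<n. (norm (Z $$ (i,j)))\<^sup>2)"
  have "pos (K *\<^sub>R cip n w w - cip m (mact Z w) (mact Z w))" for w
  proof -
    have 1: "pos (real n *\<^sub>R (\<Sum>j<n. star (Z $$ (i,j) * w j) * (Z $$ (i,j) * w j)) - star (mact Z w i) * mact Z w i)" for i
      using pos_square_of_sum[of n "\<lambda>j. Z $$ (i,j) * w j"] Z by (simp add: mact_def)
    have 2: "pos ((norm (Z $$ (i,j)))\<^sup>2 *\<^sub>R cip n w w - star (Z $$ (i,j) * w j) * (Z $$ (i,j) * w j))" if j: "j < n" for i j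
    proof -
      have "pos ((norm (Z $$ (i,j)))\<^sup>2 *\<^sub>R (star (w j) * w j) - star (w j) * (star (Z $$ (i,j)) * Z $$ (i,j)) * w j)"
        by (rule pos_conjugate_norm) simp
      moreover have "cip n w w - star (w j) * w j = (\<Sum>i\<in>{..<n}-{j}. star (w i) * w i)" using j by (simp add: cip_def sum_diff1)
      then have "pos (cip n w w - star (w j) * w j)" by (simp add: pos_sum pos_star_mult)
      then have "pos ((norm (Z $$ (i,j)))\<^sup>2 *\<^sub>R (cip n w w - star (w j) * w j))" by (rule pos_scaleR) simp
      ultimately have "pos (((norm (Z $$ (i,j)))\<^sup>2 *\<^sub>R (star (w j) * w j) - star (w j) * (star (Z $$ (i,j)) * Z $$ (i,j)) * w j)
         + (norm (Z $$ (i,j)))\<^sup>2 *\<^sub>R (cip n w w - star (w j) * w j))" by (rule pos_add)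
      then show ?thesis by (simp add: star_mult scaleR_diff_right mult.assoc)
    qed
    let ?a = "\<Sum>i<m. real n *\<^sub>R (\<Sum>j<n. (norm (Z $$ (i,j)))\<^sup>2 *\<^sub>R cip n w w - star (Z $$ (i,j) * w j) * (Z $$ (i,j) * w j))"
    let ?b = "\<Sum>i<m. real n *\<^sub>R (\<Sum>j<n. star (Z $$ (i,j) * w j) * (Z $$ (i,j) * w j)) - star (mact Z w i) * mact Z w i"
    have "pos ?a" by (intro pos_sum pos_scaleR 2) auto
    moreover have "pos ?b" by (intro pos_sum 1)
    ultimately have "pos (cip n w w + (?a + ?b))" by (intro pos_add pos_cip)
    also have "cip n w w + (?a + ?b)
       = K *\<^sub>R cip n w w - cip m (mact Z w) (mact Z w)"
      by (simp add: K_def cip_def[of m] sum_subtractf scaleR_diff_right scaleR_sum_right[symmetric] scaleR_add_left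
          scaleR_sum_left sum_distrib_left scaleR_scaleR[symmetric] del: scaleR_scaleR)
    finally show ?thesis .
  qed
  moreover have "K > 0" by (simp add: K_def add_pos_nonneg sum_nonneg)
  ultimately show ?thesis using that by blast
qed

text \<open>The spectrum of a positive matrix lies in a disk that is tangent to the imaginary axis at \<open>0\<close>,
  and all its translates by imaginary numbers satisfy the corresponding norm bound.\<close>

lemma positive_mat_norm_bounds:
  fixes X :: "'a::cstar_algebra mat"
  assumes X: "X \<in> carrier_mat m m" and pX: "positive_mat X"
  obtains t where "t > 0" "\<And>s. mat_norm (X + Matrix.mat m m (\<lambda>(i,j). if i = j then Complex (- t) s *\<^sub>C 1 else 0)) \<le> sqrt (t\<^sup>2 + s\<^sup>2)"
proof -
  obtain Y where Y: "Y \<in> carrier_mat m m" "X = star_mat Y * Y" using pX X by (auto simp: positive_mat_def)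
  have sY: "star_mat Y \<in> carrier_mat m m" using Y by simp
  obtain K where K: "K > 0" "\<And>w. pos (K *\<^sub>R cip m w w - cip m (mact (star_mat Y) w) (mact (star_mat Y) w))"
    using cip_mact_order_bound[OF sY] by blast
  define t where "t = K / 2"
  have t: "t > 0" using K by (simp add: t_def)
  have "mat_norm (X + Matrix.mat m m (\<lambda>(i,j). if i = j then Complex (- t) s *\<^sub>C 1 else 0)) \<le> sqrt (t\<^sup>2 + s\<^sup>2)" for s
  proof (rule mat_norm_leI)
    let ?E = "Matrix.mat m m (\<lambda>(i,j). if i = j then Complex (- t) s *\<^sub>C 1 else 0) :: 'a mat"
    show "X + ?E \<in> carrier_mat m m" using X by simp
    fix v :: "nat \<Rightarrow> 'a"
    define w where "w = mact Y v"
    define x where "x = mact X v"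
    have xw: "x i = mact (star_mat Y) w i" if "i < m" for i unfolding x_def w_def Y(2) by (rule mact_mult[OF sY Y(1) that])
    have vx: "cip m v x = cip m w w"
    proof -
      have "cip m v x = cip m v (mact (star_mat Y) w)" by (rule cip_cong) (auto simp: xw)
      also have "\<dots> = cip m w w" unfolding w_def by (rule cip_mact_left[OF Y(1), symmetric])
      finally show ?thesis .
    qed
    have xv: "cip m x v = cip m w w" using arg_cong[OF vx, of star] by (simp add: star_cip)
    have xx: "pos (K *\<^sub>R cip m w w - cip m x x)"
    proof -
      have "cip m x x = cip m (mact (star_mat Y) w) (mact (star_mat Y) w)" by (rule cip_cong) (auto simp: xw)
      then show ?thesis using K(2)[of w] by simp
    qed
    define a where "a i = x i - t *\<^sub>R v i" for i
    have av: "cip m a v = cip m w w - t *\<^sub>R cip m v v" unfolding a_def by (simp add: cip_diff_left cip_scaleR_left xv)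
    have va: "cip m v a = cip m w w - t *\<^sub>R cip m v v" unfolding a_def by (simp add: cip_diff_right cip_scaleR_right vx)
    have aa: "cip m a a = cip m x x - t *\<^sub>R cip m w w - (t *\<^sub>R cip m w w - (t * t) *\<^sub>R cip m v v)"
      unfolding a_def by (simp only: cip_diff_left cip_diff_right cip_scaleR_left cip_scaleR_right xv vx) (simp add: scaleR_diff_right)
    have "(t\<^sup>2) *\<^sub>R cip m v v - cip m a a = K *\<^sub>R cip m w w - cip m x x"
    proof -
      have "K *\<^sub>R cip m w w = t *\<^sub>R cip m w w + t *\<^sub>R cip m w w" by (simp add: t_def flip: scaleR_add_left)
      then show ?thesis unfolding aa by (simp add: power2_eq_square)
    qed
    then have "norm (cip m a a) \<le> norm ((t\<^sup>2) *\<^sub>R cip m v v)" using xx by (intro norm_mono_pos pos_cip) simp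
    then have na: "norm (cip m a a) \<le> t\<^sup>2 * norm (cip m v v)" by simp
    define b where "b i = a i + (\<i> * of_real s) *\<^sub>C v i" for i
    have "cip m b b = cip m a a + (s * s) *\<^sub>R cip m v v"
    proof -
      have "cip m b b = cip m a a + (\<i> * of_real s) *\<^sub>C cip m a v +
         (cnj (\<i> * of_real s) *\<^sub>C cip m v a + cnj (\<i> * of_real s) *\<^sub>C ((\<i> * of_real s) *\<^sub>C cip m v v))"
        unfolding b_def by (simp only: cip_add_left cip_add_right cip_scaleC_left cip_scaleC_right scaleC_add_right)
      also have "cnj (\<i> * of_real s) *\<^sub>C cip m v a = - ((\<i> * of_real s) *\<^sub>C cip m a v)" unfolding av va by (simp add: scaleC_minus_left)
      also have "cnj (\<i> * of_real s) *\<^sub>C ((\<i> * of_real s) *\<^sub>C cip m v v) = (s * s) *\<^sub>R cip m v v"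
        by (simp add: scaleC_scaleC flip: scaleC_of_real) (simp add: algebra_simps)?
      finally show ?thesis by simp
    qed
    then have "norm (cip m b b) \<le> norm (cip m a a) + norm ((s * s) *\<^sub>R cip m v v)" using norm_triangle_ineq by metis
    then have "norm (cip m b b) \<le> (t\<^sup>2 + s\<^sup>2) * norm (cip m v v)" using na by (simp add: power2_eq_square distrib_right)
    then have "cnorm m b \<le> sqrt (t\<^sup>2 + s\<^sup>2) * cnorm m v" unfolding cnorm_def by (simp flip: real_sqrt_mult)
    moreover have "cnorm m (mact (X + ?E) v) = cnorm m b"
    proof (rule cnorm_cong)
      fix i assume i: "i < m"
      have "mact (X + ?E) v i = x i + (\<Sum>j<m. (if i = j then Complex (- t) s *\<^sub>C 1 else 0) * v j)"
        using i X by (simp add: mact_def x_def distrib_right sum.distrib)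
      also have "(\<Sum>j<m. (if i = j then Complex (- t) s *\<^sub>C 1 else 0) * v j) = Complex (- t) s *\<^sub>C v i"
        using i by (simp add: if_distrib[of "\<lambda>x. x * _"] mult_scaleC_left cong: if_cong)
      also have "Complex (- t) s *\<^sub>C v i = - (t *\<^sub>R v i) + (\<i> * of_real s) *\<^sub>C v i"
      proof -
        have "Complex (- t) s = of_real (- t) + \<i> * of_real s" by (simp add: complex_eq_iff)
        then show ?thesis by (simp only: scaleC_add_left scaleC_of_real scaleR_minus_left)
      qed
      finally show "mact (X + ?E) v i = b i" by (simp add: b_def a_def)
    qed
    ultimately show "cnorm m (mact (X + ?E) v) \<le> sqrt (t\<^sup>2 + s\<^sup>2) * cnorm m v" by simp
  qed simp
  with t show ?thesis using that by blast
qed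

text \<open>For large \<open>s\<close> of either sign the inequalities force the imaginary part of \<open>w\<close> to vanish; \<open>s = 0\<close> gives the sign of the real part.\<close>

lemma nonneg_of_disk_bounds:
  assumes N: "N \<ge> 0" and t: "t > 0"
    and b: "\<And>s. (cmod (w + Complex (- t) s * of_real N))\<^sup>2 \<le> N * (N * (t\<^sup>2 + s\<^sup>2))"
  shows "0 \<le> w"
proof -
  have e: "(Re w)\<^sup>2 - 2 * t * N * Re w + (Im w)\<^sup>2 + 2 * s * N * Im w \<le> 0" for s
  proof -
    have "(Re w - t * N)\<^sup>2 + (Im w + s * N)\<^sup>2 \<le> N * (N * (t\<^sup>2 + s\<^sup>2))" using b[of s] unfolding cmod_power2 by simp
    then show ?thesis by (simp add: power2_eq_square algebra_simps)
  qed
  show ?thesis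
  proof (cases "N = 0")
    case True
    have "(Re w)\<^sup>2 + (Im w)\<^sup>2 \<le> 0" using e[of 0] True by simp
    then have "w = 0" by (simp add: complex_eq_iff sum_power2_le_zero_iff)
    then show ?thesis by simp
  next
    case False
    have im: "Im w = 0"
    proof (rule ccontr)
      assume i: "Im w \<noteq> 0"
      define q where "q = (Re w)\<^sup>2 - 2 * t * N * Re w + (Im w)\<^sup>2"
      have "q + 2 * ((1 - q) / (2 * N * Im w)) * N * Im w = 1" using i False by (simp add: field_simps)
      then show False using e[of "(1 - q) / (2 * N * Im w)"] by (simp add: q_def)
    qed
    have "0 \<le> Re w"
    proof (rule ccontr)
      assume "\<not> 0 \<le> Re w"
      then have "(Re w)\<^sup>2 > 0" "(2 * t * N) * Re w \<le> 0" using t N by (auto intro!: mult_nonneg_nonpos)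
      moreover have "(Re w)\<^sup>2 \<le> (2 * t * N) * Re w" using e[of 0] im by simp
      ultimately show False by linarith
    qed
    with im show ?thesis by (simp add: less_eq_complex_def)
  qed
qed

section \<open>Density of polynomials\<close>

text \<open>The closure of the set of values of polynomials is a C*-subalgebra.\<close>

lemma nc_eval_dense:
  fixes a :: "'i \<Rightarrow> 'b::cstar_algebra"
  assumes gen: "cstar_generates X" and X: "X \<subseteq> nc_eval a ` nc_polys I" and e: "e > 0"
  obtains P where "P \<in> nc_polys I" "norm (nc_eval a P - x) < e"
proof -
  let ?A = "nc_eval a ` nc_polys I"
  have im: "\<And>x. x \<in> closure ?A \<longleftrightarrow> (\<exists>P. (\<forall>n. P n \<in> nc_polys I) \<and> (\<lambda>n. nc_eval a (P n :: 'i nc_poly)) \<longlonglongrightarrow> x)"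
  proof
    fix x assume "x \<in> closure ?A"
    then obtain f where f: "\<And>n. f n \<in> ?A" "f \<longlonglongrightarrow> x" unfolding closure_sequential by blast
    then have "\<forall>n. \<exists>P. P \<in> nc_polys I \<and> f n = nc_eval a P" by blast
    then obtain P where P: "\<And>n. P n \<in> nc_polys I" "\<And>n. f n = nc_eval a (P n)" by metis
    have "f = (\<lambda>n. nc_eval a (P n))" using P(2) by (simp add: fun_eq_iff)
    then show "\<exists>P. (\<forall>n. P n \<in> nc_polys I) \<and> (\<lambda>n. nc_eval a (P n)) \<longlonglongrightarrow> x" using f(2) P(1) by blast
  next
    fix x assume "\<exists>P. (\<forall>n. P n \<in> nc_polys I) \<and> (\<lambda>n. nc_eval a (P n)) \<longlonglongrightarrow> x"
    then obtain P where P: "\<And>n. P n \<in> nc_polys I" "(\<lambda>n. nc_eval a (P n)) \<longlonglongrightarrow> x" by blast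
    then show "x \<in> closure ?A" unfolding closure_sequential by (intro exI[of _ "\<lambda>n. nc_eval a (P n)"]) simp
  qed
  have imE: "\<exists>P. (\<forall>n. P n \<in> nc_polys I) \<and> (\<lambda>n. nc_eval a (P n :: 'i nc_poly)) \<longlonglongrightarrow> x" if "x \<in> closure ?A" for x using im that by blast
  have add: "x + y \<in> closure ?A" if xy: "x \<in> closure ?A" "y \<in> closure ?A" for x y
  proof -
    obtain P where "\<And>n. P n \<in> nc_polys I" "(\<lambda>n. nc_eval a (P n)) \<longlonglongrightarrow> x" using imE[OF xy(1)] by blast
    moreover obtain Q where "\<And>n. Q n \<in> nc_polys I" "(\<lambda>n. nc_eval a (Q n)) \<longlonglongrightarrow> y" using imE[OF xy(2)] by blast
    ultimately show ?thesis unfolding im by (intro exI[of _ "\<lambda>n. P n + Q n"]) (simp add: nc_polys_add nc_eval_add tendsto_add)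
  qed
  have mult: "x * y \<in> closure ?A" if xy: "x \<in> closure ?A" "y \<in> closure ?A" for x y
  proof -
    obtain P where "\<And>n. P n \<in> nc_polys I" "(\<lambda>n. nc_eval a (P n)) \<longlonglongrightarrow> x" using imE[OF xy(1)] by blast
    moreover obtain Q where "\<And>n. Q n \<in> nc_polys I" "(\<lambda>n. nc_eval a (Q n)) \<longlonglongrightarrow> y" using imE[OF xy(2)] by blast
    ultimately show ?thesis unfolding im by (intro exI[of _ "\<lambda>n. P n * Q n"]) (simp add: nc_polys_mult nc_eval_mult tendsto_mult)
  qed
  have star: "star x \<in> closure ?A" if x: "x \<in> closure ?A" for x
  proof -
    obtain P where "\<And>n. P n \<in> nc_polys I" "(\<lambda>n. nc_eval a (P n)) \<longlonglongrightarrow> x" using imE[OF x] by blast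
    then show ?thesis unfolding im by (intro exI[of _ "\<lambda>n. nc_star (P n)"]) (simp add: nc_polys_star nc_eval_star tendsto_star)
  qed
  have one: "1 \<in> closure ?A" by (rule subsetD[OF closure_subset]) (use nc_eval_one[of a] nc_polys_one in \<open>metis imageI\<close>)
  have const: "c *\<^sub>C 1 \<in> closure ?A" for c by (rule subsetD[OF closure_subset]) (use nc_eval_const[of a c] nc_polys_const in \<open>metis imageI\<close>)
  have scale: "c *\<^sub>C x \<in> closure ?A" if "x \<in> closure ?A" for c x using mult[OF const[of c] that] by (simp add: mult_scaleC_left)
  have zero: "0 \<in> closure ?A" using const[of 0] by simp
  have "cstar_subalgebra (closure ?A)" unfolding cstar_subalgebra_def complex_vector.subspace_def using add mult star one scale zero by simp
  moreover have "X \<subseteq> closure ?A" using X closure_subset by blast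
  ultimately have "cstar_subalgebra hull X \<subseteq> closure ?A" by (intro hull_minimal)
  then have "x \<in> closure ?A" using gen by (auto simp: cstar_generates_def)
  then obtain y where "y \<in> ?A" "dist y x < e" using e by (meson closure_approachable)
  then show ?thesis using that by (auto simp: dist_norm)
qed

section \<open>Laws satisfying the norm bounds of all pencils come from traces\<close>

lemma (in pos_functional) tendsto:
  assumes "f \<longlonglongrightarrow> x" shows "(\<lambda>n. \<tau> (f n)) \<longlonglongrightarrow> \<tau> x"
proof -
  have "(\<lambda>n. norm (f n - x)) \<longlonglongrightarrow> 0" using assms by (simp add: LIM_zero tendsto_norm_zero)
  then have "(\<lambda>n. \<tau> (f n) - \<tau> x) \<longlonglongrightarrow> 0" by (rule Lim_null_comparison[rotated]) (simp add: norm_le flip: diff)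
  then show ?thesis by (rule LIM_zero_cancel)
qed

locale pencil_law = max_system V \<iota> + gns l wd
  for V :: "'a::cstar_algebra set" and \<iota> :: "'a \<Rightarrow> 'b::cstar_algebra"
    and l :: "'a nc_poly \<Rightarrow> complex" and wd :: "'a list \<Rightarrow> 'a nc_word" +
  fixes S :: "'a set"
  assumes span_S: "complex_vector.span S = V" and star_S: "star ` S = S" and one_S: "1 \<in> S"
    and max: "maximal_cstar V \<iota>"
    and l_unit: "l (nc_star (nc_var 1 - 1) * (nc_var 1 - 1)) = 0"
    and l_moments: "(m, B) \<in> coeff_tuples S \<Longrightarrow>
      Re (ptr ((pstar (pencil_poly S m B) * pencil_poly S m B) ^\<^sub>m k)) \<le> m * (mat_norm (system_pencil S m B))\<^sup>2 ^ k"
begin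

lemma S_V: "S \<subseteq> V" using complex_vector.span_superset span_S by blast

text \<open>The elements of \<open>S\<close> may be linearly dependent, so an element of \<open>V\<close> is the value \<open>val c\<close> of several families \<open>c\<close>. By \<open>pol_bound\<close>,
  the polynomials \<open>pol c\<close> of all these families act as the same operator.\<close>

definition coef :: "('a \<Rightarrow> complex) \<Rightarrow> bool" where
  "coef c \<longleftrightarrow> finite {y. c y \<noteq> 0} \<and> {y. c y \<noteq> 0} \<subseteq> S"
definition letter :: "'a \<Rightarrow> 'a nc_poly" where "letter y = (if y = 1 then 1 else nc_var y)"
definition pol :: "('a \<Rightarrow> complex) \<Rightarrow> 'a nc_poly" where
  "pol c = (\<Sum>y | c y \<noteq> 0. const (c y) * letter y)"
definition val :: "('a \<Rightarrow> complex) \<Rightarrow> 'a" where "val c = (\<Sum>y | c y \<noteq> 0. c y *\<^sub>C y)"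

lemma pol_superset: "finite T \<Longrightarrow> {y. c y \<noteq> 0} \<subseteq> T \<Longrightarrow> pol c = (\<Sum>y\<in>T. const (c y) * letter y)"
  unfolding pol_def by (rule sum.mono_neutral_left) auto
lemma val_superset: "finite T \<Longrightarrow> {y. c y \<noteq> 0} \<subseteq> T \<Longrightarrow> val c = (\<Sum>y\<in>T. c y *\<^sub>C y)" unfolding val_def by (rule sum.mono_neutral_left) auto

lemma coef_combination:
  assumes "coef c" "coef d"
  shows "coef (\<lambda>y. c y + k * d y)" "pol (\<lambda>y. c y + k * d y) = pol c + const k * pol d"
    "val (\<lambda>y. c y + k * d y) = val c + k *\<^sub>C val d"
proof -
  let ?T = "{y. c y \<noteq> 0} \<union> {y. d y \<noteq> 0}"
  have T: "finite ?T" "?T \<subseteq> S" using assms by (auto simp: coef_def)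
  have sub: "{y. c y + k * d y \<noteq> 0} \<subseteq> ?T" by auto
  show "coef (\<lambda>y. c y + k * d y)" using T sub finite_subset[OF sub T(1)] by (auto simp: coef_def)
  have "const (c y + k * d y) * letter y = const (c y) * letter y + const k * (const (d y) * letter y)" for y
    by (simp add: single_add distrib_right mult_single flip: mult.assoc)
  then show "pol (\<lambda>y. c y + k * d y) = pol c + const k * pol d"
    using T sub by (subst (1 2 3) pol_superset[of ?T]) (auto simp: sum.distrib sum_distrib_left)
  show "val (\<lambda>y. c y + k * d y) = val c + k *\<^sub>C val d" using T sub by (subst (1 2 3) val_superset[of ?T])
      (auto simp: sum.distrib complex_vector.scale_sum_right scaleC_add_left scaleC_scaleC)
qed

lemma coef_unit: "coef (\<lambda>y. if y = x then c else 0)" if "x \<in> S" using that by (auto simp: coef_def)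
lemma pol_unit: "pol (\<lambda>y. if y = x then c else 0) = const c * letter x" by (subst pol_superset[of "{x}"]) auto
lemma val_unit: "val (\<lambda>y. if y = x then c else 0) = c *\<^sub>C x" by (subst val_superset[of "{x}"]) auto

lemma coef_ex: assumes "x \<in> V" shows "\<exists>c. coef c \<and> val c = x"
proof -
  obtain T r where T: "finite T" "T \<subseteq> S" "x = (\<Sum>y\<in>T. r y *\<^sub>C y)"
    using assms unfolding span_S[symmetric] complex_vector.span_explicit by blast
  let ?c = "\<lambda>y. if y \<in> T then r y else 0"
  have s: "{y. ?c y \<noteq> 0} \<subseteq> T" by auto
  have "coef ?c" using T s finite_subset[OF s] by (auto simp: coef_def)
  moreover have "val ?c = x" unfolding val_superset[OF T(1) s] T(3) by (rule sum.cong) auto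
  ultimately show ?thesis by blast
qed

definition cf :: "'a \<Rightarrow> 'a \<Rightarrow> complex" where "cf x = (SOME c. coef c \<and> val c = x)"
lemma cf: assumes "x \<in> V" shows "coef (cf x)" "val (cf x) = x" using someI_ex[OF coef_ex[OF assms]] by (auto simp: cf_def)

text \<open>The moment bounds say that the rows of a matrix of polynomials of degree one act on the
  columns over the polynomials with the norm of the matrix of their values.\<close>

lemma column_bound:
  assumes m: "m \<ge> 1" and C: "\<And>i j. i < m \<Longrightarrow> j < m \<Longrightarrow> coef (C i j)"
  shows "(\<Sum>i<m. (sn (\<Sum>j<m. pol (C i j) * p j))\<^sup>2) \<le>
     (mat_norm (Matrix.mat m m (\<lambda>(i,j). val (C i j))))\<^sup>2 * (\<Sum>j<m. (sn (p j))\<^sup>2)"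
proof -
  define B where "B = restrict (\<lambda>y. Matrix.mat m m (\<lambda>(i,j). C i j y)) S"
  define T where "T = (\<Union>i<m. \<Union>j<m. {y. C i j y \<noteq> 0})"
  have T: "finite T" using C by (auto simp: T_def coef_def)
  have suppT: "coeff_support S m B \<subseteq> T"
  proof
    fix y assume y: "y \<in> coeff_support S m B"
    then have "Matrix.mat m m (\<lambda>(i,j). C i j y) \<noteq> 0\<^sub>m m m" by (auto simp: coeff_support_def B_def)
    then have "\<exists>i<m. \<exists>j<m. C i j y \<noteq> 0"
    proof (rule contrapos_np)
      assume "\<not> (\<exists>i<m. \<exists>j<m. C i j y \<noteq> 0)"
      then show "Matrix.mat m m (\<lambda>(i,j). C i j y) = 0\<^sub>m m m" by (intro eq_matI) auto
    qed
    then show "y \<in> T" by (auto simp: T_def)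
  qed
  have mB: "(m, B) \<in> coeff_tuples S" using m T finite_subset[OF suppT] by (auto simp: coeff_tuples_def B_def)
  let ?T = "coeff_support (S - {1}) m B"
  have fT: "finite ?T" "1 \<notin> ?T" using finite_subset[OF suppT T] finite_subset[of ?T "coeff_support S m B"] by (auto simp: coeff_support_def)
  have sub: "{y. C i j y \<noteq> 0} \<subseteq> insert 1 ?T" if ij: "i < m" "j < m" for i j
  proof
    fix y assume y: "y \<in> {y. C i j y \<noteq> 0}"
    then have yS: "y \<in> S" using C[OF ij] by (auto simp: coef_def)
    have "B y $$ (i,j) \<noteq> 0" using y yS ij by (simp add: B_def)
    then have "B y \<noteq> 0\<^sub>m m m" using ij by auto
    then show "y \<in> insert 1 ?T" using yS by (auto simp: coeff_support_def)
  qed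
  have B1: "B 1 $$ (i,j) = C i j 1" if "i < m" "j < m" for i j using that one_S by (simp add: B_def)
  have TS: "?T \<subseteq> S" by (auto simp: coeff_support_def)
  have P: "pencil_poly S m B $$ (i,j) = pol (C i j)" if ij: "i < m" "j < m" for i j
  proof -
    have "pol (C i j) = const (C i j 1) + (\<Sum>y\<in>?T. const (C i j y) * letter y)"
      using fT by (subst pol_superset[OF _ sub[OF ij]]) (auto simp: letter_def)
    also have "(\<Sum>y\<in>?T. const (C i j y) * letter y) = (\<Sum>y\<in>?T. const (B y $$ (i,j)) * nc_var y)"
      using ij fT(2) TS by (intro sum.cong) (auto simp: letter_def B_def)
    finally show ?thesis using ij one_S by (simp add: pencil_poly_def B_def)
  qed
  have X: "system_pencil S m B $$ (i,j) = val (C i j)" if ij: "i < m" "j < m" for i j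
  proof -
    have "val (C i j) = C i j 1 *\<^sub>C 1 + (\<Sum>y\<in>?T. C i j y *\<^sub>C y)" using fT by (subst val_superset[OF _ sub[OF ij]]) auto
    also have "(\<Sum>y\<in>?T. C i j y *\<^sub>C y) = (\<Sum>y\<in>?T. B y $$ (i,j) *\<^sub>C y)" using ij TS by (intro sum.cong) (auto simp: B_def)
    finally show ?thesis using ij one_S unfolding system_pencil_over(2)[OF S_V one_S mB ij] by (simp add: B1)
  qed
  have "system_pencil S m B \<in> carrier_mat m m" using system_pencil_over(1)[OF S_V one_S mB] by (simp add: mats_over_def)
  then have XX: "system_pencil S m B = Matrix.mat m m (\<lambda>(i,j). val (C i j))" by (intro eq_matI) (auto simp: X)
  let ?P = "pencil_poly S m B"
  define U where "U = Matrix.mat m m (\<lambda>(i,j). if j = 0 then p i else 0)"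
  have U: "U \<in> carrier_mat m m" by (simp add: U_def)
  have PU: "(?P * U) $$ (i,j) = (if j = 0 then \<Sum>k<m. pol (C i k) * p k else 0)" if ij: "i < m" "j < m" for i j
    using ij U pencil_poly_carrier[of S m B] by (simp add: index_mult_mat_sum P U_def del: pencil_poly_carrier)
  have pU: "U $$ (i,j) = (if j = 0 then p i else 0)" if "i < m" "j < m" for i j using that by (simp add: U_def)
  have PUc: "?P * U \<in> carrier_mat m m" using U by (intro mult_carrier_mat[of _ m m]) auto
  have pt: "Re (ptr (pstar Y * Y)) = (\<Sum>i<m. (sn (q i))\<^sup>2)"
    if Y: "Y \<in> carrier_mat m m" "\<And>i j. i < m \<Longrightarrow> j < m \<Longrightarrow> Y $$ (i,j) = (if j = 0 then q i else 0)" for Y q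
  proof -
    have "ptr (pstar Y * Y) = (\<Sum>j<m. if j = 0 then (\<Sum>i<m. l (nc_star (q i) * q i)) else 0)"
      unfolding ptr_star_mult[OF Y(1) Y(1)] by (intro sum.cong) (auto simp: Y(2))
    also have "\<dots> = (\<Sum>i<m. l (nc_star (q i) * q i))" using m by simp
    finally show ?thesis by (simp add: sn_square)
  qed
  have "Re (ptr (pstar (?P * U) * (?P * U))) \<le>
     (mat_norm (system_pencil S m B))\<^sup>2 * Re (ptr (pstar U * U))"
    by (rule mat_bound_of_moments[where C="real m" and m=m]) (use l_moments[OF mB] U in auto)
  moreover have "Re (ptr (pstar (?P * U) * (?P * U))) = (\<Sum>i<m. (sn (\<Sum>j<m. pol (C i j) * p j))\<^sup>2)" by (rule pt[OF PUc PU])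
  moreover have "Re (ptr (pstar U * U)) = (\<Sum>j<m. (sn (p j))\<^sup>2)" by (rule pt[OF U pU])
  ultimately show ?thesis unfolding XX by simp
qed

lemma pol_bound: assumes c: "coef c" shows "sn (pol c * p) \<le> norm (val c) * sn p"
proof (rule power2_le_imp_le)
  let ?v = "Matrix.mat 1 1 (\<lambda>(i,j). val c)"
  have n: "mat_norm ?v \<le> norm (val c)"
  proof (rule mat_norm_leI)
    show X: "?v \<in> carrier_mat 1 1" by simp
    show "cnorm 1 (mact ?v v) \<le> norm (val c) * cnorm 1 v" for v using cnorm_mact_crude[OF X, of v] by simp
  qed simp
  have "(sn (pol c * p))\<^sup>2 \<le> (mat_norm ?v)\<^sup>2 * (sn p)\<^sup>2" using column_bound[of 1 "\<lambda>_ _. c" "\<lambda>_. p"] c by simp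
  also have "\<dots> \<le> (norm (val c))\<^sup>2 * (sn p)\<^sup>2" by (intro mult_right_mono power_mono n) (auto simp: mat_norm_nonneg)
  finally show "(sn (pol c * p))\<^sup>2 \<le> (norm (val c) * sn p)\<^sup>2" by (simp add: power_mult_distrib)
qed simp

lemma bdd_pol: assumes "coef c" shows "bdd_map (\<lambda>p. pol c * p)"
proof -
  have "pol c * (const k * p) = const k * (pol c * p)" for k p by (metis const_commute mult.assoc)
  then show ?thesis using pol_bound[OF assms] by (auto simp: bdd_map_def distrib_left)
qed

definition \<phi> :: "'a \<Rightarrow> ('a list \<Rightarrow> complex) \<Rightarrow> ('a list \<Rightarrow> complex)" where
  "\<phi> x = op (\<lambda>p. pol (cf x) * p)"

lemma cau_pol: "coef c \<Longrightarrow> cau p \<Longrightarrow> cau (\<lambda>n. pol c * p n)" using cau_bdd_map[OF bdd_pol] by blast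

lemma \<phi>_vec: assumes c: "coef c" and p: "cau p" shows "\<phi> (val c) (vec p) = vec (\<lambda>n. pol c * p n)"
proof -
  have v: "val c \<in> V" unfolding val_def using c S_V by (intro V_sum V_scale) (auto simp: coef_def)
  have 0: "sn (pol (cf (val c)) * p n - pol c * p n) = 0" for n
  proof -
    let ?d = "\<lambda>y. cf (val c) y + (-1) * c y"
    have d: "coef ?d" by (rule coef_combination(1)[OF cf(1)[OF v] c])
    have "sn (pol ?d * p n) \<le> norm (val ?d) * sn (p n)" by (rule pol_bound[OF d])
    also have "val ?d = 0" unfolding coef_combination(3)[OF cf(1)[OF v] c] cf(2)[OF v] by simp
    finally have "sn (pol ?d * p n) = 0" using sn_nonneg[of "pol ?d * p n"] unfolding norm_zero mult_zero_left by linarith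
    then show ?thesis unfolding coef_combination(2)[OF cf(1)[OF v] c] by (simp add: left_diff_distrib flip: uminus_eq_const)
  qed
  show ?thesis unfolding \<phi>_def op_vec[OF bdd_pol[OF cf(1)[OF v]] p]
    by (rule vec_cong[OF cau_pol[OF cf(1)[OF v] p] cau_pol[OF c p]]) (simp add: 0)
qed

lemma \<phi>_combination:
  assumes x: "x \<in> V" and y: "y \<in> V" and f: "f \<in> H"
  shows "\<phi> (x + k *\<^sub>C y) f = (\<lambda>w. \<phi> x f w + k * \<phi> y f w)"
proof -
  obtain p where p: "cau p" "f = vec p" using f by (rule H_cases)
  note c = cf(1)[OF x] and d = cf(1)[OF y]
  have "\<phi> (val (\<lambda>z. cf x z + k * cf y z)) f = vec (\<lambda>n. pol (cf x) * p n + const k * (pol (cf y) * p n))"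
    unfolding p(2) \<phi>_vec[OF coef_combination(1)[OF c d] p(1)] coef_combination(2)[OF c d] by (simp add: distrib_right mult.assoc)
  also have "\<dots> = vec (\<lambda>n. pol (cf x) * p n) + (\<lambda>w. k * vec (\<lambda>n. pol (cf y) * p n) w)" unfolding vec_scale[OF cau_pol[OF d p(1)], symmetric]
    by (rule vec_add[OF cau_pol[OF c p(1)] cau_scale[OF cau_pol[OF d p(1)]]])
  also have "vec (\<lambda>n. pol (cf x) * p n) = \<phi> x f" using \<phi>_vec[OF c p(1)] cf(2)[OF x] p(2) by simp
  also have "vec (\<lambda>n. pol (cf y) * p n) = \<phi> y f" using \<phi>_vec[OF d p(1)] cf(2)[OF y] p(2) by simp
  finally show ?thesis unfolding coef_combination(3)[OF c d] cf(2)[OF x] cf(2)[OF y] by (simp add: fun_eq_iff)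
qed

lemma \<phi>_one: "f \<in> H \<Longrightarrow> \<phi> 1 f = f"
proof (erule H_cases)
  fix p assume p: "cau p" "f = vec p"
  show "\<phi> 1 f = f" using \<phi>_vec[OF coef_unit[OF one_S, of 1] p(1)] p(2) by (simp add: val_unit pol_unit letter_def scaleC_one)
qed

text \<open>Positivity of \<open>X\<close> is transported by norm bounds of the translates of \<open>X\<close> by scalars: these are pencils, to which \<open>column_bound\<close>
  applies.\<close>

lemma \<phi>_positive:
  assumes X: "X \<in> mats_over V m" "positive_mat X" and \<xi>: "\<forall>i<m. \<xi> i \<in> H"
  shows "0 \<le> (\<Sum>i<m. \<Sum>j<m. ip (\<xi> i) (\<phi> (X $$ (i,j)) (\<xi> j)))"
proof (cases "m = 0")
  case False
  then have m: "m \<ge> 1" by simp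
  have Xc: "X \<in> carrier_mat m m" "\<And>i j. i < m \<Longrightarrow> j < m \<Longrightarrow> X $$ (i,j) \<in> V" using X(1) by (auto simp: mats_over_def)
  have "\<forall>i. \<exists>p. i < m \<longrightarrow> cau p \<and> \<xi> i = vec p" using \<xi> by (auto simp: H_def)
  then obtain p where p: "\<And>i. i < m \<Longrightarrow> cau (p i)" "\<And>i. i < m \<Longrightarrow> \<xi> i = vec (p i)" by metis
  let ?c = "\<lambda>i j. cf (X $$ (i,j))"
  obtain t where t: "t > 0" "\<And>s. mat_norm (X + Matrix.mat m m (\<lambda>(i,j). if i = j then Complex (- t) s *\<^sub>C 1 else 0)) \<le> sqrt (t\<^sup>2 + s\<^sup>2)"
    using positive_mat_norm_bounds[OF Xc(1) X(2)] by blast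
  have main: "0 \<le> (\<Sum>i<m. \<Sum>j<m. l (nc_star (P i) * (pol (?c i j) * P j)))" for P
  proof (rule nonneg_of_disk_bounds[OF _ t(1)])
    define N where "N = (\<Sum>i<m. (sn (P i))\<^sup>2)"
    show "0 \<le> (\<Sum>i<m. (sn (P i))\<^sup>2)" by (intro sum_nonneg) simp
    fix s
    define z where "z = Complex (- t) s"
    define d where "d i j y = ?c i j y + (if i = j then z else 0) * (if y = 1 then 1 else 0)" for i j and y :: 'a
    have d: "coef (d i j)" "pol (d i j) = pol (?c i j) + const (if i = j then z else 0)"
      "val (d i j) = X $$ (i,j) + (if i = j then z *\<^sub>C 1 else 0)" if ij: "i < m" "j < m" for i j
      using coef_combination[OF cf(1)[OF Xc(2)[OF ij]] coef_unit[OF one_S, of 1], of "if i = j then z else 0"]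
      unfolding d_def pol_unit val_unit cf(2)[OF Xc(2)[OF ij]] by (auto simp: letter_def scaleC_one)
    define q where "q i = (\<Sum>j<m. pol (d i j) * P j)" for i
    have "(\<Sum>i<m. (sn (q i))\<^sup>2) \<le> (mat_norm (Matrix.mat m m (\<lambda>(i,j). val (d i j))))\<^sup>2 * N"
      unfolding q_def N_def by (rule column_bound[OF m d(1)])
    also have "Matrix.mat m m (\<lambda>(i,j). val (d i j)) = X + Matrix.mat m m (\<lambda>(i,j). if i = j then z *\<^sub>C 1 else 0)"
      by (rule eq_matI) (use Xc(1) in \<open>auto simp: d\<close>)
    also have "(mat_norm (X + Matrix.mat m m (\<lambda>(i,j). if i = j then z *\<^sub>C 1 else 0)))\<^sup>2 \<le> (sqrt (t\<^sup>2 + s\<^sup>2))\<^sup>2"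
      unfolding z_def by (intro power_mono t(2) mat_norm_nonneg)
    finally have q: "(\<Sum>i<m. (sn (q i))\<^sup>2) \<le> N * (t\<^sup>2 + s\<^sup>2)" by (simp add: N_def sum_nonneg mult_right_mono mult.commute)
    have w: "(\<Sum>i<m. l (nc_star (P i) * q i)) =
       (\<Sum>i<m. \<Sum>j<m. l (nc_star (P i) * (pol (?c i j) * P j))) + z * of_real N"
    proof -
      have "l (nc_star (P i) * q i) = (\<Sum>j<m. l (nc_star (P i) * (pol (?c i j) * P j))) + z * of_real ((sn (P i))\<^sup>2)"
        if i: "i < m" for i
      proof -
        have "l (nc_star (P i) * q i) = (\<Sum>j<m. l (nc_star (P i) * (pol (?c i j) * P j)) + l (nc_star (P i) * (const (if i = j then z else 0) * P j)))"
          unfolding q_def sum_distrib_left sum using i by (intro sum.cong) (auto simp: d distrib_right distrib_left add)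
        also have "\<dots> = (\<Sum>j<m. l (nc_star (P i) * (pol (?c i j) * P j))) + (\<Sum>j<m. if i = j then z * l (nc_star (P i) * P i) else 0)"
          unfolding sum.distrib
        proof (intro arg_cong2[where f="(+)"] sum.cong refl)
          fix j
          have "nc_star (P i) * (const z * P i) = const z * (nc_star (P i) * P i)" by (metis const_commute mult.assoc)
          then show "l (nc_star (P i) * (const (if i = j then z else 0) * P j)) = (if i = j then z * l (nc_star (P i) * P i) else 0)"
            by (auto simp: scale)
        qed
        finally show ?thesis using i by (simp add: l_square del: of_real_power)
      qed
      then show ?thesis by (simp add: N_def sum.distrib sum_distrib_left)
    qed
    have "cmod (\<Sum>i<m. l (nc_star (P i) * q i)) \<le> (\<Sum>i<m. sn (P i) * sn (q i))" by (intro order_trans[OF norm_sum] sum_mono cs_sn)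
    then have "(cmod (\<Sum>i<m. l (nc_star (P i) * q i)))\<^sup>2 \<le> (\<Sum>i<m. sn (P i) * sn (q i))\<^sup>2" by (rule power_mono) simp
    also have "\<dots> \<le> N * (\<Sum>i<m. (sn (q i))\<^sup>2)" unfolding N_def by (rule Cauchy_Schwarz_ineq_sum)
    also have "\<dots> \<le> N * (N * (t\<^sup>2 + s\<^sup>2))" by (intro mult_left_mono q) (simp add: N_def sum_nonneg)
    finally show "(cmod ((\<Sum>i<m. \<Sum>j<m. l (nc_star (P i) * (pol (?c i j) * P j))) + Complex (- t) s * of_real (\<Sum>i<m. (sn (P i))\<^sup>2)))\<^sup>2
       \<le> (\<Sum>i<m. (sn (P i))\<^sup>2) * ((\<Sum>i<m. (sn (P i))\<^sup>2) * (t\<^sup>2 + s\<^sup>2))" unfolding w by (simp add: z_def N_def)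
  qed
  have "(\<lambda>n. \<Sum>i<m. \<Sum>j<m. l (nc_star (p i n) * (pol (?c i j) * p j n))) \<longlonglongrightarrow> (\<Sum>i<m. \<Sum>j<m. ip (\<xi> i) (\<phi> (X $$ (i,j)) (\<xi> j)))"
  proof (intro tendsto_sum)
    fix i j assume "i \<in> {..<m}" "j \<in> {..<m}"
    then have ij: "i < m" "j < m" by auto
    note c = cf[OF Xc(2)[OF ij]]
    have "\<phi> (X $$ (i,j)) (\<xi> j) = vec (\<lambda>n. pol (?c i j) * p j n)" using \<phi>_vec[OF c(1) p(1)[OF ij(2)]] c(2) p(2)[OF ij(2)] by simp
    then show "(\<lambda>n. l (nc_star (p i n) * (pol (?c i j) * p j n))) \<longlonglongrightarrow> ip (\<xi> i) (\<phi> (X $$ (i,j)) (\<xi> j))"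
      using ip_lim[OF p(1)[OF ij(1)] cau_pol[OF c(1) p(1)[OF ij(2)]]] p(2)[OF ij(1)] by simp
  qed
  note L = this
  have "0 \<le> Re (\<Sum>i<m. \<Sum>j<m. ip (\<xi> i) (\<phi> (X $$ (i,j)) (\<xi> j)))"
    by (rule LIMSEQ_le_const[OF tendsto_Re[OF L]]) (use main in \<open>simp add: less_eq_complex_def del: Re_sum\<close>)
  moreover have "(\<lambda>n. Im (\<Sum>i<m. \<Sum>j<m. l (nc_star (p i n) * (pol (?c i j) * p j n)))) = (\<lambda>n. 0)"
    using main by (simp add: fun_eq_iff less_eq_complex_def del: Im_sum)
  then have "Im (\<Sum>i<m. \<Sum>j<m. ip (\<xi> i) (\<phi> (X $$ (i,j)) (\<xi> j))) = 0" by (intro LIMSEQ_unique[OF tendsto_Im[OF L]]) simp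
  ultimately show ?thesis by (simp add: less_eq_complex_def)
qed simp

lemma ucp_\<phi>: "ucp_map V H ip \<phi>" unfolding ucp_map_def
proof (intro conjI ballI allI impI)
  show "\<phi> x \<in> bounded_operators H ip" if "x \<in> V" for x unfolding \<phi>_def by (rule op_bounded[OF bdd_pol[OF cf(1)[OF that]]])
  show "\<phi> (x + y) f = \<phi> x f + \<phi> y f" if "x \<in> V" "y \<in> V" "f \<in> H" for x y f
    using \<phi>_combination[OF that, of 1] by (simp add: scaleC_one fun_eq_iff)
  show "\<phi> (c *\<^sub>C x) f = (\<lambda>w. c * \<phi> x f w)" if "x \<in> V" "f \<in> H" for x f c
  proof -
    have "\<phi> 0 f = 0" using \<phi>_combination[OF V_zero V_zero that(2), of 1] by (simp add: scaleC_one fun_eq_iff)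
    then show ?thesis using \<phi>_combination[OF V_zero that, of c] by simp
  qed
qed (use \<phi>_one \<phi>_positive in auto)

text \<open>The representation of the maximal algebra that extends \<open>\<phi>\<close> acts on the cyclic vector as
  left multiplication by polynomials; its vector state is the trace with law \<open>l\<close>.\<close>

lemma trace_of_law: "\<exists>\<tau>. tracial_state \<tau> \<and> (\<forall>P\<in>nc_polys S. l P = \<tau> (nc_eval \<iota> P))"
proof -
  obtain \<pi> :: "'b \<Rightarrow> ('a list \<Rightarrow> complex) \<Rightarrow> ('a list \<Rightarrow> complex)"
    where hom: "star_hom H ip \<pi>" and \<pi>: "\<And>x. x \<in> V \<Longrightarrow> \<pi> (\<iota> x) = \<phi> x" using max hilbert_space_H ucp_\<phi> unfolding maximal_cstar_def by blast
  have \<pi>_add: "\<pi> (x + y) f = \<pi> x f + \<pi> y f" if "f \<in> H" for x y f using hom that by (simp add: star_hom_def)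
  have \<pi>_scale: "\<pi> (c *\<^sub>C x) f = (\<lambda>w. c * \<pi> x f w)" if "f \<in> H" for c x f using hom that by (simp add: star_hom_def)
  have \<pi>_mult: "\<pi> (x * y) f = \<pi> x (\<pi> y f)" if "f \<in> H" for x y f using hom that by (simp add: star_hom_def)
  have \<pi>_star: "ip (\<pi> (star x) f) g = ip f (\<pi> x g)" if "f \<in> H" "g \<in> H" for f g x using hom that by (simp add: star_hom_def)
  have \<pi>_H: "\<pi> x f \<in> H" if "f \<in> H" for x f using hom that by (auto simp: star_hom_def bounded_operators_def)
  have \<pi>_one: "\<pi> 1 f = f" if "f \<in> H" for f using \<pi>[OF V_one] \<phi>_one[OF that] by (simp add: \<iota>_one)
  have \<pi>_zero: "\<pi> 0 f = 0" if "f \<in> H" for f using \<pi>_scale[OF that, of 0 0] by (simp add: fun_eq_iff)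
  \<comment> \<open>by hypothesis the vector of \<open>nc_var 1 - 1\<close> vanishes; by traciality so does that of \<open>(nc_var 1 - 1) * P\<close>\<close>
  have unit_null: "sn ((nc_var 1 - 1) * P) = 0" for P
  proof -
    let ?Z = "nc_var 1 - 1 :: 'a nc_poly"
    have "l (nc_star (?Z * P) * (?Z * P)) = l (nc_star P * (nc_star ?Z * (?Z * P)))" by (simp add: nc_star_mult mult.assoc)
    also have "\<dots> = l ((nc_star ?Z * (?Z * P)) * nc_star P)" by (rule tr)
    also have "\<dots> = l (nc_star ?Z * (?Z * P * nc_star P))" by (simp only: mult.assoc)
    finally have "cmod (l (nc_star (?Z * P) * (?Z * P))) \<le> sn ?Z * sn (?Z * P * nc_star P)" using cs_sn by simp
    also have "sn ?Z = 0" by (simp add: sn_def l_unit)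
    finally show ?thesis by (simp add: sn_def)
  qed
  have var: "\<pi> (\<iota> y) (vec p) = vec (\<lambda>n. nc_var y * p n) \<and> cau (\<lambda>n. nc_var y * p n)" if y: "y \<in> S" and p: "cau p" for y p
  proof -
    have 1: "\<pi> (\<iota> y) (vec p) = vec (\<lambda>n. letter y * p n)" "cau (\<lambda>n. letter y * p n)"
      using \<phi>_vec[OF coef_unit[OF y, of 1] p] cau_pol[OF coef_unit[OF y, of 1] p] \<pi>[of y] y S_V by (auto simp: val_unit pol_unit scaleC_one)
    show ?thesis
    proof (cases "y = 1")
      case True
      have 0: "sn (nc_var 1 * p n - p n) = 0" for n using unit_null[of "p n"] by (simp add: left_diff_distrib)
      have c: "cau (\<lambda>n. nc_var 1 * p n)"
      proof -
        have "cau (\<lambda>n. (nc_var 1 - 1) * p n)" by (rule cau_bounded_map[OF p, where C=0]) (auto simp: unit_null right_diff_distrib)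
        from cau_add[OF this p] show ?thesis by (simp add: left_diff_distrib)
      qed
      have "vec (\<lambda>n. nc_var 1 * p n) = vec p" by (rule vec_cong[OF c p]) (simp add: 0)
      then show ?thesis using 1 c True by (simp add: letter_def)
    qed (use 1 in \<open>simp add: letter_def\<close>)
  qed
  \<comment> \<open>the adjoint letters are determined by their inner products\<close>
  have adj: "\<pi> (star (\<iota> y)) (vec (\<lambda>_. Q)) = vec (\<lambda>_. nc_star (nc_var y) * Q)" if y: "y \<in> S" for y Q
  proof -
    let ?f = "\<pi> (star (\<iota> y)) (vec (\<lambda>_. Q))" and ?g = "vec (\<lambda>_. nc_star (nc_var y) * Q)"
    have fg: "?f \<in> H" "?g \<in> H" by (auto intro: \<pi>_H)
    have e: "ip ?f h = ip ?g h" if h: "h \<in> H" for h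
    proof -
      obtain p where p: "cau p" "h = vec p" using h by (rule H_cases)
      have "ip ?f h = ip (vec (\<lambda>_. Q)) (\<pi> (\<iota> y) h)" by (rule \<pi>_star) (auto simp: h)
      also have "\<dots> = ip (vec (\<lambda>_. Q)) (vec (\<lambda>n. nc_var y * p n))" using var[OF y p(1)] p(2) by simp
      also have "\<dots> = ip ?g h" unfolding p(2)
      proof (rule ip_eqI[symmetric])
        show "(\<lambda>n. l (nc_star (nc_star (nc_var y) * Q) * p n)) \<longlonglongrightarrow> ip (vec (\<lambda>_. Q)) (vec (\<lambda>n. nc_var y * p n))"
          using ip_lim[OF cau_const[of Q] conjunct2[OF var[OF y p(1)]]] by (simp add: nc_star_mult mult.assoc)
      qed (use p in auto)
      finally show ?thesis .
    qed
    have "?f - ?g = 0"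
    proof (rule ip_definite)
      show H': "?f - ?g \<in> H" by (rule H_diff[OF fg])
      have "ip (?f - ?g) ?f = cnj (ip ?f (?f - ?g))" by (rule ip_cnj[OF H' fg(1)])
      also have "\<dots> = ip (?f - ?g) ?g" unfolding e[OF H'] by (rule ip_cnj[OF H' fg(2), symmetric])
      finally have "ip (?f - ?g) ?f = ip (?f - ?g) ?g" .
      moreover have "ip (?f - ?g) ?f = ip (?f - ?g) (?f - ?g) + ip (?f - ?g) ?g" using ip_add_right[OF H' H' fg(2)] by simp
      ultimately show "ip (?f - ?g) (?f - ?g) = 0" by simp
    qed
    then show ?thesis by simp
  qed
  have word: "\<pi> (word_eval \<iota> (Word w)) (vec (\<lambda>_. Q)) = vec (\<lambda>_. wterm (Word w) 1 * Q)"
    if "fst ` set w \<subseteq> S" for w Q using that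
  proof (induction w)
    case Nil
    show ?case unfolding zero_nc_word_def[symmetric] by (simp add: \<pi>_one)
  next
    case (Cons a w)
    obtain y b where a: "a = (y,b)" by force
    have y: "y \<in> S" using Cons.prems a by auto
    have "\<pi> (word_eval \<iota> (Word (a # w))) (vec (\<lambda>_. Q)) = \<pi> (if b then star (\<iota> y) else \<iota> y) (\<pi> (word_eval \<iota> (Word w)) (vec (\<lambda>_. Q)))"
      by (simp add: word_eval_def a \<pi>_mult[OF vec_in_H[OF cau_const]])
    also have "\<dots> = vec (\<lambda>_. (if b then nc_star (nc_var y) else nc_var y) * (wterm (Word w) 1 * Q))"
      using Cons adj[OF y] var[OF y cau_const] by simp
    also have "(if b then nc_star (nc_var y) else nc_var y) * (wterm (Word w) 1 * Q) = wterm (Word (a # w)) 1 * Q"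
      by (auto simp: a nc_var_def nc_star_single word_star_def mult_single plus_nc_word_def simp flip: mult.assoc)
    finally show ?case .
  qed
  have poly: "\<pi> (nc_eval \<iota> P) (vec (\<lambda>_. Q)) = vec (\<lambda>_. P * Q)" if P: "P \<in> nc_polys S" for P Q
  proof -
    have "\<pi> (\<Sum>w\<in>K. c w *\<^sub>C word_eval \<iota> w) (vec (\<lambda>_. Q)) = vec (\<lambda>_. (\<Sum>w\<in>K. wterm w (c w)) * Q)"
      if "finite K" "\<And>w. w \<in> K \<Longrightarrow> fst ` set (letters w) \<subseteq> S" for K c using that
    proof (induction K rule: finite_induct)
      case empty then show ?case by (simp add: \<pi>_zero vec_zero)
    next
      case (insert w K)
      have "\<pi> (c w *\<^sub>C word_eval \<iota> w) (vec (\<lambda>_. Q)) = vec (\<lambda>_. const (c w) * (wterm w 1 * Q))"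
        unfolding vec_scale[OF cau_const] \<pi>_scale[OF vec_in_H[OF cau_const]] using word[of "letters w" Q] insert.prems by simp
      also have "const (c w) * (wterm w 1 * Q) = wterm w (c w) * Q" by (simp add: const_mult_single flip: mult.assoc)
      finally have "\<pi> (c w *\<^sub>C word_eval \<iota> w) (vec (\<lambda>_. Q)) = vec (\<lambda>_. wterm w (c w) * Q)" .
      then show ?case using insert vec_add[OF cau_const cau_const] by (simp add: \<pi>_add[OF vec_in_H[OF cau_const]] distrib_right)
    qed
    from this[of "words P" "wcoeff P"] show ?thesis using P by (simp add: nc_eval_alt nc_polys_def flip: poly_sum_singles)
  qed
  define \<Omega> where "\<Omega> = vec (\<lambda>_. 1)"
  have \<Omega>: "\<Omega> \<in> H" by (simp add: \<Omega>_def)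
  define \<tau> where "\<tau> b = ip \<Omega> (\<pi> b \<Omega>)" for b
  have law: "\<tau> (nc_eval \<iota> P) = l P" if "P \<in> nc_polys S" for P unfolding \<tau>_def \<Omega>_def poly[OF that] by (rule ip_eqI) auto
  interpret t: pos_functional \<tau>
  proof
    show "\<tau> (x + y) = \<tau> x + \<tau> y" for x y by (simp add: \<tau>_def \<pi>_add ip_add_right \<pi>_H \<Omega>)
    show "\<tau> (c *\<^sub>C x) = c * \<tau> x" for c x by (simp add: \<tau>_def \<pi>_scale ip_scale_right \<pi>_H \<Omega>)
    show "\<tau> 1 = 1" using law[of 1] by (simp add: one)
    show "0 \<le> \<tau> (star x * x)" for x
      using \<pi>_star[OF \<Omega> \<pi>_H[OF \<Omega>], of "star x" x] ip_nonneg[OF \<pi>_H[OF \<Omega>, of x]] by (simp add: \<tau>_def \<pi>_mult \<Omega> star_star)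
  qed
  have gen: "cstar_generates (\<iota> ` V)" using max by (simp add: maximal_cstar_def)
  have VP: "\<iota> ` V \<subseteq> nc_eval \<iota> ` nc_polys S"
  proof clarify
    fix x assume x: "x \<in> V"
    let ?P = "\<Sum>y | cf x y \<noteq> 0. const (cf x y) * nc_var y"
    have s: "{y. cf x y \<noteq> 0} \<subseteq> S" using cf(1)[OF x] by (simp add: coef_def)
    have "\<iota> (val (cf x)) = nc_eval \<iota> ?P"
      unfolding val_def using s S_V by (subst \<iota>_sum) (auto simp: nc_eval_sum nc_eval_const_mult \<iota>_scale V_scale subset_iff intro!: sum.cong)
    moreover have "?P \<in> nc_polys S" using s by (intro nc_polys_sum nc_polys_mult nc_polys_var nc_polys_const) auto
    ultimately show "\<iota> x \<in> nc_eval \<iota> ` nc_polys S" using cf(2)[OF x] by auto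
  qed
  have approx: "\<exists>P. (\<forall>n. P n \<in> nc_polys S) \<and> (\<lambda>n. nc_eval \<iota> (P n)) \<longlonglongrightarrow> x" for x
  proof -
    have "\<exists>P. P \<in> nc_polys S \<and> norm (nc_eval \<iota> P - x) < 1 / real (Suc n)" for n
    proof -
      have "1 / real (Suc n) > 0" by simp
      from nc_eval_dense[OF gen VP this, of x] show ?thesis by blast
    qed
    then obtain P where P: "\<And>n. P n \<in> nc_polys S" "\<And>n. norm (nc_eval \<iota> (P n) - x) < 1 / real (Suc n)" by metis
    have "(\<lambda>n. nc_eval \<iota> (P n) - x) \<longlonglongrightarrow> 0" by (rule Lim_null_comparison[where g="\<lambda>n. 1 / real (Suc n)"])
        (use P(2) LIMSEQ_inverse_real_of_nat in \<open>auto simp: less_imp_le inverse_eq_divide\<close>)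
    then have "(\<lambda>n. nc_eval \<iota> (P n)) \<longlonglongrightarrow> x" by (rule LIM_zero_cancel)
    then show ?thesis using P(1) by blast
  qed
  have "\<tau> (x * y) = \<tau> (y * x)" for x y
  proof -
    obtain P where P: "\<And>n. P n \<in> nc_polys S" "(\<lambda>n. nc_eval \<iota> (P n)) \<longlonglongrightarrow> x" using approx[of x] by blast
    obtain Q where Q: "\<And>n. Q n \<in> nc_polys S" "(\<lambda>n. nc_eval \<iota> (Q n)) \<longlonglongrightarrow> y" using approx[of y] by blast
    have "\<tau> (nc_eval \<iota> (P n) * nc_eval \<iota> (Q n)) = \<tau> (nc_eval \<iota> (Q n) * nc_eval \<iota> (P n))" for n
      using law[of "P n * Q n"] law[of "Q n * P n"] P(1) Q(1) tr[of "P n" "Q n"] by (simp add: nc_eval_mult nc_polys_mult)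
    then show ?thesis using LIMSEQ_unique[OF t.tendsto[OF tendsto_mult[OF P(2) Q(2)]]] t.tendsto[OF tendsto_mult[OF Q(2) P(2)]] by simp
  qed
  then have "tracial_state \<tau>" unfolding tracial_state_def using t.add t.scale t.one t.pos by blast
  with law show ?thesis by metis
qed

end

section \<open>Compactness of the space of laws\<close>

lemma closedin_Collect_ball:
  assumes "\<And>x. x \<in> A \<Longrightarrow> closedin T {l \<in> topspace T. \<phi> x l}"
  shows "closedin T {l \<in> topspace T. \<forall>x\<in>A. \<phi> x l}"
proof (cases "A = {}")
  case False
  have "closedin T (\<Inter>x\<in>A. {l \<in> topspace T. \<phi> x l})" by (rule closedin_INT[OF False]) (rule assms)
  also have "(\<Inter>x\<in>A. {l \<in> topspace T. \<phi> x l}) = {l \<in> topspace T. \<forall>x\<in>A. \<phi> x l}" using False by auto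
  finally show ?thesis .
qed auto

lemma continuous_map_scale_complex:
  "continuous_map X euclidean f \<Longrightarrow> continuous_map X euclidean (\<lambda>x. c * f x :: complex)"
  using continuous_map_compose[of X euclidean f euclidean "\<lambda>z. c * z"] by (simp add: o_def continuous_on_mult_const)

lemma closed_nonneg_complex: "closed {z :: complex. 0 \<le> z}"
proof -
  have "{z :: complex. 0 \<le> z} = {z. 0 \<le> Re z} \<inter> {z. Im z = 0}" by (auto simp: less_eq_complex_def)
  then show ?thesis by (simp add: closed_Int closed_Collect_le closed_Collect_eq continuous_on_Re continuous_on_Im)
qed

lemma closedin_complex:
  fixes f g :: "'x \<Rightarrow> complex"
  assumes f: "continuous_map T euclidean f"
  shows "continuous_map T euclidean g \<Longrightarrow> closedin T {l \<in> topspace T. f l = g l}"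
    and "closedin T {l \<in> topspace T. 0 \<le> f l}"
proof -
  show "closedin T {l \<in> topspace T. 0 \<le> f l}" using closedin_continuous_map_preimage[OF f, of "{z. 0 \<le> z}"] closed_nonneg_complex by simp
  assume g: "continuous_map T euclidean g"
  have "continuous_map T euclidean (\<lambda>l. f l - g l)" by (rule continuous_map_diff[OF f g])
  from closedin_continuous_map_preimage[OF this, of "{0}"] show "closedin T {l \<in> topspace T. f l = g l}" by simp
qed

text \<open>Tychonoff: a law is bounded on each polynomial by \<open>law_bound\<close>, and the defining conditions are closed.\<close>

lemma law_compact:
  assumes R: "R \<ge> 0"
  shows "compact_space (law_topology R I)"
proof -
  let ?T = "product_topology (\<lambda>_. euclidean) (nc_polys I) :: ('a nc_poly \<Rightarrow> complex) topology"
  define b where "b P = (\<Sum>w\<in>words P. cmod (wcoeff P w) * R ^ length (letters w))" for P :: "'a nc_poly"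
  have "compactin ?T (PiE (nc_polys I) (\<lambda>P. cball 0 (b P)))" by (subst compactin_PiE) auto
  moreover have "law_space R I \<subseteq> PiE (nc_polys I) (\<lambda>P. cball 0 (b P))"
    using law_bound[OF _ R, of _ I] by (auto simp: law_space_def PiE_def Pi_def b_def)
  moreover have "closedin ?T (law_space R I)"
  proof -
    have ev: "continuous_map ?T euclidean (\<lambda>l. l P)" if "P \<in> nc_polys I" for P by (rule continuous_map_product_projection[OF that])
    have le: "closedin ?T {l \<in> topspace ?T. f l \<le> c}"
      if "continuous_map ?T euclidean f" for f :: "('a nc_poly \<Rightarrow> complex) \<Rightarrow> complex" and c
    proof -
      have "continuous_map ?T euclidean (\<lambda>l. c - f l)" using that by (intro continuous_map_diff) auto
      moreover have "0 \<le> c - z \<longleftrightarrow> z \<le> c" for z by (auto simp: less_eq_complex_def)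
      ultimately show ?thesis using closedin_complex(2)[of ?T "\<lambda>l. c - f l"] by simp
    qed
    have mon: "(nc_star (nc_var j) * nc_var j) ^ k \<in> nc_polys I" if "j \<in> I" for j k
      using that by (intro nc_polys_power nc_polys_mult nc_polys_star nc_polys_var)
    have "closedin ?T ({l \<in> topspace ?T. \<forall>P\<in>nc_polys I. \<forall>Q\<in>nc_polys I. l (P + Q) = l P + l Q}
       \<inter> {l \<in> topspace ?T. \<forall>c\<in>UNIV. \<forall>P\<in>nc_polys I. l (const c * P) = c * l P}
       \<inter> {l \<in> topspace ?T. \<forall>P\<in>nc_polys I. 0 \<le> l (nc_star P * P)}
       \<inter> {l \<in> topspace ?T. l 1 = 1}
       \<inter> {l \<in> topspace ?T. \<forall>P\<in>nc_polys I. \<forall>Q\<in>nc_polys I. l (P * Q) = l (Q * P)}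
       \<inter> {l \<in> topspace ?T. \<forall>k\<in>UNIV. \<forall>j\<in>I. l ((nc_star (nc_var j) * nc_var j) ^ k) \<le> of_real (R ^ (2 * k))})"
      by (intro closedin_Int closedin_Collect_ball closedin_complex le ev continuous_map_add mon
          continuous_map_scale_complex nc_polys_mult nc_polys_add nc_polys_star nc_polys_const nc_polys_one)
        auto
    also have "\<dots> = law_space R I" unfolding law_space_def topspace_product_topology topspace_euclidean
      by (rule Set.set_eqI) (simp only: PiE_iff Int_iff mem_Collect_eq ball_UNIV UNIV_I simp_thms, blast)
    finally show ?thesis .
  qed
  ultimately have "compactin ?T (law_space R I)" by (rule closed_compactin)
  then show ?thesis unfolding law_topology_def by (rule compact_space_subtopology)
qed

lemma topspace_law [simp]: "topspace (law_topology R I) = law_space R I" by (auto simp: law_topology_def law_space_def PiE_def)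

lemma continuous_law: "P \<in> nc_polys I \<Longrightarrow> continuous_map (law_topology R I) euclidean (\<lambda>l. l P)"
  unfolding law_topology_def by (rule continuous_map_from_subtopology, rule continuous_map_product_projection)

lemma trace_laws_subset:
  fixes a :: "'i \<Rightarrow> 'b::cstar_algebra"
  assumes a: "\<forall>i\<in>I. norm (a i) \<le> R"
  shows "trace_laws I a \<subseteq> law_space R I"
proof
  fix l assume "l \<in> trace_laws I a"
  then obtain \<tau> where \<tau>: "tracial_state \<tau>" and l: "l = restrict (\<lambda>P. \<tau> (nc_eval a P)) (nc_polys I)" by (auto simp: trace_laws_def)
  interpret T: tracial_functional "\<lambda>P. \<tau> (nc_eval a P)" by (rule tracial_state_functional[OF \<tau>])
  interpret t: pos_functional \<tau> by (rule tracial_state_pos_functional[OF \<tau>])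
  have "\<tau> (nc_eval a ((nc_star (nc_var j) * nc_var j) ^ k)) \<le> of_real (R ^ (2 * k))" if j: "j \<in> I" for j k
  proof -
    let ?h = "star (a j) * a j"
    have "norm (?h ^ k) \<le> norm ?h ^ k" by (rule norm_power_ineq)
    also have "\<dots> = norm (a j) ^ (2 * k)" by (simp add: cstar_identity power_mult)
    also have "\<dots> \<le> R ^ (2 * k)" using a j by (intro power_mono) auto
    finally have "0 \<le> \<tau> (of_real (R ^ (2 * k)) - ?h ^ k)" by (intro t.nonneg pos_le_norm) (simp_all add: star_power star_mult star_star)
    then show ?thesis unfolding t.diff t.of_real by (simp add: nc_eval_power nc_eval_mult nc_eval_star less_eq_complex_def)
  qed
  then show "l \<in> law_space R I" unfolding l law_space_def mem_Collect_eq by (intro conjI ballI allI)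
      (simp_all only: restrict_extensional restrict_apply' nc_polys_add nc_polys_mult nc_polys_star nc_polys_power nc_polys_var
        nc_polys_const nc_polys_one T.add T.scale T.pos T.one, simp_all only: T.tr)
qed

definition law_nbhd :: "real \<Rightarrow> 'i set \<Rightarrow> ('i \<Rightarrow> 'b::cstar_algebra) \<Rightarrow> 'i nc_poly set \<Rightarrow> real \<Rightarrow> ('i nc_poly \<Rightarrow> complex) set" where
  "law_nbhd R I a Ps \<kappa> = {l \<in> law_space R I. \<exists>\<tau>. tracial_state \<tau> \<and> (\<forall>P\<in>Ps. cmod (l P - \<tau> (nc_eval a P)) < \<kappa>)}"

lemma law_nbhd_open:
  assumes Ps: "finite Ps" "Ps \<subseteq> nc_polys I"
  shows "openin (law_topology R I) (law_nbhd R I a Ps \<kappa>)"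
proof -
  let ?N = "\<lambda>\<tau> Qs. {l \<in> law_space R I. \<forall>P\<in>Qs. cmod (l P - \<tau> (nc_eval a P)) < \<kappa>}"
  have o: "openin (law_topology R I) (?N \<tau> Qs)"
    if "finite Qs" "Qs \<subseteq> nc_polys I" for \<tau> Qs using that
  proof (induction Qs rule: finite_induct)
    case empty show ?case by (simp flip: topspace_law)
  next
    case (insert P Qs)
    have c: "continuous_map (law_topology R I) euclidean (\<lambda>l. l P)" using insert.prems by (intro continuous_law) auto
    have "openin (law_topology R I) {l \<in> topspace (law_topology R I). l P \<in> ball (\<tau> (nc_eval a P)) \<kappa>}"
      by (rule openin_continuous_map_preimage[OF c]) simp
    moreover have "openin (law_topology R I) (?N \<tau> Qs)" using insert by auto
    ultimately have "openin (law_topology R I) ({l \<in> topspace (law_topology R I). l P \<in> ball (\<tau> (nc_eval a P)) \<kappa>}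
       \<inter> ?N \<tau> Qs)" by (rule openin_Int)
    also have "\<dots> = ?N \<tau> (insert P Qs)" by (auto simp: dist_norm norm_minus_commute)
    finally show ?case .
  qed
  have "law_nbhd R I a Ps \<kappa> = (\<Union>\<tau>\<in>{\<tau>. tracial_state \<tau>}. ?N \<tau> Ps)" by (auto simp: law_nbhd_def)
  then show ?thesis using o[OF Ps] by auto
qed

lemma trace_laws_nbhd:
  assumes "\<forall>i\<in>I. norm (a i) \<le> R" "Ps \<subseteq> nc_polys I" "\<kappa> > 0"
  shows "trace_laws I a \<subseteq> law_nbhd R I a Ps \<kappa>"
proof
  fix l assume l: "l \<in> trace_laws I a"
  then obtain \<tau> where \<tau>: "tracial_state \<tau>" "l = restrict (\<lambda>P. \<tau> (nc_eval a P)) (nc_polys I)" by (auto simp: trace_laws_def)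
  then show "l \<in> law_nbhd R I a Ps \<kappa>" using trace_laws_subset[OF assms(1)] l assms(2,3) by (auto simp: law_nbhd_def intro!: exI[of _ \<tau>])
qed

lemma compact_tracial_states: "compact {\<tau> :: 'b::cstar_algebra \<Rightarrow> complex. tracial_state \<tau>}"
proof -
  let ?T = "product_topology (\<lambda>_. euclidean) UNIV :: ('b \<Rightarrow> complex) topology"
  have "compactin ?T (PiE UNIV (\<lambda>x. cball 0 (norm x)))" by (subst compactin_PiE) auto
  moreover have "{\<tau>. tracial_state \<tau>} \<subseteq> PiE UNIV (\<lambda>x :: 'b. cball (0::complex) (norm x))"
    using pos_functional.norm_le[OF tracial_state_pos_functional] by auto
  moreover have "closedin ?T {\<tau>. tracial_state \<tau>}"
  proof -
    have ev: "continuous_map ?T euclidean (\<lambda>l. l x)" for x by (rule continuous_map_product_projection) simp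
    have "closedin ?T ({l \<in> topspace ?T. \<forall>x\<in>UNIV. \<forall>y\<in>UNIV. l (x + y) = l x + l y}
       \<inter> {l \<in> topspace ?T. \<forall>c\<in>UNIV. \<forall>x\<in>UNIV. l (c *\<^sub>C x) = c * l x}
       \<inter> {l \<in> topspace ?T. l 1 = 1}
       \<inter> {l \<in> topspace ?T. \<forall>x\<in>UNIV. 0 \<le> l (star x * x)}
       \<inter> {l \<in> topspace ?T. \<forall>x\<in>UNIV. \<forall>y\<in>UNIV. l (x * y) = l (y * x)})"
      by (intro closedin_Int closedin_Collect_ball closedin_complex ev continuous_map_add continuous_map_scale_complex) auto
    also have "\<dots> = {\<tau>. tracial_state \<tau>}" by (auto simp: tracial_state_def)
    finally show ?thesis .
  qed
  ultimately have "compactin ?T {\<tau>. tracial_state \<tau>}" by (rule closed_compactin)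
  then show ?thesis by (simp add: euclidean_product_topology)
qed

text \<open>A Lebesgue number argument: since the set of traces is compact, an open neighbourhood of all their laws
  contains a uniform one, given by finitely many polynomials.\<close>

lemma law_nbhd_exists:
  fixes a :: "'i \<Rightarrow> 'b::cstar_algebra"
  assumes U: "openin (law_topology R I) U" "trace_laws I a \<subseteq> U"
  obtains Ps \<kappa> where "finite Ps" "Ps \<subseteq> nc_polys I" "\<kappa> > 0" "law_nbhd R I a Ps \<kappa> \<subseteq> U"
proof -
  let ?T = "product_topology (\<lambda>_. euclidean) (nc_polys I) :: ('i nc_poly \<Rightarrow> complex) topology"
  obtain W where W: "openin ?T W" "U = W \<inter> law_space R I" using U(1) unfolding law_topology_def openin_subtopology by blast
  define TS where "TS = {\<tau> :: 'b \<Rightarrow> complex. tracial_state \<tau>}"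
  have "\<exists>Ps \<kappa>. finite Ps \<and> Ps \<subseteq> nc_polys I \<and> \<kappa> > 0 \<and>
     (\<forall>l\<in>law_space R I. (\<forall>P\<in>Ps. cmod (l P - \<tau> (nc_eval a P)) < 2 * \<kappa>) \<longrightarrow> l \<in> U)" if \<tau>: "\<tau> \<in> TS" for \<tau>
  proof -
    have "restrict (\<lambda>P. \<tau> (nc_eval a P)) (nc_polys I) \<in> W" using U(2) \<tau> W(2) by (auto simp: TS_def trace_laws_def)
    from product_topology_open_contains_basis[OF W(1) this]
    obtain X where X: "restrict (\<lambda>P. \<tau> (nc_eval a P)) (nc_polys I) \<in> PiE (nc_polys I) X"
      "\<And>P. open (X P)" "finite {P. X P \<noteq> UNIV}" "PiE (nc_polys I) X \<subseteq> W" by auto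
    let ?Ps = "{P. X P \<noteq> UNIV} \<inter> nc_polys I"
    have fin: "finite ?Ps" using X(3) by simp
    have "\<exists>e>0. ball (\<tau> (nc_eval a P)) e \<subseteq> X P" if "P \<in> ?Ps" for P
    proof -
      have "\<tau> (nc_eval a P) \<in> X P" using X(1) that by (auto simp: PiE_def Pi_def)
      then show ?thesis using X(2) openE by blast
    qed
    then obtain e where e: "\<And>P. P \<in> ?Ps \<Longrightarrow> e P > 0" "\<And>P. P \<in> ?Ps \<Longrightarrow> ball (\<tau> (nc_eval a P)) (e P) \<subseteq> X P" by metis
    define k where "k = Min (insert 1 (e ` ?Ps))"
    have k: "k > 0" "\<And>P. P \<in> ?Ps \<Longrightarrow> k \<le> e P" using fin e(1) by (auto simp: k_def)
    have "l \<in> U" if l: "l \<in> law_space R I" "\<forall>P\<in>?Ps. cmod (l P - \<tau> (nc_eval a P)) < 2 * (k / 2)" for l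
    proof -
      have "l P \<in> X P" if P: "P \<in> nc_polys I" for P
      proof (cases "X P = UNIV")
        case False
        then have PP: "P \<in> ?Ps" using P by simp
        have "cmod (l P - \<tau> (nc_eval a P)) < e P" using l(2)[rule_format, OF PP] k(2)[OF PP] by simp
        then show ?thesis using e(2)[OF PP] by (auto simp: dist_norm norm_minus_commute)
      qed simp
      then have "l \<in> PiE (nc_polys I) X" using l(1) by (auto simp: law_space_def PiE_def)
      then show ?thesis using X(4) W(2) l(1) by auto
    qed
    then show ?thesis using fin k(1) by (intro exI[of _ ?Ps] exI[of _ "k / 2"]) auto
  qed
  then obtain Ps k where Pk: "\<And>\<tau>. \<tau> \<in> TS \<Longrightarrow> finite (Ps \<tau>)" "\<And>\<tau>. \<tau> \<in> TS \<Longrightarrow> Ps \<tau> \<subseteq> nc_polys I" "\<And>\<tau>. \<tau> \<in> TS \<Longrightarrow> k \<tau> > 0"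
    "\<And>\<tau> l. \<tau> \<in> TS \<Longrightarrow> l \<in> law_space R I \<Longrightarrow> (\<And>P. P \<in> Ps \<tau> \<Longrightarrow> cmod (l P - \<tau> (nc_eval a P)) < 2 * k \<tau>) \<Longrightarrow> l \<in> U" by metis
  define O' where "O' \<tau> = {\<sigma> :: 'b \<Rightarrow> complex. \<forall>P\<in>Ps \<tau>. \<sigma> (nc_eval a P) \<in> ball (\<tau> (nc_eval a P)) (k \<tau>)}" for \<tau>
  have "open (O' \<tau>)" if \<tau>: "\<tau> \<in> TS" for \<tau>
  proof -
    have "O' \<tau> = (\<Inter>P\<in>Ps \<tau>. (\<lambda>\<sigma>. \<sigma> (nc_eval a P)) -` ball (\<tau> (nc_eval a P)) (k \<tau>))" by (auto simp: O'_def)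
    also have "open \<dots>" using Pk(1)[OF \<tau>] by (intro open_INT ballI open_vimage open_ball) (auto intro: continuous_on_product_coordinates)
    finally show ?thesis .
  qed
  moreover have "TS \<subseteq> (\<Union>\<tau>\<in>TS. O' \<tau>)" using Pk(3) by (auto simp: O'_def)
  moreover have "compact TS" unfolding TS_def by (rule compact_tracial_states)
  ultimately obtain D where D: "D \<subseteq> TS" "finite D" "TS \<subseteq> (\<Union>\<tau>\<in>D. O' \<tau>)" using compactE_image[of TS TS O'] by metis
  define \<kappa> where "\<kappa> = Min (insert 1 (k ` D))"
  have \<kappa>: "\<kappa> > 0" "\<And>\<tau>. \<tau> \<in> D \<Longrightarrow> \<kappa> \<le> k \<tau>" using D Pk(3) by (auto simp: \<kappa>_def)
  show ?thesis
  proof (rule that[of "\<Union>\<tau>\<in>D. Ps \<tau>" \<kappa>])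
    show "finite (\<Union>\<tau>\<in>D. Ps \<tau>)" "(\<Union>\<tau>\<in>D. Ps \<tau>) \<subseteq> nc_polys I" "\<kappa> > 0" using D Pk(1,2) \<kappa>(1) by blast+
    show "law_nbhd R I a (\<Union>\<tau>\<in>D. Ps \<tau>) \<kappa> \<subseteq> U"
    proof
      fix l assume "l \<in> law_nbhd R I a (\<Union>\<tau>\<in>D. Ps \<tau>) \<kappa>"
      then obtain \<sigma> where l: "l \<in> law_space R I" and \<sigma>: "\<sigma> \<in> TS"
        and ls: "\<And>\<tau> P. \<tau> \<in> D \<Longrightarrow> P \<in> Ps \<tau> \<Longrightarrow> cmod (l P - \<sigma> (nc_eval a P)) < \<kappa>" by (auto simp: law_nbhd_def TS_def)
      obtain \<tau> where \<tau>: "\<tau> \<in> D" "\<sigma> \<in> O' \<tau>" using D(3) \<sigma> by blast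
      show "l \<in> U"
      proof (rule Pk(4)[OF _ l])
        show "\<tau> \<in> TS" using \<tau> D by auto
        fix P assume P: "P \<in> Ps \<tau>"
        have "cmod (l P - \<tau> (nc_eval a P)) \<le> cmod (l P - \<sigma> (nc_eval a P)) + cmod (\<sigma> (nc_eval a P) - \<tau> (nc_eval a P))"
          using norm_triangle_ineq[of "l P - \<sigma> (nc_eval a P)" "\<sigma> (nc_eval a P) - \<tau> (nc_eval a P)"] by simp
        moreover have "cmod (\<sigma> (nc_eval a P) - \<tau> (nc_eval a P)) < k \<tau>" using \<tau>(2) P by (auto simp: O'_def dist_norm norm_minus_commute)
        ultimately show "cmod (l P - \<tau> (nc_eval a P)) < 2 * k \<tau>" using ls[OF \<tau>(1) P] \<kappa>(2)[OF \<tau>(1)] by simp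
      qed
    qed
  qed
qed

section \<open>Comparison of orbital covering numbers\<close>

text \<open>Two points whose images lie near the orbit of the same centre are themselves near in the orbit distance;
  so one point over each centre suffices.\<close>

lemma orbital_covering_le:
  assumes f: "\<And>C. C \<in> \<Omega>1 \<Longrightarrow> f C \<in> \<Omega>2" and c: "\<And>B i. B \<in> \<Omega>2 \<Longrightarrow> i \<in> E' \<Longrightarrow> B i \<in> carrier_mat N N"
    and close: "\<And>C C' U. C \<in> \<Omega>1 \<Longrightarrow> C' \<in> \<Omega>1 \<Longrightarrow> U \<in> unitary_mats N \<Longrightarrow>
      (\<And>i. i \<in> E' \<Longrightarrow> norm2 (f C i - uconj U (f C' i)) < 2 * \<epsilon>') \<Longrightarrow> (\<And>i. i \<in> E \<Longrightarrow> norm2 (C i - uconj U (C' i)) < \<epsilon>)"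
  shows "orbital_covering_number N E \<epsilon> \<Omega>1 \<le> orbital_covering_number N E' \<epsilon>' \<Omega>2"
  unfolding orbital_covering_number_def mat_adjoint_eq uconj_def[symmetric]
proof (rule INF_greatest)
  fix \<Omega>' assume "\<Omega>' \<in> {\<Omega>'. \<Omega>' \<subseteq> \<Omega>2 \<and> finite \<Omega>' \<and> (\<forall>C\<in>\<Omega>2. \<exists>B\<in>\<Omega>'. \<exists>U\<in>unitary_mats N. \<forall>i\<in>E'. norm2 (C i - uconj U (B i)) < \<epsilon>')}"
  then have \<Omega>': "\<Omega>' \<subseteq> \<Omega>2" "finite \<Omega>'" "\<And>C. C \<in> \<Omega>2 \<Longrightarrow> \<exists>B\<in>\<Omega>'. \<exists>U\<in>unitary_mats N. \<forall>i\<in>E'. norm2 (C i - uconj U (B i)) < \<epsilon>'" by auto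
  define near where "near C B \<longleftrightarrow> (\<exists>U\<in>unitary_mats N. \<forall>i\<in>E'. norm2 (f C i - uconj U (B i)) < \<epsilon>')" for C B
  define g where "g B = (SOME C. C \<in> \<Omega>1 \<and> near C B)" for B
  define D where "D = {B \<in> \<Omega>'. \<exists>C\<in>\<Omega>1. near C B}"
  have g: "g B \<in> \<Omega>1" "near (g B) B" if "B \<in> D" for B using someI_ex[of "\<lambda>C. C \<in> \<Omega>1 \<and> near C B"] that by (auto simp: D_def g_def)
  have "\<exists>C'\<in>g ` D. \<exists>U\<in>unitary_mats N. \<forall>i\<in>E. norm2 (C i - uconj U (C' i)) < \<epsilon>" if C: "C \<in> \<Omega>1" for C
  proof -
    obtain B U where B: "B \<in> \<Omega>'" and U: "U \<in> unitary_mats N" and n: "\<And>i. i \<in> E' \<Longrightarrow> norm2 (f C i - uconj U (B i)) < \<epsilon>'"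
      using \<Omega>'(3)[OF f[OF C]] by blast
    have BD: "B \<in> D" using B U n C by (auto simp: D_def near_def)
    obtain W where W: "W \<in> unitary_mats N" and n': "\<And>i. i \<in> E' \<Longrightarrow> norm2 (f (g B) i - uconj W (B i)) < \<epsilon>'"
      using g(2)[OF BD] by (auto simp: near_def)
    have W': "star_mat W \<in> unitary_mats N" by (rule unitary_star[OF W])
    have UW: "U * star_mat W \<in> unitary_mats N" by (rule unitary_mult[OF U W'])
    have "norm2 (C i - uconj (U * star_mat W) (g B i)) < \<epsilon>" if "i \<in> E" for i
    proof (rule close[OF C g(1)[OF BD] UW _ that])
      fix i assume i: "i \<in> E'"
      have cs: "f C i \<in> carrier_mat N N" "f (g B) i \<in> carrier_mat N N" "B i \<in> carrier_mat N N"
        using c[OF f[OF C] i] c[OF f[OF g(1)[OF BD]] i] c[of B i] \<Omega>'(1) B i by auto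
      have ccB: "uconj W (B i) \<in> carrier_mat N N" "uconj U (B i) \<in> carrier_mat N N" by (simp_all add: uconj_carrier[OF W] uconj_carrier[OF U] cs)
      have Vc: "uconj (U * star_mat W) X \<in> carrier_mat N N" if "X \<in> carrier_mat N N" for X by (rule uconj_carrier[OF UW that])
      have e: "uconj (U * star_mat W) (uconj W (B i)) = uconj U (B i)"
        unfolding uconj_uconj[OF U W' ccB(1), symmetric] uconj_cancel[OF W cs(3)] ..
      have "norm2 (f C i - uconj (U * star_mat W) (f (g B) i)) \<le>
         norm2 (f C i - uconj U (B i)) + norm2 (uconj U (B i) - uconj (U * star_mat W) (f (g B) i))"
        by (rule norm2_diff_triangle[OF cs(1) ccB(2) Vc[OF cs(2)]])
      also have "uconj U (B i) - uconj (U * star_mat W) (f (g B) i) = uconj (U * star_mat W) (uconj W (B i) - f (g B) i)"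
        unfolding uconj_diff[OF UW ccB(1) cs(2)] e ..
      also have "norm2 (uconj (U * star_mat W) (uconj W (B i) - f (g B) i)) \<le> norm2 (uconj W (B i) - f (g B) i)"
        by (rule norm2_uconj[OF UW]) (simp add: cs minus_carrier_mat)
      also have "\<dots> = norm2 (f (g B) i - uconj W (B i))" by (rule norm2_minus_commute[OF ccB(1) cs(2)])
      finally show "norm2 (f C i - uconj (U * star_mat W) (f (g B) i)) < 2 * \<epsilon>'" using n[OF i] n'[OF i] by simp
    qed
    then show ?thesis using BD UW by blast
  qed
  moreover have "g ` D \<subseteq> \<Omega>1" "finite (g ` D)" using g(1) \<Omega>'(2) by (auto simp: D_def)
  moreover have "card (g ` D) \<le> card \<Omega>'" by (rule order_trans[OF card_image_le card_mono]) (use \<Omega>'(2) in \<open>auto simp: D_def\<close>)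
  ultimately show "(INF \<Omega>'\<in>{\<Omega>'. \<Omega>' \<subseteq> \<Omega>1 \<and> finite \<Omega>' \<and> (\<forall>C\<in>\<Omega>1. \<exists>B\<in>\<Omega>'. \<exists>U\<in>unitary_mats N. \<forall>i\<in>E. norm2 (C i - uconj U (B i)) < \<epsilon>)}.
      enat (card \<Omega>')) \<le> enat (card \<Omega>')" by (intro INF_lower2[of "g ` D"]) auto
qed

lemma orbital_growth_mono:
  assumes "\<And>N. N \<ge> 1 \<Longrightarrow> orbital_covering_number N E \<epsilon> (\<Omega>1 N) \<le> orbital_covering_number N E' \<epsilon>' (\<Omega>2 N)"
  shows "orbital_growth E \<epsilon> \<Omega>1 \<le> orbital_growth E' \<epsilon>' \<Omega>2"
proof -
  have log: "log_enat m \<le> log_enat n" if "m \<le> n" for m n using that by (cases m; cases n) (auto simp: log_enat_def)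
  show ?thesis unfolding orbital_growth_def
    by (rule Limsup_mono) (auto simp: eventually_sequentially intro!: exI[of _ 1] ereal_mult_left_mono log assms)
qed

text \<open>The centres of a covering lie in the covered set, so that passing to a subset costs a factor \<open>2\<close> in the radius.\<close>

lemma orbital_growth_subset:
  assumes sub: "\<And>N. N \<ge> 1 \<Longrightarrow> \<Omega>1 N \<subseteq> \<Omega>2 N" and c: "\<And>N B i. B \<in> \<Omega>2 N \<Longrightarrow> i \<in> E \<Longrightarrow> B i \<in> carrier_mat N N"
  shows "orbital_growth E \<epsilon> \<Omega>1 \<le> orbital_growth E (\<epsilon> / 2) \<Omega>2"
  by (rule orbital_growth_mono, rule orbital_covering_le[where f="\<lambda>C. C"]) (use sub c in auto)

section \<open>Microstates with prescribed units\<close>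

text \<open>Operator system microstates have \<open>A\<^sub>1 = 1\<close> exactly, but the law of a microstate gives this only approximately. Requiring it on
  the indices \<open>I0\<close> of units connects the two.\<close>

definition unital_microstates ::
  "real \<Rightarrow> 'i set \<Rightarrow> 'i set \<Rightarrow> nat \<Rightarrow> ('i nc_poly \<Rightarrow> complex) set \<Rightarrow> ('i \<Rightarrow> complex mat) set" where
  "unital_microstates R I I0 N U = {A \<in> microstates R I N U. \<forall>i\<in>I0. A i = 1\<^sub>m N}"

definition unital_entropy :: "real \<Rightarrow> 'i set \<Rightarrow> 'i set \<Rightarrow> ('i nc_poly \<Rightarrow> complex) set \<Rightarrow> ereal" where
  "unital_entropy R I I0 K =
     (SUP E\<in>{E. finite E \<and> E \<subseteq> I}. SUP \<epsilon>\<in>{0<..}.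
        INF U\<in>{U. openin (law_topology R I) U \<and> K \<subseteq> U}.
          orbital_growth E \<epsilon> (\<lambda>N. unital_microstates R I I0 N U))"

lemma unital_entropy_empty: "unital_entropy R I {} K = one_bounded_entropy R I K"
  by (simp add: unital_entropy_def one_bounded_entropy_def unital_microstates_def)

text \<open>A tuple on \<open>I\<close> is undefined elsewhere, whereas the evaluation of polynomials is stated for tuples of matrices of the same size at
  all indices.\<close>

definition zero_ext :: "nat \<Rightarrow> 'i set \<Rightarrow> ('i \<Rightarrow> complex mat) \<Rightarrow> 'i \<Rightarrow> complex mat" where
  "zero_ext N I A i = (if i \<in> I then A i else 0\<^sub>m N N)"

lemma zero_ext_carrier: "A \<in> I \<rightarrow>\<^sub>E carrier_mat N N \<Longrightarrow> zero_ext N I A i \<in> carrier_mat N N" by (auto simp: zero_ext_def)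

lemma mat_law_zero_ext: "P \<in> nc_polys I \<Longrightarrow> mat_law N I A P = ntr (nc_eval_mat N (zero_ext N I A) P)"
  by (simp add: mat_law_def nc_eval_mat_cong[of P I A "zero_ext N I A"] zero_ext_def)

section \<open>Independence of the generators\<close>

lemma var_image: "a ` I \<subseteq> nc_eval a ` nc_polys I"
proof clarify
  fix i assume "i \<in> I"
  then show "a i \<in> nc_eval a ` nc_polys I" using nc_polys_var[of i I] by (intro image_eqI[of _ _ "nc_var i"]) auto
qed

lemma approx_poly:
  assumes "cstar_generates (a ` I)" "e > 0"
  obtains P where "P \<in> nc_polys I" "norm (nc_eval a P - x) < e" using nc_eval_dense[OF assms(1) var_image assms(2)] by blast

text \<open>Approximating \<open>(1 - d) x\<close> yields a strict bound of the norm; it makes the ratio of the moments to the powers of \<open>R\<close> tend to \<open>0\<close>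
  when a microstate is truncated.\<close>

lemma approx_poly_bounded:
  assumes gen: "cstar_generates (a ` I)" and e: "e > 0" and R: "R > 0" and x: "norm x \<le> R"
  obtains P where "P \<in> nc_polys I" "norm (nc_eval a P - x) < e" "norm (nc_eval a P) < R"
proof -
  define d where "d = min 1 (e / (2 * R))"
  have d: "0 < d" "d \<le> 1" "d * R \<le> e / 2" using e R by (auto simp: d_def min_def field_simps)
  have "min (e / 2) (d * R) > 0" using d R e by simp
  from approx_poly[OF gen this, of "(1 - d) *\<^sub>R x"]
  obtain P where P: "P \<in> nc_polys I" "norm (nc_eval a P - (1 - d) *\<^sub>R x) < min (e / 2) (d * R)" by blast
  have "norm (nc_eval a P - x) \<le> norm (nc_eval a P - (1 - d) *\<^sub>R x) + norm ((1 - d) *\<^sub>R x - x)"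
    using norm_triangle_ineq[of "nc_eval a P - (1 - d) *\<^sub>R x" "(1 - d) *\<^sub>R x - x"] by simp
  also have "(1 - d) *\<^sub>R x - x = - (d *\<^sub>R x)" by (simp add: scaleR_left_diff_distrib)
  also have "norm (- (d *\<^sub>R x)) \<le> d * R" using d x by (simp add: mult_left_mono)
  finally have 1: "norm (nc_eval a P - x) < e" using P(2) d by simp
  have "norm (nc_eval a P) \<le> norm (nc_eval a P - (1 - d) *\<^sub>R x) + norm ((1 - d) *\<^sub>R x)"
    using norm_triangle_ineq[of "nc_eval a P - (1 - d) *\<^sub>R x" "(1 - d) *\<^sub>R x"] by simp
  also have "norm ((1 - d) *\<^sub>R x) \<le> (1 - d) * R" using d x by (simp add: mult_left_mono)
  finally have "norm (nc_eval a P) < R" using P(2) by (simp add: algebra_simps)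
  with P(1) 1 show ?thesis using that by blast
qed

lemma finite_common_support:
  assumes "finite Ps" "Ps \<subseteq> nc_polys I"
  obtains I' where "finite I'" "I' \<subseteq> I" "Ps \<subseteq> nc_polys I'"
proof -
  have "\<exists>J. finite J \<and> J \<subseteq> I \<and> P \<in> nc_polys J" if P: "P \<in> Ps" for P
  proof -
    have "P \<in> nc_polys I" using assms(2) P by blast
    from nc_polys_finite_support[OF this] show ?thesis by metis
  qed
  then obtain J where J: "\<And>P. P \<in> Ps \<Longrightarrow> finite (J P)" "\<And>P. P \<in> Ps \<Longrightarrow> J P \<subseteq> I" "\<And>P. P \<in> Ps \<Longrightarrow> P \<in> nc_polys (J P)" by metis
  show ?thesis
  proof (rule that[of "\<Union>P\<in>Ps. J P"])
    show "finite (\<Union>P\<in>Ps. J P)" using assms(1) J(1) by (rule finite_UN_I)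
    show "(\<Union>P\<in>Ps. J P) \<subseteq> I" using J(2) by (rule UN_least)
    show "Ps \<subseteq> nc_polys (\<Union>P\<in>Ps. J P)"
    proof
      fix P assume P: "P \<in> Ps"
      then show "P \<in> nc_polys (\<Union>P\<in>Ps. J P)" using nc_polys_mono[of "J P" "\<Union>P\<in>Ps. J P"] J(3)[OF P] P by blast
    qed
  qed
qed

text \<open>A microstate for the second generators is obtained from one for the first by inserting it
  into polynomials \<open>p j\<close> that approximate the second generators and truncating; the prescribed units are inserted exactly.
  The first microstate is recovered up to a small error by the polynomials \<open>Q i\<close>, which approximate the first generators in
  terms of the second. So a covering by orbits pulls back.\<close>

lemma microstate_transfer:
  fixes a :: "'i \<Rightarrow> 'b::cstar_algebra" and b :: "'j \<Rightarrow> 'b"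
  assumes genI: "cstar_generates (a ` I)" and aR: "\<forall>i\<in>I. norm (a i) \<le> R1" and R1: "R1 > 0"
    and bR: "\<forall>j\<in>J. norm (b j) \<le> R2" and R2: "R2 > 0" and J0: "J0 \<subseteq> J" "\<forall>j\<in>J0. b j = 1"
    and E: "finite E" "E \<subseteq> I" and \<epsilon>: "\<epsilon> > 0" and E': "finite E'" "E' \<subseteq> J"
    and Q: "\<And>i. i \<in> E \<Longrightarrow> Q i \<in> nc_polys E'" "\<And>i. i \<in> E \<Longrightarrow> norm (nc_eval b (Q i) - a i) < \<epsilon> / 16"
    and \<epsilon>': "\<epsilon>' > 0" "\<And>i. i \<in> E \<Longrightarrow> poly_const (max 1 R2) (Q i) * (2 * \<epsilon>') \<le> \<epsilon> / 4"
    and U': "openin (law_topology R2 J) U'" "trace_laws J b \<subseteq> U'"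
  obtains U where "openin (law_topology R1 I) U" "trace_laws I a \<subseteq> U"
    "\<And>N. N \<ge> 1 \<Longrightarrow> orbital_covering_number N E \<epsilon> (unital_microstates R1 I I0 N U)
       \<le> orbital_covering_number N E' \<epsilon>' (unital_microstates R2 J J0 N U')"
proof -
  obtain Ps' \<kappa>' where Ps': "finite Ps'" "Ps' \<subseteq> nc_polys J" and \<kappa>': "\<kappa>' > 0" and nb: "law_nbhd R2 J b Ps' \<kappa>' \<subseteq> U'"
    using law_nbhd_exists[OF U'] by blast
  obtain J1 where J1: "finite J1" "J1 \<subseteq> J" "Ps' \<subseteq> nc_polys J1" using finite_common_support[OF Ps'] by blast
  define J2 where "J2 = E' \<union> J1"
  have J2: "finite J2" "J2 \<subseteq> J" "E' \<subseteq> J2" using J1 E' by (auto simp: J2_def)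
  have PsJ2: "P \<in> nc_polys J2" if "P \<in> Ps'" for P using that J1(3) nc_polys_mono[of J1 J2] by (auto simp: J2_def)
  have QJ2: "Q i \<in> nc_polys J2" if "i \<in> E" for i using Q(1)[OF that] nc_polys_mono[OF J2(3)] by blast
  \<comment> \<open>polynomials approximating the second generators\<close>
  have "\<exists>P. P \<in> nc_polys I \<and> norm (nc_eval a P - b j) < 1 / real (Suc n) \<and> norm (nc_eval a P) < R2"
    if j: "j \<in> J" for n j
  proof -
    have "1 / real (Suc n) > 0" by simp
    from approx_poly_bounded[OF genI this R2, of "b j"] show ?thesis using bR j by metis
  qed
  then have "\<forall>n j. \<exists>P. j \<in> J \<longrightarrow> P \<in> nc_polys I \<and> norm (nc_eval a P - b j) < 1 / real (Suc n) \<and> norm (nc_eval a P) < R2" by blast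
  then obtain p0 where p0: "\<And>n j. j \<in> J \<Longrightarrow> p0 n j \<in> nc_polys I"
    "\<And>n j. j \<in> J \<Longrightarrow> norm (nc_eval a (p0 n j) - b j) < 1 / real (Suc n)"
    "\<And>n j. j \<in> J \<Longrightarrow> norm (nc_eval a (p0 n j)) < R2" by metis
  define p1 where "p1 n j = (if j \<in> J0 then 1 else p0 n j)" for n j
  have lim: "(\<lambda>n. nc_eval a (p1 n j)) \<longlonglongrightarrow> b j" if j: "j \<in> J2" for j
  proof -
    have jJ: "j \<in> J" using j J2 by auto
    have "(\<lambda>n. nc_eval a (p1 n j) - b j) \<longlonglongrightarrow> 0"
    proof (rule Lim_null_comparison[where g="\<lambda>n. 1 / real (Suc n)"])
      show "\<forall>\<^sub>F n in sequentially. norm (nc_eval a (p1 n j) - b j) \<le> 1 / real (Suc n)"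
        using p0(2)[OF jJ] J0(2) by (auto simp: p1_def less_imp_le)
      show "(\<lambda>n. 1 / real (Suc n)) \<longlonglongrightarrow> 0" using LIMSEQ_inverse_real_of_nat by (simp add: inverse_eq_divide)
    qed
    then show ?thesis by (rule LIM_zero_cancel)
  qed
  have PQ: "P \<in> nc_polys J2" if "P \<in> Ps' \<union> Q ` E" for P using that PsJ2 QJ2 by auto
  have "\<forall>\<^sub>F n in sequentially. \<forall>P\<in>Ps' \<union> Q ` E. norm (nc_eval (\<lambda>j. nc_eval a (p1 n j)) P - nc_eval b P) < min (\<kappa>' / 3) (\<epsilon> / 32)"
  proof (rule eventually_ball_finite, use Ps'(1) E(1) in simp, rule ballI)
    fix P assume "P \<in> Ps' \<union> Q ` E"
    from tendsto_nc_eval[OF lim PQ[OF this]]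
    show "\<forall>\<^sub>F n in sequentially. norm (nc_eval (\<lambda>j. nc_eval a (p1 n j)) P - nc_eval b P) < min (\<kappa>' / 3) (\<epsilon> / 32)"
      using tendstoD[of _ _ _ "min (\<kappa>' / 3) (\<epsilon> / 32)"] \<kappa>' \<epsilon> by (fastforce simp: dist_norm)
  qed
  from eventually_happens'[OF _ this] obtain n where
    n: "\<And>P. P \<in> Ps' \<union> Q ` E \<Longrightarrow> norm (nc_eval (\<lambda>j. nc_eval a (p1 n j)) P - nc_eval b P) < min (\<kappa>' / 3) (\<epsilon> / 32)" by auto
  define p where "p j = (if j \<in> J2 then p1 n j else 0)" for j
  have pI: "p j \<in> nc_polys I" for j using p0(1) J2 by (auto simp: p_def p1_def)
  have p_one: "p j = 1" if "j \<in> J2" "j \<in> J0" for j using that by (simp add: p_def p1_def)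
  have p_less: "norm (nc_eval a (p j)) < R2" if "j \<in> J2" "j \<notin> J0" for j using that p0(3) J2 by (auto simp: p_def p1_def)
  have subst_eq: "nc_eval a (nc_subst p P) = nc_eval (\<lambda>j. nc_eval a (p1 n j)) P" if "P \<in> nc_polys J2" for P
    unfolding nc_eval_subst by (rule nc_eval_cong[OF that]) (simp add: p_def)
  have nP: "norm (nc_eval a (nc_subst p P) - nc_eval b P) < \<kappa>' / 3" if "P \<in> Ps'" for P
    unfolding subst_eq[OF PsJ2[OF that]] using n[of P] that by simp
  define Z where "Z i = nc_subst p (Q i) - nc_var i" for i
  have ZI: "Z i \<in> nc_polys I" if "i \<in> E" for i
    unfolding Z_def using E that pI by (intro nc_polys_diff nc_polys_var nc_polys_subst[OF QJ2]) auto
  have nZ: "norm (nc_eval a (Z i)) < 3 * \<epsilon> / 32" if i: "i \<in> E" for i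
  proof -
    have "nc_eval a (Z i) = (nc_eval (\<lambda>j. nc_eval a (p1 n j)) (Q i) - nc_eval b (Q i)) + (nc_eval b (Q i) - a i)"
      by (simp add: Z_def nc_eval_diff subst_eq[OF QJ2[OF i]])
    also have "norm \<dots> \<le> norm (nc_eval (\<lambda>j. nc_eval a (p1 n j)) (Q i) - nc_eval b (Q i)) + norm (nc_eval b (Q i) - a i)"
      by (rule norm_triangle_ineq)
    finally show ?thesis using n[of "Q i"] i Q(2)[OF i] by simp
  qed
  \<comment> \<open>uniform bounds and Lipschitz constants for matrices\<close>
  define M where "M = max (max 1 R2) (\<Sum>j\<in>J2. poly_const (max 1 R1) (p j))"
  have M: "M \<ge> 1" "R2 \<le> M" by (auto simp: M_def)
  have pM: "mat_norm (nc_eval_mat N A (p j)) \<le> M" if j: "j \<in> J2" and A: "bounded_tuple N I (max 1 R1) A" for j N A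
  proof -
    have "mat_norm (nc_eval_mat N A (p j)) \<le> poly_const (max 1 R1) (p j)" by (rule poly_mat_norm_bound[OF pI A]) simp
    also have "\<dots> \<le> (\<Sum>j\<in>J2. poly_const (max 1 R1) (p j))" by (rule member_le_sum[OF j]) (auto simp: J2 poly_const_nonneg)
    finally show ?thesis by (simp add: M_def)
  qed
  define L where "L = (\<Sum>P\<in>Ps' \<union> Q ` E. poly_const M P)"
  have L0: "L \<ge> 0" using M by (auto simp: L_def intro!: sum_nonneg poly_const_nonneg)
  have L: "norm2 (nc_eval_mat N A P - nc_eval_mat N B P) \<le> L * d"
    if P: "P \<in> Ps' \<union> Q ` E" and AB: "bounded_tuple N J2 M A" "bounded_tuple N J2 M B"
      and d: "\<And>j. j \<in> J2 \<Longrightarrow> norm2 (A j - B j) \<le> d" "0 \<le> d" for P N A B d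
  proof -
    have "norm2 (nc_eval_mat N A P - nc_eval_mat N B P) \<le> poly_const M P * d" by (rule poly_mat_lipschitz[OF PQ[OF P] AB d M(1)])
    also have "poly_const M P \<le> L" unfolding L_def by (rule member_le_sum[OF P]) (use M Ps' E in \<open>auto intro: poly_const_nonneg\<close>)
    finally show ?thesis using d(2) by (simp add: mult_right_mono)
  qed
  define \<eta> where "\<eta> = min (\<kappa>' / 3) (\<epsilon> / 8) / (L + 1)"
  have \<eta>: "\<eta> > 0" "L * \<eta> \<le> \<kappa>' / 3" "L * \<eta> \<le> \<epsilon> / 8"
  proof -
    have m: "min (\<kappa>' / 3) (\<epsilon> / 8) > 0" using \<kappa>' \<epsilon> by simp
    then show "\<eta> > 0" using L0 by (simp add: \<eta>_def)
    have "(L + 1) * \<eta> = min (\<kappa>' / 3) (\<epsilon> / 8)" using L0 by (simp add: \<eta>_def)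
    then have "L * \<eta> \<le> min (\<kappa>' / 3) (\<epsilon> / 8)" using \<open>\<eta> > 0\<close> unfolding distrib_right by linarith
    then show "L * \<eta> \<le> \<kappa>' / 3" "L * \<eta> \<le> \<epsilon> / 8" by auto
  qed
  \<comment> \<open>a moment that is high enough to detect the part of the spectrum beyond \<open>R2\<close>\<close>
  have "\<forall>\<^sub>F k in sequentially. \<forall>j\<in>J2 - J0. M\<^sup>2 * ((norm (nc_eval a (p j)) / R2)\<^sup>2) ^ k < \<eta>\<^sup>2 / 2"
  proof (rule eventually_ball_finite, use J2 in simp, rule ballI)
    fix j assume j: "j \<in> J2 - J0"
    have "(norm (nc_eval a (p j)) / R2)\<^sup>2 < 1" using p_less[of j] j R2 by (simp add: power_less_one_iff abs_less_iff)
    then have "(\<lambda>k. M\<^sup>2 * ((norm (nc_eval a (p j)) / R2)\<^sup>2) ^ k) \<longlonglongrightarrow> M\<^sup>2 * 0" by (intro tendsto_intros LIMSEQ_power_zero) simp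
    then show "\<forall>\<^sub>F k in sequentially. M\<^sup>2 * ((norm (nc_eval a (p j)) / R2)\<^sup>2) ^ k < \<eta>\<^sup>2 / 2" by (rule order_tendstoD) (use \<eta> in simp)
  qed
  then obtain k where k: "\<And>j. j \<in> J2 \<Longrightarrow> j \<notin> J0 \<Longrightarrow> M\<^sup>2 * ((norm (nc_eval a (p j)) / R2)\<^sup>2) ^ k < \<eta>\<^sup>2 / 2"
    using eventually_happens'[of sequentially] by fastforce
  \<comment> \<open>the bound \<open>\<epsilon>\<^sup>2 / 1024\<close> is taken because \<open>(3/32)\<^sup>2 + 1/1024 \<le> (1/8)\<^sup>2\<close>\<close>
  define \<kappa> where "\<kappa> = min (min (\<kappa>' / 3) (\<epsilon>\<^sup>2 / 1024)) (\<eta>\<^sup>2 / 2 * R2 ^ (2 * k) / M\<^sup>2)"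
  have \<kappa>: "\<kappa> > 0" "\<kappa> \<le> \<kappa>' / 3" "\<kappa> \<le> \<epsilon>\<^sup>2 / 1024" "M\<^sup>2 * (\<kappa> / R2 ^ (2 * k)) \<le> \<eta>\<^sup>2 / 2"
  proof -
    show "\<kappa> > 0" using \<kappa>' \<epsilon> \<eta>(1) R2 M(1) by (simp add: \<kappa>_def)
    show "\<kappa> \<le> \<kappa>' / 3" "\<kappa> \<le> \<epsilon>\<^sup>2 / 1024" by (simp_all add: \<kappa>_def)
    have "\<kappa> \<le> \<eta>\<^sup>2 / 2 * R2 ^ (2 * k) / M\<^sup>2" by (simp add: \<kappa>_def)
    then have "M\<^sup>2 * (\<kappa> / R2 ^ (2 * k)) \<le> M\<^sup>2 * ((\<eta>\<^sup>2 / 2 * R2 ^ (2 * k) / M\<^sup>2) / R2 ^ (2 * k))"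
      using R2 by (intro mult_left_mono divide_right_mono) auto
    also have "\<dots> = \<eta>\<^sup>2 / 2" using R2 M(1) by simp
    finally show "M\<^sup>2 * (\<kappa> / R2 ^ (2 * k)) \<le> \<eta>\<^sup>2 / 2" .
  qed
  define mo where "mo j = (nc_star (p j) * p j) ^ k" for j
  define Ps where "Ps = nc_subst p ` Ps' \<union> mo ` J2 \<union> (\<lambda>i. nc_star (Z i) * Z i) ` E"
  have Ps: "finite Ps" "Ps \<subseteq> nc_polys I"
  proof -
    show "finite Ps" using Ps'(1) J2(1) E(1) by (simp add: Ps_def)
    have "nc_subst p ` Ps' \<subseteq> nc_polys I" using pI by (auto intro!: nc_polys_subst[OF PsJ2])
    moreover have "mo ` J2 \<subseteq> nc_polys I" using pI by (auto simp: mo_def intro!: nc_polys_power nc_polys_mult nc_polys_star)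
    moreover have "(\<lambda>i. nc_star (Z i) * Z i) ` E \<subseteq> nc_polys I" using ZI by (auto intro!: nc_polys_mult nc_polys_star)
    ultimately show "Ps \<subseteq> nc_polys I" by (simp add: Ps_def)
  qed
  define U where "U = law_nbhd R1 I a Ps \<kappa>"
  show ?thesis
  proof (rule that[of U])
    show "openin (law_topology R1 I) U" unfolding U_def by (rule law_nbhd_open[OF Ps])
    show "trace_laws I a \<subseteq> U" unfolding U_def by (rule trace_laws_nbhd[OF aR Ps(2) \<kappa>(1)])
    fix N :: nat assume N: "N \<ge> 1"
    let ?\<Omega>1 = "unital_microstates R1 I I0 N U" and ?\<Omega>2 = "unital_microstates R2 J J0 N U'"
    let ?p = "\<lambda>A j. nc_eval_mat N (zero_ext N I A) (p j)"
    have A: "zero_ext N I A i \<in> carrier_mat N N" "i \<in> I \<Longrightarrow> mat_norm (zero_ext N I A i) \<le> R1" if "A \<in> ?\<Omega>1" for A i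
      using that zero_ext_carrier[of A I N i] by (auto simp: unital_microstates_def microstates_def zero_ext_def)
    have At: "bounded_tuple N I (max 1 R1) (zero_ext N I A)" if "A \<in> ?\<Omega>1" for A using A[OF that] by (fastforce simp: bounded_tuple_def)
    have pc: "?p A j \<in> carrier_mat N N" if "A \<in> ?\<Omega>1" for A j by (rule nc_eval_mat_carrier[OF A(1)[OF that]])
    have pt: "bounded_tuple N J2 M (?p A)" if "A \<in> ?\<Omega>1" for A using pM[OF _ At[OF that]] pc[OF that] by (simp add: bounded_tuple_def)
    have law: "\<exists>\<tau>. tracial_state \<tau> \<and> (\<forall>P\<in>Ps. cmod (ntr (nc_eval_mat N (zero_ext N I A) P) - \<tau> (nc_eval a P)) < \<kappa>)"
      if "A \<in> ?\<Omega>1" for A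
    proof -
      have "mat_law N I A \<in> law_nbhd R1 I a Ps \<kappa>" using that by (simp add: unital_microstates_def microstates_def U_def)
      then obtain \<tau> where "tracial_state \<tau>" "\<And>P. P \<in> Ps \<Longrightarrow> cmod (mat_law N I A P - \<tau> (nc_eval a P)) < \<kappa>" by (auto simp: law_nbhd_def)
      moreover have "mat_law N I A P = ntr (nc_eval_mat N (zero_ext N I A) P)" if "P \<in> Ps" for P
        using Ps(2) that by (intro mat_law_zero_ext) blast
      ultimately show ?thesis by (intro exI[of _ \<tau>]) simp
    qed
    have close_gen: "norm2 (A i - nc_eval_mat N (?p A) (Q i)) \<le> \<epsilon> / 8" if A1: "A \<in> ?\<Omega>1" and i: "i \<in> E" for A i
    proof -
      obtain \<tau> where \<tau>: "tracial_state \<tau>" and l: "\<And>P. P \<in> Ps \<Longrightarrow> cmod (ntr (nc_eval_mat N (zero_ext N I A) P) - \<tau> (nc_eval a P)) < \<kappa>"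
        using law[OF A1] by blast
      interpret t: pos_functional \<tau> by (rule tracial_state_pos_functional[OF \<tau>])
      note Ac = A(1)[OF A1]
      let ?X = "nc_eval_mat N (zero_ext N I A) (Z i)"
      have X: "?X \<in> carrier_mat N N" by (rule nc_eval_mat_carrier[OF Ac])
      have "ntr (nc_eval_mat N (zero_ext N I A) (nc_star (Z i) * Z i)) = of_real ((norm2 ?X)\<^sup>2)"
        unfolding nc_eval_mat_mult[OF Ac] nc_eval_mat_star[OF Ac] by (rule ntr_star_mult_norm2[OF X])
      moreover have "cmod (ntr (nc_eval_mat N (zero_ext N I A) (nc_star (Z i) * Z i)) - \<tau> (nc_eval a (nc_star (Z i) * Z i))) < \<kappa>"
        using i by (intro l) (simp add: Ps_def)
      moreover have "cmod (\<tau> (nc_eval a (nc_star (Z i) * Z i))) \<le> (3 * \<epsilon> / 32)\<^sup>2"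
      proof -
        have "cmod (\<tau> (nc_eval a (nc_star (Z i) * Z i))) \<le> norm (nc_eval a (nc_star (Z i) * Z i))" by (rule t.norm_le)
        also have "\<dots> = (norm (nc_eval a (Z i)))\<^sup>2" by (simp add: nc_eval_mult nc_eval_star cstar_identity)
        also have "\<dots> \<le> (3 * \<epsilon> / 32)\<^sup>2" using nZ[OF i] by (intro power_mono) auto
        finally show ?thesis .
      qed
      ultimately have "cmod (of_real ((norm2 ?X)\<^sup>2)) \<le> \<kappa> + (3 * \<epsilon> / 32)\<^sup>2"
        using norm_triangle_ineq2[of "of_real ((norm2 ?X)\<^sup>2)" "\<tau> (nc_eval a (nc_star (Z i) * Z i))"] by (simp del: of_real_power)
      also have "\<dots> \<le> \<epsilon>\<^sup>2 / 1024 + (3 * \<epsilon> / 32)\<^sup>2" using \<kappa>(3) by simp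
      also have "\<dots> \<le> (\<epsilon> / 8)\<^sup>2" by (simp add: power_divide power_mult_distrib)
      finally have "(norm2 ?X)\<^sup>2 \<le> (\<epsilon> / 8)\<^sup>2" by (simp del: of_real_power)
      then have le: "norm2 ?X \<le> \<epsilon> / 8" by (rule power2_le_imp_le) (use \<epsilon> in simp)
      have iI: "i \<in> I" using i E by auto
      have Ai: "zero_ext N I A i = A i" using iI by (simp add: zero_ext_def)
      have "?X = nc_eval_mat N (?p A) (Q i) - A i"
        unfolding Z_def nc_eval_mat_diff[OF Ac] nc_eval_mat_subst[OF Ac] nc_eval_mat_var[OF Ac] Ai ..
      moreover have "A i \<in> carrier_mat N N" using Ac[of i] iI by (simp add: zero_ext_def)
      moreover have "nc_eval_mat N (?p A) (Q i) \<in> carrier_mat N N" by (rule nc_eval_mat_carrier[OF pc[OF A1]])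
      ultimately show ?thesis using le norm2_minus_commute by metis
    qed
    have "\<exists>Y. Y \<in> ?\<Omega>2 \<and> (\<forall>j\<in>J2. norm2 (?p A j - Y j) \<le> \<eta>)" if A1: "A \<in> ?\<Omega>1" for A
    proof -
      obtain \<tau> where \<tau>: "tracial_state \<tau>" and l: "\<And>P. P \<in> Ps \<Longrightarrow> cmod (ntr (nc_eval_mat N (zero_ext N I A) P) - \<tau> (nc_eval a P)) < \<kappa>"
        using law[OF A1] by blast
      interpret t: pos_functional \<tau> by (rule tracial_state_pos_functional[OF \<tau>])
      note Ac = A(1)[OF A1] and pcA = pc[OF A1]
      have "\<exists>Y. Y \<in> carrier_mat N N \<and> mat_norm Y \<le> R2 \<and> norm2 (?p A j - Y) \<le> \<eta>" if j: "j \<in> J2" "j \<notin> J0" for j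
      proof -
        obtain Y where Y: "Y \<in> carrier_mat N N" "mat_norm Y \<le> R2"
          "\<And>k. (norm2 (?p A j - Y))\<^sup>2 \<le> M\<^sup>2 * (Re (ntr ((star_mat (?p A j) * ?p A j) ^\<^sub>m k)) / R2 ^ (2 * k))"
          using truncation[OF pcA R2 pM[OF j(1) At[OF A1]]] by blast
        have mo: "nc_eval_mat N (zero_ext N I A) (mo j) = (star_mat (?p A j) * ?p A j) ^\<^sub>m k"
          unfolding mo_def nc_eval_mat_power[OF Ac] nc_eval_mat_mult[OF Ac] nc_eval_mat_star[OF Ac] ..
        have "Re (ntr (nc_eval_mat N (zero_ext N I A) (mo j))) \<le> cmod (\<tau> (nc_eval a (mo j))) + \<kappa>"
        proof -
          have "cmod (ntr (nc_eval_mat N (zero_ext N I A) (mo j)) - \<tau> (nc_eval a (mo j))) < \<kappa>" using j by (intro l) (simp add: Ps_def)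
          then show ?thesis using norm_triangle_ineq2[of "ntr (nc_eval_mat N (zero_ext N I A) (mo j))" "\<tau> (nc_eval a (mo j))"]
              complex_Re_le_cmod[of "ntr (nc_eval_mat N (zero_ext N I A) (mo j))"] by simp
        qed
        also have "cmod (\<tau> (nc_eval a (mo j))) \<le> ((norm (nc_eval a (p j)))\<^sup>2) ^ k"
        proof -
          have "cmod (\<tau> (nc_eval a (mo j))) \<le> norm (nc_eval a (mo j))" by (rule t.norm_le)
          also have "\<dots> \<le> norm (star (nc_eval a (p j)) * nc_eval a (p j)) ^ k"
            unfolding mo_def nc_eval_power nc_eval_mult nc_eval_star by (rule norm_power_ineq)
          finally show ?thesis by (simp add: cstar_identity)
        qed
        finally have "M\<^sup>2 * (Re (ntr ((star_mat (?p A j) * ?p A j) ^\<^sub>m k)) / R2 ^ (2 * k)) \<le>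
           M\<^sup>2 * ((((norm (nc_eval a (p j)))\<^sup>2) ^ k + \<kappa>) / R2 ^ (2 * k))"
          unfolding mo using R2 by (intro mult_left_mono divide_right_mono) auto
        also have "\<dots> = M\<^sup>2 * ((norm (nc_eval a (p j)) / R2)\<^sup>2) ^ k + M\<^sup>2 * (\<kappa> / R2 ^ (2 * k))"
          by (simp add: add_divide_distrib distrib_left power_divide power_mult)
        also have "\<dots> \<le> \<eta>\<^sup>2 / 2 + \<eta>\<^sup>2 / 2" using k[OF j] \<kappa>(4) by (intro add_mono) auto
        finally have "(norm2 (?p A j - Y))\<^sup>2 \<le> \<eta>\<^sup>2" using Y(3)[of k] by simp
        then have "norm2 (?p A j - Y) \<le> \<eta>" by (rule power2_le_imp_le) (use \<eta> in simp)
        then show ?thesis using Y by blast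
      qed
      then obtain T where T: "\<And>j. j \<in> J2 \<Longrightarrow> j \<notin> J0 \<Longrightarrow> T j \<in> carrier_mat N N"
        "\<And>j. j \<in> J2 \<Longrightarrow> j \<notin> J0 \<Longrightarrow> mat_norm (T j) \<le> R2" "\<And>j. j \<in> J2 \<Longrightarrow> j \<notin> J0 \<Longrightarrow> norm2 (?p A j - T j) \<le> \<eta>" by metis
      define Y where "Y = restrict (\<lambda>j. if j \<in> J0 then 1\<^sub>m N else if j \<in> J2 then T j else 0\<^sub>m N N) J"
      have Yc: "Y \<in> J \<rightarrow>\<^sub>E carrier_mat N N" using T by (auto simp: Y_def)
      have Yn: "mat_norm (Y j) \<le> R2" if j: "j \<in> J" for j
      proof (cases "j \<in> J0")
        case True
        have "1 \<le> R2" using bR[rule_format, OF j] J0(2) True by simp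
        then show ?thesis using j True mat_norm_one_le[of N, where 'a=complex] by (simp add: Y_def)
      qed (use j T R2 in \<open>auto simp: Y_def\<close>)
      have Yd: "norm2 (?p A j - Y j) \<le> \<eta>" if j: "j \<in> J2" for j
      proof (cases "j \<in> J0")
        case True
        have z: "1\<^sub>m N - 1\<^sub>m N = (0\<^sub>m N N :: complex mat)" by (rule eq_matI) auto
        have "norm2 (0\<^sub>m N N) \<le> 0" using norm2_le_mat_norm[of "0\<^sub>m N N" N] by simp
        then show ?thesis using j True J2 \<eta> p_one[OF j True] by (auto simp: Y_def nc_eval_mat_one[OF Ac] z)
      qed (use j T J2 in \<open>auto simp: Y_def\<close>)
      have Yt: "zero_ext N J Y j \<in> carrier_mat N N" for j by (rule zero_ext_carrier[OF Yc])
      have "mat_law N J Y \<in> law_nbhd R2 J b Ps' \<kappa>'" unfolding law_nbhd_def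
      proof (intro CollectI conjI exI[of _ \<tau>] ballI \<tau>)
        show "mat_law N J Y \<in> law_space R2 J" by (rule mat_law_in_law_space[OF Yc Yn]) (use R2 N in auto)
        fix P assume P: "P \<in> Ps'"
        let ?A = "nc_eval_mat N (?p A) P" and ?Y = "nc_eval_mat N (zero_ext N J Y) P"
        let ?t = "\<tau> (nc_eval a (nc_subst p P))" and ?b = "\<tau> (nc_eval b P)"
        have "norm2 (?A - ?Y) \<le> L * \<eta>"
        proof (rule L[OF _ pt[OF A1]])
          show "P \<in> Ps' \<union> Q ` E" using P by simp
          have "mat_norm (zero_ext N J Y j) \<le> M" if "j \<in> J2" for j using order_trans[OF Yn M(2)] that J2(2) by (auto simp: zero_ext_def)
          then show "bounded_tuple N J2 M (zero_ext N J Y)" using Yt by (simp add: bounded_tuple_def)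
          show "norm2 (?p A j - zero_ext N J Y j) \<le> \<eta>" if "j \<in> J2" for j using Yd[OF that] that J2(2) by (auto simp: zero_ext_def)
        qed (use \<eta>(1) in auto)
        moreover have "?A - ?Y \<in> carrier_mat N N" by (rule minus_carrier_mat[OF nc_eval_mat_carrier[OF Yt]])
        ultimately have "cmod (ntr (?A - ?Y)) \<le> \<kappa>' / 3" using \<eta>(2) ntr_le_norm2 by (meson order_trans)
        moreover have "ntr (?A - ?Y) = ntr ?A - ntr ?Y" by (rule ntr_diff[OF nc_eval_mat_carrier[OF pcA] nc_eval_mat_carrier[OF Yt]])
        ultimately have 1: "cmod (ntr ?A - ntr ?Y) \<le> \<kappa>' / 3" by simp
        have 2: "cmod (ntr ?A - ?t) < \<kappa>' / 3" using l[of "nc_subst p P"] P \<kappa>(2) unfolding nc_eval_mat_subst[OF Ac] by (simp add: Ps_def)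
        have 3: "cmod (?t - ?b) < \<kappa>' / 3" using nP[OF P] t.norm_le[of "nc_eval a (nc_subst p P) - nc_eval b P"] by (simp add: t.diff)
        have PJ: "P \<in> nc_polys J" using P Ps' by blast
        have "mat_law N J Y P - ?b = (ntr ?A - ?t) + (?t - ?b) - (ntr ?A - ntr ?Y)" unfolding mat_law_zero_ext[OF PJ] by simp
        also have "cmod \<dots> \<le> cmod (ntr ?A - ?t) + cmod (?t - ?b) + cmod (ntr ?A - ntr ?Y)"
          by (intro order_trans[OF norm_triangle_ineq4] add_right_mono norm_triangle_ineq)
        finally show "cmod (mat_law N J Y P - ?b) < \<kappa>'" using 1 2 3 by simp
      qed
      then have "Y \<in> ?\<Omega>2" using nb Yc Yn J0(1) by (auto simp: unital_microstates_def microstates_def Y_def)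
      then show ?thesis using Yd by blast
    qed
    then obtain f where f: "\<And>A. A \<in> ?\<Omega>1 \<Longrightarrow> f A \<in> ?\<Omega>2" "\<And>A j. A \<in> ?\<Omega>1 \<Longrightarrow> j \<in> J2 \<Longrightarrow> norm2 (?p A j - f A j) \<le> \<eta>" by metis
    have fY: "f A \<in> J \<rightarrow>\<^sub>E carrier_mat N N" "\<And>j. j \<in> J \<Longrightarrow> mat_norm (f A j) \<le> R2" if "A \<in> ?\<Omega>1" for A
      using f(1)[OF that] by (auto simp: unital_microstates_def microstates_def)
    have ft: "zero_ext N J (f A) j \<in> carrier_mat N N" if "A \<in> ?\<Omega>1" for A j by (rule zero_ext_carrier[OF fY(1)[OF that]])
    let ?q = "\<lambda>A i. nc_eval_mat N (zero_ext N J (f A)) (Q i)"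
    have qc: "?q A i \<in> carrier_mat N N" if "A \<in> ?\<Omega>1" for A i by (rule nc_eval_mat_carrier[OF ft[OF that]])
    have near: "norm2 (A i - ?q A i) \<le> \<epsilon> / 4" if A1: "A \<in> ?\<Omega>1" and i: "i \<in> E" for A i
    proof -
      have iI: "i \<in> I" using i E by auto
      have Ai: "A i \<in> carrier_mat N N" using A(1)[OF A1, of i] iI by (simp add: zero_ext_def)
      have "norm2 (nc_eval_mat N (?p A) (Q i) - ?q A i) \<le> L * \<eta>"
      proof (rule L[OF _ pt[OF A1]])
        show "Q i \<in> Ps' \<union> Q ` E" using i by simp
        have "mat_norm (zero_ext N J (f A) j) \<le> M" if "j \<in> J2" for j
          using order_trans[OF fY(2)[OF A1] M(2)] that J2(2) by (auto simp: zero_ext_def)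
        then show "bounded_tuple N J2 M (zero_ext N J (f A))" using ft[OF A1] by (simp add: bounded_tuple_def)
        show "norm2 (?p A j - zero_ext N J (f A) j) \<le> \<eta>" if "j \<in> J2" for j using f(2)[OF A1 that] that J2(2) by (auto simp: zero_ext_def)
      qed (use \<eta>(1) in auto)
      moreover have "norm2 (A i - ?q A i) \<le> norm2 (A i - nc_eval_mat N (?p A) (Q i)) + norm2 (nc_eval_mat N (?p A) (Q i) - ?q A i)"
        by (rule norm2_diff_triangle[OF Ai nc_eval_mat_carrier[OF pc[OF A1]] qc[OF A1]])
      ultimately show ?thesis using close_gen[OF A1 i] \<eta>(3) by linarith
    qed
    show "orbital_covering_number N E \<epsilon> ?\<Omega>1 \<le> orbital_covering_number N E' \<epsilon>' ?\<Omega>2"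
    proof (rule orbital_covering_le[where f=f])
      show "f C \<in> ?\<Omega>2" if "C \<in> ?\<Omega>1" for C by (rule f(1)[OF that])
      show "B i \<in> carrier_mat N N" if "B \<in> ?\<Omega>2" "i \<in> E'" for B i using that E' by (auto simp: unital_microstates_def microstates_def)
      fix C C' W i
      assume C: "C \<in> ?\<Omega>1" "C' \<in> ?\<Omega>1" and W: "W \<in> unitary_mats N" and i: "i \<in> E"
        and cl: "\<And>i. i \<in> E' \<Longrightarrow> norm2 (f C i - uconj W (f C' i)) < 2 * \<epsilon>'"
      have iI: "i \<in> I" using i E by auto
      have c: "C i \<in> carrier_mat N N" "C' i \<in> carrier_mat N N" using A(1)[OF C(1), of i] A(1)[OF C(2), of i] iI by (auto simp: zero_ext_def)
      have q: "?q C i \<in> carrier_mat N N" "?q C' i \<in> carrier_mat N N" by (rule qc[OF C(1)], rule qc[OF C(2)])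
      have "norm2 (?q C i - uconj W (?q C' i)) \<le> poly_const (max 1 R2) (Q i) * (2 * \<epsilon>')"
        unfolding nc_eval_mat_uconj[OF W ft[OF C(2)], symmetric]
      proof (rule poly_mat_lipschitz[OF Q(1)[OF i]])
        have n: "mat_norm (zero_ext N J (f B) j) \<le> max 1 R2" if "B \<in> ?\<Omega>1" "j \<in> E'" for B j
          using fY(2)[OF that(1)] that(2) E' by (auto simp: zero_ext_def le_max_iff_disj)
        then show "bounded_tuple N E' (max 1 R2) (zero_ext N J (f C))" using ft[OF C(1)] C(1) by (simp add: bounded_tuple_def)
        show "bounded_tuple N E' (max 1 R2) (\<lambda>j. uconj W (zero_ext N J (f C') j))"
          using order_trans[OF mat_norm_uconj[OF W ft[OF C(2)]] n[OF C(2)]] uconj_carrier[OF W ft[OF C(2)]] by (simp add: bounded_tuple_def)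
        show "norm2 (zero_ext N J (f C) j - uconj W (zero_ext N J (f C') j)) \<le> 2 * \<epsilon>'" if j: "j \<in> E'" for j
          using cl[OF j] j E' by (auto simp: zero_ext_def)
      qed (use \<epsilon>' in auto)
      then have 1: "norm2 (?q C i - uconj W (?q C' i)) \<le> \<epsilon> / 4" using \<epsilon>'(2)[OF i] by linarith
      have 2: "norm2 (uconj W (?q C' i) - uconj W (C' i)) \<le> \<epsilon> / 4"
      proof -
        have "norm2 (uconj W (?q C' i - C' i)) \<le> norm2 (?q C' i - C' i)"
          by (rule norm2_uconj[OF W]) (use q c in \<open>simp add: minus_carrier_mat\<close>)
        also have "\<dots> = norm2 (C' i - ?q C' i)" by (rule norm2_minus_commute[OF q(2) c(2)])
        also have "\<dots> \<le> \<epsilon> / 4" by (rule near[OF C(2) i])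
        finally show ?thesis unfolding uconj_diff[OF W q(2) c(2)] .
      qed
      have u: "uconj W (?q C' i) \<in> carrier_mat N N" "uconj W (C' i) \<in> carrier_mat N N"
        by (rule uconj_carrier[OF W q(2)], rule uconj_carrier[OF W c(2)])
      \<comment> \<open>three errors of at most \<open>\<epsilon> / 4\<close>: recovering \<open>C\<close>, moving between the recovered tuples, recovering \<open>C'\<close>\<close>
      have "norm2 (C i - uconj W (C' i)) \<le> norm2 (C i - ?q C i) + norm2 (?q C i - uconj W (C' i))"
        by (rule norm2_diff_triangle[OF c(1) q(1) u(2)])
      also have "norm2 (?q C i - uconj W (C' i)) \<le> norm2 (?q C i - uconj W (?q C' i)) + norm2 (uconj W (?q C' i) - uconj W (C' i))"
        by (rule norm2_diff_triangle[OF q(1) u])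
      finally show "norm2 (C i - uconj W (C' i)) < \<epsilon>" using near[OF C(1) i] 1 2 \<epsilon> by simp
    qed
  qed
qed

text \<open>Applied in both directions, this shows that the entropy depends neither on the generators nor on the prescribed units.\<close>

theorem unital_entropy_le:
  fixes a :: "'i \<Rightarrow> 'b::cstar_algebra" and b :: "'j \<Rightarrow> 'b"
  assumes genI: "cstar_generates (a ` I)" and aR: "\<forall>i\<in>I. norm (a i) \<le> R1" and R1: "R1 > 0"
    and genJ: "cstar_generates (b ` J)" and bR: "\<forall>j\<in>J. norm (b j) \<le> R2" and R2: "R2 > 0"
    and J0: "J0 \<subseteq> J" "\<forall>j\<in>J0. b j = 1"
  shows "unital_entropy R1 I I0 (trace_laws I a) \<le> unital_entropy R2 J J0 (trace_laws J b)" unfolding unital_entropy_def[of R1]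
proof (intro SUP_least)
  fix E and \<epsilon> :: real assume "E \<in> {E. finite E \<and> E \<subseteq> I}" "\<epsilon> \<in> {0<..}"
  then have E: "finite E" "E \<subseteq> I" and \<epsilon>: "\<epsilon> > 0" by auto
  have "\<exists>P. P \<in> nc_polys J \<and> norm (nc_eval b P - a i) < \<epsilon> / 16" for i
    using approx_poly[OF genJ, of "\<epsilon> / 16" "a i"] \<epsilon> by (metis divide_pos_pos zero_less_numeral)
  then obtain Q where Q: "\<And>i. Q i \<in> nc_polys J" "\<And>i. norm (nc_eval b (Q i) - a i) < \<epsilon> / 16" by metis
  have QE: "finite (Q ` E)" "Q ` E \<subseteq> nc_polys J" using E(1) Q(1) by auto
  obtain E' where E': "finite E'" "E' \<subseteq> J" "Q ` E \<subseteq> nc_polys E'" using finite_common_support[OF QE] by blast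
  define K where "K = (\<Sum>i\<in>E. poly_const (max 1 R2) (Q i))"
  have K: "poly_const (max 1 R2) (Q i) \<le> K" if "i \<in> E" for i
    unfolding K_def by (rule member_le_sum[OF that _ E(1)]) (auto intro: poly_const_nonneg)
  have K0: "K \<ge> 0" unfolding K_def by (intro sum_nonneg poly_const_nonneg) simp
  define \<epsilon>' where "\<epsilon>' = \<epsilon> / (8 * (K + 1))"
  have \<epsilon>'0: "\<epsilon>' > 0" "K * (2 * \<epsilon>') \<le> \<epsilon> / 4" using \<epsilon> K0 by (auto simp: \<epsilon>'_def field_simps)
  have \<epsilon>': "poly_const (max 1 R2) (Q i) * (2 * \<epsilon>') \<le> \<epsilon> / 4" if "i \<in> E" for i
    by (rule order_trans[OF mult_right_mono[OF K[OF that]] \<epsilon>'0(2)]) (use \<epsilon>'0(1) in simp)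
  let ?l = "INF U\<in>{U. openin (law_topology R1 I) U \<and> trace_laws I a \<subseteq> U}. orbital_growth E \<epsilon> (\<lambda>N. unital_microstates R1 I I0 N U)"
  have "?l
    \<le> (INF U\<in>{U. openin (law_topology R2 J) U \<and> trace_laws J b \<subseteq> U}. orbital_growth E' \<epsilon>' (\<lambda>N. unital_microstates R2 J J0 N U))"
  proof (rule INF_greatest)
    fix U' assume "U' \<in> {U. openin (law_topology R2 J) U \<and> trace_laws J b \<subseteq> U}"
    then have U': "openin (law_topology R2 J) U'" "trace_laws J b \<subseteq> U'" by auto
    obtain U where U: "openin (law_topology R1 I) U" "trace_laws I a \<subseteq> U"
      "\<And>N. N \<ge> 1 \<Longrightarrow> orbital_covering_number N E \<epsilon> (unital_microstates R1 I I0 N U)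
         \<le> orbital_covering_number N E' \<epsilon>' (unital_microstates R2 J J0 N U')"
    proof (rule microstate_transfer[OF genI aR R1 bR R2 J0 E \<epsilon> E'(1,2) _ Q(2) \<epsilon>'0(1) \<epsilon>' U'])
      show "Q i \<in> nc_polys E'" if "i \<in> E" for i using E'(3) that by blast
    qed auto
    show "?l
      \<le> orbital_growth E' \<epsilon>' (\<lambda>N. unital_microstates R2 J J0 N U')" by (rule INF_lower2[of U]) (use U orbital_growth_mono[OF U(3)] in auto)
  qed
  also have "\<dots> \<le> unital_entropy R2 J J0 (trace_laws J b)"
    unfolding unital_entropy_def using E' \<epsilon>'0(1) by (intro SUP_upper2[of E'] SUP_upper2[of \<epsilon>']) auto
  finally show "?l
    \<le> unital_entropy R2 J J0 (trace_laws J b)" .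
qed

section \<open>Pencils of matrices\<close>

lemma sum_div_mod:
  fixes g :: "nat \<Rightarrow> nat \<Rightarrow> 'a::comm_monoid_add"
  assumes N: "N > 0"
  shows "(\<Sum>k<m * N. g (k div N) (k mod N)) = (\<Sum>t<m. \<Sum>w<N. g t w)"
proof (induction m)
  case (Suc m)
  have "(\<Sum>k<Suc m * N. g (k div N) (k mod N)) = (\<Sum>k<m * N + N. g (k div N) (k mod N))" by (simp add: add.commute)
  also have "\<dots> = (\<Sum>k<m * N. g (k div N) (k mod N)) + (\<Sum>w<N. g ((m * N + w) div N) ((m * N + w) mod N))" by (rule sum_lessThan_add)
  also have "(\<Sum>w<N. g ((m * N + w) div N) ((m * N + w) mod N)) = (\<Sum>w<N. g m w)" by (rule sum.cong) auto
  finally show ?case using Suc by simp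
qed simp

text \<open>The homomorphism from matrices of polynomials to \<open>M\<^sub>m(M\<^sub>N) = M\<^sub>m\<^sub>N\<close>. An index \<open>r\<close> stands for the block \<open>r div N\<close> and the place
  \<open>r mod N\<close> in it, as in the Kronecker product.\<close>

definition block_eval :: "nat \<Rightarrow> ('i \<Rightarrow> complex mat) \<Rightarrow> nat \<Rightarrow> 'i nc_poly mat \<Rightarrow> complex mat" where
  "block_eval N A m Z = Matrix.mat (m * N) (m * N)
     (\<lambda>(r,s). nc_eval_mat N A (Z $$ (r div N, s div N)) $$ (r mod N, s mod N))"

lemma block_eval_carrier [simp]: "block_eval N A m Z \<in> carrier_mat (m * N) (m * N)" by (simp add: block_eval_def)

lemma div_mod_less: "r < m * N \<Longrightarrow> r div N < m \<and> r mod N < (N::nat)" by (cases "N = 0") (auto simp: less_mult_imp_div_less)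

context
  fixes N :: nat and A :: "'i \<Rightarrow> complex mat"
  assumes A: "\<And>i. A i \<in> carrier_mat N N" and N: "N > 0"
begin

lemma eval_dims: "dim_row (nc_eval_mat N A P) = N" "dim_col (nc_eval_mat N A P) = N" by (rule dim_nc_eval_mat[OF A])+

lemma nc_eval_mat_sum_index:
  assumes "u < N" "v < N"
  shows "nc_eval_mat N A (sum f T) $$ (u,v) = (\<Sum>t\<in>T. nc_eval_mat N A (f t) $$ (u,v))"
proof -
  note d = eval_dims
  show ?thesis using assms by (induction T rule: infinite_finite_induct) (simp_all add: nc_eval_mat_zero[OF A] nc_eval_mat_add[OF A] d)
qed

lemma nc_eval_mat_mult_index:
  assumes "u < N" "v < N"
  shows "nc_eval_mat N A (P * Q) $$ (u,v) = (\<Sum>w<N. nc_eval_mat N A P $$ (u,w) * nc_eval_mat N A Q $$ (w,v))"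
proof -
  note d = eval_dims
  show ?thesis unfolding nc_eval_mat_mult[OF A] using assms by (subst index_mult_mat_sum) (simp_all add: d)
qed

lemma block_eval_mult:
  assumes Z: "Z \<in> carrier_mat m m" and W: "W \<in> carrier_mat m m"
  shows "block_eval N A m (Z * W) = block_eval N A m Z * block_eval N A m W"
proof (rule eq_matI)
  fix r s assume "r < dim_row (block_eval N A m Z * block_eval N A m W)" "s < dim_col (block_eval N A m Z * block_eval N A m W)"
  then have rs: "r < m * N" "s < m * N" by (auto simp: block_eval_def)
  let ?i = "r div N" and ?u = "r mod N" and ?j = "s div N" and ?v = "s mod N"
  note b = div_mod_less[OF rs(1)] div_mod_less[OF rs(2)]
  have "(Z * W) $$ (?i,?j) = (\<Sum>t<m. Z $$ (?i,t) * W $$ (t,?j))" using Z W b by (subst index_mult_mat_sum) auto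
  then have "block_eval N A m (Z * W) $$ (r,s) = (\<Sum>t<m. \<Sum>w<N. nc_eval_mat N A (Z $$ (?i,t)) $$ (?u,w) * nc_eval_mat N A (W $$ (t,?j)) $$ (w,?v))"
    using rs b by (simp add: block_eval_def nc_eval_mat_sum_index nc_eval_mat_mult_index)
  also have "\<dots> = (\<Sum>k<m * N. nc_eval_mat N A (Z $$ (?i,k div N)) $$ (?u,k mod N) * nc_eval_mat N A (W $$ (k div N,?j)) $$ (k mod N,?v))"
    by (rule sum_div_mod[OF N, symmetric])
  also have "\<dots> = (block_eval N A m Z * block_eval N A m W) $$ (r,s)" using rs by (subst index_mult_mat_sum) (auto simp: block_eval_def)
  finally show "block_eval N A m (Z * W) $$ (r,s) = (block_eval N A m Z * block_eval N A m W) $$ (r,s)" .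
qed (auto simp: block_eval_def)

lemma block_eval_star:
  assumes Z: "Z \<in> carrier_mat m m"
  shows "block_eval N A m (pstar Z) = star_mat (block_eval N A m Z)"
proof (rule eq_matI)
  fix r s assume "r < dim_row (star_mat (block_eval N A m Z))" "s < dim_col (star_mat (block_eval N A m Z))"
  then have rs: "r < m * N" "s < m * N" by (auto simp: block_eval_def)
  note d = eval_dims
  show "block_eval N A m (pstar Z) $$ (r,s) = star_mat (block_eval N A m Z) $$ (r,s)"
    using rs Z div_mod_less[OF rs(1)] div_mod_less[OF rs(2)] by (simp add: block_eval_def nc_eval_mat_star[OF A] d)
qed (auto simp: block_eval_def)

lemma block_eval_one: "block_eval N A m (1\<^sub>m m) = 1\<^sub>m (m * N)"
proof (rule eq_matI)
  fix r s assume "r < dim_row (1\<^sub>m (m * N))" "s < dim_col (1\<^sub>m (m * N))"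
  then have rs: "r < m * N" "s < m * N" by auto
  have "r = s \<longleftrightarrow> r div N = s div N \<and> r mod N = s mod N" by (metis div_mult_mod_eq)
  then show "block_eval N A m (1\<^sub>m m) $$ (r,s) = 1\<^sub>m (m * N) $$ (r,s)" using rs div_mod_less[OF rs(1)] div_mod_less[OF rs(2)]
    by (auto simp: block_eval_def nc_eval_mat_one[OF A] nc_eval_mat_zero[OF A])
qed (auto simp: block_eval_def)

lemma block_eval_power:
  assumes Z: "Z \<in> carrier_mat m m"
  shows "block_eval N A m (Z ^\<^sub>m k) = block_eval N A m Z ^\<^sub>m k"
proof (induction k)
  case 0
  have "dim_row (block_eval N A m Z) = m * N" by (simp add: block_eval_def)
  then show ?case using Z by (simp add: block_eval_one)
next
  case (Suc k)
  have "Z ^\<^sub>m k \<in> carrier_mat m m" by (rule pow_carrier_mat[OF Z])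
  from block_eval_mult[OF this Z] show ?case using Suc by simp
qed

lemma ntr_block_eval: "ntr (block_eval N A m Z) = (\<Sum>i<m. ntr (nc_eval_mat N A (Z $$ (i,i)))) / of_nat m"
proof -
  note d = eval_dims
  have "(\<Sum>k<m * N. block_eval N A m Z $$ (k,k)) = (\<Sum>k<m * N. nc_eval_mat N A (Z $$ (k div N, k div N)) $$ (k mod N, k mod N))"
    by (rule sum.cong) (auto simp: block_eval_def)
  also have "\<dots> = (\<Sum>i<m. \<Sum>u<N. nc_eval_mat N A (Z $$ (i,i)) $$ (u,u))" by (rule sum_div_mod[OF N])
  finally have "ntr (block_eval N A m Z) = (\<Sum>i<m. \<Sum>u<N. nc_eval_mat N A (Z $$ (i,i)) $$ (u,u)) / (of_nat m * of_nat N)"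
    by (simp add: ntr_def block_eval_def)
  also have "\<dots> = (\<Sum>i<m. ntr (nc_eval_mat N A (Z $$ (i,i)))) / of_nat m" by (simp add: ntr_def d sum_divide_distrib mult.commute)
  finally show ?thesis .
qed

end

lemma block_eval_pencil:
  fixes A :: "'a::cstar_algebra \<Rightarrow> complex mat"
  assumes A: "\<And>i. A i \<in> carrier_mat N N" and N: "N > 0" and mB: "(m, B) \<in> coeff_tuples S" and S: "1 \<in> S" and AS: "\<And>y. y \<in> S \<Longrightarrow> A' y = A y"
  shows "block_eval N A m (pencil_poly S m B) = mat_pencil S m N B A'"
proof (rule eq_matI)
  let ?T = "coeff_support (S - {1}) m B"
  have B: "B y \<in> carrier_mat m m" if "y \<in> S" for y using mB that by (auto simp: coeff_tuples_def)
  have T: "?T \<subseteq> S" by (auto simp: coeff_support_def)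
  note d = dim_nc_eval_mat[where N=N and A=A, OF A]
  have dB: "dim_row (B y) = m" "dim_col (B y) = m" if "y \<in> S" for y using B[OF that] by auto
  have dA: "dim_row (A y) = N" "dim_col (A y) = N" for y using A[of y] by auto
  show "dim_row (block_eval N A m (pencil_poly S m B)) = dim_row (mat_pencil S m N B A')"
    "dim_col (block_eval N A m (pencil_poly S m B)) = dim_col (mat_pencil S m N B A')"
    by (simp_all add: block_eval_def mat_pencil_def msum_def)
  fix r s assume "r < dim_row (mat_pencil S m N B A')" "s < dim_col (mat_pencil S m N B A')"
  then have rs: "r < m * N" "s < m * N" by (auto simp: mat_pencil_def msum_def)
  note b = div_mod_less[OF rs(1)] div_mod_less[OF rs(2)]
  let ?i = "r div N" and ?u = "r mod N" and ?j = "s div N" and ?v = "s mod N"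
  have "block_eval N A m (pencil_poly S m B) $$ (r,s) =
     nc_eval_mat N A (const (B 1 $$ (?i,?j)) + (\<Sum>y\<in>?T. const (B y $$ (?i,?j)) * nc_var y)) $$ (?u,?v)"
    using rs b by (simp add: block_eval_def pencil_poly_def)
  also have "\<dots> = B 1 $$ (?i,?j) * 1\<^sub>m N $$ (?u,?v) + (\<Sum>y\<in>?T. B y $$ (?i,?j) * A y $$ (?u,?v))"
    using b by (simp add: nc_eval_mat_add[OF A] nc_eval_mat_const[OF A] nc_eval_mat_sum_index[OF A N] nc_eval_mat_const_mult[OF A]
        nc_eval_mat_var[OF A] d dA)
  also have "\<dots> = kron (B 1) (1\<^sub>m N) $$ (r,s) + (\<Sum>y\<in>?T. kron (B y) (A' y) $$ (r,s))"
  proof -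
    have "kron (B y) (A' y) $$ (r,s) = B y $$ (?i,?j) * A y $$ (?u,?v)" if "y \<in> ?T" for y
    proof -
      have y: "y \<in> S" using that T by blast
      show ?thesis using rs by (simp add: kron_def AS[OF y] dA dB[OF y])
    qed
    moreover have "kron (B 1) (1\<^sub>m N) $$ (r,s) = B 1 $$ (?i,?j) * 1\<^sub>m N $$ (?u,?v)" using rs by (simp add: kron_def dB[OF S])
    ultimately show ?thesis by simp
  qed
  also have "\<dots> = mat_pencil S m N B A' $$ (r,s)" using rs by (simp add: mat_pencil_def msum_def)
  finally show "block_eval N A m (pencil_poly S m B) $$ (r,s) = mat_pencil S m N B A' $$ (r,s)" .
qed

text \<open>Up to the factor \<open>m\<close>, the polynomial whose value under a tracial functional is the \<open>2k\<close>-th moment of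
  the absolute value of the pencil.\<close>

definition moment_poly :: "'a::one set \<Rightarrow> nat \<Rightarrow> ('a \<Rightarrow> complex mat) \<Rightarrow> nat \<Rightarrow> 'a nc_poly" where
  "moment_poly S m B k = (\<Sum>i<m. ((pstar (pencil_poly S m B) * pencil_poly S m B) ^\<^sub>m k) $$ (i,i))"

lemma moment_poly_in: "moment_poly S m B k \<in> nc_polys (S :: 'a::cstar_algebra set)"
proof -
  let ?e = "\<lambda>Z :: 'a nc_poly mat. Z \<in> carrier_mat m m \<and> (\<forall>i<m. \<forall>j<m. Z $$ (i,j) \<in> nc_polys S)"
  have P: "?e (pencil_poly S m B)"
    by (auto simp: pencil_poly_def coeff_support_def intro!: nc_polys_add nc_polys_sum nc_polys_mult nc_polys_var nc_polys_const)
  note dims = carrier_matD[OF pencil_poly_carrier[of S m B]]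
  have P': "?e (pstar (pencil_poly S m B))" using P by (auto simp: dims intro!: nc_polys_star)
  have mult: "?e (Z * W)" if Z: "?e Z" and W: "?e W" for Z W
  proof -
    have "(Z * W) $$ (i,j) \<in> nc_polys S" if "i < m" "j < m" for i j
      using Z W that by (subst index_mult_mat_sum) (auto intro!: nc_polys_sum nc_polys_mult)
    then show ?thesis using Z W by auto
  qed
  have H: "?e (pstar (pencil_poly S m B) * pencil_poly S m B)" by (rule mult[OF P' P])
  have "?e ((pstar (pencil_poly S m B) * pencil_poly S m B) ^\<^sub>m k)"
  proof (induction k)
    case 0
    have "dim_row (pstar (pencil_poly S m B) * pencil_poly S m B) = m" by (simp add: dims)
    then show ?case by auto
  next
    case (Suc k) show ?case unfolding pow_mat.simps by (rule mult[OF Suc H])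
  qed
  then show ?thesis unfolding moment_poly_def by (intro nc_polys_sum) auto
qed

lemma mat_pencil_moment:
  assumes A: "\<And>i. A i \<in> carrier_mat N N" and N: "N > 0"
    and mB: "(m, B) \<in> coeff_tuples S" and S: "1 \<in> S" and AS: "\<And>y. y \<in> S \<Longrightarrow> A' y = A y"
  shows "ntr ((star_mat (mat_pencil S m N B A') * mat_pencil S m N B A') ^\<^sub>m k) = ntr (nc_eval_mat N A (moment_poly S m B k)) / of_nat m"
    "mat_pencil S m N B A' \<in> carrier_mat (m * N) (m * N)"
proof -
  let ?P = "pencil_poly S m B" and ?M = "mat_pencil S m N B A'"
  let ?H = "(pstar ?P * ?P) ^\<^sub>m k"
  have P: "?P \<in> carrier_mat m m" "pstar ?P \<in> carrier_mat m m" by simp_all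
  have PP: "pstar ?P * ?P \<in> carrier_mat m m" using P by simp
  have pencil: "block_eval N A m ?P = ?M" by (rule block_eval_pencil[OF A N mB S AS])
  have "block_eval N A m ?H = (star_mat (?M) * ?M) ^\<^sub>m k"
    unfolding block_eval_power[OF A N PP] block_eval_mult[OF A N P(2,1)] block_eval_star[OF A N P(1)] pencil ..
  then have "ntr ((star_mat (?M) * ?M) ^\<^sub>m k) =
     (\<Sum>i<m. ntr (nc_eval_mat N A (?H $$ (i,i)))) / of_nat m" using ntr_block_eval[where A=A and m=m and Z="?H", OF A N] by simp
  also have "(\<Sum>i<m. ntr (nc_eval_mat N A (?H $$ (i,i)))) = ntr (nc_eval_mat N A (moment_poly S m B k))"
  proof -
    note d = dim_nc_eval_mat[where N=N and A=A, OF A]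
    have "(\<Sum>u<N. \<Sum>i<m. nc_eval_mat N A (?H $$ (i,i)) $$ (u,u)) =
       (\<Sum>u<N. nc_eval_mat N A (moment_poly S m B k) $$ (u,u))"
      unfolding moment_poly_def by (intro sum.cong refl nc_eval_mat_sum_index[OF A N, symmetric]) auto
    then show ?thesis by (subst (asm) sum.swap) (simp add: ntr_def d flip: sum_divide_distrib)
  qed
  finally show "ntr ((star_mat (?M) * ?M) ^\<^sub>m k) = ntr (nc_eval_mat N A (moment_poly S m B k)) / of_nat m" .
  show "?M \<in> carrier_mat (m * N) (m * N)" unfolding pencil[symmetric] by simp
qed

section \<open>Operator system microstates and microstates of the maximal algebra\<close>

text \<open>The universal property concerns Hilbert spaces of functions on lists over the operator system, so the words that index the GNS
  construction are coded by such lists: each variable is followed by an element that is \<open>1\<close> if the letter is an adjoint.\<close>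

fun decode :: "'a::zero_neq_one list \<Rightarrow> ('a \<times> bool) list" where
  "decode (x # y # u) = (x, y = 1) # decode u"
| "decode u = []"

lemma surj_decode: "surj (\<lambda>u. Word (decode u))"
proof (rule surjI)
  fix v :: "'a nc_word"
  have "decode (concat (map (\<lambda>(x,b). [x, if b then 1 else 0]) w)) = w" for w :: "('a \<times> bool) list" by (induction w) auto
  then show "Word (decode (concat (map (\<lambda>(x,b). [x, if b then 1 else 0]) (letters v)))) = v" by simp
qed

lemma system_microstates_carrier: "A \<in> system_microstates R S N F \<delta> q \<Longrightarrow> y \<in> S \<Longrightarrow> A y \<in> carrier_mat N N"
  by (auto simp: system_microstates_def)

lemma unital_microstates_carrier: "A \<in> unital_microstates R S S0 N U \<Longrightarrow> y \<in> S \<Longrightarrow> A y \<in> carrier_mat N N"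
  by (auto simp: unital_microstates_def microstates_def)

lemma law_pencil_moment:
  fixes S :: "'a::cstar_algebra set"
  assumes A: "A \<in> S \<rightarrow>\<^sub>E carrier_mat N N" and N: "N \<ge> 1" and mB: "(m, B) \<in> coeff_tuples S" and S: "1 \<in> S"
  shows "ntr ((star_mat (mat_pencil S m N B A) * mat_pencil S m N B A) ^\<^sub>m k) = mat_law N S A (moment_poly S m B k) / of_nat m"
    "mat_pencil S m N B A \<in> carrier_mat (m * N) (m * N)" "m * N > 0"
proof -
  let ?M = "mat_pencil S m N B A"
  have c: "zero_ext N S A i \<in> carrier_mat N N" for i by (rule zero_ext_carrier[OF A])
  have N0: "N > 0" using N by simp
  have e: "\<And>y. y \<in> S \<Longrightarrow> A y = zero_ext N S A y" by (simp add: zero_ext_def)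
  show "ntr ((star_mat (?M) * ?M) ^\<^sub>m k) = mat_law N S A (moment_poly S m B k) / of_nat m"
    unfolding mat_law_zero_ext[OF moment_poly_in] by (rule mat_pencil_moment(1)[OF c N0 mB S e])
  show "?M \<in> carrier_mat (m * N) (m * N)" by (rule mat_pencil_moment(2)[OF c N0 mB S e])
  show "m * N > 0" using N mB by (auto simp: coeff_tuples_def)
qed

locale generated_system = max_system V \<iota> for V :: "'a::cstar_algebra set" and \<iota> :: "'a \<Rightarrow> 'b::cstar_algebra" +
  fixes S :: "'a set" and R :: real
  assumes R: "R > 0" and span_S: "complex_vector.span S = V" and star_S: "star ` S = S" and one_S: "1 \<in> S"
    and norm_S: "\<forall>x\<in>S. norm x \<le> R" and max: "maximal_cstar V \<iota>"
begin

lemma S_V: "S \<subseteq> V" using complex_vector.span_superset span_S by blast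

lemma norm_\<iota>_S: "\<forall>y\<in>S. norm (\<iota> y) \<le> R" using norm_\<iota>_le norm_S S_V order_trans by blast

lemma generates_S: "cstar_generates (\<iota> ` S)"
proof -
  have "\<iota> ` V \<subseteq> B" if B: "cstar_subalgebra B" "\<iota> ` S \<subseteq> B" for B
  proof clarify
    fix x assume "x \<in> V"
    then obtain T r where T: "finite T" "T \<subseteq> S" "x = (\<Sum>y\<in>T. r y *\<^sub>C y)" unfolding span_S[symmetric] complex_vector.span_explicit by blast
    have "\<iota> x = (\<Sum>y\<in>T. r y *\<^sub>C \<iota> y)" unfolding T(3) using T S_V by (subst \<iota>_sum) (auto simp: \<iota>_scale V_scale subset_iff intro!: sum.cong)
    moreover have "(\<Sum>y\<in>T. r y *\<^sub>C \<iota> y) \<in> B"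
      by (rule complex_vector.subspace_sum) (use B T in \<open>auto simp: cstar_subalgebra_def intro!: complex_vector.subspace_scale\<close>)
    ultimately show "\<iota> x \<in> B" by simp
  qed
  then have "cstar_subalgebra hull (\<iota> ` V) \<subseteq> cstar_subalgebra hull (\<iota> ` S)" unfolding hull_def by blast
  then show ?thesis using max by (auto simp: maximal_cstar_def cstar_generates_def)
qed

lemma trace_moment_poly:
  assumes \<tau>: "tracial_state \<tau>" and mB: "(m, B) \<in> coeff_tuples S"
  shows "Re (\<tau> (nc_eval \<iota> (moment_poly S m B k))) \<le> mat_norm (system_pencil S m B) ^ (2 * k) * m"
proof -
  interpret T: tracial_functional "\<lambda>P. \<tau> (nc_eval \<iota> P)" by (rule tracial_state_functional[OF \<tau>])
  let ?P = "pencil_poly S m B"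
  have "pstar ?P * ?P \<in> carrier_mat m m" using pencil_poly_carrier[of S m B] by simp
  from pow_carrier_mat[OF this, of k] have "dim_row ((pstar ?P * ?P) ^\<^sub>m k) = m" by (rule carrier_matD)
  then have "T.ptr ((pstar ?P * ?P) ^\<^sub>m k) = \<tau> (nc_eval \<iota> (moment_poly S m B k))" unfolding T.ptr_def moment_poly_def T.sum by simp
  then show ?thesis using trace_pencil_moments[OF S_V one_S \<tau> mB, of k] by simp
qed

text \<open>Traces satisfy the moment bounds of the pencils, so the laws near them nearly do, and for matrices moments
  dominate \<open>L\<^sup>q\<close>-norms.\<close>

lemma unital_in_system:
  assumes F: "finite F" "F \<subseteq> coeff_tuples S" and \<delta>: "\<delta> > 0" and q: "q \<ge> 1"
  obtains U where "openin (law_topology R S) U" "trace_laws S \<iota> \<subseteq> U"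
    "\<And>N. N \<ge> 1 \<Longrightarrow> unital_microstates R S {1} N U \<subseteq> system_microstates R S N F \<delta> q"
proof -
  obtain k :: nat where "q \<le> real k" using real_arch_simple by blast
  then have k: "q \<le> 2 * real k" "k \<ge> 1" using q by linarith+
  let ?n = "\<lambda>mB. mat_norm (system_pencil S (fst mB) (snd mB))"
  define G where "G mB = {l \<in> topspace (law_topology R S). l (moment_poly S (fst mB) (snd mB) k) \<in>
     {z. Re z < real (fst mB) * (\<delta> + ?n mB) ^ (2 * k)}}" for mB
  have Go: "openin (law_topology R S) (G mB)" for mB unfolding G_def
    by (rule openin_continuous_map_preimage[OF continuous_law[OF moment_poly_in]]) (simp add: open_halfspace_Re_lt)
  let ?U = "(\<Inter>mB\<in>F. G mB) \<inter> topspace (law_topology R S)"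
  show ?thesis
  proof (rule that)
    show "openin (law_topology R S) ?U" by (rule openin_INT[OF F(1) Go])
    show "trace_laws S \<iota> \<subseteq> ?U"
    proof
      fix l assume l: "l \<in> trace_laws S \<iota>"
      then obtain \<tau> where \<tau>: "tracial_state \<tau>" "l = restrict (\<lambda>P. \<tau> (nc_eval \<iota> P)) (nc_polys S)" by (auto simp: trace_laws_def)
      have lS: "l \<in> law_space R S" using trace_laws_subset[OF norm_\<iota>_S] l by blast
      have "l \<in> G mB" if mB: "mB \<in> F" for mB
      proof -
        have mB': "(fst mB, snd mB) \<in> coeff_tuples S" using F(2) mB by auto
        then have m: "fst mB \<ge> 1" by (auto simp: coeff_tuples_def)
        have "?n mB ^ (2 * k) < (\<delta> + ?n mB) ^ (2 * k)" using \<delta> k(2) mat_norm_nonneg by (intro power_strict_mono) auto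
        then have "?n mB ^ (2 * k) * real (fst mB) < (\<delta> + ?n mB) ^ (2 * k) * real (fst mB)" using m by (intro mult_strict_right_mono) auto
        then show ?thesis using trace_moment_poly[OF \<tau>(1) mB', of k] lS by (simp add: G_def \<tau>(2) moment_poly_in mult.commute)
      qed
      then show "l \<in> ?U" using lS by auto
    qed
    fix N :: nat assume N: "N \<ge> 1"
    show "unital_microstates R S {1} N ?U \<subseteq> system_microstates R S N F \<delta> q"
    proof
      fix A assume "A \<in> unital_microstates R S {1} N ?U"
      then have A: "A \<in> S \<rightarrow>\<^sub>E carrier_mat N N" "\<forall>y\<in>S. mat_norm (A y) \<le> R" "A 1 = 1\<^sub>m N"
        and l: "\<And>mB. mB \<in> F \<Longrightarrow> mat_law N S A \<in> G mB" by (auto simp: unital_microstates_def microstates_def)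
      have "Lq_norm q (mat_pencil S m N B A) \<le> \<delta> + mat_norm (system_pencil S m B)" if mB: "(m, B) \<in> F" for m B
      proof -
        let ?M = "mat_pencil S m N B A" and ?n = "mat_norm (system_pencil S m B)"
        have mB': "(m, B) \<in> coeff_tuples S" using mB F by blast
        then have m: "m \<ge> 1" by (auto simp: coeff_tuples_def)
        note P = law_pencil_moment[OF A(1) N mB' one_S]
        have "Re (mat_law N S A (moment_poly S m B k)) < real m * (\<delta> + ?n) ^ (2 * k)" using l[OF mB] by (simp add: G_def)
        then have "Re (ntr ((star_mat (?M) * ?M) ^\<^sub>m k)) \<le> (\<delta> + ?n) ^ (2 * k)"
          unfolding P(1) using m by (simp add: divide_simps mult.commute)
        then show ?thesis by (rule Lq_le_even_moment[OF P(2,3) k(2) q k(1)]) (use \<delta> mat_norm_nonneg[of "system_pencil S m B"] in linarith)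
      qed
      then show "A \<in> system_microstates R S N F \<delta> q" using A by (auto simp: system_microstates_def)
    qed
  qed
qed

text \<open>The extension of \<open>l\<close> to all polynomials satisfies the same bounds, and \<open>trace_of_law\<close> provides the trace.\<close>

lemma trace_law_of_pencil_moments:
  assumes l: "l \<in> law_space R S" and unit: "l (nc_star (nc_var 1 - 1) * (nc_var 1 - 1)) = 0"
    and mom: "\<And>m B k. (m, B) \<in> coeff_tuples S \<Longrightarrow> Re (l (moment_poly S m B k)) \<le> m * (mat_norm (system_pencil S m B))\<^sup>2 ^ k"
  shows "l \<in> trace_laws S \<iota>"
proof -
  define l' where "l' P = l (nc_subst (restrict_vars S) P)" for P
  interpret L: tracial_functional l' unfolding l'_def by (rule law_space_extend[OF l])
  have l'_eq: "l' P = l P" if "P \<in> nc_polys S" for P unfolding l'_def using that by (simp add: restrict_vars_id)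
  obtain wd :: "'a list \<Rightarrow> 'a nc_word" where wd: "surj wd" using surj_decode by blast
  have u: "nc_star (nc_var 1 - 1) * (nc_var 1 - 1) \<in> nc_polys S"
    using one_S by (intro nc_polys_mult nc_polys_star nc_polys_diff nc_polys_var nc_polys_one)
  interpret P: pencil_law V \<iota> l' wd S
  proof
    show "surj wd" by (rule wd)
    show "complex_vector.span S = V" "star ` S = S" "1 \<in> S" "maximal_cstar V \<iota>" by (rule span_S star_S one_S max)+
    show "l' (nc_star (nc_var 1 - 1) * (nc_var 1 - 1)) = 0" using unit by (simp add: l'_eq[OF u])
    fix m B k assume mB: "(m, B) \<in> coeff_tuples S"
    let ?P = "pencil_poly S m B"
    have "pstar ?P * ?P \<in> carrier_mat m m" using pencil_poly_carrier[of S m B] by simp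
    from pow_carrier_mat[OF this, of k] have "dim_row ((pstar ?P * ?P) ^\<^sub>m k) = m" by (rule carrier_matD)
    then have "L.ptr ((pstar ?P * ?P) ^\<^sub>m k) = l' (moment_poly S m B k)" unfolding L.ptr_def moment_poly_def L.sum by simp
    then show "Re (L.ptr ((pstar ?P * ?P) ^\<^sub>m k)) \<le> m * (mat_norm (system_pencil S m B))\<^sup>2 ^ k"
      using mom[OF mB, of k] by (simp add: l'_eq moment_poly_in)
  qed
  obtain \<tau> where \<tau>: "tracial_state \<tau>" "\<And>P. P \<in> nc_polys S \<Longrightarrow> l' P = \<tau> (nc_eval \<iota> P)" using P.trace_of_law by blast
  have "l \<in> extensional (nc_polys S)" using l by (simp add: law_space_def)
  then have "l = restrict (\<lambda>P. \<tau> (nc_eval \<iota> P)) (nc_polys S)"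
    by (intro extensionalityI[of _ "nc_polys S"]) (auto simp: \<tau>(2)[symmetric] l'_eq)
  then show ?thesis using \<tau>(1) unfolding trace_laws_def by blast
qed

text \<open>By compactness, finitely many pencils, one tolerance and one exponent suffice to force the law of a
  microstate into a given neighbourhood.\<close>

lemma system_in_unital:
  assumes U: "openin (law_topology R S) U" "trace_laws S \<iota> \<subseteq> U"
  obtains F \<delta> q where "finite F" "F \<subseteq> coeff_tuples S" "\<delta> > 0" "q \<ge> 1"
    "\<And>N. N \<ge> 1 \<Longrightarrow> system_microstates R S N F \<delta> q \<subseteq> unital_microstates R S {1} N U"
proof -
  let ?T = "law_topology R S"
  let ?u = "nc_star (nc_var 1 - 1) * (nc_var 1 - 1) :: 'a nc_poly"
  have u: "?u \<in> nc_polys S" using one_S by (intro nc_polys_mult nc_polys_star nc_polys_diff nc_polys_var nc_polys_one)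
  let ?n = "\<lambda>m B. mat_norm (system_pencil S m B)"
  define D where "D = {((m, B), k, d). (m, B) \<in> coeff_tuples S \<and> k \<ge> (1::nat) \<and> d > (0::real)}"
  define G where "G = (\<lambda>((m, B), k, d). {l \<in> topspace ?T. l (moment_poly S m B k) \<in> {z. Re z > real m * (d + ?n m B) ^ (2 * k)}})"
  have Go: "openin ?T (G x)" for x unfolding G_def case_prod_unfold
    by (rule openin_continuous_map_preimage[OF continuous_law[OF moment_poly_in]]) (simp add: open_halfspace_Re_gt)
  define C where "C = {l \<in> topspace ?T. l ?u \<in> {0}} - U"
  have "closedin ?T C" unfolding C_def by (intro closedin_diff U closedin_continuous_map_preimage[OF continuous_law[OF u]]) simp
  then have comp: "compactin ?T C" using law_compact[of R S] R by (intro closedin_compact_space) auto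
  have "C \<subseteq> \<Union>(G ` D)"
  proof
    fix l assume l: "l \<in> C"
    then have lS: "l \<in> law_space R S" "l ?u = 0" "l \<notin> U" by (auto simp: C_def)
    show "l \<in> \<Union>(G ` D)"
    proof (rule ccontr)
      assume n: "l \<notin> \<Union>(G ` D)"
      have "Re (l (moment_poly S m B k)) \<le> m * (?n m B)\<^sup>2 ^ k" if mB: "(m, B) \<in> coeff_tuples S" for m B k
      proof (cases "k = 0")
        case True
        have P: "pencil_poly S m B \<in> carrier_mat m m" by simp
        have "moment_poly S m B 0 = (\<Sum>i<m. 1)" unfolding moment_poly_def using carrier_matD[OF P] by simp
        moreover have "l (\<Sum>i<m. 1) = of_nat m"
        proof (induction m)
          case 0
          have "l (const 0 * 0) = 0 * l 0" using lS(1) nc_polys_zero[of S] unfolding law_space_def by blast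
          then show ?case by simp
        next
          case (Suc m)
          have "l ((\<Sum>i<m. 1) + 1) = l (\<Sum>i<m. 1) + l 1"
            using lS(1) nc_polys_sum[of "{..<m}" "\<lambda>_. 1" S] nc_polys_one[of S] unfolding law_space_def by blast
          moreover have "l 1 = 1" using lS(1) by (simp add: law_space_def)
          ultimately show ?case using Suc by (simp add: add.commute)
        qed
        ultimately show ?thesis using True by simp
      next
        case False
        have "Re (l (moment_poly S m B k)) \<le> real m * (1 / real (Suc n) + ?n m B) ^ (2 * k)" for n
        proof -
          have "((m, B), k, 1 / real (Suc n)) \<in> D" using mB False by (simp add: D_def)
          then have "l \<notin> G ((m, B), k, 1 / real (Suc n))" using n by blast
          then show ?thesis using lS(1) by (simp add: G_def)
        qed
        moreover have "(\<lambda>n. real m * (1 / real (Suc n) + ?n m B) ^ (2 * k)) \<longlonglongrightarrow> real m * (0 + ?n m B) ^ (2 * k)"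
          by (intro tendsto_intros) (use LIMSEQ_inverse_real_of_nat in \<open>simp add: inverse_eq_divide\<close>)
        ultimately have "Re (l (moment_poly S m B k)) \<le> real m * (0 + ?n m B) ^ (2 * k)" by (intro LIMSEQ_le_const) auto
        then show ?thesis by (simp add: power_mult)
      qed
      then have "l \<in> trace_laws S \<iota>" by (rule trace_law_of_pencil_moments[OF lS(1,2)])
      then show False using U(2) lS(3) by blast
    qed
  qed
  note cover = this
  have "openin ?T W" if "W \<in> G ` D" for W using that Go by blast
  from compactinD[OF comp this cover] obtain \<G> where \<G>: "finite \<G>" "\<G> \<subseteq> G ` D" "C \<subseteq> \<Union>\<G>" by blast
  obtain X where X: "X \<subseteq> D" "finite X" "\<G> = G ` X" using finite_subset_image[OF \<G>(1,2)] by blast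
  define F where "F = fst ` X"
  define \<delta> where "\<delta> = Min (insert 1 ((\<lambda>(mB, k, d). d) ` X))"
  define q where "q = Max (insert 1 ((\<lambda>(mB, k, d). 2 * real k) ` X))"
  have F: "finite F" "F \<subseteq> coeff_tuples S" using X by (auto simp: F_def D_def)
  have \<delta>: "\<delta> > 0" using X by (auto simp: \<delta>_def D_def)
  have q: "q \<ge> 1" using X(2) by (auto simp: q_def)
  show ?thesis
  proof (rule that[OF F \<delta> q])
    fix N :: nat assume N: "N \<ge> 1"
    show "system_microstates R S N F \<delta> q \<subseteq> unital_microstates R S {1} N U"
    proof
      fix A assume "A \<in> system_microstates R S N F \<delta> q"
      then have A: "A \<in> S \<rightarrow>\<^sub>E carrier_mat N N" "\<And>y. y \<in> S \<Longrightarrow> mat_norm (A y) \<le> R" "A 1 = 1\<^sub>m N"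
        and Lq: "\<And>m B. (m, B) \<in> F \<Longrightarrow> Lq_norm q (mat_pencil S m N B A) \<le> \<delta> + ?n m B" by (auto simp: system_microstates_def)
      let ?l = "mat_law N S A"
      have l: "?l \<in> law_space R S" by (rule mat_law_in_law_space[OF A(1,2)]) (use R N in auto)
      have c: "zero_ext N S A i \<in> carrier_mat N N" for i by (rule zero_ext_carrier[OF A(1)])
      have lu: "?l ?u = 0"
      proof -
        have "zero_ext N S A 1 = 1\<^sub>m N" using one_S A(3) by (simp add: zero_ext_def)
        then have "nc_eval_mat N (zero_ext N S A) (nc_var 1 - 1) = 1\<^sub>m N - 1\<^sub>m N"
          by (simp add: nc_eval_mat_diff[OF c] nc_eval_mat_var[OF c] nc_eval_mat_one[OF c])
        also have "\<dots> = 0\<^sub>m N N" by (rule eq_matI) auto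
        finally have z: "nc_eval_mat N (zero_ext N S A) (nc_var 1 - 1) = 0\<^sub>m N N" .
        have "star_mat (0\<^sub>m N N) * 0\<^sub>m N N = (0\<^sub>m N N :: complex mat)" by (rule right_mult_zero_mat) simp
        then show ?thesis unfolding mat_law_zero_ext[OF u] nc_eval_mat_mult[OF c] nc_eval_mat_star[OF c] z by (simp add: ntr_def)
      qed
      have "?l \<in> U"
      proof (rule ccontr)
        assume "?l \<notin> U"
        then have "?l \<in> C" using l lu by (simp add: C_def)
        then obtain x where x: "x \<in> X" "?l \<in> G x" using \<G>(3) X(3) by blast
        obtain m B k d where xe: "x = ((m, B), k, d)" by (cases x) auto
        have mB: "(m, B) \<in> coeff_tuples S" and k: "k \<ge> 1" and d: "d > 0" using X(1) x(1) by (auto simp: D_def xe)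
        have mF: "(m, B) \<in> F" using x(1) by (force simp: F_def xe)
        have dd: "\<delta> \<le> d" using x(1) X(2) unfolding \<delta>_def xe by (intro Min_le) (auto intro!: image_eqI[of _ _ "((m, B), k, d)"])
        have qk: "2 * real k \<le> q" using x(1) X(2) unfolding q_def xe by (intro Max_ge) (auto intro!: image_eqI[of _ _ "((m, B), k, d)"])
        have m: "m \<ge> 1" using mB by (auto simp: coeff_tuples_def)
        note P = law_pencil_moment[OF A(1) N mB one_S]
        let ?M = "mat_pencil S m N B A"
        have "Re (ntr ((star_mat (?M) * ?M) ^\<^sub>m k)) \<le> Lq_norm q (?M) ^ (2 * k)" by (rule even_moment_le_Lq[OF P(2,3) k qk])
        also have "\<dots> \<le> (d + ?n m B) ^ (2 * k)"
        proof (rule power_mono)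
          show "Lq_norm q (?M) \<le> d + ?n m B" using Lq[OF mF] dd by linarith
          show "0 \<le> Lq_norm q (?M)" by (simp add: Lq_norm_def)
        qed
        finally have "Re (?l (moment_poly S m B k)) \<le> real m * (d + ?n m B) ^ (2 * k)"
          unfolding P(1) using m by (simp add: divide_simps mult.commute)
        moreover have "Re (?l (moment_poly S m B k)) > real m * (d + ?n m B) ^ (2 * k)" using x(2) by (simp add: G_def xe)
        ultimately show False by simp
      qed
      then show "A \<in> unital_microstates R S {1} N U" using A by (auto simp: unital_microstates_def microstates_def)
    qed
  qed
qed

text \<open>Each kind of microstate space contains one of the other kind, so the two infima agree up to a factor \<open>2\<close> in \<open>\<epsilon>\<close>, which the
  supremum absorbs.\<close>

lemma unital_entropy_system:
  "unital_entropy R S {1} (trace_laws S \<iota>) =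
     (SUP \<epsilon>\<in>{0<..}. SUP E\<in>{E. finite E \<and> E \<subseteq> S}.
        INF F\<in>{F. finite F \<and> F \<subseteq> coeff_tuples S}. INF \<delta>\<in>{0<..}. INF q\<in>{1..}.
          orbital_growth E \<epsilon> (\<lambda>N. system_microstates R S N F \<delta> q))"
    (is "_ = (SUP \<epsilon>\<in>_. SUP E\<in>_. ?r E \<epsilon>)")
proof (rule antisym)
  let ?l = "\<lambda>E \<epsilon>. INF U\<in>{U. openin (law_topology R S) U \<and> trace_laws S \<iota> \<subseteq> U}.
     orbital_growth E \<epsilon> (\<lambda>N. unital_microstates R S {1} N U)"
  have 1: "?l E \<epsilon> \<le> ?r E (\<epsilon> / 2)" if E: "E \<subseteq> S" for E \<epsilon>
  proof (intro INF_greatest)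
    fix F and \<delta> q :: real assume "F \<in> {F. finite F \<and> F \<subseteq> coeff_tuples S}" "\<delta> \<in> {0<..}" "q \<in> {1..}"
    then have "finite F" "F \<subseteq> coeff_tuples S" "(\<delta>::real) > 0" "(q::real) \<ge> 1" by auto
    from unital_in_system[OF this] obtain U where U: "openin (law_topology R S) U" "trace_laws S \<iota> \<subseteq> U"
      "\<And>N. N \<ge> 1 \<Longrightarrow> unital_microstates R S {1} N U \<subseteq> system_microstates R S N F \<delta> q" by blast
    have g: "orbital_growth E \<epsilon> (\<lambda>N. unital_microstates R S {1} N U) \<le> orbital_growth E (\<epsilon> / 2) (\<lambda>N. system_microstates R S N F \<delta> q)"
      by (rule orbital_growth_subset[OF U(3)]) (use E in \<open>auto intro: system_microstates_carrier\<close>)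
    show "?l E \<epsilon> \<le> orbital_growth E (\<epsilon> / 2) (\<lambda>N. system_microstates R S N F \<delta> q)" by (rule INF_lower2[of U], use U in simp, rule g)
  qed
  have 2: "?r E \<epsilon> \<le> ?l E (\<epsilon> / 2)" if E: "E \<subseteq> S" for E \<epsilon>
  proof (rule INF_greatest)
    fix U assume "U \<in> {U. openin (law_topology R S) U \<and> trace_laws S \<iota> \<subseteq> U}"
    then have "openin (law_topology R S) U" "trace_laws S \<iota> \<subseteq> U" by auto
    from system_in_unital[OF this] obtain F \<delta> q where F: "finite F" "F \<subseteq> coeff_tuples S" "\<delta> > 0" "q \<ge> 1"
      "\<And>N. N \<ge> 1 \<Longrightarrow> system_microstates R S N F \<delta> q \<subseteq> unital_microstates R S {1} N U" by blast
    have g: "orbital_growth E \<epsilon> (\<lambda>N. system_microstates R S N F \<delta> q) \<le> orbital_growth E (\<epsilon> / 2) (\<lambda>N. unital_microstates R S {1} N U)"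
      by (rule orbital_growth_subset[OF F(5)]) (use E in \<open>auto intro: unital_microstates_carrier\<close>)
    show "?r E \<epsilon> \<le> orbital_growth E (\<epsilon> / 2) (\<lambda>N. unital_microstates R S {1} N U)"
      by (rule INF_lower2[of F], use F in simp, rule INF_lower2[of \<delta>], use F in simp, rule INF_lower2[of q], use F in simp, rule g)
  qed
  show "unital_entropy R S {1} (trace_laws S \<iota>) \<le> (SUP \<epsilon>\<in>{0<..}. SUP E\<in>{E. finite E \<and> E \<subseteq> S}. ?r E \<epsilon>)" unfolding unital_entropy_def
  proof (intro SUP_least)
    fix E and \<epsilon> :: real assume "E \<in> {E. finite E \<and> E \<subseteq> S}" "\<epsilon> \<in> {0<..}"
    then show "?l E \<epsilon> \<le> (SUP \<epsilon>\<in>{0<..}. SUP E\<in>{E. finite E \<and> E \<subseteq> S}. ?r E \<epsilon>)" by (intro SUP_upper2[of "\<epsilon> / 2"] SUP_upper2[of E] 1) auto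
  qed
  show "(SUP \<epsilon>\<in>{0<..}. SUP E\<in>{E. finite E \<and> E \<subseteq> S}. ?r E \<epsilon>) \<le> unital_entropy R S {1} (trace_laws S \<iota>)" unfolding unital_entropy_def
  proof (intro SUP_least)
    fix E and \<epsilon> :: real assume "\<epsilon> \<in> {0<..}" "E \<in> {E. finite E \<and> E \<subseteq> S}"
    then show "?r E \<epsilon> \<le> (SUP E\<in>{E. finite E \<and> E \<subseteq> S}. SUP \<epsilon>\<in>{0<..}. ?l E \<epsilon>)" by (intro SUP_upper2[of E] SUP_upper2[of "\<epsilon> / 2"] 2) auto
  qed
qed

end

theorem theorem9p2:
  fixes V S :: "'a::cstar_algebra set"
    and \<iota> :: "'a \<Rightarrow> 'b::cstar_algebra"
    and I :: "'i set" and a :: "'i \<Rightarrow> 'b"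
    and R R' :: real
  assumes "R > 0"
    and "operator_system V"
    and "complex_vector.span S = V" and "star ` S = S" and "1 \<in> S"
    and "\<forall>x\<in>S. norm x \<le> R"
    and "maximal_cstar V \<iota>"
    and "R' > 0" and "cstar_generates (a ` I)" and "\<forall>i\<in>I. norm (a i) \<le> R'"
  shows "one_bounded_entropy R' I (trace_laws I a) =
     (SUP \<epsilon>\<in>{0<..}. SUP E\<in>{E. finite E \<and> E \<subseteq> S}.
        INF F\<in>{F. finite F \<and> F \<subseteq> coeff_tuples S}. INF \<delta>\<in>{0<..}. INF q\<in>{1..}.
          orbital_growth E \<epsilon> (\<lambda>N. system_microstates R S N F \<delta> q))"
proof -
  interpret generated_system V \<iota> S R using assms(1-7) by unfold_locales (auto simp: maximal_cstar_def)
  have "unital_entropy R' I {} (trace_laws I a) = unital_entropy R S {1} (trace_laws S \<iota>)"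
  proof (rule antisym)
    show "unital_entropy R' I {} (trace_laws I a) \<le> unital_entropy R S {1} (trace_laws S \<iota>)"
      by (rule unital_entropy_le[OF assms(9,10,8) generates_S norm_\<iota>_S R]) (use one_S \<iota>_one in auto)
    show "unital_entropy R S {1} (trace_laws S \<iota>) \<le> unital_entropy R' I {} (trace_laws I a)"
      by (rule unital_entropy_le[OF generates_S norm_\<iota>_S R assms(9,10,8)]) auto
  qed
  then show ?thesis by (simp only: unital_entropy_empty unital_entropy_system)
qed

end
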